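(* Let $t,u\in[0,1)$, let $a=(a_1,\dots)$ and $b=(b_1,\dots)$ be (finite or infinite) alphabets of parameters in $(0,1)$, let $\lambda$ be distributed according to the periodic Hall--Littlewood measure with parameters $a,b,t,u$, and let $\chi$ be an independent $t$-geometric random variable. Let $C$ be a positively oriented circle centered at $0$ and containing all points $a_i$ and $b_j^{-1}$ (or interpret the contour integrals formally). Then for every nonnegative integer $n$, $$\mathbb{P}(l(\lambda)+\chi\le n)=\frac{\Phi(a,b;t,0,u)}{\widetilde\Phi(a,b;t,u)\,\Phi(a,b;0,t,u)}\oint_C\frac{dz_1}{2\pi iz_1}\cdots\oint_C\frac{dz_n}{2\pi iz_n}\prod_{i,j}\frac{1-tz_i^{-1}a_j}{1-z_i^{-1}a_j}\prod_{i,j}\frac{1-tz_ib_j}{1-z_ib_j}\,\widetilde\Delta(z;t,u),$$ where $l(\lambda)$ is the number of nonzero parts of $\lambda$, and in the products $i$ runs over $1,\dots,n$ and $j$ over the indices of the alphabet $a$ or $b$ respectively.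
   Context: $P_\lambda(x;q,t)$ are the Macdonald symmetric functions (Macdonald's normalization: unitriangular in the monomial basis with respect to dominance order), orthogonal for $\langle p_\lambda,p_\mu\rangle=\delta_{\lambda\mu}z_\lambda\prod_i\frac{1-q^{\lambda_i}}{1-t^{\lambda_i}}$, where $p_\lambda=\prod_i p_{\lambda_i}$ are the power sums, $z_\lambda=\prod_i m_i(\lambda)!\,i^{m_i(\lambda)}$ and $m_i(\lambda)$ is the multiplicity of $i$ in $\lambda$; $Q_\lambda$ is the dual basis. Skew functions are defined by $\langle P_{\lambda/\mu},Q_\nu\rangle=\langle P_\lambda,Q_\mu Q_\nu\rangle$ for all $\nu$, and $Q_{\lambda/\mu}$ similarly with $P,Q$ exchanged; they vanish unless $\mu\subseteq\lambda$. Hall--Littlewood functions are the case $q=0$ (first parameter zero). The periodic Hall--Littlewood measure is the probability measure on partitions $$\mathbb{P}(\lambda)=\frac{1}{\Phi(a,b;0,t,u)}\sum_\mu u^{|\mu|}P_{\lambda/\mu}(a;0,t)Q_{\lambda/\mu}(b;0,t),$$ where $|\mu|$ is the sum of the parts of $\mu$. Constants: for parameters $q,t,u$, $$\Phi(a,b;q,t,u)=\frac{1}{(u;u)_\infty}\prod_{i,j}\frac{(ta_ib_j;q,u)_\infty}{(a_ib_j;q,u)_\infty},$$ $$\widetilde\Phi(a,b;t,u)=\frac{n!\,(1-t)^n(1-u)^n}{(t;t)_\infty(u;u)_\infty(1-tu)^n\prod_{i,j}(a_ib_j;t,u)_\infty},$$ $$\widetilde\Delta(z;t,u)=\prod_{1\le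 i\ne j\le n}\frac{(1-tuz_iz_j^{-1})(1-z_iz_j^{-1})}{(1-tz_iz_j^{-1})(1-uz_iz_j^{-1})},$$ with $(z;q)_k=\prod_{r=0}^{k-1}(1-q^rz)$ ($k=\infty$ allowed) and $(z;q,u)_\infty=\prod_{k,l\ge0}(1-q^ku^lz)$ (where $0^0=1$). A random variable $\chi$ is $t$-geometric if $\mathbb{P}(\chi=k)=t^k\frac{(t;t)_\infty}{(t;t)_k}$ for $k\ge0$. Interpreting the contour integrals formally means extracting the constant term in $z_1,\dots,z_n$ of the integrand viewed as a formal series.
   Formalization: The circle C contains all a_i but has every b_j^{-1} outside (with both inside, the formula fails for n=1, t=u=0 and one letter each), which agrees with the formal interpretation; infinite alphabets are assumed summable so that the products converge. *)

theory Defs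
  imports "HOL-Probability.Probability" "HOL-Complex_Analysis.Complex_Analysis"
begin

section \<open>Partitions\<close>

text \<open>
  A partition is the multiset of its nonzero parts: \<open>|\<lambda>|\<close> is \<open>sum_mset \<lambda>\<close>, \<open>l(\<lambda>)\<close> is \<open>size \<lambda>\<close>,
  and \<open>m\<^sub>i(\<lambda>)\<close> is \<open>count \<lambda> i\<close>.
\<close>

type_synonym partition = "nat multiset"

definition partitions :: "partition set"
  where "partitions = {la. 0 \<notin># la}"

definition parts :: "partition \<Rightarrow> nat list"
  where "parts la = rev (sorted_list_of_multiset la)"

definition dominance_le :: "partition \<Rightarrow> partition \<Rightarrow> bool"
  where "dominance_le mu la \<longleftrightarrow>
    sum_mset mu = sum_mset la \<and>
    (\<forall>k. sum_list (take k (parts mu)) \<le> sum_list (take k (parts la)))"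

definition z_coeff :: "partition \<Rightarrow> real"
  where "z_coeff la = (\<Prod>i\<in>set_mset la. fact (count la i) * real i ^ count la i)"


section \<open>Symmetric functions with real coefficients\<close>

text \<open>
  A monomial in the variables \<open>x\<^sub>0, x\<^sub>1, \<dots>\<close> is the multiset of its variable indices, so
  \<open>{#0,0,1#}\<close> is the product of \<open>x\<^sub>0\<close> squared and \<open>x\<^sub>1\<close>.  A formal power series is given by its
  coefficients, and the symmetric functions are the symmetric series of bounded degree.
\<close>

type_synonym monomial = "nat multiset"
type_synonym series = "monomial \<Rightarrow> real"

definition symmetric_functions :: "series set"
  where "symmetric_functions =
    {f. (\<forall>p. bij p \<longrightarrow> (\<forall>M. f (image_mset p M) = f M)) \<and> (\<exists>d. \<forall>M. size M > d \<longrightarrow> f M = 0)}"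

definition series_one :: series
  where "series_one M = (if M = {#} then 1 else 0)"

definition series_mult :: "series \<Rightarrow> series \<Rightarrow> series"
  where "series_mult f g M = (\<Sum>A | A \<subseteq># M. f A * g (M - A))"

definition exponents :: "monomial \<Rightarrow> partition"
  where "exponents M = image_mset (count M) (mset_set (set_mset M))"

definition monomial_sym :: "partition \<Rightarrow> series"
  where "monomial_sym la M = (if exponents M = la then 1 else 0)"

definition power_sum :: "nat \<Rightarrow> series"
  where "power_sum k M = (if \<exists>i. M = replicate_mset k i then 1 else 0)"

definition power_sum_partition :: "partition \<Rightarrow> series"
  where "power_sum_partition la = foldr series_mult (map power_sum (parts la)) series_one"

text \<open>
  Evaluation at a sequence of real numbers.  Variables set to zero drop out, so a finite alphabet is
  a sequence that is zero from some index on.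
\<close>

definition eval_series :: "series \<Rightarrow> (nat \<Rightarrow> real) \<Rightarrow> real"
  where "eval_series f a = (\<Sum>\<^sub>\<infinity>M. f M * (\<Prod>i\<in>#M. a i))"

text \<open>The finitely supported coefficients of a symmetric function in the basis of the \<open>p\<^sub>\<lambda>\<close>.\<close>

definition power_sum_coeffs :: "series \<Rightarrow> partition \<Rightarrow> real"
  where "power_sum_coeffs f =
    (THE c. finite {la. c la \<noteq> 0} \<and> {la. c la \<noteq> 0} \<subseteq> partitions \<and>
       f = (\<lambda>M. \<Sum>la | c la \<noteq> 0. c la * power_sum_partition la M))"

text \<open>The bilinear form for which the \<open>p\<^sub>\<lambda>\<close> are orthogonal, extended from this basis.\<close>

definition macdonald_form :: "real \<Rightarrow> real \<Rightarrow> series \<Rightarrow> series \<Rightarrow> real"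
  where "macdonald_form q t f g =
    (\<Sum>la | power_sum_coeffs f la \<noteq> 0.
       power_sum_coeffs f la * power_sum_coeffs g la *
       (z_coeff la * (\<Prod>i\<in>#la. (1 - q ^ i) / (1 - t ^ i))))"


section \<open>Macdonald and skew Macdonald functions\<close>

definition macdonald_P :: "real \<Rightarrow> real \<Rightarrow> partition \<Rightarrow> series"
  where "macdonald_P q t =
    (THE P. P \<in> partitions \<rightarrow>\<^sub>E symmetric_functions \<and>
       (\<forall>la\<in>partitions. \<exists>c. P la = (\<lambda>M. monomial_sym la M +
          (\<Sum>mu | mu \<in> partitions \<and> dominance_le mu la \<and> mu \<noteq> la. c mu * monomial_sym mu M))) \<and>
       (\<forall>la\<in>partitions. \<forall>mu\<in>partitions. la \<noteq> mu \<longrightarrow> macdonald_form q t (P la) (P mu) = 0))"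

definition macdonald_Q :: "real \<Rightarrow> real \<Rightarrow> partition \<Rightarrow> series"
  where "macdonald_Q q t =
    (THE Q. Q \<in> partitions \<rightarrow>\<^sub>E symmetric_functions \<and>
       (\<forall>la\<in>partitions. \<forall>mu\<in>partitions.
          macdonald_form q t (macdonald_P q t la) (Q mu) = (if la = mu then 1 else 0)))"

definition skew_P :: "real \<Rightarrow> real \<Rightarrow> partition \<Rightarrow> partition \<Rightarrow> series"
  where "skew_P q t la mu =
    (THE f. f \<in> symmetric_functions \<and>
       (\<forall>nu\<in>partitions. macdonald_form q t f (macdonald_Q q t nu) =
          macdonald_form q t (macdonald_P q t la)
            (series_mult (macdonald_Q q t mu) (macdonald_Q q t nu))))"

definition skew_Q :: "real \<Rightarrow> real \<Rightarrow> partition \<Rightarrow> partition \<Rightarrow> series"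
  where "skew_Q q t la mu =
    (THE f. f \<in> symmetric_functions \<and>
       (\<forall>nu\<in>partitions. macdonald_form q t f (macdonald_P q t nu) =
          macdonald_form q t (macdonald_Q q t la)
            (series_mult (macdonald_P q t mu) (macdonald_P q t nu))))"


section \<open>Pochhammer symbols and constants\<close>

definition qpoch :: "real \<Rightarrow> real \<Rightarrow> nat \<Rightarrow> real"
  where "qpoch z q k = (\<Prod>r<k. 1 - q ^ r * z)"

definition qpoch_inf :: "real \<Rightarrow> real \<Rightarrow> real"
  where "qpoch_inf z q = (\<Prod>r. 1 - q ^ r * z)"

definition qpoch2_inf :: "real \<Rightarrow> real \<Rightarrow> real \<Rightarrow> real"
  where "qpoch2_inf z q u = (\<Prod>k. \<Prod>l. 1 - q ^ k * u ^ l * z)"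

text \<open>
  An alphabet of \<open>N \<le> \<infinity>\<close> letters in \<open>(0,1)\<close>, padded with zeros if \<open>N\<close> is finite.  In all the
  products below a padding entry contributes the factor 1.
\<close>

definition alphabet :: "(nat \<Rightarrow> real) \<Rightarrow> bool"
  where "alphabet a \<longleftrightarrow> (\<exists>N::enat. \<forall>i. if enat i < N then 0 < a i \<and> a i < 1 else a i = 0)"

definition Phi :: "(nat \<Rightarrow> real) \<Rightarrow> (nat \<Rightarrow> real) \<Rightarrow> real \<Rightarrow> real \<Rightarrow> real \<Rightarrow> real"
  where "Phi a b q t u =
    1 / qpoch_inf u u * (\<Prod>i. \<Prod>j. qpoch2_inf (t * a i * b j) q u / qpoch2_inf (a i * b j) q u)"

definition Phi_tilde :: "nat \<Rightarrow> (nat \<Rightarrow> real) \<Rightarrow> (nat \<Rightarrow> real) \<Rightarrow> real \<Rightarrow> real \<Rightarrow> real"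
  where "Phi_tilde n a b t u =
    fact n * (1 - t) ^ n * (1 - u) ^ n /
    (qpoch_inf t t * qpoch_inf u u * (1 - t * u) ^ n * (\<Prod>i. \<Prod>j. qpoch2_inf (a i * b j) t u))"

text \<open>The variables \<open>z\<^sub>1, \<dots>, z\<^sub>n\<close> are \<open>z 0, \<dots>, z (n - 1)\<close>.\<close>

definition Delta_tilde :: "nat \<Rightarrow> (nat \<Rightarrow> complex) \<Rightarrow> real \<Rightarrow> real \<Rightarrow> complex"
  where "Delta_tilde n z t u =
    (\<Prod>(i, j) | i < n \<and> j < n \<and> i \<noteq> j.
       ((1 - of_real (t * u) * z i * inverse (z j)) * (1 - z i * inverse (z j))) /
       ((1 - of_real t * z i * inverse (z j)) * (1 - of_real u * z i * inverse (z j))))"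


section \<open>The periodic Hall--Littlewood measure and the iterated contour integral\<close>

definition periodic_HL :: "(nat \<Rightarrow> real) \<Rightarrow> (nat \<Rightarrow> real) \<Rightarrow> real \<Rightarrow> real \<Rightarrow> partition \<Rightarrow> real"
  where "periodic_HL a b t u la =
    1 / Phi a b 0 t u *
    (\<Sum>\<^sub>\<infinity>mu\<in>partitions.
       u ^ sum_mset mu * eval_series (skew_P 0 t la mu) a * eval_series (skew_Q 0 t la mu) b)"

definition t_geometric :: "real \<Rightarrow> nat \<Rightarrow> real"
  where "t_geometric t k = t ^ k * (qpoch_inf t t / qpoch t t k)"

text \<open>
  The \<open>n\<close>-fold integral of \<open>F(z\<^sub>1,\<dots>,z\<^sub>n)\<close> against \<open>dz\<^sub>1/(2\<pi>iz\<^sub>1) \<dots> dz\<^sub>n/(2\<pi>iz\<^sub>n)\<close>, every variable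
  running over the positively oriented circle of radius \<open>r\<close> around 0; \<open>z\<^sub>1\<close> is outermost.
\<close>

primrec torus_integral :: "nat \<Rightarrow> real \<Rightarrow> ((nat \<Rightarrow> complex) \<Rightarrow> complex) \<Rightarrow> complex"
  where
    "torus_integral 0 r F = F (\<lambda>_. 0)"
  | "torus_integral (Suc n) r F =
       contour_integral (circlepath 0 r)
         (\<lambda>w. torus_integral n r (\<lambda>z. F (case_nat w z)) / (2 * of_real pi * \<i> * w))"

end

theory Submission
  imports Defs "HOL-Combinatorics.Multiset_Permutations"
begin

text \<open>
  At \<open>q = 0\<close> the branching coefficients are explicit, and the Cauchy kernel
  \<open>K(z;b) = \<Prod> (1 - t z\<^sub>i b\<^sub>j) / (1 - z\<^sub>i b\<^sub>j)\<close> satisfies \<open>K(z;b) P\<^sub>\<nu>(z) = \<Sum>\<^sub>\<kappa> P\<^sub>\<kappa>(z) Q\<^sub>\<kappa>\<^sub>/\<^sub>\<nu>(b)\<close>.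
  Up to a constant, \<open>\<Delta>(z;t,u)\<close> is the Hall--Littlewood torus density times the kernel at
  \<open>b\<^sub>j = u / z\<^sub>j\<close>, which is \<open>\<Sum>\<^sub>\<nu> u\<^bsup>|\<nu>|\<^esup> Q\<^sub>\<nu>(z) P\<^sub>\<nu>(1/z)\<close>.  So the integrand is a sum over
  \<open>\<nu>, \<kappa>, \<kappa>'\<close> of \<open>P\<^sub>\<kappa>(z) P\<^sub>\<kappa>\<^sub>'(1/z)\<close> times the density, and torus orthogonality leaves the terms
  \<open>\<kappa> = \<kappa>'\<close> of length at most \<open>n\<close>.  Their norm carries a factor \<open>1 / (t;t)\<^bsub>n - l(\<kappa>)\<^esub>\<close>, which is
  proportional to the probability of \<open>\<chi> \<le> n - l(\<kappa>)\<close>.  Positivity of the normalization follows from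
  total mass one, so the normalization never has to be evaluated.
\<close>

section \<open>Partitions and the dominance order\<close>

text \<open>P, Q, the skew functions and the power sum coefficients are definite descriptions, so
  each needs an explicit candidate and a uniqueness proof. The candidate for P comes from the
  symmetrised rational function in n variables, which is not visibly a polynomial; solving the
  vertical strip Pieri rule for its top term produces series with these values. The horizontal strip
  rule follows from the vertical one through E(-y) Q(y) = E(-ty), where E and Q generate the e_r and
  q_r. Multiplication by q_r is adjoint to taking the coefficient of x_0^r, so the horizontal rule
  yields both the orthogonality of the P and the coefficients of Q_{la/mu}, which are nonnegative.
  Nonnegativity drives the convergence arguments: a series is dominated by its value at the moduli
  of the variables, where the kernel identity holds without cancellation. Partitions are handled
  through \<open>col la j\<close>, the column length with index shifted to start at 0: strips become
  pointwise inequalities, and the coefficients become products over columns.\<close>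

definition col :: "partition \<Rightarrow> nat \<Rightarrow> nat"
  where "col la j = size {#i \<in># la. j < i#}"

lemma col_empty [simp]: "col {#} j = 0"
  by (simp add: col_def)

lemma col_add_mset [simp]: "col (add_mset x la) j = (if j < x then Suc (col la j) else col la j)"
  by (simp add: col_def)

lemma col_union [simp]: "col (la + mu) j = col la j + col mu j"
  by (simp add: col_def)

lemma col_Suc: "col la j = col la (Suc j) + count la (Suc j)"
  by (induction la) auto

lemma col_antimono: "i \<le> j \<Longrightarrow> col la j \<le> col la i"
  by (induction la) auto

lemma count_eq_col: "count la (Suc j) = col la j - col la (Suc j)"
  using col_Suc[of la j] by simp

lemma col_0: "la \<in> partitions \<Longrightarrow> col la 0 = size la"
  unfolding partitions_def
  by (induction la) auto

lemma col_le_size: "col la j \<le> size la"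
  by (simp add: col_def size_filter_mset_lesseq)

lemma col_eq_0: "sum_mset la \<le> j \<Longrightarrow> col la j = 0"
  by (induction la arbitrary: j) auto

lemma sum_if_less: "(\<Sum>j<N. if j < x then 1 else (0::nat)) = min N x"
proof -
  have "(\<Sum>j<N. if j < x then 1 else (0::nat)) = card {j\<in>{..<N}. j < x}"
    by (simp add: sum.If_cases Int_def)
  also have "{j\<in>{..<N}. j < x} = {..<min N x}" by auto
  finally show ?thesis by simp
qed

lemma sum_col: "sum_mset la \<le> N \<Longrightarrow> (\<Sum>j<N. col la j) = sum_mset la"
proof (induction la)
  case (add x la)
  have "(\<Sum>j<N. col (add_mset x la) j) = (\<Sum>j<N. (if j < x then 1 else 0) + col la j)"
    by (intro sum.cong) auto
  also have "\<dots> = min N x + (\<Sum>j<N. col la j)"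
    by (simp add: sum.distrib sum_if_less)
  finally show ?case using add by simp
qed simp

lemma partition_eqI:
  assumes "la \<in> partitions" "mu \<in> partitions" "\<And>j. col la j = col mu j"
  shows "la = mu"
proof (rule multiset_eqI)
  fix i show "count la i = count mu i"
    using assms count_eq_col[of la "i - 1"] count_eq_col[of mu "i - 1"]
    by (cases i) (auto simp: partitions_def not_in_iff)
qed

lemma empty_partition [simp]: "{#} \<in> partitions"
  by (simp add: partitions_def)

text \<open>Conjugation in reverse: the part \<open>Suc j\<close> must occur
  \<open>c j - c (Suc j)\<close> times. New shapes below are specified by their columns and obtained
  here.\<close>

lemma col_exists:
  assumes "\<And>j. c (Suc j) \<le> c j" "c N = (0::nat)"
  obtains la where "la \<in> partitions" "\<And>j. col la j = c j"
proof -
  have cle: "c j \<le> c N" if "N \<le> j" for j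
    using that by (induction j rule: dec_induct) (auto intro: order_trans[OF assms(1)])
  then have c0: "c j = 0" if "j \<ge> N" for j using that assms(2) by fastforce
  define F where "F m = (\<Sum>j<m. replicate_mset (c j - c (Suc j)) (Suc j))" for m
  have F: "0 \<notin># F m" for m
    by (induction m) (auto simp: F_def)
  have ct: "count (F m) (Suc i) = (if i < m then c i - c (Suc i) else 0)" for m i
    by (induction m) (auto simp: F_def)
  have bd: "x \<le> m" if "x \<in># F m" for m x
    using that by (induction m) (auto simp: F_def split: if_splits)
  have sz: "col (F N) j = c j" if "j \<le> N" for j
    using that
  proof (induction j rule: inc_induct)
    case base
    have "filter_mset (\<lambda>i. N < i) (F N) = {#}"
      using bd[of _ N] by (auto dest: leD)
    then show ?case by (simp add: col_def assms)
  next
    case (step j)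
    then show ?case using col_Suc[of "F N" j] ct[of N j] assms(1)[of j] by simp
  qed
  have sz': "col (F N) j = c j" for j
  proof (cases "j \<le> N")
    case False
    then show ?thesis using c0[of j] c0[of N] sz[of N] col_antimono[of N j "F N"] by simp
  qed (use sz in auto)
  show thesis
    by (rule that[of "F N"]) (use F sz' in \<open>auto simp: partitions_def\<close>)
qed

lemma finite_partitions_le: "finite {la \<in> partitions. sum_mset la \<le> n}"
proof -
  have "\<exists>xs. la = mset xs \<and> set xs \<subseteq> {..n} \<and> length xs \<le> n"
    if "la \<in> partitions" "sum_mset la \<le> n" for la
  proof -
    obtain xs where xs: "mset xs = la" using ex_mset by blast
    have "length xs \<le> sum_list xs" if "0 \<notin> set xs" for xs :: "nat list"
      using that by (induction xs) auto
    moreover have "x \<le> sum_list xs" if "x \<in> set xs" for x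
      using that by (rule member_le_sum_list) auto
    moreover have "sum_list xs \<le> n" "0 \<notin> set xs" using that xs
      by (auto simp: partitions_def sum_mset_sum_list)
    ultimately have "set xs \<subseteq> {..n}" "length xs \<le> n"
      using order_trans by blast+
    then show ?thesis using xs by blast
  qed
  then have "{la \<in> partitions. sum_mset la \<le> n} \<subseteq> mset ` {xs. set xs \<subseteq> {..n} \<and> length xs \<le> n}"
    by fastforce
  then show ?thesis
    using finite_lists_length_le[of "{..n}" n] finite_surj by blast
qed

lemma finite_partitions_of: "finite {la \<in> partitions. sum_mset la = n}"
  by (rule finite_subset[OF _ finite_partitions_le[of n]]) auto

lemma size_le_sum_partition: "la \<in> partitions \<Longrightarrow> size la \<le> sum_mset la"
  unfolding partitions_def by (induction la) auto

lemma in_partition_pos: "la \<in> partitions \<Longrightarrow> x \<in># la \<Longrightarrow> 0 < x"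
  by (metis (mono_tags, lifting) gr0I mem_Collect_eq partitions_def)

text \<open>The sum of the k largest parts, read off the columns: the first k rows meet column j in
  \<open>min k (col la j)\<close> boxes. In this form dominance can be checked column by
  column.\<close>

definition topsum :: "partition \<Rightarrow> nat \<Rightarrow> nat"
  where "topsum la k = (\<Sum>j<sum_mset la. min k (col la j))"

lemma top_eq: "sum_mset la \<le> N \<Longrightarrow> topsum la k = (\<Sum>j<N. min k (col la j))"
  unfolding topsum_def by (rule sum.mono_neutral_left) (auto simp: col_eq_0)

lemma sum_take_sorted_desc:
  assumes "sorted (rev xs)" "sum_list xs \<le> N"
  shows "sum_list (take k xs) = (\<Sum>j<N. min k (col (mset xs) j))"
  using assms
proof (induction xs arbitrary: k)
  case (Cons x xs)
  show ?case
  proof (cases k)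
    case (Suc m)
    have le: "\<forall>y\<in>set xs. y \<le> x" using Cons.prems by (auto simp: sorted_append)
    have "min k (col (mset (x#xs)) j) = (if j < x then 1 else 0) + min m (col (mset xs) j)" for j
    proof (cases "j < x")
      case False
      then have "filter_mset (\<lambda>i. j < i) (mset xs) = {#}" using le by (auto dest: leD)
      then have "col (mset xs) j = 0" by (simp add: col_def)
      then show ?thesis using False by simp
    qed (simp add: Suc)
    then have "(\<Sum>j<N. min k (col (mset (x#xs)) j)) = min N x + (\<Sum>j<N. min m (col (mset xs) j))"
      by (simp add: sum.distrib sum_if_less)
    moreover have "sum_list (take m xs) = (\<Sum>j<N. min m (col (mset xs) j))"
      using Cons by (simp add: sorted_append)
    ultimately show ?thesis using Cons.prems by (simp add: Suc)
  qed simp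
qed simp

lemma mset_parts [simp]: "mset (parts la) = la"
  by (simp add: parts_def)

lemma sum_take_parts: "sum_list (take k (parts la)) = topsum la k"
proof -
  have "sum_list (parts la) = sum_mset la" by (metis mset_parts sum_mset_sum_list)
  moreover have "sorted (rev (parts la))" by (simp add: parts_def)
  ultimately show ?thesis unfolding topsum_def
    using sum_take_sorted_desc[of "parts la" "sum_mset la" k] by (simp only: mset_parts)
qed

lemma dominance_le_iff:
  "dominance_le mu la \<longleftrightarrow> sum_mset mu = sum_mset la \<and> (\<forall>k. topsum mu k \<le> topsum la k)"
  by (simp add: dominance_le_def sum_take_parts)

lemma dominance_le_refl [simp]: "dominance_le la la"
  by (simp add: dominance_le_iff)

lemma dominance_le_trans: "dominance_le la mu \<Longrightarrow> dominance_le mu nu \<Longrightarrow> dominance_le la nu"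
  unfolding dominance_le_iff by (metis le_trans)

lemma prefix_sums_eq:
  assumes "0 \<notin> set xs" "0 \<notin> set ys" "\<And>k. sum_list (take k xs) = sum_list (take k (ys :: nat list))"
  shows "xs = ys"
  using assms
proof (induction xs arbitrary: ys)
  case Nil
  then show ?case using Nil(3)[of 1] by (cases ys) auto
next
  case (Cons x xs)
  obtain y ys' where ys: "ys = y # ys'"
    using Cons.prems(1) Cons.prems(3)[of 1] by (cases ys) auto
  have xy: "x = y" using Cons.prems(3)[of 1] ys by simp
  have "xs = ys'"
  proof (rule Cons.IH)
    fix k show "sum_list (take k xs) = sum_list (take k ys')"
      using Cons.prems(3)[of "Suc k"] ys xy by simp
  qed (use Cons.prems ys in auto)
  then show ?case using xy ys by simp
qed

lemma dominance_le_antisym: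
  assumes "la \<in> partitions" "mu \<in> partitions" "dominance_le la mu" "dominance_le mu la"
  shows "la = mu"
proof -
  have "parts la = parts mu"
  proof (rule prefix_sums_eq)
    show "0 \<notin> set (parts la)" "0 \<notin> set (parts mu)" using assms
      by (metis (mono_tags, lifting) mem_Collect_eq mset_parts partitions_def set_mset_mset)+
    show "sum_list (take k (parts la)) = sum_list (take k (parts mu))" for k
      using assms by (simp add: sum_take_parts dominance_le_iff le_antisym)
  qed
  then show ?thesis by (metis mset_parts)
qed

text \<open>A numerical rank that is strictly monotone for dominance (\<open>dom_rank_less\<close>),
  so that inductions along the dominance order become inductions on naturals.\<close>

definition dom_rank :: "partition \<Rightarrow> nat"
  where "dom_rank la = (\<Sum>k\<le>sum_mset la. topsum la k)"

lemma top_large: 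
  assumes "la \<in> partitions" "k \<ge> sum_mset la" shows "topsum la k = sum_mset la"
proof -
  have "min k (col la j) = col la j" for j
    using col_le_size[of la j] size_le_sum_partition[OF assms(1)] assms(2) by simp
  then show ?thesis by (simp add: topsum_def sum_col)
qed

lemma dom_rank_less:
  assumes "la \<in> partitions" "mu \<in> partitions" "dominance_le la mu" "la \<noteq> mu"
  shows "dom_rank la < dom_rank mu"
proof -
  have eq: "sum_mset la = sum_mset mu" and le: "\<And>k. topsum la k \<le> topsum mu k"
    using assms by (auto simp: dominance_le_iff)
  have "\<not> dominance_le mu la" using assms dominance_le_antisym by blast
  then obtain k where k: "topsum la k < topsum mu k"
    using eq le by (auto simp: dominance_le_iff not_le)
  \<comment> \<open>Beyond the weight both sums have reached their common total, so a strict
    inequality must occur within the range of summation.\<close>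
  have "k \<le> sum_mset mu"
    using k top_large[OF assms(1), of k] top_large[OF assms(2), of k] eq by force
  then show ?thesis unfolding dom_rank_def eq
    by (intro sum_strict_mono_ex1) (use le k in auto)
qed

section \<open>Exponent partitions of monomials\<close>

lemma exponents_partition [simp]: "exponents M \<in> partitions"
  by (force simp: exponents_def partitions_def simp flip: not_in_iff)

lemma size_exponents [simp]: "size (exponents M) = card (set_mset M)"
  by (simp add: exponents_def)

lemma sum_exponents [simp]: "sum_mset (exponents M) = size M"
  by (simp add: exponents_def size_multiset_overloaded_eq sum_unfold_sum_mset)

lemma exponents_empty [simp]: "exponents {#} = {#}"
  by (simp add: exponents_def)

lemma col_exponents: "col (exponents M) j = card {i. j < count M i}"
proof -
  have "{i. j < count M i} = {i \<in> set_mset M. j < count M i}"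
    by (auto simp: count_greater_zero_iff[symmetric] simp del: count_greater_zero_iff)
  then show ?thesis
    by (simp add: col_def exponents_def filter_mset_image_mset)
qed

lemma finite_count_gt [simp]: "finite {i. j < count M (i::'a)}"
  by (rule finite_subset[of _ "set_mset M"]) (auto simp: count_greater_zero_iff[symmetric] simp del: count_greater_zero_iff)

text \<open>Counting boxes level by level: at most \<open>min k (col (exponents M) j)\<close> of the
  chosen variables have exponent above j. Together with \<open>top_attained\<close> this makes
  \<open>topsum\<close> a maximum over sets of at most k variables.\<close>

lemma sum_count_le_topsum:
  assumes "finite K" "card K \<le> k"
  shows "(\<Sum>i\<in>K. count M i) \<le> topsum (exponents M) k"
proof -
  have "(\<Sum>i\<in>K. count M i) = (\<Sum>i\<in>K. \<Sum>j<size M. if j < count M i then 1 else 0)"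
  proof (rule sum.cong)
    fix i show "count M i = (\<Sum>j<size M. if j < count M i then 1 else 0)"
      unfolding sum_if_less using count_le_size[of M i] by simp
  qed simp
  also have "\<dots> = (\<Sum>j<size M. \<Sum>i\<in>K. if j < count M i then 1 else 0)"
    by (rule sum.swap)
  also have "\<dots> \<le> (\<Sum>j<size M. min k (col (exponents M) j))"
  proof (rule sum_mono)
    fix j
    have "(\<Sum>i\<in>K. if j < count M i then 1 else 0) = card {i\<in>K. j < count M i}"
      using assms by (simp add: sum.If_cases Int_def)
    moreover have "card {i\<in>K. j < count M i} \<le> card K" using assms by (intro card_mono) auto
    moreover have "card {i\<in>K. j < count M i} \<le> card {i. j < count M i}" by (intro card_mono) auto
    ultimately show "(\<Sum>i\<in>K. if j < count M i then 1 else 0) \<le> min k (col (exponents M) j)"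
      using assms by (simp add: col_exponents)
  qed
  finally show ?thesis by (simp add: topsum_def)
qed

lemma top_attained:
  obtains K where "finite K" "card K \<le> k" "topsum (exponents M) k = (\<Sum>i\<in>K. count M i)"
proof -
  define xs where "xs = rev (sort_key (count M) (sorted_list_of_set (set_mset M)))"
  have d: "distinct xs" "set xs = set_mset M" by (auto simp: xs_def)
  have m: "mset (map (count M) xs) = exponents M"
    by (simp add: xs_def exponents_def flip: sorted_list_of_mset_set)
  have s: "sorted (rev (map (count M) xs))" by (simp add: xs_def rev_map)
  have "sum_list (take k (map (count M) xs)) = topsum (exponents M) k"
    unfolding topsum_def
  proof (subst m[symmetric], rule sum_take_sorted_desc[OF s])
    show "sum_list (map (count M) xs) \<le> sum_mset (exponents M)"
      by (metis m order_refl sum_mset_sum_list)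
  qed
  moreover have "sum_list (take k (map (count M) xs)) = (\<Sum>i\<in>set (take k xs). count M i)"
    using d by (simp add: take_map sum_list_distinct_conv_sum_set)
  moreover have "card (set (take k xs)) \<le> k"
    by (metis card_length length_take min.cobounded2 order_trans)
  ultimately show thesis by (intro that[of "set (take k xs)"]) auto
qed

text \<open>The monomial with exponent list al. Splitting off variable 0 and shifting the others
  matches the operator \<open>Dop\<close>, which takes the coefficient of a power of variable
  0.\<close>

primrec mono_of :: "nat list \<Rightarrow> monomial" where
  "mono_of [] = {#}"
| "mono_of (a # al) = replicate_mset a 0 + image_mset Suc (mono_of al)"

lemma count_image_Suc: "count (image_mset Suc M) i = (case i of 0 \<Rightarrow> 0 | Suc j \<Rightarrow> count M j)"
  by (induction M) (auto split: nat.splits)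

lemma count_mono_of: "count (mono_of al) i = (if i < length al then al ! i else 0)"
  by (induction al arbitrary: i) (auto simp: count_image_Suc nth_Cons split: nat.splits)

lemma size_mono_of: "size (mono_of al) = sum_list al"
  by (induction al) auto

lemma exponents_mono_of: "exponents (mono_of al) = filter_mset (\<lambda>x. x \<noteq> 0) (mset al)"
proof (induction al)
  case (Cons a al)
  have inj: "exponents (image_mset Suc M) = exponents M" for M
  proof -
    have "mset_set (Suc ` set_mset M) = image_mset Suc (mset_set (set_mset M))"
      by (simp add: image_mset_mset_set)
    then show ?thesis by (simp add: exponents_def image_mset.compositionality comp_def count_image_Suc)
  qed
  show ?case
  proof (cases "a = 0")
    case True then show ?thesis using Cons inj by simp
  next
    case False
    let ?M = "replicate_mset a 0 + image_mset Suc (mono_of al)"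
    have st: "set_mset ?M = insert 0 (Suc ` set_mset (mono_of al))" using False by auto
    have "exponents ?M = add_mset a (image_mset (count ?M) (mset_set (Suc ` set_mset (mono_of al))))"
      unfolding exponents_def st using False by (subst mset_set.insert) (auto simp: count_image_Suc)
    also have "image_mset (count ?M) (mset_set (Suc ` set_mset (mono_of al)))
       = image_mset (count (image_mset Suc (mono_of al))) (mset_set (Suc ` set_mset (mono_of al)))"
      by (rule image_mset_cong) (auto simp: count_image_Suc)
    also have "\<dots> = exponents (image_mset Suc (mono_of al))" by (simp add: exponents_def)
    finally show ?thesis using Cons inj False by simp
  qed
qed simp

lemma exponents_mono_of_parts [simp]: "la \<in> partitions \<Longrightarrow> exponents (mono_of (parts la)) = la"
  by (auto simp: exponents_mono_of partitions_def filter_mset_eq_conv intro: gr0I)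

lemma mono_of_exists: "\<exists>al. M = mono_of al"
proof -
  obtain N where N: "\<And>i. i \<in># M \<Longrightarrow> i < N"
    using finite_nat_set_iff_bounded[of "set_mset M"] by auto
  have "M = mono_of (map (count M) [0..<N])"
    using N by (intro multiset_eqI) (auto simp: count_mono_of not_in_iff[symmetric])
  then show ?thesis ..
qed

section \<open>Symmetric functions\<close>

lemma finite_submsets [simp]: "finite {A. A \<subseteq># (M::'a multiset)}"
proof -
  have "A \<in> mset ` {xs. set xs \<subseteq> set_mset M \<and> length xs \<le> size M}" if A: "A \<subseteq># M" for A
  proof -
    obtain xs where "mset xs = A" using ex_mset by blast
    then show ?thesis using set_mset_mono[OF A] size_mset_mono[OF A] by force
  qed
  then have "{A. A \<subseteq># M} \<subseteq> mset ` {xs. set xs \<subseteq> set_mset M \<and> length xs \<le> size M}" by blast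
  then show ?thesis using finite_lists_length_le[of "set_mset M" "size M"] finite_surj by blast
qed

lemma count_image_mset_inj': "inj p \<Longrightarrow> count (image_mset p M) (p x) = count M x"
  by (induction M) (auto dest: injD)

lemma submset_diff_diff: "A \<subseteq># M \<Longrightarrow> M - (M - A) = A"
  by (simp add: multiset_eq_iff subseteq_mset_def)

lemma submset_diff_mono: "A \<subseteq># M \<Longrightarrow> A - B \<subseteq># M - B"
  by (simp add: subseteq_mset_def diff_le_mono)

lemma submset_add_diff: "B \<subseteq># M \<Longrightarrow> C \<subseteq># M - B \<Longrightarrow> B + C \<subseteq># M"
  by (metis subset_mset.add_left_mono subset_mset.add_diff_inverse)

lemma submset_diff_diff2: "B \<subseteq># A \<Longrightarrow> A \<subseteq># M \<Longrightarrow> M - B - (A - B) = M - A"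
  by (simp add: multiset_eq_iff subseteq_mset_def)

lemma series_mult_commute: "series_mult f g = series_mult g f"
proof
  fix M
  show "series_mult f g M = series_mult g f M"
    unfolding series_mult_def
    by (rule sum.reindex_bij_witness[of _ "\<lambda>A. M - A" "\<lambda>A. M - A"])
      (auto simp: submset_diff_diff)
qed

lemma series_mult_assoc: "series_mult (series_mult f g) h = series_mult f (series_mult g h)"
proof
  fix M
  have "series_mult (series_mult f g) h M
      = (\<Sum>(A,B)\<in>(SIGMA A:{A. A \<subseteq># M}. {B. B \<subseteq># A}). f B * g (A - B) * h (M - A))"
    by (simp add: series_mult_def sum_distrib_right sum.Sigma)
  also have "\<dots> = (\<Sum>(B,C)\<in>(SIGMA B:{B. B \<subseteq># M}. {C. C \<subseteq># M - B}). f B * (g C * h (M - B - C)))"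
    by (rule sum.reindex_bij_witness[of _ "\<lambda>(B,C). (B + C, B)" "\<lambda>(A,B). (B, A - B)"])
      (auto simp: mult.assoc diff_diff_add_mset submset_diff_diff2 submset_diff_mono submset_add_diff
         intro: subset_mset.order_trans)
  also have "\<dots> = series_mult f (series_mult g h) M"
    by (simp add: series_mult_def sum_distrib_left sum.Sigma)
  finally show "series_mult (series_mult f g) h M = series_mult f (series_mult g h) M" .
qed

lemma series_mult_one: "series_mult series_one f = f"
proof
  fix M
  have "series_mult series_one f M = (\<Sum>A\<in>{{#}}. series_one A * f (M - A))"
    unfolding series_mult_def by (rule sum.mono_neutral_right) (auto simp: series_one_def)
  then show "series_mult series_one f M = f M" by (simp add: series_one_def)
qed

section \<open>The commutative ring of formal power series\<close>

typedef mps = "UNIV :: series set" morphisms cf Ser ..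

lemma cf_Ser [simp]: "cf (Ser f) = f"
  by (simp add: Ser_inverse)

lemma mps_eqI: "(\<And>M. cf f M = cf g M) \<Longrightarrow> f = g"
  by (metis cf_inject ext)

instantiation mps :: comm_ring_1
begin
definition "0 = Ser (\<lambda>_. 0)"
definition "1 = Ser series_one"
definition "f + g = Ser (\<lambda>M. cf f M + cf g M)"
definition "- f = Ser (\<lambda>M. - cf f M)"
definition "f - g = Ser (\<lambda>M. cf f M - cf g M)"
definition "f * g = Ser (series_mult (cf f) (cf g))"
instance
proof
  fix f g h :: mps
  show "f * g * h = f * (g * h)" by (simp add: times_mps_def series_mult_assoc)
  show "f * g = g * f" by (simp add: times_mps_def series_mult_commute)
  show "1 * f = f" by (simp add: times_mps_def one_mps_def series_mult_one cf_inverse)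
  show "f + g + h = f + (g + h)" "f + g = g + f" "0 + f = f" "- f + f = 0" "f - g = f + - g"
    by (auto simp: plus_mps_def zero_mps_def uminus_mps_def minus_mps_def cf_inverse add_ac)
  show "(f + g) * h = f * h + g * h"
    by (auto simp: times_mps_def plus_mps_def series_mult_def[abs_def] sum.distrib algebra_simps)
  have "cf (0::mps) {#} \<noteq> cf 1 {#}" by (simp add: zero_mps_def one_mps_def series_one_def)
  then show "(0::mps) \<noteq> 1" by metis
qed
end

lemma cf_zero [simp]: "cf 0 M = 0" by (simp add: zero_mps_def)
lemma cf_one: "cf 1 M = (if M = {#} then 1 else 0)" by (simp add: one_mps_def series_one_def)
lemma cf_add [simp]: "cf (f + g) M = cf f M + cf g M" by (simp add: plus_mps_def)
lemma cf_uminus [simp]: "cf (- f) M = - cf f M" by (simp add: uminus_mps_def)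
lemma cf_diff [simp]: "cf (f - g) M = cf f M - cf g M" by (simp add: minus_mps_def)
lemma cf_mult: "cf (f * g) M = (\<Sum>A | A \<subseteq># M. cf f A * cf g (M - A))"
  by (simp add: times_mps_def series_mult_def)
lemma cf_mult_series: "cf (f * g) = series_mult (cf f) (cf g)" by (simp add: times_mps_def)
lemma cf_sum [simp]: "cf (\<Sum>x\<in>S. f x) M = (\<Sum>x\<in>S. cf (f x) M)"
  by (induction S rule: infinite_finite_induct) auto

definition sc :: "real \<Rightarrow> mps" where "sc c = Ser (\<lambda>M. if M = {#} then c else 0)"

lemma cf_sc_mult [simp]: "cf (sc c * f) M = c * cf f M"
proof -
  have "cf (sc c * f) M = (\<Sum>A\<in>{{#}}. cf (sc c) A * cf f (M - A))"
    unfolding cf_mult by (rule sum.mono_neutral_right) (auto simp: sc_def)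
  then show ?thesis by (simp add: sc_def)
qed

lemma sc_0 [simp]: "sc 0 = 0" by (rule mps_eqI) (simp add: sc_def)
lemma sc_1 [simp]: "sc 1 = 1" by (rule mps_eqI) (simp add: sc_def cf_one)
lemma sc_mult: "sc (a * b) = sc a * sc b" by (rule mps_eqI) (simp, simp add: sc_def)
lemma sc_add: "sc (a + b) = sc a + sc b" by (rule mps_eqI) (simp add: sc_def)
lemma sc_minus: "sc (- a) = - sc a" by (rule mps_eqI) (simp add: sc_def)
lemma sc_diff: "sc (a - b) = sc a - sc b" by (rule mps_eqI) (simp add: sc_def)
lemma sc_sum: "sc (\<Sum>x\<in>S. f x) = (\<Sum>x\<in>S. sc (f x))"
  by (induction S rule: infinite_finite_induct) (auto simp: sc_add)

definition bounded_deg :: "mps \<Rightarrow> bool"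
  where "bounded_deg f \<longleftrightarrow> (\<exists>d. \<forall>M. size M > d \<longrightarrow> cf f M = 0)"

definition symf :: "mps \<Rightarrow> bool"
  where "symf f \<longleftrightarrow> cf f \<in> symmetric_functions"

lemma symf_iff: "symf f \<longleftrightarrow> (\<forall>p. bij p \<longrightarrow> (\<forall>M. cf f (image_mset p M) = cf f M)) \<and> bounded_deg f"
  by (simp add: symf_def symmetric_functions_def bounded_deg_def)

lemma bounded_deg_mult:
  assumes "bounded_deg f" "bounded_deg g" shows "bounded_deg (f * g)"
proof -
  obtain d e where de: "\<And>M. size M > d \<Longrightarrow> cf f M = 0" "\<And>M. size M > e \<Longrightarrow> cf g M = 0"
    using assms by (auto simp: bounded_deg_def)
  have "cf (f * g) M = 0" if "size M > d + e" for M
    unfolding cf_mult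
  proof (intro sum.neutral ballI)
    fix A assume "A \<in> {A. A \<subseteq># M}"
    then have "size M = size A + size (M - A)" by (simp add: size_Diff_submset size_mset_mono)
    then have "size A > d \<or> size (M - A) > e" using that by linarith
    then show "cf f A * cf g (M - A) = 0" using de by auto
  qed
  then show ?thesis by (auto simp: bounded_deg_def)
qed

lemma bounded_deg_add:
  assumes "bounded_deg f" "bounded_deg g" shows "bounded_deg (f + g)"
proof -
  obtain d e where "\<And>M. size M > d \<Longrightarrow> cf f M = 0" "\<And>M. size M > e \<Longrightarrow> cf g M = 0"
    using assms by (auto simp: bounded_deg_def)
  then show ?thesis by (auto simp: bounded_deg_def intro!: exI[of _ "max d e"])
qed

lemma bounded_deg_sc [simp]: "bounded_deg (sc c)"
  by (auto simp: bounded_deg_def sc_def)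

lemma symf_mult [intro]:
  assumes "symf f" "symf g" shows "symf (f * g)"
proof -
  have "cf (f * g) (image_mset p M) = cf (f * g) M" if p: "bij p" for p M
  proof -
    have ip: "image_mset p (image_mset (inv p) A) = A" for A
      using p by (simp add: image_mset.compositionality comp_def bij_is_surj surj_f_inv_f)
    have ip': "image_mset (inv p) (image_mset p A) = A" for A
      using p by (simp add: image_mset.compositionality comp_def bij_is_inj)
    show ?thesis unfolding cf_mult
    proof (rule sum.reindex_bij_witness[of _ "image_mset p" "image_mset (inv p)"])
      fix A assume A: "A \<in> {A. A \<subseteq># image_mset p M}"
      then have A': "image_mset (inv p) A \<subseteq># M"
        using image_mset_subseteq_mono[of A "image_mset p M" "inv p"] ip' by auto
      then show "image_mset (inv p) A \<in> {A. A \<subseteq># M}" by simp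
      have "M - image_mset (inv p) A = image_mset (inv p) (image_mset p M - A)"
        using A by (simp add: image_mset_Diff ip')
      moreover have "bij (inv p)" using p by (rule bij_imp_bij_inv)
      ultimately show "cf f (image_mset (inv p) A) * cf g (M - image_mset (inv p) A)
          = cf f A * cf g (image_mset p M - A)"
        using assms by (simp add: symf_iff)
    qed (auto simp: ip ip' intro: image_mset_subseteq_mono)
  qed
  then show ?thesis using assms by (simp add: symf_iff bounded_deg_mult)
qed

lemma symf_add [intro]: "symf f \<Longrightarrow> symf g \<Longrightarrow> symf (f + g)"
  by (auto simp: symf_iff bounded_deg_add)
lemma symf_sc [simp]: "symf (sc c)" by (simp add: symf_iff) (simp add: sc_def)
lemma symf_0 [simp]: "symf 0" using symf_sc[of 0] by simp
lemma symf_1 [simp]: "symf 1" using symf_sc[of 1] by simp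
lemma symf_uminus [intro]: "symf f \<Longrightarrow> symf (- f)" using symf_mult[OF symf_sc[of "-1"], of f] by (simp add: sc_minus)
lemma symf_diff [intro]: "symf f \<Longrightarrow> symf g \<Longrightarrow> symf (f - g)" using symf_add[of f "- g"] by auto
lemma symf_sum [intro]: "(\<And>x. x \<in> S \<Longrightarrow> symf (f x)) \<Longrightarrow> symf (\<Sum>x\<in>S. f x)"
  by (induction S rule: infinite_finite_induct) auto
lemma symf_bounded: "symf f \<Longrightarrow> bounded_deg f" by (simp add: symf_iff)

text \<open>Symmetry is invariance under permutations of all variables, so a renaming of finitely
  many of them has to be extended. Inside the union of A and B the complements of A and of B have
  equal size; outside, the identity works.\<close>

lemma bij_extending:
  assumes "finite (A :: nat set)" "finite (B :: nat set)" "bij_betw g A B"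
  obtains p where "bij p" "\<And>x. x \<in> A \<Longrightarrow> p x = g x"
proof -
  have "card A = card B" using assms bij_betw_same_card by blast
  then have "card ((A \<union> B) - A) = card ((A \<union> B) - B)"
    using assms by (simp add: card_Diff_subset)
  then obtain h where h: "bij_betw h ((A \<union> B) - A) ((A \<union> B) - B)"
    using assms finite_same_card_bij[of "(A \<union> B) - A" "(A \<union> B) - B"] by auto
  have 1: "bij_betw (\<lambda>x. if x \<in> A then g x else h x) (A \<union> ((A \<union> B) - A)) (B \<union> ((A \<union> B) - B))"
    by (rule bij_betw_disjoint_Un) (use assms h in auto)
  then have 1: "bij_betw (\<lambda>x. if x \<in> A then g x else h x) (A \<union> B) (A \<union> B)"
    by (simp add: Un_Diff_cancel Un_commute Un_left_commute)
  have "bij_betw (\<lambda>x. if x \<in> A \<union> B then (if x \<in> A then g x else h x) else id x)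
      ((A \<union> B) \<union> - (A \<union> B)) ((A \<union> B) \<union> - (A \<union> B))"
    by (rule bij_betw_disjoint_Un[OF 1]) (auto simp: bij_betw_def)
  then have "bij (\<lambda>x. if x \<in> A \<union> B then (if x \<in> A then g x else h x) else id x)"
    by (simp only: Compl_partition)
  then show thesis by (rule that) auto
qed

lemma image_mset_eq_bij:
  assumes "finite A" "finite B" "image_mset f (mset_set A) = image_mset g (mset_set B)"
  obtains h where "bij_betw h A B" "\<And>a. a \<in> A \<Longrightarrow> g (h a) = f a"
proof -
  have "\<exists>h. bij_betw h A B \<and> (\<forall>a\<in>A. g (h a) = f a)"
    using assms
  proof (induction A arbitrary: B rule: finite_induct)
    case empty
    then have "B = {}" by (metis finite_set_mset_mset_set image_mset_is_empty_iff mset_set.empty set_mset_empty)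
    then show ?case by (auto simp: bij_betw_def)
  next
    case (insert a A)
    have "f a \<in># image_mset g (mset_set B)"
      using insert.hyps by (simp flip: insert.prems(2))
    then obtain b where b: "b \<in> B" "g b = f a" using insert.prems by auto
    have B: "mset_set B = add_mset b (mset_set (B - {b}))"
      using b insert.prems by (simp add: mset_set.remove)
    have "image_mset f (mset_set A) = image_mset g (mset_set (B - {b}))"
      using insert.prems(2) b insert.hyps unfolding B by simp
    then obtain h where h: "bij_betw h A (B - {b})" "\<forall>a\<in>A. g (h a) = f a"
      using insert.IH[of "B - {b}"] insert.prems by auto
    have "bij_betw (h(a := b)) (insert a A) B"
    proof -
      have "bij_betw (h(a := b)) A (B - {b})"
        using h(1) insert.hyps by (subst bij_betw_cong[of _ _ h]) auto
      moreover have "b \<notin> B - {b}" by simp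
      ultimately have "bij_betw (h(a := b)) (A \<union> {a}) ((B - {b}) \<union> {b})"
        using insert.hyps notIn_Un_bij_betw[of a A "h(a := b)" "B - {b}"] by simp
      then show ?thesis using b by (simp add: insert_absorb)
    qed
    moreover have "\<forall>x\<in>insert a A. g ((h(a := b)) x) = f x" using h b insert.hyps by auto
    ultimately show ?case by blast
  qed
  then show thesis using that by blast
qed

text \<open>Monomials of equal shape differ by a bijection of their supports that respects
  exponents, and this bijection extends to a permutation of all variables.\<close>

lemma symf_exponents:
  assumes "symf f" "exponents M = exponents M'"
  shows "cf f M = cf f M'"
proof -
  obtain h where h: "bij_betw h (set_mset M) (set_mset M')"
    "\<And>a. a \<in> set_mset M \<Longrightarrow> count M' (h a) = count M a"
    using image_mset_eq_bij[of "set_mset M" "set_mset M'" "count M" "count M'"] assms(2)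
    by (auto simp: exponents_def)
  obtain p where p: "bij p" "\<And>x. x \<in> set_mset M \<Longrightarrow> p x = h x"
    using bij_extending[OF _ _ h(1)] by auto
  have "image_mset p M = M'"
  proof (rule multiset_eqI)
    fix i
    have i: "i = p (inv p i)" using p by (simp add: bij_is_surj surj_f_inv_f)
    have "count (image_mset p M) (p (inv p i)) = count M (inv p i)"
      using p(1) by (simp add: bij_is_inj count_image_mset_inj')
    also have "\<dots> = count M' (p (inv p i))"
    proof (cases "inv p i \<in># M")
      case True
      then show ?thesis using p h by simp
    next
      case False
      have "p (inv p i) \<notin># M'"
      proof
        assume "p (inv p i) \<in># M'"
        then obtain x where "x \<in># M" "p (inv p i) = h x" using h(1) by (auto simp: bij_betw_def)
        then have "inv p i = x" using p by (metis bij_is_inj injD)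
        then show False using False \<open>x \<in># M\<close> by simp
      qed
      then show ?thesis using False by (simp add: not_in_iff)
    qed
    finally show "count (image_mset p M) i = count M' i" using i by simp
  qed
  then show ?thesis using assms p by (metis symf_iff)
qed

section \<open>Families triangular in the monomial basis\<close>

abbreviation partitions_in :: "nat set \<Rightarrow> partition set"
  where "partitions_in D \<equiv> {la \<in> partitions. sum_mset la \<in> D}"

lemma finite_partitions_in: "finite D \<Longrightarrow> finite (partitions_in D)"
  by (rule finite_subset[OF _ finite_partitions_le[of "Max (insert 0 D)"]]) auto

text \<open>Spanning and independence are needed for two families: the power sums, ranked by their
  number of parts, and the Hall-Littlewood functions, ranked by \<open>dom_rank\<close>. Both are
  triangular in the monomial functions for their rank.\<close>

locale triangular_family =
  fixes B :: "partition \<Rightarrow> mps" and rk :: "partition \<Rightarrow> nat"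
  assumes sym: "la \<in> partitions \<Longrightarrow> symf (B la)"
    and tri: "la \<in> partitions \<Longrightarrow> cf (B la) M \<noteq> 0 \<Longrightarrow>
      size M = sum_mset la \<and> (exponents M = la \<or> rk (exponents M) < rk la)"
    and diag: "la \<in> partitions \<Longrightarrow> exponents M = la \<Longrightarrow> cf (B la) M \<noteq> 0"
begin

lemma span:
  assumes f: "symf f" and D: "finite D" and deg: "\<And>M. cf f M \<noteq> 0 \<Longrightarrow> size M \<in> D"
  shows "\<exists>c. f = (\<Sum>la\<in>partitions_in D. sc (c la) * B la)"
proof -
  note fin = finite_partitions_in[OF D]
  \<comment> \<open>Induction on a strict bound for the ranks of the shapes in f: subtracting
    suitable multiples of the \<open>B la\<close> of top rank clears all coefficients of that rank
    and disturbs only smaller ones.\<close>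
  have ind: "symf f \<Longrightarrow> (\<And>M. cf f M \<noteq> 0 \<Longrightarrow> size M \<in> D \<and> rk (exponents M) < R) \<Longrightarrow>
      \<exists>c. f = (\<Sum>la\<in>partitions_in D. sc (c la) * B la)" for R f
  proof (induction R arbitrary: f)
    case 0
    then have "f = 0" by (intro mps_eqI) auto
    then show ?case by (intro exI[of _ "\<lambda>_. 0"]) simp
  next
    case (Suc R)
    define X where "X la = mono_of (parts la)" for la
    define T where "T = {la \<in> partitions_in D. rk la = R}"
    have T: "T \<subseteq> partitions_in D" by (auto simp: T_def)
    then have T: "finite T" "T \<subseteq> partitions_in D" using fin finite_subset by blast+
    define c0 where "c0 la = (if la \<in> T then cf f (X la) / cf (B la) (X la) else 0)" for la
    define g where "g = f - (\<Sum>la\<in>partitions_in D. sc (c0 la) * B la)"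
    have s: "symf g" unfolding g_def using Suc.prems sym by (intro symf_diff symf_sum symf_mult) auto
    have g: "g = f - (\<Sum>la\<in>T. sc (c0 la) * B la)"
      unfolding g_def using T fin by (subst sum.mono_neutral_right[of "partitions_in D" T]) (auto simp: c0_def)
    have "size M \<in> D \<and> rk (exponents M) < R" if M: "cf g M \<noteq> 0" for M
    proof (rule ccontr)
      assume neg: "\<not> (size M \<in> D \<and> rk (exponents M) < R)"
      have "cf g M = 0"
      proof (cases "size M \<in> D \<and> rk (exponents M) = R")
        case True
        then have inT: "exponents M \<in> T" by (auto simp: T_def)
        have "(\<Sum>la\<in>T. c0 la * cf (B la) M) = (\<Sum>la\<in>{exponents M}. c0 la * cf (B la) M)"
          by (rule sum.mono_neutral_right) (use T inT tri in \<open>auto simp: T_def\<close>, fastforce+)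
        moreover have "cf f M = cf f (X (exponents M))"
          by (rule symf_exponents) (use Suc.prems in \<open>auto simp: X_def\<close>)
        moreover have "cf (B (exponents M)) M = cf (B (exponents M)) (X (exponents M))"
          by (rule symf_exponents) (auto simp: X_def sym)
        moreover have "cf (B (exponents M)) M \<noteq> 0" using diag by auto
        ultimately show ?thesis using inT by (simp add: g c0_def)
      next
        case False
        have "cf f M = 0" using Suc.prems(2)[of M] neg False by (cases "cf f M = 0") auto
        moreover have "cf (B la) M = 0" if "la \<in> T" for la
          using tri[of la M] that neg False by (cases "cf (B la) M = 0") (auto simp: T_def)
        ultimately show ?thesis by (simp add: g)
      qed
      then show False using M by simp
    qed
    from Suc.IH[OF s this] obtain c where c: "g = (\<Sum>la\<in>partitions_in D. sc (c la) * B la)" by auto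
    have "f = (\<Sum>la\<in>partitions_in D. sc (c la + c0 la) * B la)"
      using c by (simp add: g_def sc_add distrib_right sum.distrib algebra_simps)
    then show ?case by (intro exI)
  qed
  define R where "R = Suc (Max (insert 0 (rk ` partitions_in D)))"
  show ?thesis
  proof (rule ind[of f R, OF f])
    fix M assume "cf f M \<noteq> 0"
    then have "size M \<in> D" by (rule deg)
    then have "rk (exponents M) \<in> insert 0 (rk ` partitions_in D)" by auto
    then have "rk (exponents M) \<le> Max (insert 0 (rk ` partitions_in D))" using fin by (intro Max_ge) auto
    then show "size M \<in> D \<and> rk (exponents M) < R" using \<open>size M \<in> D\<close> by (simp add: R_def)
  qed
qed

lemma span_bounded:
  assumes "symf f"
  obtains d c where "f = (\<Sum>la\<in>partitions_in {..d}. sc (c la) * B la)"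
proof -
  obtain d where d: "\<And>M. d < size M \<Longrightarrow> cf f M = 0"
    using symf_bounded[OF assms] by (auto simp: bounded_deg_def)
  show thesis using span[OF assms, of "{..d}"] d that by (metis atMost_iff finite_atMost not_le)
qed

text \<open>At a shape mu of maximal rank among the nonzero coefficients, only \<open>B mu\<close>
  has a nonzero coefficient at monomials of shape mu.\<close>

lemma indep:
  assumes F: "finite F" "F \<subseteq> partitions" "(\<Sum>la\<in>F. sc (c la) * B la) = 0" "la \<in> F"
  shows "c la = 0"
proof (rule ccontr)
  assume "c la \<noteq> 0"
  define G where "G = {la\<in>F. c la \<noteq> 0}"
  have G: "finite G" "G \<noteq> {}" using F \<open>c la \<noteq> 0\<close> by (auto simp: G_def)
  obtain mu where mu: "mu \<in> G" "\<And>nu. nu \<in> G \<Longrightarrow> rk nu \<le> rk mu"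
    using obtains_MAX[OF G, of rk] Max_ge[of "rk ` G"] G by (metis finite_imageI imageI)
  have muP: "mu \<in> partitions" using mu F by (auto simp: G_def)
  define M where "M = mono_of (parts mu)"
  have M: "exponents M = mu" using muP by (simp add: M_def)
  have "0 = (\<Sum>la\<in>F. c la * cf (B la) M)" using arg_cong[OF F(3), of "\<lambda>f. cf f M"] by simp
  also have "\<dots> = (\<Sum>la\<in>{mu}. c la * cf (B la) M)"
  proof (rule sum.mono_neutral_right)
    show "\<forall>la\<in>F - {mu}. c la * cf (B la) M = 0"
    proof
      fix la assume la: "la \<in> F - {mu}"
      show "c la * cf (B la) M = 0"
        using tri[of la M] M la F(2) mu(2)[of la] by (cases "c la = 0"; cases "cf (B la) M = 0") (auto simp: G_def)
    qed
  qed (use F mu in \<open>auto simp: G_def\<close>)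
  finally show False using diag[OF muP M] mu by (simp add: G_def)
qed

end

section \<open>Power sums\<close>

definition pw :: "nat \<Rightarrow> mps" where "pw k = Ser (power_sum k)"

definition pp :: "partition \<Rightarrow> mps" where "pp la = prod_mset (image_mset pw la)"

lemma pp_empty [simp]: "pp {#} = 1" by (simp add: pp_def)
lemma pp_add_mset [simp]: "pp (add_mset k la) = pw k * pp la" by (simp add: pp_def)
lemma pp_union: "pp (la + mu) = pp la * pp mu" by (simp add: pp_def)

lemma cf_pp: "cf (pp la) = power_sum_partition la"
proof -
  have "foldr series_mult (map power_sum xs) series_one = cf (pp (mset xs))" for xs
    by (induction xs) (auto simp: cf_mult_series pw_def, simp add: one_mps_def)
  from this[of "parts la"] show ?thesis by (simp add: power_sum_partition_def)
qed

lemma submset_replicate_iff: "replicate_mset k i \<subseteq># M \<longleftrightarrow> k \<le> count M i"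
  by (simp add: subseteq_mset_def)

lemma cf_pw_mult:
  assumes "0 < k"
  shows "cf (pw k * g) M = (\<Sum>i | i \<in># M \<and> k \<le> count M i. cf g (M - replicate_mset k i))"
proof -
  let ?I = "{i. i \<in># M \<and> k \<le> count M i}"
  have inj: "inj_on (replicate_mset k) ?I"
    using assms by (intro inj_onI) (metis count_replicate_mset less_irrefl)
  have "cf (pw k * g) M = (\<Sum>A\<in>replicate_mset k ` ?I. cf (pw k) A * cf g (M - A))"
    unfolding cf_mult
  proof (rule sum.mono_neutral_right)
    show "replicate_mset k ` ?I \<subseteq> {A. A \<subseteq># M}" by (auto simp: submset_replicate_iff)
    show "\<forall>A\<in>{A. A \<subseteq># M} - replicate_mset k ` ?I. cf (pw k) A * cf g (M - A) = 0"
    proof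
      fix A assume A: "A \<in> {A. A \<subseteq># M} - replicate_mset k ` ?I"
      have "\<not> (\<exists>i. A = replicate_mset k i)"
      proof
        assume "\<exists>i. A = replicate_mset k i"
        then obtain i where i: "A = replicate_mset k i" ..
        then have "k \<le> count M i" using A by (simp add: submset_replicate_iff)
        then have "i \<in> ?I" using assms by (metis (mono_tags, lifting) count_greater_zero_iff less_le_trans mem_Collect_eq)
        then show False using A i by blast
      qed
      then show "cf (pw k) A * cf g (M - A) = 0" by (simp add: pw_def power_sum_def)
    qed
  qed simp
  also have "\<dots> = (\<Sum>i\<in>?I. cf g (M - replicate_mset k i))"
    using inj by (subst sum.reindex) (auto simp: pw_def power_sum_def intro!: sum.cong)
  finally show ?thesis .
qed

lemma replicate_mset_image_iff:
  assumes "bij p" shows "(\<exists>i. image_mset p M = replicate_mset k i) \<longleftrightarrow> (\<exists>i. M = replicate_mset k i)"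
proof
  assume "\<exists>i. image_mset p M = replicate_mset k i"
  then obtain i where "image_mset p M = replicate_mset k i" ..
  then have "image_mset (inv p) (image_mset p M) = replicate_mset k (inv p i)" by simp
  then have "M = replicate_mset k (inv p i)"
    using assms by (simp add: image_mset.compositionality comp_def bij_is_inj)
  then show "\<exists>i. M = replicate_mset k i" ..
qed auto

lemma symf_pw [simp]: "symf (pw k)"
proof -
  have "bounded_deg (pw k)" unfolding bounded_deg_def pw_def power_sum_def
    by (auto intro!: exI[of _ k])
  then show ?thesis by (auto simp: symf_iff pw_def power_sum_def replicate_mset_image_iff)
qed

lemma symf_pp [simp]: "symf (pp la)"
  by (induction la) auto

lemma pp_nonneg: "0 \<notin># la \<Longrightarrow> 0 \<le> cf (pp la) M"
proof (induction la arbitrary: M)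
  case (add k la)
  then have "0 < k" by (auto intro: gr0I)
  then show ?case using add by (auto simp: cf_pw_mult intro!: sum_nonneg)
qed (simp add: cf_one)

lemma exponents_add:
  assumes "i \<notin># M" "0 < k"
  shows "exponents (M + replicate_mset k i) = add_mset k (exponents M)"
proof -
  have "set_mset (M + replicate_mset k i) = insert i (set_mset M)" using assms by auto
  moreover have "image_mset (count (M + replicate_mset k i)) (mset_set (set_mset M)) =
      image_mset (count M) (mset_set (set_mset M))"
    using assms by (intro image_mset_cong) auto
  ultimately show ?thesis using assms unfolding exponents_def by (simp add: not_in_iff)
qed

text \<open>Multiplication by p_k raises one exponent by k. Either the variable is new, and the
  shape gains the part k, or it was present, and from then on there are fewer variables than
  parts.\<close>

lemma pp_triangular:
  assumes "0 \<notin># la" "cf (pp la) M \<noteq> 0"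
  shows "size M = sum_mset la \<and> (exponents M = la \<or> card (set_mset M) < size la)"
  using assms
proof (induction la arbitrary: M)
  case (add k la)
  have k: "0 < k" using add.prems(1) by (auto intro: gr0I)
  then obtain i where i: "i \<in># M" "k \<le> count M i" "cf (pp la) (M - replicate_mset k i) \<noteq> 0"
    using add.prems(2) by (auto simp: cf_pw_mult elim!: sum.not_neutral_contains_not_neutral)
  define M' where "M' = M - replicate_mset k i"
  have M: "M = M' + replicate_mset k i" using i by (simp add: M'_def submset_replicate_iff)
  have IH: "size M' = sum_mset la" "exponents M' = la \<or> card (set_mset M') < size la"
    using add.IH[of M'] i add.prems by (auto simp: M'_def)
  have card: "card (set_mset M) = (if i \<in># M' then card (set_mset M') else Suc (card (set_mset M')))"
    using k by (auto simp: M insert_absorb)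
  show ?case
  proof (cases "exponents M' = la \<and> i \<notin># M'")
    case True
    then show ?thesis using IH exponents_add[of i M' k] k by (simp add: M)
  next
    case False
    have "exponents M' = la \<Longrightarrow> card (set_mset M') = size la" by (metis size_exponents)
    then show ?thesis using False IH card by (auto simp: M)
  qed
qed (auto simp: cf_one split: if_splits)

text \<open>All coefficients are nonnegative, so one way of assembling the monomial already bounds
  its coefficient from below.\<close>

lemma pp_diag:
  assumes "0 \<notin># la" "exponents M = la"
  shows "1 \<le> cf (pp la) M"
  using assms
proof (induction la arbitrary: M)
  case empty
  then have "size M = 0" using sum_exponents[of M] by simp
  then show ?case by (simp add: cf_one)
next
  case (add k la)
  have k: "0 < k" using add.prems(1) by (auto intro: gr0I)
  have "k \<in># exponents M" using add.prems by simp
  then obtain i where i: "i \<in># M" "count M i = k" by (auto simp: exponents_def)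
  define M' where "M' = M - replicate_mset k i"
  have M: "M = M' + replicate_mset k i" using i by (simp add: M'_def submset_replicate_iff)
  have ni: "i \<notin># M'" using i by (simp add: M'_def not_in_iff)
  then have "exponents M' = la" using exponents_add[of i M' k] k add.prems by (simp add: M)
  then have "1 \<le> cf (pp la) M'" using add by auto
  also have "\<dots> \<le> cf (pp (add_mset k la)) M"
    unfolding pp_add_mset cf_pw_mult[OF k] M'_def
    by (rule member_le_sum[of i]) (use i add.prems pp_nonneg in auto)
  finally show ?case .
qed

interpretation pp: triangular_family pp size
  using pp_triangular pp_diag by unfold_locales (fastforce simp: partitions_def)+

definition pc :: "mps \<Rightarrow> partition \<Rightarrow> real" where "pc f = power_sum_coeffs (cf f)"

text \<open>Independence of the power sums makes the description in \<open>power_sum_coeffs\<close>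
  unique. The facts on \<open>pc\<close> below go through this rule.\<close>

lemma pc_eqI:
  assumes F: "finite F" "F \<subseteq> partitions" and f: "f = (\<Sum>la\<in>F. sc (c la) * pp la)"
  shows "pc f = (\<lambda>la. if la \<in> F then c la else 0)"
  unfolding pc_def power_sum_coeffs_def
proof (rule the_equality)
  let ?c = "\<lambda>la. if la \<in> F then c la else 0"
  have S: "{la. ?c la \<noteq> 0} \<subseteq> F" by auto
  have "cf f = (\<lambda>M. \<Sum>la | ?c la \<noteq> 0. ?c la * power_sum_partition la M)"
  proof
    fix M
    have "cf f M = (\<Sum>la\<in>F. ?c la * power_sum_partition la M)" by (simp add: f cf_pp)
    also have "\<dots> = (\<Sum>la | ?c la \<noteq> 0. ?c la * power_sum_partition la M)"
      by (rule sum.mono_neutral_right) (use S F in auto)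
    finally show "cf f M = (\<Sum>la | ?c la \<noteq> 0. ?c la * power_sum_partition la M)" .
  qed
  then show "finite {la. ?c la \<noteq> 0} \<and> {la. ?c la \<noteq> 0} \<subseteq> partitions \<and>
      cf f = (\<lambda>M. \<Sum>la | ?c la \<noteq> 0. ?c la * power_sum_partition la M)"
    using S F by (auto intro: finite_subset)
next
  fix d assume d: "finite {la. d la \<noteq> 0} \<and> {la. d la \<noteq> 0} \<subseteq> partitions \<and>
      cf f = (\<lambda>M. \<Sum>la | d la \<noteq> 0. d la * power_sum_partition la M)"
  let ?c = "\<lambda>la. if la \<in> F then c la else 0"
  let ?G = "F \<union> {la. d la \<noteq> 0}"
  have "(\<Sum>la\<in>?G. sc (d la - ?c la) * pp la) = 0"
  proof (rule mps_eqI)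
    fix M
    have "cf f M = (\<Sum>la\<in>?G. d la * cf (pp la) M)"
      using d F by (auto simp: cf_pp intro!: sum.mono_neutral_left)
    moreover have "cf f M = (\<Sum>la\<in>?G. ?c la * cf (pp la) M)"
      unfolding f using d F by (auto intro!: sum.mono_neutral_cong_left)
    ultimately show "cf (\<Sum>la\<in>?G. sc (d la - ?c la) * pp la) M = cf 0 M"
      by (simp add: left_diff_distrib sum_subtractf)
  qed
  then have "d la - ?c la = 0" if "la \<in> ?G" for la
    using pp.indep[of ?G "\<lambda>la. d la - ?c la" la] d F that by blast
  then show "d = ?c" by (intro ext) force
qed

lemma pc_expand:
  assumes "symf f"
  obtains F where "finite F" "F \<subseteq> partitions" "\<forall>la. la \<notin> F \<longrightarrow> pc f la = 0"
    "f = (\<Sum>la\<in>F. sc (pc f la) * pp la)"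
proof -
  obtain d c where f: "f = (\<Sum>la\<in>partitions_in {..d}. sc (c la) * pp la)"
    using pp.span_bounded[OF assms] .
  have fin: "finite (partitions_in {..d})" by (rule finite_partitions_in) simp
  have "pc f = (\<lambda>la. if la \<in> partitions_in {..d} then c la else 0)"
    by (rule pc_eqI[OF fin _ f]) auto
  then have "f = (\<Sum>la\<in>partitions_in {..d}. sc (pc f la) * pp la)"
    by (subst f, intro sum.cong) simp_all
  then show thesis using fin \<open>pc f = _\<close> by (intro that[of "partitions_in {..d}"]) auto
qed

lemma pc_add:
  assumes "symf f" "symf g" shows "pc (f + g) la = pc f la + pc g la"
proof -
  obtain F where F: "finite F" "F \<subseteq> partitions" "\<forall>la. la \<notin> F \<longrightarrow> pc f la = 0" "f = (\<Sum>la\<in>F. sc (pc f la) * pp la)"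
    by (rule pc_expand[OF assms(1)]) (rule that; assumption)
  obtain G where G: "finite G" "G \<subseteq> partitions" "\<forall>la. la \<notin> G \<longrightarrow> pc g la = 0" "g = (\<Sum>la\<in>G. sc (pc g la) * pp la)"
    by (rule pc_expand[OF assms(2)]) (rule that; assumption)
  have 1: "f = (\<Sum>la\<in>F \<union> G. sc (pc f la) * pp la)"
    by (subst F(4), rule sum.mono_neutral_left) (use F G in auto)
  have 2: "g = (\<Sum>la\<in>F \<union> G. sc (pc g la) * pp la)"
    by (subst G(4), rule sum.mono_neutral_left) (use F G in auto)
  have "f + g = (\<Sum>la\<in>F \<union> G. sc (pc f la + pc g la) * pp la)"
    by (subst 1, subst 2) (simp add: sc_add distrib_right sum.distrib)
  from pc_eqI[OF _ _ this] show ?thesis using F G by auto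
qed

lemma pc_sc:
  assumes "symf f" shows "pc (sc a * f) la = a * pc f la"
proof -
  obtain F where F: "finite F" "F \<subseteq> partitions" "\<forall>la. la \<notin> F \<longrightarrow> pc f la = 0" "f = (\<Sum>la\<in>F. sc (pc f la) * pp la)"
    by (rule pc_expand[OF assms]) (rule that; assumption)
  have "sc a * f = (\<Sum>la\<in>F. sc (a * pc f la) * pp la)"
    by (subst F(4)) (simp add: sum_distrib_left sc_mult mult.assoc)
  from pc_eqI[OF F(1,2) this] show ?thesis using F by auto
qed

lemma pc_pp: "la \<in> partitions \<Longrightarrow> pc (pp la) mu = (if mu = la then 1 else 0)"
  using pc_eqI[of "{la}" "pp la" "\<lambda>_. 1"] by simp

section \<open>The Hall--Littlewood form\<close>

text \<open>The coefficient of x_0^r, with the remaining variables renumbered from 0. It turns out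
  to be the adjoint of multiplication by \<open>qs r\<close>.\<close>

definition Dop :: "nat \<Rightarrow> mps \<Rightarrow> mps"
  where "Dop r g = Ser (\<lambda>M. cf g (image_mset Suc M + replicate_mset r 0))"

lemma cf_Dop: "cf (Dop r g) M = cf g (image_mset Suc M + replicate_mset r 0)"
  by (simp add: Dop_def)

lemma Dop_sc: "Dop r (sc c * g) = sc c * Dop r g"
  by (rule mps_eqI) (simp add: cf_Dop)
lemma Dop_sum: "Dop r (\<Sum>x\<in>S. f x) = (\<Sum>x\<in>S. Dop r (f x))"
  by (rule mps_eqI) (simp add: cf_Dop)

lemma symf_Dop:
  assumes "symf g" shows "symf (Dop r g)"
proof -
  have "cf (Dop r g) (image_mset p M) = cf (Dop r g) M" if p: "bij p" for p M
  proof -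
    define q where "q i = (case i of 0 \<Rightarrow> 0 | Suc j \<Rightarrow> Suc (p j))" for i
    have "bij q"
    proof (rule bijI)
      show "inj q"
      proof (rule injI)
        fix x y assume "q x = q y"
        then show "x = y" using p by (cases x; cases y) (auto simp: q_def bij_def inj_def)
      qed
      have "\<exists>x. i = q x" for i
      proof (cases i)
        case 0
        then show ?thesis by (intro exI[of _ 0]) (simp add: q_def)
      next
        case (Suc j)
        then obtain y where "j = p y" using p by (meson bij_pointE)
        then show ?thesis using Suc by (intro exI[of _ "Suc y"]) (simp add: q_def)
      qed
      then show "surj q" unfolding surj_def by blast
    qed
    moreover have "image_mset q (image_mset Suc M + replicate_mset r 0) = image_mset Suc (image_mset p M) + replicate_mset r 0"
      by (simp add: image_mset.compositionality comp_def q_def)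
    ultimately show ?thesis using assms unfolding cf_Dop symf_iff by metis
  qed
  moreover obtain d where "\<And>M. d < size M \<Longrightarrow> cf g M = 0"
    using symf_bounded[OF assms] by (auto simp: bounded_deg_def)
  then have "bounded_deg (Dop r g)" by (auto simp: bounded_deg_def cf_Dop intro!: exI[of _ d])
  ultimately show ?thesis by (simp add: symf_iff)
qed

lemma Dop_1: "Dop r 1 = (if r = 0 then 1 else 0)"
  by (rule mps_eqI) (auto simp: cf_Dop cf_one)

lemma image_Suc_minus: "image_mset Suc M + replicate_mset r 0 - replicate_mset k (Suc j)
    = image_mset Suc (M - replicate_mset k j) + replicate_mset r 0"
  by (rule multiset_eqI) (auto simp: count_image_Suc split: nat.splits)

text \<open>The power sum splits as x_0^k plus the power sum of the other variables.\<close>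

lemma Dop_pw_mult:
  assumes k: "0 < k"
  shows "Dop r (pw k * g) = pw k * Dop r g + (if k \<le> r then Dop (r - k) g else 0)"
proof (rule mps_eqI)
  fix M
  let ?M = "image_mset Suc M + replicate_mset r 0"
  let ?I = "{i. i \<in># ?M \<and> k \<le> count ?M i}"
  have c0: "count ?M 0 = r" "count ?M (Suc j) = count M j" for j by (auto simp: count_image_Suc)
  have I: "?I = (if k \<le> r then {0} else {}) \<union> Suc ` {j. j \<in># M \<and> k \<le> count M j}"
  proof -
    have "i \<in> ?I \<longleftrightarrow> i \<in> (if k \<le> r then {0} else {}) \<union> Suc ` {j. j \<in># M \<and> k \<le> count M j}" for i
      using k c0 by (cases i) (auto simp: count_greater_zero_iff[symmetric] simp del: count_greater_zero_iff count_union)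
    then show ?thesis by blast
  qed
  have "cf (Dop r (pw k * g)) M = (\<Sum>i\<in>?I. cf g (?M - replicate_mset k i))"
    unfolding cf_Dop cf_pw_mult[OF k] ..
  also have "\<dots> = (if k \<le> r then cf g (?M - replicate_mset k 0) else 0) +
      (\<Sum>j | j \<in># M \<and> k \<le> count M j. cf g (?M - replicate_mset k (Suc j)))"
  proof -
    have "(\<Sum>i\<in>Suc ` {j. j \<in># M \<and> k \<le> count M j}. cf g (?M - replicate_mset k i)) =
        (\<Sum>j | j \<in># M \<and> k \<le> count M j. cf g (?M - replicate_mset k (Suc j)))"
      by (subst sum.reindex) simp_all
    then show ?thesis unfolding I by (subst sum.union_disjoint) auto
  qed
  also have "?M - replicate_mset k 0 = image_mset Suc M + replicate_mset (r - k) 0"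
    by (rule multiset_eqI) (auto simp: count_image_Suc split: nat.splits)
  finally show "cf (Dop r (pw k * g)) M = cf (pw k * Dop r g + (if k \<le> r then Dop (r - k) g else 0)) M"
    by (simp add: cf_Dop cf_pw_mult[OF k] image_Suc_minus)
qed

locale hl =
  fixes t :: real
  assumes t0: "0 \<le> t" and t1: "t < 1"
begin

lemma one_minus_pow: "0 < i \<Longrightarrow> 0 < 1 - t ^ i"
  using t0 t1 power_strict_mono[of t 1 i] by simp

text \<open>The squared length of p_la at q = 0, usually written z_la(t). For positive parts the
  factor \<open>1 - 0 ^ i\<close> is 1.\<close>

definition wt :: "partition \<Rightarrow> real"
  where "wt la = z_coeff la * (\<Prod>i\<in>#la. (1 - 0 ^ i) / (1 - t ^ i))"

lemma z_coeff_add: "0 < k \<Longrightarrow> z_coeff (add_mset k la) = z_coeff la * (real k * (real (count la k) + 1))"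
proof -
  have *: "(\<Prod>i\<in>set_mset la - {k}. fact (count (add_mset k la) i) * real i ^ count (add_mset k la) i)
     = (\<Prod>i\<in>set_mset la - {k}. fact (count la i) * real i ^ count la i)"
    by (intro prod.cong) auto
  show ?thesis
  proof (cases "k \<in># la")
    case True
    then show ?thesis unfolding z_coeff_def
      by (simp add: insert_absorb prod.remove[of "set_mset la" k] del: count_add_mset)
        (simp add: *[simplified] algebra_simps)
  next
    case False
    then show ?thesis using * unfolding z_coeff_def by (simp add: not_in_iff)
  qed
qed

lemma wt_empty [simp]: "wt {#} = 1" by (simp add: wt_def z_coeff_def)

lemma wt_add: "0 < k \<Longrightarrow> wt (add_mset k la) = wt la * (real k * (real (count la k) + 1) / (1 - t ^ k))"
  by (simp add: wt_def z_coeff_add)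

lemma wt_pos: "la \<in> partitions \<Longrightarrow> 0 < wt la"
  unfolding partitions_def
proof (induction la)
  case (add k la)
  then have "0 < k" by (auto intro: gr0I)
  then show ?case using add one_minus_pow[of k] by (simp add: wt_add)
qed simp

definition frm :: "mps \<Rightarrow> mps \<Rightarrow> real" where "frm f g = macdonald_form 0 t (cf f) (cf g)"

lemma frm_eq:
  assumes "finite F" "\<And>la. la \<notin> F \<Longrightarrow> pc f la = 0 \<or> pc g la = 0" "finite {la. pc f la \<noteq> 0}"
  shows "frm f g = (\<Sum>la\<in>F. pc f la * pc g la * wt la)"
proof -
  have "frm f g = (\<Sum>la | pc f la \<noteq> 0. pc f la * pc g la * wt la)"
    by (simp add: frm_def macdonald_form_def pc_def wt_def)
  also have "\<dots> = (\<Sum>la\<in>F. pc f la * pc g la * wt la)"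
    by (rule sum.mono_neutral_cong) (use assms in force)+
  finally show ?thesis .
qed

lemma symf_finite_pc: "symf f \<Longrightarrow> finite {la. pc f la \<noteq> 0}"
  by (rule pc_expand) (auto intro: finite_subset)

lemma frm_eq':
  assumes "finite F" "\<And>la. la \<notin> F \<Longrightarrow> pc f la = 0 \<or> pc g la = 0" "symf f"
  shows "frm f g = (\<Sum>la\<in>F. pc f la * pc g la * wt la)"
  using assms symf_finite_pc by (intro frm_eq)

lemma frm_commute: "symf f \<Longrightarrow> symf g \<Longrightarrow> frm f g = frm g f"
  using frm_eq'[of "{la. pc f la \<noteq> 0}" f g] frm_eq'[of "{la. pc f la \<noteq> 0}" g f] symf_finite_pc[of f]
  by (simp add: ac_simps)

lemma frm_add_right:
  assumes "symf f" "symf g" "symf h" shows "frm f (g + h) = frm f g + frm f h"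
proof -
  note F = symf_finite_pc[OF assms(1)]
  show ?thesis
    by (subst (1 2 3) frm_eq'[OF F]) (use assms in \<open>auto simp: pc_add algebra_simps sum.distrib\<close>)
qed

lemma frm_sc_right:
  assumes "symf f" "symf g" shows "frm f (sc a * g) = a * frm f g"
proof -
  note F = symf_finite_pc[OF assms(1)]
  show ?thesis
    by (subst (1 2) frm_eq'[OF F]) (use assms in \<open>auto simp: pc_sc sum_distrib_left intro!: sum.cong\<close>)
qed

lemma frm_add_left: "symf f \<Longrightarrow> symf g \<Longrightarrow> symf h \<Longrightarrow> frm (g + h) f = frm g f + frm h f"
  using frm_add_right[of f g h] frm_commute by (metis symf_add)

lemma frm_sc_left: "symf f \<Longrightarrow> symf g \<Longrightarrow> frm (sc a * g) f = a * frm g f"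
  using frm_sc_right[of f g a] frm_commute by (metis symf_mult symf_sc)

lemma frm_0_right [simp]: "symf f \<Longrightarrow> frm f 0 = 0"
  using frm_sc_right[of f 0 0] by simp

lemma frm_0_left [simp]: "symf f \<Longrightarrow> frm 0 f = 0"
  using frm_sc_left[of f 0 0] by simp

lemma frm_sum_right:
  assumes "symf f" "\<And>x. x \<in> S \<Longrightarrow> symf (g x)"
  shows "frm f (\<Sum>x\<in>S. g x) = (\<Sum>x\<in>S. frm f (g x))"
  using assms by (induction S rule: infinite_finite_induct) (auto simp: frm_add_right symf_sum)

lemma frm_sum_left:
  assumes "symf f" "\<And>x. x \<in> S \<Longrightarrow> symf (g x)"
  shows "frm (\<Sum>x\<in>S. g x) f = (\<Sum>x\<in>S. frm (g x) f)"
  using assms by (induction S rule: infinite_finite_induct) (auto simp: frm_add_left symf_sum)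

lemma frm_pp:
  assumes "la \<in> partitions" "mu \<in> partitions"
  shows "frm (pp la) (pp mu) = (if la = mu then wt la else 0)"
  by (subst frm_eq'[of "{la}"]) (use assms in \<open>auto simp: pc_pp\<close>)

text \<open>The one-row function q_r with generating series \<Sum> q_r y^r = \<Prod> (1 - t x_i y) /
  (1 - x_i y): every variable that occurs contributes a factor 1 - t, whatever its exponent.\<close>

definition qs :: "nat \<Rightarrow> mps"
  where "qs r = Ser (\<lambda>M. if size M = r then (1 - t) ^ card (set_mset M) else 0)"

lemma cf_qs: "cf (qs r) M = (if size M = r then (1 - t) ^ card (set_mset M) else 0)"
  by (simp add: qs_def)

lemma symf_qs [simp]: "symf (qs r)"
proof -
  have "card (set_mset (image_mset p M)) = card (set_mset M)" if "bij p" for p :: "nat \<Rightarrow> nat" and M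
    using that by (simp add: card_image bij_is_inj inj_on_subset[OF bij_is_inj])
  then show ?thesis by (auto simp: symf_iff cf_qs bounded_deg_def)
qed

lemma qs_0 [simp]: "qs 0 = 1"
  by (rule mps_eqI) (auto simp: cf_qs cf_one)

lemma of_nat_sc: "of_nat r = sc (real r)"
  by (induction r) (auto simp: sc_add)

text \<open>The contribution of one variable of exponent m to the recurrence for q_r. Removing x^k
  with k < m keeps the variable, k = m loses it; hence the drop in the exponent of 1 - t.\<close>

lemma geometric_step:
  assumes "0 < m" "0 < s"
  shows "(\<Sum>k=1..m. (1 - t ^ k) * (1 - t) ^ (if k = m then s - 1 else s)) = real m * (1 - t) ^ s"
proof -
  have split: "{1..m} = insert m {1..<m}" using assms by auto
  have g: "(\<Sum>k=1..<m. (1 - t) * (1 - t ^ k)) = real m * (1 - t) - (1 - t ^ m)"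
    using assms(1)
  proof (induction m rule: nat_induct_non_zero)
    case (Suc m)
    then show ?case by (simp add: algebra_simps)
  qed simp
  have s: "(1 - t) ^ s = (1 - t) ^ (s - 1) * (1 - t)" using assms by (cases s) auto
  have "(\<Sum>k=1..m. (1 - t ^ k) * (1 - t) ^ (if k = m then s - 1 else s))
     = (1 - t ^ m) * (1 - t) ^ (s - 1) + (\<Sum>k=1..<m. (1 - t ^ k) * (1 - t) ^ s)"
    unfolding split by (subst sum.insert) (auto intro!: sum.cong)
  also have "(\<Sum>k=1..<m. (1 - t ^ k) * (1 - t) ^ s) = (1 - t) ^ (s - 1) * (\<Sum>k=1..<m. (1 - t) * (1 - t ^ k))"
    unfolding s by (simp add: sum_distrib_left ac_simps)
  finally show ?thesis unfolding g s by (simp add: algebra_simps)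
qed

text \<open>The Newton identity for q_r, i.e. the logarithmic derivative of the generating series,
  checked one monomial at a time.\<close>

lemma qs_recurrence: "of_nat r * qs r = (\<Sum>k=1..r. sc (1 - t ^ k) * (pw k * qs (r - k)))"
proof (rule mps_eqI)
  fix M :: monomial
  let ?s = "card (set_mset M)"
  have "cf (\<Sum>k=1..r. sc (1 - t ^ k) * (pw k * qs (r - k))) M
      = (\<Sum>k=1..r. \<Sum>i | i \<in># M \<and> k \<le> count M i. (1 - t ^ k) * cf (qs (r - k)) (M - replicate_mset k i))"
    by (auto simp: cf_pw_mult sum_distrib_left intro!: sum.cong)
  also have "\<dots> = real r * cf (qs r) M"
  proof (cases "size M = r")
    case False
    have "cf (qs (r - k)) (M - replicate_mset k i) = 0" if "k \<in> {1..r}" "k \<le> count M i" for k i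
    proof -
      have "size (M - replicate_mset k i) = size M - k" using that by (simp add: size_Diff_submset submset_replicate_iff)
      moreover have "k \<le> size M" using that count_le_size[of M i] by linarith
      ultimately show ?thesis using False that by (auto simp: cf_qs)
    qed
    then show ?thesis using False by (auto simp: cf_qs intro!: sum.neutral)
  next
    case True
    have "(\<Sum>k=1..r. \<Sum>i | i \<in># M \<and> k \<le> count M i. (1 - t ^ k) * cf (qs (r - k)) (M - replicate_mset k i))
        = (\<Sum>i\<in>set_mset M. \<Sum>k=1..count M i. (1 - t ^ k) * cf (qs (r - k)) (M - replicate_mset k i))"
    proof -
      have "(\<Sum>k=1..r. \<Sum>i | i \<in># M \<and> k \<le> count M i. (1 - t ^ k) * cf (qs (r - k)) (M - replicate_mset k i))
        = (\<Sum>(k,i)\<in>Sigma {1..r} (\<lambda>k. {i. i \<in># M \<and> k \<le> count M i}). (1 - t ^ k) * cf (qs (r - k)) (M - replicate_mset k i))"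
        by (rule sum.Sigma) auto
      also have "\<dots> = (\<Sum>(i,k)\<in>Sigma (set_mset M) (\<lambda>i. {1..count M i}). (1 - t ^ k) * cf (qs (r - k)) (M - replicate_mset k i))"
        by (rule sum.reindex_bij_witness[of _ "\<lambda>(i,k). (k,i)" "\<lambda>(k,i). (i,k)"])
          (use True le_trans[OF _ count_le_size[of M]] in auto)
      also have "\<dots> = (\<Sum>i\<in>set_mset M. \<Sum>k=1..count M i. (1 - t ^ k) * cf (qs (r - k)) (M - replicate_mset k i))"
        by (rule sum.Sigma[symmetric]) auto
      finally show ?thesis .
    qed
    also have "\<dots> = (\<Sum>i\<in>set_mset M. real (count M i) * (1 - t) ^ ?s)"
    proof (rule sum.cong)
      fix i assume i: "i \<in># M"
      have "cf (qs (r - k)) (M - replicate_mset k i) = (1 - t) ^ (if k = count M i then ?s - 1 else ?s)"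
        if k: "k \<in> {1..count M i}" for k
      proof -
        have "size (M - replicate_mset k i) = r - k" using k True by (simp add: size_Diff_submset submset_replicate_iff)
        moreover have "set_mset (M - replicate_mset k i) = (if k = count M i then set_mset M - {i} else set_mset M)"
        proof -
          have "x \<in># M - replicate_mset k i \<longleftrightarrow> x \<in> (if k = count M i then set_mset M - {i} else set_mset M)" for x
            using k by (auto simp flip: count_greater_zero_iff split: if_splits)
          then show ?thesis by blast
        qed
        ultimately show ?thesis using i by (simp add: cf_qs)
      qed
      then have "(\<Sum>k=1..count M i. (1 - t ^ k) * cf (qs (r - k)) (M - replicate_mset k i))
         = (\<Sum>k=1..count M i. (1 - t ^ k) * (1 - t) ^ (if k = count M i then ?s - 1 else ?s))"
        by (intro sum.cong) auto
      also have "\<dots> = real (count M i) * (1 - t) ^ ?s"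
        using i by (intro geometric_step) (auto simp: card_gt_0_iff)
      finally show "(\<Sum>k=1..count M i. (1 - t ^ k) * cf (qs (r - k)) (M - replicate_mset k i)) = real (count M i) * (1 - t) ^ ?s" .
    qed simp
    also have "\<dots> = real r * (1 - t) ^ ?s"
      using True by (simp add: size_multiset_overloaded_eq flip: sum_distrib_right of_nat_sum)
    finally show ?thesis using True by (simp add: cf_qs)
  qed
  finally show "cf (of_nat r * qs r) M = cf (\<Sum>k=1..r. sc (1 - t ^ k) * (pw k * qs (r - k))) M"
    by (simp add: of_nat_sc)
qed

lemma sum_mset_multiplicity_id: "real (sum_mset la) = (\<Sum>k\<in>set_mset la. real (count la k) * real k)"
proof -
  have "real (sum_mset mu) = (\<Sum>k\<in>S. real (count mu k) * real k)" if "finite S" "set_mset mu \<subseteq> S" for mu S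
    using that
  proof (induction mu)
    case (add x mu)
    have "(\<Sum>k\<in>S. real (count (add_mset x mu) k) * real k)
        = (\<Sum>k\<in>S. real (count mu k) * real k + (if k = x then real x else 0))"
      by (intro sum.cong) (auto simp: algebra_simps)
    then show ?case using add by (simp add: sum.distrib sum.delta)
  qed simp
  from this[of "set_mset la" la] show ?thesis by simp
qed

lemma wt_remove:
  assumes "la \<in> partitions" "k \<in># la"
  shows "wt la = wt (la - {#k#}) * (real k * real (count la k) / (1 - t ^ k))"
proof -
  have "0 < k" using assms in_partition_pos by blast
  moreover have "la = add_mset k (la - {#k#})" using assms by simp
  ultimately show ?thesis using assms(2) by (subst \<open>la = _\<close>, subst wt_add) (auto simp: of_nat_diff Suc_leI)
qed

text \<open>The recurrence builds each la by adjoining one of its distinct parts k with weight k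
  times its multiplicity. These weights add up to r, which cancels the factor r on the left.\<close>

lemma qs_power_sums: "qs r = (\<Sum>la | la \<in> partitions \<and> sum_mset la = r. sc (1 / wt la) * pp la)"
proof (induction r rule: less_induct)
  case (less r)
  show ?case
  proof (cases "r = 0")
    case True
    have "la = {#}" if "la \<in> partitions" "sum_mset la = 0" for la :: partition
      using size_le_sum_partition[of la] that by (simp del: sum_mset_0_iff)
    then have "{la. la \<in> partitions \<and> sum_mset la = 0} = {{#}}" by auto
    then show ?thesis using True by simp
  next
    case False
    let ?P = "\<lambda>r. {la. la \<in> partitions \<and> sum_mset la = r}"
    have fin: "finite (?P r)" for r by (rule finite_partitions_of)
    have "of_nat r * qs r = (\<Sum>k=1..r. sc (1 - t ^ k) * (pw k * (\<Sum>la\<in>?P (r - k). sc (1 / wt la) * pp la)))"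
      unfolding qs_recurrence using less by (intro sum.cong) auto
    also have "\<dots> = (\<Sum>k=1..r. \<Sum>la\<in>?P (r - k). sc ((1 - t ^ k) / wt la) * pp (add_mset k la))"
    proof -
      have *: "sc ((1 - t ^ k) / wt la) = sc (1 - t ^ k) * sc (1 / wt la)" for k la
        by (simp flip: sc_mult)
      show ?thesis by (simp add: sum_distrib_left * ac_simps)
    qed
    also have "\<dots> = (\<Sum>(k,la)\<in>Sigma {1..r} (\<lambda>k. ?P (r - k)). sc ((1 - t ^ k) / wt la) * pp (add_mset k la))"
      by (rule sum.Sigma) (auto simp: fin)
    also have "\<dots> = (\<Sum>(la,k)\<in>Sigma (?P r) set_mset. sc (real k * real (count la k) / wt la) * pp la)"
    proof (rule sum.reindex_bij_witness[of _ "\<lambda>(la,k). (k, la - {#k#})" "\<lambda>(k,la). (add_mset k la, k)"], goal_cases)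
      case (1 a) then show ?case by auto
    next
      case (2 a) then show ?case by (auto simp: partitions_def)
    next
      case (3 b) then show ?case by auto
    next
      case (4 b)
      then obtain la k where b: "b = (la, k)" "la \<in> partitions" "sum_mset la = r" "k \<in># la" by auto
      have "la = add_mset k (la - {#k#})" using b by simp
      then have "r = k + sum_mset (la - {#k#})" using b(3) by (metis sum_mset.add_mset)
      then show ?case using b in_partition_pos[of la k] by (auto simp: partitions_def dest: in_diffD)
    next
      case (5 a)
      then obtain k la where a: "a = (k, la)" "k \<in> {1..r}" "la \<in> partitions" by auto
      define w where "w = real k * (real (count la k) + 1)"
      have "wt la \<noteq> 0" "1 - t ^ k \<noteq> 0" "w \<noteq> 0"
        using wt_pos[OF a(3)] one_minus_pow[of k] a by (auto simp: w_def)
      moreover have "wt (add_mset k la) = wt la * (w / (1 - t ^ k))"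
        using a wt_add[of k la] by (simp add: w_def)
      moreover have "real k * real (count (add_mset k la) k) = w" by (simp add: w_def algebra_simps)
      ultimately have "real k * real (count (add_mset k la) k) / wt (add_mset k la) = (1 - t ^ k) / wt la"
        by simp
      then show ?case using a by simp
    qed
    also have "\<dots> = (\<Sum>la\<in>?P r. \<Sum>k\<in>set_mset la. sc (real k * real (count la k) / wt la) * pp la)"
      by (rule sum.Sigma[symmetric]) (auto simp: fin)
    also have "\<dots> = (\<Sum>la\<in>?P r. sc (real r / wt la) * pp la)"
    proof (rule sum.cong)
      fix la assume la: "la \<in> ?P r"
      have e: "sum_mset la = r" using la by simp
      have "(\<Sum>k\<in>set_mset la. real k * real (count la k)) = real r"
        unfolding e[symmetric] sum_mset_multiplicity_id by (simp add: mult.commute)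
      then show "(\<Sum>k\<in>set_mset la. sc (real k * real (count la k) / wt la) * pp la) = sc (real r / wt la) * pp la"
        using la by (simp flip: sc_sum sum_distrib_right sum_divide_distrib)
    qed simp
    finally have "of_nat r * qs r = (\<Sum>la\<in>?P r. sc (real r / wt la) * pp la)" .
    then have "sc (1 / real r) * (of_nat r * qs r) = (\<Sum>la\<in>?P r. sc (1 / real r) * (sc (real r / wt la) * pp la))"
      by (simp add: sum_distrib_left)
    then show ?thesis using False by (simp add: of_nat_sc flip: mult.assoc sc_mult)
  qed
qed

lemma sum_submset_add:
  fixes h :: "nat multiset \<Rightarrow> mps"
  shows "(\<Sum>ga | ga \<subseteq># add_mset k la \<and> k \<in># ga \<and> Q ga. h ga) = (\<Sum>de | de \<subseteq># la \<and> Q (add_mset k de). h (add_mset k de))"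
  by (rule sum.reindex_bij_witness[of _ "add_mset k" "\<lambda>ga. ga - {#k#}"])
    (auto simp: subset_eq_diff_conv insert_DiffM)

text \<open>Each factor of p_la either supplies its power of x_0 or its sum over the other
  variables. The number of ways to let the parts in ga supply x_0 is a product of binomials of
  multiplicities, which is the quotient of weights here, the factors depending on t
  cancelling.\<close>

lemma Dop_pp:
  assumes "la \<in> partitions"
  shows "Dop r (pp la) = (\<Sum>ga | ga \<subseteq># la \<and> sum_mset ga = r. sc (wt la / (wt ga * wt (la - ga))) * pp (la - ga))"
  using assms
proof (induction la arbitrary: r)
  case empty
  have "{ga. ga = {#} \<and> sum_mset ga = r} = (if r = 0 then {{#}} else {})" by auto
  then show ?case by (simp add: Dop_1)
next
  case (add k la r)
  have k: "0 < k" and la: "la \<in> partitions" using add.prems by (auto simp: partitions_def intro: gr0I)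
  have sub: "ga \<in> partitions" if "ga \<subseteq># la" for ga using that la mset_subset_eqD by (fastforce simp: partitions_def)
  have sub': "ga \<in> partitions" if "ga \<subseteq># add_mset k la" for ga
    using that add.prems mset_subset_eqD by (fastforce simp: partitions_def)
  define S where "S = {ga. ga \<subseteq># add_mset k la \<and> sum_mset ga = r}"
  have finS: "finite S" unfolding S_def by (rule finite_subset[OF _ finite_submsets[of "add_mset k la"]]) auto
  define A where "A ga = (if k \<in># ga then wt la / (wt (ga - {#k#}) * wt (add_mset k la - ga)) else 0)" for ga
  define B where "B ga = (if k \<in># add_mset k la - ga then wt la / (wt ga * wt (add_mset k la - ga - {#k#})) else 0)" for ga
  \<comment> \<open>Pascal's rule: the adjoined part k lies either in ga or in its complement. Both
    terms are first brought to the denominator of the left side.\<close>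
  have AB: "wt (add_mset k la) / (wt ga * wt (add_mset k la - ga)) = A ga + B ga" if ga: "ga \<subseteq># add_mset k la" for ga
  proof -
    let ?de = "add_mset k la - ga"
    have P: "ga \<in> partitions" "?de \<in> partitions" using sub' ga by auto
    define x where "x = real k / (1 - t ^ k)"
    have x: "x \<noteq> 0" using k one_minus_pow[of k] by (simp add: x_def)
    have cancel1: "a / (w * d) = a * y / (w * y * d)" and cancel2: "a / (d * w) = a * y / (d * (w * y))"
      if "y \<noteq> 0" for a w d y :: real using that by simp_all
    have 1: "A ga = wt la * (x * real (count ga k)) / (wt ga * wt ?de)"
    proof (cases "k \<in># ga")
      case True
      have w: "wt ga = wt (ga - {#k#}) * (x * real (count ga k))" using wt_remove[OF P(1) True] by (simp add: x_def)
      have y: "x * real (count ga k) \<noteq> 0" using True x by simp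
      have "A ga = wt la / (wt (ga - {#k#}) * wt ?de)" using True by (simp add: A_def)
      also have "\<dots> = wt la * (x * real (count ga k)) / (wt (ga - {#k#}) * (x * real (count ga k)) * wt ?de)"
        by (rule cancel1[OF y])
      finally show ?thesis unfolding w .
    qed (simp add: A_def not_in_iff[THEN iffD1])
    have 2: "B ga = wt la * (x * real (count ?de k)) / (wt ga * wt ?de)"
    proof (cases "k \<in># ?de")
      case True
      have w: "wt ?de = wt (?de - {#k#}) * (x * real (count ?de k))" using wt_remove[OF P(2) True] by (simp add: x_def)
      have y: "x * real (count ?de k) \<noteq> 0" using True x by (simp del: count_diff)
      have "B ga = wt la / (wt ga * wt (?de - {#k#}))" using True by (simp add: B_def)
      also have "\<dots> = wt la * (x * real (count ?de k)) / (wt ga * (wt (?de - {#k#}) * (x * real (count ?de k))))"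
        by (rule cancel2[OF y])
      finally show ?thesis unfolding w .
    qed (simp add: B_def not_in_iff[THEN iffD1] del: count_diff)
    have "count ga k \<le> Suc (count la k)" using ga mset_subset_eq_count[of ga "add_mset k la" k] by simp
    then have 3: "real (count ga k) + real (count ?de k) = real (count la k) + 1" by simp
    have "wt (add_mset k la) = wt la * (x * (real (count ga k) + real (count ?de k)))"
      unfolding 3 using k by (simp add: wt_add x_def)
    then show ?thesis unfolding 1 2 by (simp add: add_divide_distrib algebra_simps)
  qed
  have "(\<Sum>ga\<in>S. sc (wt (add_mset k la) / (wt ga * wt (add_mset k la - ga))) * pp (add_mset k la - ga))
     = (\<Sum>ga\<in>S. sc (A ga) * pp (add_mset k la - ga)) + (\<Sum>ga\<in>S. sc (B ga) * pp (add_mset k la - ga))"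
    unfolding sum.distrib[symmetric] by (rule sum.cong) (auto simp: S_def AB sc_add distrib_right)
  also have "(\<Sum>ga\<in>S. sc (A ga) * pp (add_mset k la - ga)) = (if k \<le> r then Dop (r - k) (pp la) else 0)"
  proof -
    have "(\<Sum>ga\<in>S. sc (A ga) * pp (add_mset k la - ga)) =
      (\<Sum>ga | ga \<subseteq># add_mset k la \<and> k \<in># ga \<and> sum_mset ga = r. sc (A ga) * pp (add_mset k la - ga))"
      by (rule sum.mono_neutral_right) (use finS in \<open>auto simp: S_def A_def\<close>)
    also have "\<dots> = (\<Sum>de | de \<subseteq># la \<and> sum_mset (add_mset k de) = r. sc (A (add_mset k de)) * pp (la - de))"
      by (subst sum_submset_add) simp
    also have "\<dots> = (if k \<le> r then Dop (r - k) (pp la) else 0)"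
    proof (cases "k \<le> r")
      case True
      then have "{de. de \<subseteq># la \<and> sum_mset (add_mset k de) = r} = {ga. ga \<subseteq># la \<and> sum_mset ga = r - k}" by auto
      then show ?thesis using True add.IH[OF la, of "r - k"] by (simp add: A_def)
    qed (auto intro!: sum.neutral)
    finally show ?thesis .
  qed
  also have "(\<Sum>ga\<in>S. sc (B ga) * pp (add_mset k la - ga)) = pw k * Dop r (pp la)"
  proof -
    have iff: "ga \<subseteq># la \<longleftrightarrow> ga \<subseteq># add_mset k la \<and> k \<in># add_mset k la - ga" for ga
    proof
      assume "ga \<subseteq># la"
      then show "ga \<subseteq># add_mset k la \<and> k \<in># add_mset k la - ga"
        using mset_subset_eq_count[of ga la k]
        by (auto simp: subseteq_mset_def in_diff_count less_Suc_eq_le intro: le_SucI)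
    next
      assume *: "ga \<subseteq># add_mset k la \<and> k \<in># add_mset k la - ga"
      then have "count ga k \<le> count la k" by (simp add: in_diff_count)
      moreover have "count ga x \<le> count la x" if "x \<noteq> k" for x
        using * that mset_subset_eq_count[of ga "add_mset k la" x] by simp
      ultimately show "ga \<subseteq># la" unfolding subseteq_mset_def by metis
    qed
    have "(\<Sum>ga\<in>S. sc (B ga) * pp (add_mset k la - ga)) =
      (\<Sum>ga | ga \<subseteq># la \<and> sum_mset ga = r. sc (B ga) * pp (add_mset k la - ga))"
      by (rule sum.mono_neutral_right) (use finS iff in \<open>auto simp: S_def B_def\<close>)
    also have "\<dots> = (\<Sum>ga | ga \<subseteq># la \<and> sum_mset ga = r. sc (wt la / (wt ga * wt (la - ga))) * (pw k * pp (la - ga)))"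
    proof (rule sum.cong)
      fix ga assume ga: "ga \<in> {ga. ga \<subseteq># la \<and> sum_mset ga = r}"
      then have "add_mset k la - ga = add_mset k (la - ga)"
        by (simp add: multiset_diff_union_assoc[of ga la "{#k#}", simplified])
      then show "sc (B ga) * pp (add_mset k la - ga) = sc (wt la / (wt ga * wt (la - ga))) * (pw k * pp (la - ga))"
        using ga iff by (simp add: B_def)
    qed simp
    also have "\<dots> = pw k * Dop r (pp la)"
      using add.IH[OF la, of r] by (simp add: sum_distrib_left ac_simps)
    finally show ?thesis .
  qed
  finally show ?case using Dop_pw_mult[OF k, of r "pp la"] by (simp add: S_def add.commute)
qed

text \<open>On either side only ga = be - al can contribute, and it gives wt be / wt (be -
  al).\<close>

lemma adjoint_pp:
  assumes al: "al \<in> partitions" and be: "be \<in> partitions"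
  shows "frm (qs r * pp al) (pp be) = frm (pp al) (Dop r (pp be))"
proof -
  have un: "ga + al \<in> partitions" if "ga \<in> partitions" for ga using that al by (auto simp: partitions_def)
  let ?c = "al \<subseteq># be \<and> sum_mset (be - al) = r"
  have sub: "ga \<in> partitions" if "ga \<subseteq># be" for ga using that be mset_subset_eqD by (fastforce simp: partitions_def)
  have fin: "finite {la \<in> partitions. sum_mset la = r}" by (rule finite_partitions_of)
  have fin2: "finite {ga. ga \<subseteq># be \<and> sum_mset ga = r}"
    by (rule finite_subset[OF _ finite_submsets[of be]]) auto
  have "frm (qs r * pp al) (pp be) = (\<Sum>ga | ga \<in> partitions \<and> sum_mset ga = r. 1 / wt ga * (if ga + al = be then wt be else 0))"
    unfolding qs_power_sums sum_distrib_right
    by (subst frm_sum_left)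
      (auto simp: mult.assoc pp_union[symmetric] frm_sc_left frm_pp un be intro!: sum.cong)
  also have "\<dots> = (\<Sum>ga | ga \<in> partitions \<and> sum_mset ga = r. if ga = be - al \<and> al \<subseteq># be then wt be / wt ga else 0)"
    by (intro sum.cong) auto
  also have "\<dots> = (if ?c then wt be / wt (be - al) else 0)"
  proof (cases "al \<subseteq># be")
    case True
    then have "be - al \<in> partitions" using sub by simp
    then show ?thesis using True fin by (simp add: sum.delta)
  qed simp
  also have "\<dots> = (\<Sum>ga | ga \<subseteq># be \<and> sum_mset ga = r. if ga = be - al \<and> al \<subseteq># be then wt be / wt ga else 0)"
  proof (cases "al \<subseteq># be")
    case True
    then show ?thesis using fin2 by (simp add: sum.delta)
  qed simp
  also have "\<dots> = (\<Sum>ga | ga \<subseteq># be \<and> sum_mset ga = r. wt be / (wt ga * wt (be - ga)) * (if al = be - ga then wt al else 0))"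
  proof (rule sum.cong)
    fix ga assume ga: "ga \<in> {ga. ga \<subseteq># be \<and> sum_mset ga = r}"
    then have "al = be - ga \<longleftrightarrow> ga = be - al \<and> al \<subseteq># be" by (auto simp: submset_diff_diff)
    moreover have "wt al \<noteq> 0" using wt_pos[OF al] by simp
    ultimately show "(if ga = be - al \<and> al \<subseteq># be then wt be / wt ga else 0) =
      wt be / (wt ga * wt (be - ga)) * (if al = be - ga then wt al else 0)"
      by (cases "al = be - ga") auto
  qed simp
  also have "\<dots> = frm (pp al) (Dop r (pp be))"
    unfolding Dop_pp[OF be]
    by (subst frm_sum_right) (auto simp: frm_sc_right frm_pp al sub intro!: sum.cong)
  finally show ?thesis .
qed

lemma adjoint:
  assumes "symf f" "symf g" shows "frm (qs r * f) g = frm f (Dop r g)"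
proof -
  obtain F where F: "finite F" "F \<subseteq> partitions" "\<forall>la. la \<notin> F \<longrightarrow> pc f la = 0" "f = (\<Sum>la\<in>F. sc (pc f la) * pp la)"
    by (rule pc_expand[OF assms(1)]) (rule that; assumption)
  obtain G where G: "finite G" "G \<subseteq> partitions" "\<forall>la. la \<notin> G \<longrightarrow> pc g la = 0" "g = (\<Sum>la\<in>G. sc (pc g la) * pp la)"
    by (rule pc_expand[OF assms(2)]) (rule that; assumption)
  have D: "symf (Dop r (pp la))" for la by (simp add: symf_Dop)
  define x where "x = pc f"
  define y where "y = pc g"
  have f: "f = (\<Sum>la\<in>F. sc (x la) * pp la)" and g: "g = (\<Sum>la\<in>G. sc (y la) * pp la)"
    using F(4) G(4) unfolding x_def y_def .
  have 1: "frm (qs r * f) g = (\<Sum>la\<in>F. x la * (\<Sum>mu\<in>G. y mu * frm (qs r * pp la) (pp mu)))"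
  proof -
    have "frm (qs r * f) g = frm (\<Sum>la\<in>F. sc (x la) * (qs r * pp la)) g"
      by (simp add: f sum_distrib_left mult.left_commute)
    also have "\<dots> = (\<Sum>la\<in>F. x la * frm (qs r * pp la) g)"
      by (subst frm_sum_left) (use assms in \<open>auto simp: frm_sc_left symf_mult\<close>)
    also have "\<dots> = (\<Sum>la\<in>F. x la * (\<Sum>mu\<in>G. y mu * frm (qs r * pp la) (pp mu)))"
      unfolding g by (subst frm_sum_right) (auto simp: frm_sc_right symf_mult)
    finally show ?thesis .
  qed
  have 2: "frm f (Dop r g) = (\<Sum>la\<in>F. x la * (\<Sum>mu\<in>G. y mu * frm (pp la) (Dop r (pp mu))))"
  proof -
    have "frm f (Dop r g) = (\<Sum>la\<in>F. x la * frm (pp la) (Dop r g))"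
      unfolding f by (subst frm_sum_left) (use assms symf_Dop in \<open>auto simp: frm_sc_left\<close>)
    also have "\<dots> = (\<Sum>la\<in>F. x la * (\<Sum>mu\<in>G. y mu * frm (pp la) (Dop r (pp mu))))"
      unfolding g Dop_sum Dop_sc by (subst frm_sum_right) (auto simp: frm_sc_right D)
    finally show ?thesis .
  qed
  show ?thesis unfolding 1 2
    by (intro sum.cong refl arg_cong2[of _ _ _ _ "(*)"]) (use F G in \<open>auto intro!: adjoint_pp\<close>)
qed

definition qprod :: "nat list \<Rightarrow> mps" where "qprod al = prod_list (map qs al)"

lemma qprod_simps [simp]: "qprod [] = 1" "qprod (a # al) = qs a * qprod al"
  by (simp_all add: qprod_def)

lemma symf_qprod [simp]: "symf (qprod al)" by (induction al) auto

lemma frm_1: assumes "symf g" shows "frm 1 g = cf g {#}"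
proof -
  obtain G where G: "finite G" "G \<subseteq> partitions" "\<forall>la. la \<notin> G \<longrightarrow> pc g la = 0" "g = (\<Sum>la\<in>G. sc (pc g la) * pp la)"
    by (rule pc_expand[OF assms]) (rule that; assumption)
  have p: "cf (pp la) {#} = (if la = {#} then 1 else 0)" if "la \<in> partitions" for la
  proof (cases "cf (pp la) {#} = 0")
    case False
    then have "sum_mset la = 0" using that pp_triangular[of la "{#}"] by (auto simp: partitions_def)
    then have "la = {#}" using size_le_sum_partition[OF that] by (simp del: sum_mset_0_iff)
    then show ?thesis by (simp add: cf_one)
  qed (auto simp: cf_one)
  have "frm 1 g = (\<Sum>la\<in>{{#}}. pc (pp {#}) la * pc g la * wt la)"
    by (subst pp_empty[symmetric], rule frm_eq') (auto simp: pc_pp simp del: pp_empty)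
  also have "\<dots> = pc g {#}" by (simp add: pc_pp del: pp_empty)
  also have "\<dots> = (\<Sum>la\<in>G. pc g la * (if la = {#} then 1 else 0))"
    using G(1,3) by (auto simp: if_distrib[of "(*) _"] sum.delta cong: if_cong)
  also have "\<dots> = (\<Sum>la\<in>G. pc g la * cf (pp la) {#})"
    using G(2) p by (intro sum.cong) (auto simp: cf_one)
  also have "\<dots> = cf g {#}" by (subst (2) G(4)) simp
  finally show ?thesis .
qed

text \<open>Iterated adjointness strips off one variable at a time: the products of q's are dual to
  the monomial functions.\<close>

lemma frm_qprod: "symf g \<Longrightarrow> frm (qprod al) g = cf g (mono_of al)"
proof (induction al arbitrary: g)
  case (Cons a al)
  have "frm (qprod (a # al)) g = frm (qprod al) (Dop a g)" using Cons.prems adjoint by simp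
  also have "\<dots> = cf g (mono_of (a # al))"
    using Cons.IH[OF symf_Dop[OF Cons.prems]] by (simp add: cf_Dop add.commute)
  finally show ?case .
qed (simp add: frm_1)

end

context hl
begin

section \<open>Rational function identities\<close>

definition ge :: "(nat \<Rightarrow> complex) \<Rightarrow> nat set \<Rightarrow> nat \<Rightarrow> complex"
  where "ge z I i = (\<Prod>j\<in>I - {i}. (z i - of_real t * z j) / (z i - z j))"

text \<open>For a list with as many entries as I this is the symmetrisation of z^al times the
  product over i < j of (z_i - t z_j) / (z_i - z_j), organised by which variable receives the first
  exponent. The list need not be decreasing.\<close>

primrec rr :: "nat list \<Rightarrow> nat set \<Rightarrow> (nat \<Rightarrow> complex) \<Rightarrow> complex" where
  "rr [] I z = 1"
| "rr (a # al) I z = (\<Sum>i\<in>I. z i ^ a * ge z I i * rr al (I - {i}) z)"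

text \<open>The elementary symmetric polynomial with an integer degree: negative degrees give 0, so
  removing a variable needs no case distinction at r = 0.\<close>

definition esI :: "int \<Rightarrow> nat set \<Rightarrow> (nat \<Rightarrow> complex) \<Rightarrow> complex"
  where "esI r I z = (\<Sum>S | S \<subseteq> I \<and> int (card S) = r. \<Prod>i\<in>S. z i)"

lemma esI_remove:
  assumes "finite I" "i \<in> I"
  shows "esI r I z = esI r (I - {i}) z + z i * esI (r - 1) (I - {i}) z"
proof -
  have fin: "finite {S. S \<subseteq> I \<and> int (card S) = r \<and> Q S}" for Q
    using assms by (rule_tac finite_subset[of _ "Pow I"]) auto
  have "{S. S \<subseteq> I \<and> int (card S) = r} = {S. S \<subseteq> I \<and> int (card S) = r \<and> i \<notin> S} \<union> {S. S \<subseteq> I \<and> int (card S) = r \<and> i \<in> S}"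
    by blast
  then have "esI r I z = (\<Sum>S\<in>{S. S \<subseteq> I \<and> int (card S) = r \<and> i \<notin> S} \<union> {S. S \<subseteq> I \<and> int (card S) = r \<and> i \<in> S}. \<Prod>i\<in>S. z i)"
    unfolding esI_def by (rule sum.cong) (rule refl)
  also have "\<dots> = (\<Sum>S | S \<subseteq> I \<and> int (card S) = r \<and> i \<notin> S. \<Prod>i\<in>S. z i) +
      (\<Sum>S | S \<subseteq> I \<and> int (card S) = r \<and> i \<in> S. \<Prod>i\<in>S. z i)"
    by (rule sum.union_disjoint[OF fin fin]) blast
  also have "{S. S \<subseteq> I \<and> int (card S) = r \<and> i \<notin> S} = {S. S \<subseteq> I - {i} \<and> int (card S) = r}" by auto
  also have "(\<Sum>S | S \<subseteq> I \<and> int (card S) = r \<and> i \<in> S. \<Prod>i\<in>S. z i)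
      = (\<Sum>S | S \<subseteq> I - {i} \<and> int (card S) = r - 1. z i * (\<Prod>i\<in>S. z i))"
  proof (rule sum.reindex_bij_witness[of _ "insert i" "\<lambda>S. S - {i}"], goal_cases)
    case (2 S) 
    then have "finite S" "i \<in> S" using assms finite_subset by auto
    then have "card S = Suc (card (S - {i}))" by (rule card_Suc_Diff1[symmetric])
    then show ?case using 2 by auto
  next
    case (4 S)
    then have "finite S" "i \<notin> S" using assms finite_subset by auto
    then show ?case using 4 assms by auto
  next
    case (5 S)
    then have "finite S" "i \<in> S" using assms finite_subset by auto
    then show ?case by (simp add: prod.remove[of S i])
  qed auto
  finally show ?thesis by (simp add: esI_def sum_distrib_left)
qed

lemma esI_empty: "esI r {} z = (if r = 0 then 1 else 0)"
proof -
  have "esI r {} z = (\<Sum>S\<in>(if r = 0 then {{}} else {}). \<Prod>i\<in>S. z i)"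
    unfolding esI_def by (rule sum.cong) auto
  then show ?thesis by simp
qed

text \<open>The sum of \<phi> over all lists obtained from al by raising exactly r entries by
  1.\<close>

primrec Er :: "nat list \<Rightarrow> int \<Rightarrow> (nat list \<Rightarrow> complex) \<Rightarrow> complex" where
  "Er [] r \<phi> = (if r = 0 then \<phi> [] else 0)"
| "Er (a # al) r \<phi> = Er al r (\<lambda>be. \<phi> (a # be)) + Er al (r - 1) (\<lambda>be. \<phi> (Suc a # be))"

lemma Er_sum: "finite I \<Longrightarrow> Er al r (\<lambda>be. \<Sum>i\<in>I. c i * \<phi> i be) = (\<Sum>i\<in>I. c i * Er al r (\<phi> i))"
  by (induction al arbitrary: r \<phi>) (auto simp: sum.distrib algebra_simps)

lemma Er_scale: "Er al r (\<lambda>be. c * \<phi> be) = c * Er al r \<phi>"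
  by (induction al arbitrary: r \<phi>) (auto simp: algebra_simps)

text \<open>The elementary polynomial is symmetric and can be moved inside the symmetrisation, where
  its monomials raise entries of the exponent list. The induction splits it by whether the variable
  in first position is chosen.\<close>

lemma esI_rr:
  assumes "finite I" "card I = length al"
  shows "esI r I z * rr al I z = Er al r (\<lambda>be. rr be I z)"
  using assms
proof (induction al arbitrary: r I)
  case Nil
  then show ?case by (simp add: esI_empty)
next
  case (Cons a al)
  have IH: "esI r (I - {i}) z * rr al (I - {i}) z = Er al r (\<lambda>be. rr be (I - {i}) z)" if "i \<in> I" for i r
    using Cons that by simp
  have "esI r I z * rr (a # al) I z = (\<Sum>i\<in>I. (z i ^ a * ge z I i) * (esI r I z * rr al (I - {i}) z))"
    by (simp add: sum_distrib_left ac_simps)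
  also have "\<dots> = (\<Sum>i\<in>I. (z i ^ a * ge z I i) * Er al r (\<lambda>be. rr be (I - {i}) z)
      + (z i ^ Suc a * ge z I i) * Er al (r - 1) (\<lambda>be. rr be (I - {i}) z))"
  proof (rule sum.cong)
    fix i assume i: "i \<in> I"
    show "(z i ^ a * ge z I i) * (esI r I z * rr al (I - {i}) z) = (z i ^ a * ge z I i) * Er al r (\<lambda>be. rr be (I - {i}) z)
      + (z i ^ Suc a * ge z I i) * Er al (r - 1) (\<lambda>be. rr be (I - {i}) z)"
      unfolding esI_remove[OF Cons.prems(1) i] IH[OF i, symmetric] by (simp add: algebra_simps)
  qed simp
  also have "\<dots> = Er (a # al) r (\<lambda>be. rr be I z)"
    using Cons.prems by (simp add: sum.distrib Er_sum del: power_Suc)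
  finally show ?case .
qed

text \<open>The straightening rule: an ascent by one costs a factor t when it is put in order. It
  suffices to sort the lists that arise from raising entries of a decreasing list.\<close>

definition strt :: "(nat list \<Rightarrow> complex) \<Rightarrow> bool"
  where "strt \<phi> \<longleftrightarrow> (\<forall>xs a ys. \<phi> (xs @ a # Suc a # ys) = of_real t * \<phi> (xs @ Suc a # a # ys))"

lemma strt_Cons: "strt \<phi> \<Longrightarrow> strt (\<lambda>be. \<phi> (x # be))"
  unfolding strt_def by (metis append_Cons)

lemma strt_append: "strt \<phi> \<Longrightarrow> strt (\<lambda>be. \<phi> (xs @ be))"
  unfolding strt_def by (metis append_assoc)

lemma ge_pair:
  assumes "finite I" "i \<in> I" "j \<in> I" "i \<noteq> j"
  shows "ge z I i * ge z (I - {i}) j = (z i - of_real t * z j) / (z i - z j) *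
    (\<Prod>k\<in>I - {i,j}. (z i - of_real t * z k) / (z i - z k) * ((z j - of_real t * z k) / (z j - z k)))"
proof -
  have 1: "I - {i} = insert j (I - {i,j})" "I - {i} - {j} = I - {i,j}" using assms by auto
  show ?thesis unfolding ge_def 1(2) unfolding 1(1) using assms
    unfolding prod.distrib by (subst prod.insert) (simp_all only: finite_Diff Diff_iff insert_iff mult.assoc refl, auto)
qed

text \<open>The difference of the two sides is a sum over pairs (i, j) of a term with factor (z_j -
  t z_i) (z_i - t z_j) / (z_i - z_j), which changes sign when i and j are exchanged.\<close>

lemma rr_straighten0:
  assumes "finite I" "inj_on z I"
  shows "rr (a # Suc a # ys) I z = of_real t * rr (Suc a # a # ys) I z"
proof -
  define T where "T = Sigma I (\<lambda>i. I - {i})"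
  define W where "W i j = (\<Prod>k\<in>I - {i,j}. (z i - of_real t * z k) / (z i - z k) * ((z j - of_real t * z k) / (z j - z k))) *
     rr ys (I - {i,j}) z" for i j
  have expand: "rr (b # c # ys) I z = (\<Sum>(i,j)\<in>T. z i ^ b * z j ^ c * ((z i - of_real t * z j) / (z i - z j)) * W i j)" for b c
  proof -
    have "rr (b # c # ys) I z = (\<Sum>i\<in>I. \<Sum>j\<in>I - {i}. z i ^ b * z j ^ c * ((z i - of_real t * z j) / (z i - z j)) * W i j)"
      unfolding rr.simps sum_distrib_left
    proof (intro sum.cong refl)
      fix i j assume ij: "i \<in> I" "j \<in> I - {i}"
      have e: "I - {i} - {j} = I - {i,j}" by auto
      have "z i ^ b * ge z I i * (z j ^ c * ge z (I - {i}) j * rr ys (I - {i,j}) z)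
         = z i ^ b * z j ^ c * (ge z I i * ge z (I - {i}) j) * rr ys (I - {i,j}) z"
        by (simp only: ac_simps)
      also have "ge z I i * ge z (I - {i}) j = (z i - of_real t * z j) / (z i - z j) *
          (\<Prod>k\<in>I - {i,j}. (z i - of_real t * z k) / (z i - z k) * ((z j - of_real t * z k) / (z j - z k)))"
        by (rule ge_pair) (use assms ij in auto)
      finally show "z i ^ b * ge z I i * (z j ^ c * ge z (I - {i}) j * rr ys (I - {i} - {j}) z)
         = z i ^ b * z j ^ c * ((z i - of_real t * z j) / (z i - z j)) * W i j"
        unfolding e W_def by (simp only: ac_simps)
    qed
    then show ?thesis unfolding T_def using assms by (subst (asm) sum.Sigma) auto
  qed
  have Wsym: "W i j = W j i" for i j
    by (simp add: W_def insert_commute mult.commute)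
  define X where "X i j = (z i - of_real t * z j) / (z i - z j)" for i j
  define D where "D i j = (z i * z j) ^ a * ((z j - of_real t * z i) * X i j) * W i j" for i j
  have anti: "D j i = - D i j" if "(i,j) \<in> T" for i j
  proof -
    have "z i \<noteq> z j" using that assms by (auto simp: T_def inj_on_def)
    have "X j i = - ((z j - of_real t * z i) / (z i - z j))"
      unfolding X_def by (simp only: minus_divide_right minus_diff_eq)
    then have "(z i - of_real t * z j) * X j i = - ((z j - of_real t * z i) * X i j)"
      by (simp add: X_def mult.commute)
    then show ?thesis unfolding D_def by (simp add: Wsym[of j i] mult.commute[of "z j" "z i"])
  qed
  have "(\<Sum>(i,j)\<in>T. D i j) = (\<Sum>(i,j)\<in>T. D j i)"
    by (rule sum.reindex_bij_witness[of _ "\<lambda>(i,j). (j,i)" "\<lambda>(i,j). (j,i)"]) (auto simp: T_def)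
  also have "\<dots> = - (\<Sum>(i,j)\<in>T. D i j)"
    unfolding sum_negf[symmetric] by (intro sum.cong) (auto simp: anti)
  finally have "(\<Sum>(i,j)\<in>T. D i j) = 0" by simp
  moreover have "rr (a # Suc a # ys) I z - t * rr (Suc a # a # ys) I z = (\<Sum>(i,j)\<in>T. D i j)"
    unfolding expand sum_distrib_left sum_subtractf[symmetric] X_def[symmetric]
    by (intro sum.cong) (auto simp: D_def power_mult_distrib algebra_simps)
  ultimately show ?thesis by simp
qed

lemma strt_rr: "finite I \<Longrightarrow> inj_on z I \<Longrightarrow> strt (\<lambda>be. rr be I z)"
  unfolding strt_def
proof (intro allI)
  fix xs a ys
  show "finite I \<Longrightarrow> inj_on z I \<Longrightarrow> rr (xs @ a # Suc a # ys) I z = of_real t * rr (xs @ Suc a # a # ys) I z"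
  proof (induction xs arbitrary: I)
    case Nil
    then show ?case using rr_straighten0 by simp
  next
    case (Cons x xs)
    have "rr (xs @ a # Suc a # ys) (I - {i}) z = of_real t * rr (xs @ Suc a # a # ys) (I - {i}) z" for i
      using Cons.prems by (intro Cons.IH) (auto intro: inj_on_subset)
    then show ?case by (simp add: sum_distrib_left ac_simps)
  qed
qed

section \<open>Gaussian binomials and blocks of equal exponents\<close>

abbreviation qp :: "nat \<Rightarrow> real" where "qp \<equiv> qpoch t t"

lemma qp_0 [simp]: "qp 0 = 1" by (simp add: qpoch_def)
lemma qp_Suc: "qp (Suc m) = qp m * (1 - t ^ Suc m)" by (simp add: qpoch_def mult.commute)
lemma qp_pos: "0 < qp m" 
  using one_minus_pow by (induction m) (auto simp: qp_Suc simp del: power_Suc intro!: mult_pos_pos)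
lemma qp_nz [simp]: "qp m \<noteq> 0" using qp_pos[of m] by simp

definition qbin :: "nat \<Rightarrow> nat \<Rightarrow> real"
  where "qbin m k = (if k \<le> m then qp m / (qp k * qp (m - k)) else 0)"

lemma qbin_0 [simp]: "qbin m 0 = 1" by (simp add: qbin_def)

lemma qbin_pascal: "qbin (Suc m) k = t ^ k * qbin m k + (if k = 0 then 0 else qbin m (k - 1))"
proof (cases k)
  case (Suc j)
  consider "k \<le> m" | "k = Suc m" | "k > Suc m" by linarith
  then show ?thesis
  proof cases
    case 1
    define d where "d = m - k"
    have m: "m = d + Suc j" using 1 Suc by (simp add: d_def)
    have e: "Suc m - k = Suc d" "m - k = d" "m - j = Suc d" using m Suc by auto
    have "qp (Suc m) = qp m * (1 - t ^ Suc m)" by (rule qp_Suc)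
    moreover have "qp k = qp j * (1 - t ^ k)" "qp (Suc d) = qp d * (1 - t ^ Suc d)" using Suc qp_Suc by auto
    moreover have "1 - t ^ k \<noteq> 0" "1 - t ^ Suc d \<noteq> 0" using one_minus_pow[of k] one_minus_pow[of "Suc d"] Suc by auto
    moreover have "t ^ Suc m = t ^ k * t ^ Suc d" unfolding power_add[symmetric] using m Suc by (simp only: add_Suc_right add.commute)
    ultimately show ?thesis using 1 Suc e by (simp add: qbin_def divide_simps del: power_Suc) (simp add: algebra_simps)
  qed (use Suc in \<open>auto simp: qbin_def\<close>)
qed simp

lemma strt_move: "strt \<phi> \<Longrightarrow> \<phi> (a # replicate k (Suc a) @ ys) = of_real (t ^ k) * \<phi> (replicate k (Suc a) @ a # ys)"
proof (induction k arbitrary: \<phi>)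
  case (Suc k)
  have "\<phi> (a # replicate (Suc k) (Suc a) @ ys) = of_real t * \<phi> (Suc a # a # replicate k (Suc a) @ ys)"
    using Suc.prems unfolding strt_def by (metis append_Cons append_Nil replicate_Suc)
  also have "\<dots> = of_real t * (of_real (t ^ k) * \<phi> (Suc a # replicate k (Suc a) @ a # ys))"
    using Suc.IH[OF strt_Cons[OF Suc.prems]] by simp
  finally show ?case by simp
qed simp

text \<open>Sorting a block in which k of m equal entries were raised costs one t per inversion;
  summing over the choices gives the Gaussian binomial, here through its Pascal rule.\<close>

lemma Er_block:
  assumes "strt \<phi>"
  shows "Er (replicate m a @ ys) r \<phi> = (\<Sum>k\<le>m. qbin m k * Er ys (r - int k) (\<lambda>be. \<phi> (replicate k (Suc a) @ replicate (m - k) a @ be)))"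
  using assms
proof (induction m arbitrary: r \<phi>)
  case (Suc m)
  define G where "G k = Er ys (r - int k) (\<lambda>be. \<phi> (replicate k (Suc a) @ replicate (Suc m - k) a @ be))" for k
  have 1: "Er (replicate m a @ ys) r (\<lambda>be. \<phi> (a # be)) = (\<Sum>k\<le>m. t ^ k * qbin m k * G k)"
  proof -
    have "\<phi> (a # replicate k (Suc a) @ replicate (m - k) a @ be) = of_real (t ^ k) * \<phi> (replicate k (Suc a) @ replicate (Suc m - k) a @ be)"
      if "k \<le> m" for k be
      using strt_move[OF Suc.prems, of a k "replicate (m - k) a @ be"] that by (simp add: Suc_diff_le)
    then show ?thesis
      unfolding Suc.IH[OF strt_Cons[OF Suc.prems]] G_def
      by (intro sum.cong) (auto simp: Er_scale simp flip: of_real_power)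
  qed
  have 2: "Er (replicate m a @ ys) (r - 1) (\<lambda>be. \<phi> (Suc a # be)) = (\<Sum>k\<le>m. qbin m k * G (Suc k))"
    unfolding Suc.IH[OF strt_Cons[OF Suc.prems]] G_def by (intro sum.cong) (auto simp: algebra_simps)
  have "(\<Sum>k\<le>Suc m. qbin (Suc m) k * G k) =
      (\<Sum>k\<le>Suc m. (t ^ k * qbin m k) * G k) + (\<Sum>k\<le>Suc m. of_real (if k = 0 then 0 else qbin m (k - 1)) * G k)"
    unfolding sum.distrib[symmetric] qbin_pascal by (intro sum.cong) (auto simp: algebra_simps)
  also have "(\<Sum>k\<le>Suc m. (t ^ k * qbin m k) * G k) = (\<Sum>k\<le>m. t ^ k * qbin m k * G k)"
    by (simp add: qbin_def)
  also have "(\<Sum>k\<le>Suc m. of_real (if k = 0 then 0 else qbin m (k - 1)) * G k) = (\<Sum>k\<le>m. qbin m k * G (Suc k))"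
    by (subst sum.atMost_Suc_shift) simp
  finally show ?case using 1 2 by (simp add: G_def)
qed simp

text \<open>The decreasing list in which each j < N occurs \<open>m j\<close> times.\<close>

primrec blk :: "(nat \<Rightarrow> nat) \<Rightarrow> nat \<Rightarrow> nat list" where
  "blk m 0 = []"
| "blk m (Suc N) = replicate (m N) N @ blk m N"

text \<open>The list \<open>blk m N\<close> after raising \<open>k j\<close> of its entries j and
  sorting within each block.\<close>

primrec blk' :: "(nat \<Rightarrow> nat) \<Rightarrow> (nat \<Rightarrow> nat) \<Rightarrow> nat \<Rightarrow> nat list" where
  "blk' m k 0 = []"
| "blk' m k (Suc N) = replicate (k N) (Suc N) @ replicate (m N - k N) N @ blk' m k N"

lemma blk_cong: "(\<And>j. j < N \<Longrightarrow> m j = m' j) \<Longrightarrow> blk m N = blk m' N"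
  by (induction N) auto

lemma blk'_cong: "(\<And>j. j < N \<Longrightarrow> k j = k' j) \<Longrightarrow> blk' m k N = blk' m k' N"
  by (induction N) auto

lemma length_blk: "length (blk m N) = (\<Sum>j<N. m j)"
  by (induction N) auto

text \<open>Raised entries from block j - 1 join the unraised ones of block j, so the new
  multiplicity of j is m j - k j + k (j - 1). The top block is left out on the left because its
  raised entries lead to the value \<open>Suc N\<close>.\<close>

lemma blk'_eq: "replicate (m N - k N) N @ blk' m k N = blk (\<lambda>j. m j - k j + (if j = 0 then 0 else k (j - 1))) (Suc N)"
proof (induction N)
  case (Suc N)
  show ?case unfolding blk'.simps Suc.IH 
    by (simp only: blk.simps(2)[of _ "Suc N"]) (simp add: replicate_add del: blk.simps)
qed simp

text \<open>The numbers of raised entries per block. The value 0 from N on makes each choice a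
  unique function.\<close>

definition KN :: "(nat \<Rightarrow> nat) \<Rightarrow> nat \<Rightarrow> (nat \<Rightarrow> nat) set"
  where "KN m N = {k. (\<forall>j<N. k j \<le> m j) \<and> (\<forall>j\<ge>N. k j = 0)}"

lemma KN_0: "KN m 0 = {\<lambda>_. 0}"
  by (auto simp: KN_def)

lemma sum_KN_Suc: "(\<Sum>k\<in>KN m (Suc N). f k) = (\<Sum>(x,k)\<in>{..m N} \<times> KN m N. f (k(N := x)))"
  by (rule sum.reindex_bij_witness[of _ "\<lambda>(x,k). k(N := x)" "\<lambda>k. (k N, k(N := 0))"])
    (auto simp: KN_def less_Suc_eq le_Suc_eq fun_eq_iff not_less_eq_eq)

lemma Er_blk:
  assumes "strt \<phi>"
  shows "Er (blk m N) r \<phi> = (\<Sum>k\<in>KN m N. if int (\<Sum>j<N. k j) = r then of_real (\<Prod>j<N. qbin (m j) (k j)) * \<phi> (blk' m k N) else 0)"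
  using assms
proof (induction N arbitrary: r \<phi>)
  case 0
  then show ?case by (simp add: KN_0)
next
  case (Suc N)
  have "Er (blk m (Suc N)) r \<phi> = (\<Sum>x\<le>m N. qbin (m N) x * Er (blk m N) (r - int x) (\<lambda>be. \<phi> (replicate x (Suc N) @ replicate (m N - x) N @ be)))"
    using Er_block[OF Suc.prems] by simp
  also have "\<dots> = (\<Sum>x\<le>m N. \<Sum>k\<in>KN m N. if int (\<Sum>j<Suc N. (k(N := x)) j) = r
     then of_real (\<Prod>j<Suc N. qbin (m j) ((k(N := x)) j)) * \<phi> (blk' m (k(N := x)) (Suc N)) else 0)"
  proof (intro sum.cong refl)
    fix x
    have st: "strt (\<lambda>be. \<phi> (replicate x (Suc N) @ replicate (m N - x) N @ be))"
      using strt_append[OF Suc.prems, of "replicate x (Suc N) @ replicate (m N - x) N"] by simp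
    have b: "blk' m (k(N := x)) N = blk' m k N" for k by (rule blk'_cong) simp
    have s: "(\<Sum>j<N. (k(N := x)) j) = (\<Sum>j<N. k j)" "(\<Prod>j<N. qbin (m j) ((k(N := x)) j)) = (\<Prod>j<N. qbin (m j) (k j))" for k
      by (auto intro!: sum.cong prod.cong)
    show "qbin (m N) x * Er (blk m N) (r - int x) (\<lambda>be. \<phi> (replicate x (Suc N) @ replicate (m N - x) N @ be))
      = (\<Sum>k\<in>KN m N. if int (\<Sum>j<Suc N. (k(N := x)) j) = r
     then of_real (\<Prod>j<Suc N. qbin (m j) ((k(N := x)) j)) * \<phi> (blk' m (k(N := x)) (Suc N)) else 0)"
      unfolding Suc.IH[OF st] sum_distrib_left
      by (intro sum.cong refl) (auto simp: s b algebra_simps)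
  qed
  also have "\<dots> = (\<Sum>k\<in>KN m (Suc N). if int (\<Sum>j<Suc N. k j) = r then of_real (\<Prod>j<Suc N. qbin (m j) (k j)) * \<phi> (blk' m k (Suc N)) else 0)"
    unfolding sum_KN_Suc by (simp add: sum.cartesian_product)
  finally show ?case .
qed

end

section \<open>Evaluation at complex points\<close>

definition mon :: "(nat \<Rightarrow> 'a::comm_monoid_mult) \<Rightarrow> monomial \<Rightarrow> 'a"
  where "mon z M = prod_mset (image_mset z M)"

lemma mon_simps [simp]: "mon z {#} = 1" "mon z (add_mset i M) = z i * mon z M"
  "mon z (M + N) = mon z M * mon z N" "mon z (replicate_mset k i) = z i ^ k"
  by (simp_all add: mon_def)

definition ev :: "(nat \<Rightarrow> complex) \<Rightarrow> mps \<Rightarrow> complex"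
  where "ev z f = (\<Sum>\<^sub>\<infinity>M. of_real (cf f M) * mon z M)"

definition monoms :: "nat \<Rightarrow> nat \<Rightarrow> monomial set"
  where "monoms n d = {M. set_mset M \<subseteq> {..<n} \<and> size M \<le> d}"

lemma finite_monoms [simp]: "finite (monoms n d)"
proof -
  have "monoms n d \<subseteq> mset ` {xs. set xs \<subseteq> {..<n} \<and> length xs \<le> d}"
  proof
    fix M assume "M \<in> monoms n d"
    moreover obtain xs where "mset xs = M" using ex_mset by blast
    ultimately show "M \<in> mset ` {xs. set xs \<subseteq> {..<n} \<and> length xs \<le> d}" by (auto simp: monoms_def)
  qed
  then show ?thesis using finite_lists_length_le[of "{..<n}" d] finite_surj by blast
qed

lemma mon_eq_0: "i \<in># M \<Longrightarrow> z i = (0::complex) \<Longrightarrow> mon z M = 0"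
  by (induction M) auto

lemma ev_finite:
  assumes "\<And>i. n \<le> i \<Longrightarrow> z i = 0" "\<And>M. d < size M \<Longrightarrow> cf f M = 0"
  shows "ev z f = (\<Sum>M\<in>monoms n d. of_real (cf f M) * mon z M)"
proof -
  have "ev z f = (\<Sum>\<^sub>\<infinity>M\<in>monoms n d. of_real (cf f M) * mon z M)"
    unfolding ev_def
  proof (rule infsum_cong_neutral)
    fix M assume "M \<in> UNIV - monoms n d"
    then have "d < size M \<or> (\<exists>i. i \<in># M \<and> n \<le> i)" by (auto simp: monoms_def not_le not_less subset_iff)
    then show "of_real (cf f M) * mon z M = 0" using assms mon_eq_0 by fastforce
  qed auto
  then show ?thesis by simp
qed

text \<open>The first n variables are distinct and nonzero, so that the denominators in
  \<open>rr\<close> do not vanish; the others are 0, so that \<open>ev\<close> is evaluation in n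
  variables.\<close>

definition zgood :: "nat \<Rightarrow> (nat \<Rightarrow> complex) \<Rightarrow> bool"
  where "zgood n z \<longleftrightarrow> (\<forall>i<n. z i \<noteq> 0) \<and> inj_on z {..<n} \<and> (\<forall>i\<ge>n. z i = 0)"

lemma ev_sc_mult [simp]: "ev z (sc c * f) = of_real c * ev z f"
  unfolding ev_def by (simp add: mult.assoc infsum_cmult_right')

lemma ev_0 [simp]: "ev z 0 = 0"
  by (simp add: ev_def)

context
  fixes n :: nat and z :: "nat \<Rightarrow> complex"
  assumes z: "\<And>i. n \<le> i \<Longrightarrow> z i = 0"
begin

lemma ev_add:
  assumes "bounded_deg f" "bounded_deg g"
  shows "ev z (f + g) = ev z f + ev z g"
proof -
  obtain d e where de: "\<And>M. size M > d \<Longrightarrow> cf f M = 0" "\<And>M. size M > e \<Longrightarrow> cf g M = 0"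
    using assms by (auto simp: bounded_deg_def)
  have "ev z h = (\<Sum>M\<in>monoms n (max d e). of_real (cf h M) * mon z M)" if "h \<in> {f, g, f + g}" for h
    by (rule ev_finite) (use that z de in auto)
  then show ?thesis by (simp add: sum.distrib algebra_simps)
qed

lemma ev_sum:
  assumes "\<And>x. x \<in> S \<Longrightarrow> bounded_deg (f x)"
  shows "ev z (\<Sum>x\<in>S. f x) = (\<Sum>x\<in>S. ev z (f x))"
proof -
  have "ev z (\<Sum>x\<in>S. f x) = (\<Sum>x\<in>S. ev z (f x)) \<and> bounded_deg (\<Sum>x\<in>S. f x)"
    using assms
  proof (induction S rule: infinite_finite_induct)
    case (insert x S)
    then show ?case by (simp add: ev_add bounded_deg_add)
  qed (auto simp: bounded_deg_def)
  then show ?thesis ..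
qed

lemma ev_diff:
  assumes "bounded_deg f" "bounded_deg g"
  shows "ev z (f - g) = ev z f - ev z g"
proof -
  have "bounded_deg (sc (- 1) * g)" using assms bounded_deg_mult bounded_deg_sc by blast
  then have "ev z (f + sc (- 1) * g) = ev z f + ev z (sc (- 1) * g)" using assms ev_add by blast
  then show ?thesis by (simp only: ev_sc_mult) (simp add: sc_minus)
qed

lemma ev_mult:
  assumes "bounded_deg f" "bounded_deg g"
  shows "ev z (f * g) = ev z f * ev z g"
proof -
  obtain d e where de: "\<And>M. size M > d \<Longrightarrow> cf f M = 0" "\<And>M. size M > e \<Longrightarrow> cf g M = 0"
    using assms by (auto simp: bounded_deg_def)
  define F where "F M = of_real (cf f M) * mon z M" for M
  define G where "G M = of_real (cf g M) * mon z M" for M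
  have fg: "cf (f * g) M = 0" if "size M > d + e" for M
    unfolding cf_mult
  proof (intro sum.neutral ballI)
    fix A assume "A \<in> {A. A \<subseteq># M}"
    then have "size M = size A + size (M - A)" by (simp add: size_Diff_submset size_mset_mono)
    then have "size A > d \<or> size (M - A) > e" using that by linarith
    then show "cf f A * cf g (M - A) = 0" using de by auto
  qed
  have "ev z (f * g) = (\<Sum>M\<in>monoms n (d + e). of_real (cf (f * g) M) * mon z M)"
    by (rule ev_finite) (use z fg in auto)
  also have "\<dots> = (\<Sum>M\<in>monoms n (d + e). \<Sum>A | A \<subseteq># M. F A * G (M - A))"
  proof (rule sum.cong)
    fix M
    have "mon z M = mon z A * mon z (M - A)" if "A \<subseteq># M" for A
      using that mon_simps(3)[of z A "M - A"] by simp
    then show "of_real (cf (f * g) M) * mon z M = (\<Sum>A | A \<subseteq># M. F A * G (M - A))"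
      unfolding cf_mult of_real_sum sum_distrib_right F_def G_def by (intro sum.cong) auto
  qed simp
  also have "\<dots> = (\<Sum>(M,A)\<in>Sigma (monoms n (d + e)) (\<lambda>M. {A. A \<subseteq># M}). F A * G (M - A))"
    by (rule sum.Sigma) auto
  also have "\<dots> = (\<Sum>(A,B)\<in>{(A,B). set_mset A \<subseteq> {..<n} \<and> set_mset B \<subseteq> {..<n} \<and> size A + size B \<le> d + e}. F A * G B)"
    by (rule sum.reindex_bij_witness[of _ "\<lambda>(A,B). (A + B, A)" "\<lambda>(M,A). (A, M - A)"])
      (auto simp: monoms_def size_Diff_submset size_mset_mono dest: mset_subset_eqD in_diffD)
  also have "\<dots> = (\<Sum>(A,B)\<in>monoms n d \<times> monoms n e. F A * G B)"
  proof (rule sum.mono_neutral_right)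
    show "finite {(A,B). set_mset A \<subseteq> {..<n} \<and> set_mset B \<subseteq> {..<n} \<and> size A + size B \<le> d + e}"
      by (rule finite_subset[OF _ finite_cartesian_product[OF finite_monoms[of n "d + e"] finite_monoms[of n "d + e"]]])
        (auto simp: monoms_def)
    show "\<forall>x\<in>{(A,B). set_mset A \<subseteq> {..<n} \<and> set_mset B \<subseteq> {..<n} \<and> size A + size B \<le> d + e} - monoms n d \<times> monoms n e.
        (case x of (A, B) \<Rightarrow> F A * G B) = 0"
      using de by (auto simp: monoms_def F_def G_def) (meson not_le)+
  qed (auto simp: monoms_def)
  also have "\<dots> = (\<Sum>A\<in>monoms n d. F A) * (\<Sum>B\<in>monoms n e. G B)"
    by (simp add: sum_product sum.cartesian_product)
  also have "(\<Sum>A\<in>monoms n d. F A) = ev z f" unfolding F_def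
    by (rule ev_finite[symmetric]) (use z de in auto)
  also have "(\<Sum>A\<in>monoms n e. G A) = ev z g" unfolding G_def
    by (rule ev_finite[symmetric]) (use z de in auto)
  finally show ?thesis .
qed

end

lemma ev_1 [simp]: "ev z 1 = 1"
proof -
  have "ev z 1 = (\<Sum>\<^sub>\<infinity>M\<in>{{#}}. of_real (cf 1 M) * mon z M)"
    unfolding ev_def by (rule infsum_cong_neutral) (auto simp: cf_one)
  then show ?thesis by (simp add: cf_one)
qed

section \<open>Elementary symmetric functions\<close>

definition es :: "nat \<Rightarrow> mps"
  where "es r = Ser (\<lambda>M. if size M = r \<and> (\<forall>i. count M i \<le> 1) then 1 else 0)"

lemma cf_es: "cf (es r) M = (if size M = r \<and> (\<forall>i. count M i \<le> 1) then 1 else 0)"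
  by (simp add: es_def)

lemma symf_es [simp]: "symf (es r)"
proof -
  have "(\<forall>i. count (image_mset p M) i \<le> 1) \<longleftrightarrow> (\<forall>i. count M i \<le> 1)" if "bij p" for p :: "nat \<Rightarrow> nat" and M
    using that by (metis bij_is_inj bij_pointE count_image_mset_inj')
  then show ?thesis by (auto simp: symf_iff cf_es bounded_deg_def)
qed

lemma squarefree_iff: "(\<forall>i. count M i \<le> 1) \<longleftrightarrow> M = mset_set (set_mset M)"
proof
  assume *: "\<forall>i. count M i \<le> 1"
  show "M = mset_set (set_mset M)"
  proof (rule multiset_eqI)
    fix i
    show "count M i = count (mset_set (set_mset M)) i"
    proof (cases "i \<in># M")
      case True
      then have "0 < count M i" by simp
      moreover have "count M i \<le> 1" using * by blast
      ultimately have "count M i = 1" by linarith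
      then show ?thesis using True by (simp add: count_mset_set')
    qed (simp add: not_in_iff[THEN iffD1])
  qed
next
  assume e: "M = mset_set (set_mset M)"
  show "\<forall>i. count M i \<le> 1"
  proof
    fix i
    have "count M i = count (mset_set (set_mset M)) i" by (rule arg_cong[OF e])
    then show "count M i \<le> 1" by (simp only: count_mset_set') simp
  qed
qed

lemma ev_es:
  assumes "\<And>i. n \<le> i \<Longrightarrow> z i = 0"
  shows "ev z (es r) = (\<Sum>S | S \<subseteq> {..<n} \<and> card S = r. \<Prod>i\<in>S. z i)"
proof -
  have "ev z (es r) = (\<Sum>M\<in>monoms n r. of_real (cf (es r) M) * mon z M)"
    by (rule ev_finite) (use assms in \<open>auto simp: cf_es\<close>)
  also have "\<dots> = (\<Sum>M\<in>mset_set ` {S. S \<subseteq> {..<n} \<and> card S = r}. of_real (cf (es r) M) * mon z M)"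
  proof (rule sum.mono_neutral_right)
    show "mset_set ` {S. S \<subseteq> {..<n} \<and> card S = r} \<subseteq> monoms n r"
      using finite_subset by (fastforce simp: monoms_def)
    show "\<forall>M\<in>monoms n r - mset_set ` {S. S \<subseteq> {..<n} \<and> card S = r}. of_real (cf (es r) M) * mon z M = 0"
    proof
      fix M assume M: "M \<in> monoms n r - mset_set ` {S. S \<subseteq> {..<n} \<and> card S = r}"
      have "\<not> (size M = r \<and> M = mset_set (set_mset M))"
      proof
        assume *: "size M = r \<and> M = mset_set (set_mset M)"
        then have "card (set_mset M) = r" by (metis size_mset_set)
        then show False using M * by (auto simp: monoms_def)
      qed
      then have "\<not> (size M = r \<and> (\<forall>i. count M i \<le> 1))" unfolding squarefree_iff .
      then have "cf (es r) M = 0" unfolding cf_es by (rule if_not_P)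
      then show "of_real (cf (es r) M) * mon z M = 0" by simp
    qed
  qed simp
  also have "\<dots> = (\<Sum>S | S \<subseteq> {..<n} \<and> card S = r. \<Prod>i\<in>S. z i)"
  proof (subst sum.reindex)
    show "inj_on mset_set {S. S \<subseteq> {..<n} \<and> card S = r}"
      by (rule inj_onI) (metis (no_types, lifting) finite_lessThan finite_subset mem_Collect_eq finite_set_mset_mset_set)
    show "sum ((\<lambda>M. of_real (cf (es r) M) * mon z M) \<circ> mset_set) {S. S \<subseteq> {..<n} \<and> card S = r} = (\<Sum>S | S \<subseteq> {..<n} \<and> card S = r. \<Prod>i\<in>S. z i)"
    proof (rule sum.cong)
      fix S assume S: "S \<in> {S. S \<subseteq> {..<n} \<and> card S = r}"
      then have "finite S" using finite_subset by auto
      then show "((\<lambda>M. of_real (cf (es r) M) * mon z M) \<circ> mset_set) S = (\<Prod>i\<in>S. z i)"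
        using S by (auto simp: cf_es mon_def prod_unfold_prod_mset count_mset_set')
    qed simp
  qed
  finally show ?thesis .
qed

lemma digits_inj:
  assumes "\<And>i. i < n \<Longrightarrow> a i < B \<and> b i < B" "(\<Sum>i<n. a i * B ^ i) = (\<Sum>i<n. b i * B ^ i)" "i < n"
  shows "a i = (b i :: nat)"
  using assms
proof (induction n arbitrary: a b i)
  case (Suc n)
  have split: "(\<Sum>i<Suc n. c i * B ^ i) = c 0 + B * (\<Sum>i<n. c (Suc i) * B ^ i)" for c :: "nat \<Rightarrow> nat"
    by (simp add: sum.lessThan_Suc_shift sum_distrib_left ac_simps del: sum.lessThan_Suc)
  have eq: "a 0 + B * (\<Sum>i<n. a (Suc i) * B ^ i) = b 0 + B * (\<Sum>i<n. b (Suc i) * B ^ i)"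
    using Suc.prems(2) unfolding split .
  have lt: "a 0 < B" "b 0 < B" using Suc.prems(1)[of 0] by auto
  have "a 0 = b 0"
    using arg_cong[OF eq, of "\<lambda>x. x mod B"] lt by simp
  moreover have "(\<Sum>i<n. a (Suc i) * B ^ i) = (\<Sum>i<n. b (Suc i) * B ^ i)"
    using eq lt \<open>a 0 = b 0\<close> by simp
  then have "a (Suc j) = b (Suc j)" if "j < n" for j
    using Suc.IH[of "\<lambda>i. a (Suc i)" "\<lambda>i. b (Suc i)" j] Suc.prems(1) that by simp
  ultimately show ?case using Suc.prems(3) by (cases i) auto
qed simp

lemma mon_count:
  assumes "set_mset M \<subseteq> {..<n}" shows "mon z M = (\<Prod>i<n. z i ^ count M i)"
  using assms
proof (induction M)
  case (add j M)
  have "(\<Prod>i<n. z i ^ count (add_mset j M) i) = (\<Prod>i<n. (if i = j then z j else 1) * z i ^ count M i)"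
    by (intro prod.cong) auto
  then show ?case using add by (simp add: prod.distrib)
qed simp

text \<open>Kronecker's substitution \<open>z\<^sub>i = y\<^bsup>B\<^sup>i\<^esup>\<close> separates the monomials of bounded degree.\<close>

lemma ev_eq_0_imp:
  assumes "bounded_deg f" "\<And>n z. zgood n z \<Longrightarrow> ev z f = 0"
  shows "f = 0"
proof (rule mps_eqI)
  fix M0 :: monomial
  obtain d0 where d0: "\<And>M. size M > d0 \<Longrightarrow> cf f M = 0" using assms by (auto simp: bounded_deg_def)
  \<comment> \<open>The lower bound 1 gives B at least 2, so that the powers of B are distinct; B
    also exceeds every exponent that occurs.\<close>
  define d where "d = max 1 (max d0 (size M0))"
  define B where "B = Suc d"
  have d: "\<And>M. size M > d \<Longrightarrow> cf f M = 0" using d0 by (auto simp: d_def)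
  obtain n where n: "set_mset M0 \<subseteq> {..<n}"
    using finite_nat_set_iff_bounded[of "set_mset M0"] by auto
  have M0: "M0 \<in> monoms n d" using n by (simp add: monoms_def d_def)
  define e where "e M = (\<Sum>i<n. count M i * B ^ i)" for M
  have inj: "inj_on e (monoms n d)"
  proof (rule inj_onI)
    fix M N assume MN: "M \<in> monoms n d" "N \<in> monoms n d" "e M = e N"
    have lt: "count M' i < B" if "M' \<in> monoms n d" for M' i
      using that count_le_size[of M' i] by (simp add: monoms_def B_def)
    have "count M i = count N i" if "i < n" for i
      by (rule digits_inj[of n _ B]) (use lt MN that in \<open>auto simp: e_def\<close>)
    moreover have "count M i = count N i" if "\<not> i < n" for i
      using MN that by (metis (no_types, lifting) lessThan_iff mem_Collect_eq monoms_def not_in_iff subsetD)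
    ultimately show "M = N" by (metis multiset_eqI)
  qed
  define P where "P = (\<Sum>M\<in>monoms n d. monom (complex_of_real (cf f M)) (e M))"
  have "poly P (of_real y) = 0" if y: "y > 1" for y :: real
  proof -
    define z where "z i = (if i < n then complex_of_real y ^ (B ^ i) else 0)" for i
    have "inj_on z {..<n}"
    proof (rule inj_onI)
      fix i j assume ij: "i \<in> {..<n}" "j \<in> {..<n}" "z i = z j"
      then have "complex_of_real (y ^ (B ^ i)) = complex_of_real (y ^ (B ^ j))" by (simp add: z_def)
      then have "y ^ (B ^ i) = y ^ (B ^ j)" using of_real_eq_iff by blast
      then have "B ^ i = B ^ j" using y by (simp add: power_inject_exp)
      then show "i = j" by (simp add: B_def d_def)
    qed
    then have "ev z f = 0" using assms(2)[of n z] y by (auto simp: zgood_def z_def)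
    moreover have "ev z f = (\<Sum>M\<in>monoms n d. of_real (cf f M) * mon z M)"
      by (rule ev_finite) (use d in \<open>auto simp: z_def\<close>)
    moreover have "mon z M = of_real y ^ e M" if "M \<in> monoms n d" for M
    proof -
      have "mon z M = (\<Prod>i<n. z i ^ count M i)" using that by (intro mon_count) (auto simp: monoms_def)
      also have "\<dots> = (\<Prod>i<n. of_real y ^ (count M i * B ^ i))"
        by (intro prod.cong) (auto simp: z_def power_mult[symmetric] mult.commute)
      finally show ?thesis by (simp add: e_def power_sum)
    qed
    ultimately show ?thesis by (simp add: P_def poly_sum poly_monom)
  qed
  then have "of_real ` {1<..} \<subseteq> {x. poly P x = 0}" by auto
  moreover have "infinite (complex_of_real ` {1<..})"
    by (subst finite_image_iff) (auto simp: inj_on_def infinite_Ioi)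
  ultimately have "P = 0" using poly_roots_finite finite_subset by metis
  moreover have "coeff P (e M0) = of_real (cf f M0)"
  proof -
    have "coeff P (e M0) = (\<Sum>M\<in>monoms n d. if M = M0 then of_real (cf f M) else 0)"
      unfolding P_def coeff_sum using inj M0 by (intro sum.cong) (auto simp: inj_on_def)
    then show ?thesis using M0 by simp
  qed
  ultimately show "cf f M0 = cf 0 M0" by simp
qed

section \<open>Partial fractions in the variables\<close>

context hl begin

text \<open>As a function of w the left side tends to 1 at infinity and has simple poles at the z_i
  with residue (1 - t) z_i \<open>ge z I i\<close>. The induction adds a variable y and uses the
  formula for I both at w and at w = z_y.\<close>

lemma partial_fractions:
  assumes "finite I" "inj_on z I" "w \<notin> z ` I"
  shows "(\<Prod>i\<in>I. (w - of_real t * z i) / (w - z i)) = 1 + (1 - of_real t) * (\<Sum>i\<in>I. z i / (w - z i) * ge z I i)"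
  using assms
proof (induction I arbitrary: w rule: finite_induct)
  case (insert y I)
  let ?y = "z y" and ?t = "of_real t :: complex"
  have inj: "inj_on z I" and wy: "w \<noteq> ?y" and wI: "w \<notin> z ` I" and yI: "?y \<notin> z ` I"
    using insert.prems insert.hyps by (auto simp: inj_on_def)
  have gy: "ge z (insert y I) y = 1 + (1 - ?t) * (\<Sum>i\<in>I. z i / (?y - z i) * ge z I i)"
    using insert.IH[OF inj yI] insert.hyps by (simp add: ge_def)
  have gi: "ge z (insert y I) i = (z i - ?t * ?y) / (z i - ?y) * ge z I i" if "i \<in> I" for i
  proof -
    have "insert y I - {i} = insert y (I - {i})" using that insert.hyps by auto
    then show ?thesis using insert.hyps by (simp add: ge_def)
  qed
  have key: "z i / (w - z i) * ge z I i * ((w - ?t * ?y) / (w - ?y)) =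
     z i / (w - z i) * ((z i - ?t * ?y) / (z i - ?y) * ge z I i) +
     ?y / (w - ?y) * (1 - ?t) * (z i / (?y - z i) * ge z I i)" if "i \<in> I" for i
  proof -
    have "z i \<noteq> ?y" "z i \<noteq> w" using yI wI that by (metis imageI)+
    then have ne: "w - z i \<noteq> 0" "w - ?y \<noteq> 0" "z i - ?y \<noteq> 0" "?y - z i \<noteq> 0" using wy by auto
    have "(w - ?t * ?y) / ((w - z i) * (w - ?y)) = (z i - ?t * ?y) / ((w - z i) * (z i - ?y)) + ?y * (1 - ?t) / ((w - ?y) * (?y - z i))"
      using ne by (simp add: divide_simps) (simp add: algebra_simps)
    then have "z i * ge z I i * ((w - ?t * ?y) / ((w - z i) * (w - ?y))) =
      z i * ge z I i * ((z i - ?t * ?y) / ((w - z i) * (z i - ?y)) + ?y * (1 - ?t) / ((w - ?y) * (?y - z i)))" by simp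
    then show ?thesis by (simp add: distrib_left mult_ac)
  qed
  have "(\<Prod>i\<in>insert y I. (w - ?t * z i) / (w - z i)) =
      (w - ?t * ?y) / (w - ?y) + (1 - ?t) * (\<Sum>i\<in>I. z i / (w - z i) * ge z I i * ((w - ?t * ?y) / (w - ?y)))"
    using insert.hyps insert.IH[OF inj wI] by (simp add: distrib_left sum_distrib_right sum_distrib_left mult_ac)
  also have "(\<Sum>i\<in>I. z i / (w - z i) * ge z I i * ((w - ?t * ?y) / (w - ?y))) =
     (\<Sum>i\<in>I. z i / (w - z i) * ge z (insert y I) i) + ?y / (w - ?y) * (1 - ?t) * (\<Sum>i\<in>I. z i / (?y - z i) * ge z I i)"
    unfolding sum_distrib_left sum.distrib[symmetric] by (intro sum.cong refl) (simp only: key gi)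
  also have "(w - ?t * ?y) / (w - ?y) = 1 + (1 - ?t) * (?y / (w - ?y))"
    using wy by (simp add: field_simps)
  finally have F: "(\<Prod>i\<in>insert y I. (w - ?t * z i) / (w - z i)) = 1 + (1 - ?t) * (?y / (w - ?y)) + (1 - ?t) *
     ((\<Sum>i\<in>I. z i / (w - z i) * ge z (insert y I) i) + ?y / (w - ?y) * (1 - ?t) * (\<Sum>i\<in>I. z i / (?y - z i) * ge z I i))" .
  have G: "(\<Sum>i\<in>insert y I. z i / (w - z i) * ge z (insert y I) i) =
     ?y / (w - ?y) * (1 + (1 - ?t) * (\<Sum>i\<in>I. z i / (?y - z i) * ge z I i)) + (\<Sum>i\<in>I. z i / (w - z i) * ge z (insert y I) i)"
    unfolding gy[symmetric] using insert.hyps by (rule sum.insert)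
  have aux: "1 + a * c + a * (s + c * a * s') = 1 + a * (c * (1 + a * s') + s)" for a c s s' :: complex
    by (simp add: algebra_simps)
  show ?case unfolding F G by (rule aux)
qed simp

text \<open>Partial fractions at w = 0 give the sum of the \<open>ge z I i\<close> as (1 - t^n) / (1
  - t) for n = card I. Peeling off zeros one by one yields a t-factorial, which normalises the
  function of the empty partition to 1.\<close>

lemma rr_replicate_0:
  assumes "finite I" "inj_on z I" "0 \<notin> z ` I"
  shows "rr (replicate (card I) 0) I z = of_real (qp (card I) / (1 - t) ^ card I)"
  using assms
proof (induction "card I" arbitrary: I)
  case 0
  then show ?case by simp
next
  case (Suc n)
  have "(\<Sum>i\<in>I. ge z I i) * (1 - of_real t) = 1 - of_real t ^ card I"
  proof -
    have "(\<Prod>i\<in>I. (0 - of_real t * z i) / (0 - z i)) = (\<Prod>i\<in>I. of_real t :: complex)"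
      using Suc.prems(3) by (intro prod.cong) auto
    moreover have "(\<Sum>i\<in>I. z i / (0 - z i) * ge z I i) = - (\<Sum>i\<in>I. ge z I i)"
      unfolding sum_negf[symmetric] using Suc.prems(3) by (intro sum.cong) auto
    ultimately show ?thesis using partial_fractions[OF Suc.prems] by (simp add: algebra_simps)
  qed
  then have g: "(\<Sum>i\<in>I. ge z I i) = of_real ((1 - t ^ card I) / (1 - t))"
  proof -
    have ne: "complex_of_real (1 - t) \<noteq> 0" using t1 unfolding of_real_eq_0_iff by simp
    have "(\<Sum>i\<in>I. ge z I i) * complex_of_real (1 - t) = of_real (1 - t ^ card I)"
      using \<open>_ = 1 - of_real t ^ card I\<close> by simp
    then show ?thesis unfolding of_real_divide nonzero_eq_divide_eq[OF ne] .
  qed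
  have "rr (replicate (card (I - {i})) 0) (I - {i}) z = of_real (qp n / (1 - t) ^ n)" if "i \<in> I" for i
  proof -
    have n: "n = card (I - {i})" using Suc.hyps(2) that by simp
    show ?thesis using Suc.hyps(1)[OF n] Suc.prems n by (auto intro: inj_on_subset)
  qed
  then have "rr (replicate (card I) 0) I z = (\<Sum>i\<in>I. ge z I i * of_real (qp n / (1 - t) ^ n))"
    using Suc.hyps(2)[symmetric] by (auto intro!: sum.cong)
  also have "\<dots> = of_real ((1 - t ^ card I) / (1 - t)) * of_real (qp n / (1 - t) ^ n)"
    unfolding g[symmetric] sum_distrib_right ..
  also have "\<dots> = of_real (qp (card I) / (1 - t) ^ card I)"
    unfolding Suc.hyps(2)[symmetric] of_real_mult[symmetric] qp_Suc by (simp add: mult.commute)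
  finally show ?case .
qed

end

section \<open>Hall--Littlewood functions\<close>

lemma sum_count_col: "(\<Sum>j<N. count la (Suc j)) + col la N = col la 0"
proof (induction N)
  case (Suc N)
  then show ?case using col_Suc[of la N] by simp
qed simp

lemma sum_mset_col_Suc: "sum_mset la \<le> N \<Longrightarrow> sum_mset la = col la 0 + (\<Sum>j<N. col la (Suc j))"
  using sum_col[of la "Suc N"] by (simp add: sum.lessThan_Suc_shift del: sum.lessThan_Suc)

lemma topsum_Suc: "sum_mset la \<le> N \<Longrightarrow> topsum la k = min k (col la 0) + (\<Sum>j<N. min k (col la (Suc j)))"
  using top_eq[of la "Suc N" k] by (simp add: sum.lessThan_Suc_shift del: sum.lessThan_Suc)

text \<open>The la for which la/mu is a vertical strip of size r: the column lengths of la and mu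
  interlace.\<close>

definition vstrips :: "partition \<Rightarrow> nat \<Rightarrow> partition set"
  where "vstrips mu r = {la \<in> partitions. sum_mset la = sum_mset mu + r \<and>
    (\<forall>j. col mu j \<le> col la j \<and> col la (Suc j) \<le> col mu j)}"

lemma finite_vstrips [simp]: "finite (vstrips mu r)"
  by (rule finite_subset[OF _ finite_partitions_of[of "sum_mset mu + r"]]) (auto simp: vstrips_def)

text \<open>A vertical strip has at most one box in each row, so the first k rows gain at most
  \<open>min k r\<close> boxes.\<close>

lemma topsum_vstrip:
  assumes "la \<in> vstrips mu r"
  shows "topsum la k \<le> topsum mu k + min k r"
proof -
  define N where "N = sum_mset la"
  have sl: "sum_mset la = sum_mset mu + r" and c: "\<And>j. col mu j \<le> col la j" "\<And>j. col la (Suc j) \<le> col mu j"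
    using assms by (auto simp: vstrips_def)
  have m: "topsum mu k = (\<Sum>j<N. min k (col mu j))" by (rule top_eq) (simp add: N_def sl)
  have l: "topsum la k = (\<Sum>j<N. min k (col la j))" by (rule top_eq) (simp add: N_def)
  have "topsum la k \<le> topsum mu k + k"
  proof -
    have "(\<Sum>j<N. min k (col la (Suc j))) \<le> (\<Sum>j<N. min k (col mu j))"
      using c(2) by (intro sum_mono) (simp add: min.coboundedI2)
    then show ?thesis using topsum_Suc[of la N k] by (simp add: N_def m)
  qed
  moreover have "topsum la k \<le> topsum mu k + r"
  proof -
    have "topsum la k + (\<Sum>j<N. col mu j) \<le> topsum mu k + (\<Sum>j<N. col la j)"
      unfolding l m sum.distrib[symmetric]
    proof (rule sum_mono)
      fix j show "min k (col la j) + col mu j \<le> min k (col mu j) + col la j" using c(1)[of j] by linarith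
    qed
    then show ?thesis using sum_col[of mu N] sum_col[of la N] by (simp add: N_def sl)
  qed
  ultimately show ?thesis by simp
qed

context hl begin

text \<open>Multiplicities of the parts of la after padding with zeros to n parts; the zeros count
  as a part with its own multiplicity.\<close>

definition mm :: "nat \<Rightarrow> partition \<Rightarrow> nat \<Rightarrow> nat"
  where "mm n la j = (if j = 0 then n - size la else count la j)"

text \<open>The formula for P_la in n variables: the symmetrisation divided by v_la(t), the product
  of the t-factorials of all multiplicities, the zeros included. It is 0 if la has more than n
  parts.\<close>

definition Pn :: "nat \<Rightarrow> partition \<Rightarrow> (nat \<Rightarrow> complex) \<Rightarrow> complex"
  where "Pn n la z = (if size la \<le> n then
    of_real ((1 - t) ^ n / (\<Prod>j\<le>sum_mset la. qp (mm n la j))) * rr (blk (mm n la) (Suc (sum_mset la))) {..<n} z else 0)"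

lemma count_large: "sum_mset (la :: partition) < j \<Longrightarrow> count la j = 0"
  using col_Suc[of la "j - 1"] col_eq_0[of la "j - 1"] by (cases j) auto

lemma Pn_eq:
  assumes "size la \<le> n" "sum_mset la \<le> N"
  shows "Pn n la z = of_real ((1 - t) ^ n / (\<Prod>j\<le>N. qp (mm n la j))) * rr (blk (mm n la) (Suc N)) {..<n} z"
  using assms(2)
proof (induction N rule: dec_induct)
  case base
  then show ?case using assms by (simp add: Pn_def)
next
  case (step N)
  have "mm n la (Suc N) = 0" using step count_large[of la "Suc N"] by (simp add: mm_def)
  then show ?case using step by simp
qed

lemma length_blk_mm:
  assumes "la \<in> partitions" "size la \<le> n" "sum_mset la \<le> N"
  shows "length (blk (mm n la) (Suc N)) = n"
proof -
  have "length (blk (mm n la) (Suc N)) = n - size la + (\<Sum>j<N. count la (Suc j))"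
    unfolding length_blk sum.lessThan_Suc_shift by (simp add: mm_def)
  then show ?thesis using sum_count_col[of la N] col_eq_0[OF assms(3)] col_0[OF assms(1)] assms(2) by simp
qed

text \<open>The coefficient of P_la in e_r P_mu: a product over columns of Gaussian binomials,
  choosing the rows that end in that column because of a new box.\<close>

definition dd :: "partition \<Rightarrow> partition \<Rightarrow> real"
  where "dd la mu = (\<Prod>j<sum_mset la. qbin (count la (Suc j)) (col la j - col mu j))"

lemma dd_eq:
  assumes "sum_mset la \<le> N"
  shows "dd la mu = (\<Prod>j<N. qbin (count la (Suc j)) (col la j - col mu j))"
  unfolding dd_def
  by (rule prod.mono_neutral_left) (use assms in \<open>auto simp: col_eq_0 count_large\<close>)

text \<open>The elementary polynomial raises r entries of the padded list of parts. The number of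
  entries j that are raised is the number of boxes of la/mu in column j, so the sum over raisings is
  a sum over vertical strips, and the Gaussian binomials combine with the normalisations to
  \<open>dd\<close>.\<close>

lemma Pn_pieri:
  assumes mu: "mu \<in> partitions" and z: "zgood n z"
  shows "esI (int r) {..<n} z * Pn n mu z = (\<Sum>la\<in>vstrips mu r. of_real (dd la mu) * Pn n la z)"
proof (cases "size mu \<le> n")
  case False
  have "Pn n la z = 0" if "la \<in> vstrips mu r" for la
  proof -
    have "la \<in> partitions" "col mu 0 \<le> col la 0" using that unfolding vstrips_def by blast+
    then have "size mu \<le> size la" using col_0[OF mu] col_0[of la] by simp
    then show ?thesis using False by (simp add: Pn_def)
  qed
  then show ?thesis using False by (simp add: Pn_def)
next
  case True
  \<comment> \<open>No part of mu equals J, so nothing is raised out of the top block, and the lists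
    after raising are again covered by \<open>blk\<close> up to \<open>Suc J\<close>.\<close>
  define J where "J = sum_mset mu + r + 1"
  define V where "V = {la \<in> vstrips mu r. size la \<le> n}"
  define K where "K = {k \<in> KN (mm n mu) (Suc J). (\<Sum>j<Suc J. k j) = r}"
  \<comment> \<open>The number of rows of length j in mu that are lengthened, which is the number of
    new boxes in column j.\<close>
  define kk where "kk la j = col la j - col mu j" for la j
  have VK: "kk la \<in> K" if "la \<in> V" for la
  proof -
    have la: "la \<in> partitions" "sum_mset la = sum_mset mu + r" "\<And>j. col mu j \<le> col la j" "\<And>j. col la (Suc j) \<le> col mu j" "size la \<le> n"
      using that by (auto simp: V_def vstrips_def)
    have "kk la j \<le> mm n mu j" for j
    proof (cases j)
      case 0
      then show ?thesis using la col_0[of la] col_0[OF mu] by (simp add: kk_def mm_def)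
    next
      case (Suc i)
      then show ?thesis using la(4)[of i] count_eq_col[of mu i] by (simp add: kk_def mm_def)
    qed
    moreover have "kk la j = 0" if "j \<ge> Suc J" for j
      using that la(2) by (simp add: kk_def col_eq_0 J_def)
    moreover have "(\<Sum>j<Suc J. kk la j) = r"
      unfolding kk_def sum_subtractf_nat[OF la(3)] using la(2) sum_col[of la "Suc J"] sum_col[of mu "Suc J"]
      by (simp add: J_def del: sum.lessThan_Suc)
    ultimately show ?thesis by (simp add: K_def KN_def)
  qed
  have KV: "\<exists>la\<in>V. kk la = k" if k: "k \<in> K" for k
  proof -
    have k1: "\<And>j. j < Suc J \<Longrightarrow> k j \<le> mm n mu j" "\<And>j. j \<ge> Suc J \<Longrightarrow> k j = 0" "(\<Sum>j<Suc J. k j) = r"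
      using k by (auto simp: K_def KN_def)
    have le: "col mu (Suc j) + k (Suc j) \<le> col mu j" for j
    proof (cases "Suc j < Suc J")
      case True
      then show ?thesis using k1(1)[of "Suc j"] col_Suc[of mu j] by (simp add: mm_def)
    qed (use k1(2)[of "Suc j"] col_Suc[of mu j] in auto)
    have mono: "col mu (Suc j) + k (Suc j) \<le> col mu j + k j" for j using le[of j] by simp
    have zero: "col mu (Suc J) + k (Suc J) = 0" using k1(2)[of "Suc J"] by (simp add: col_eq_0 J_def)
    obtain la where la: "la \<in> partitions" "\<And>j. col la j = col mu j + k j"
      using col_exists[of "\<lambda>j. col mu j + k j" "Suc J", OF mono zero] by blast
    define N where "N = max (Suc J) (sum_mset la)"
    have "sum_mset la = (\<Sum>j<N. col la j)" by (rule sum_col[symmetric]) (simp add: N_def)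
    also have "\<dots> = (\<Sum>j<N. col mu j) + (\<Sum>j<N. k j)" by (simp add: la sum.distrib)
    also have "(\<Sum>j<N. col mu j) = sum_mset mu" by (rule sum_col) (simp add: N_def J_def)
    also have "(\<Sum>j<N. k j) = (\<Sum>j<Suc J. k j)"
      by (rule sum.mono_neutral_right) (use k1(2) in \<open>auto simp: N_def\<close>)
    finally have s: "sum_mset la = sum_mset mu + r" using k1(3) by simp
    have "size la \<le> n" using la(2)[of 0] k1(1)[of 0] True col_0[OF la(1)] col_0[OF mu] by (simp add: mm_def)
    then have "la \<in> V" using la s le by (auto simp: V_def vstrips_def)
    moreover have "kk la = k" using la by (auto simp: kk_def)
    ultimately show ?thesis by blast
  qed
  have inj: "inj_on kk V"
  proof (rule inj_onI)
    fix la la' assume *: "la \<in> V" "la' \<in> V" "kk la = kk la'"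
    have P: "la \<in> partitions" "la' \<in> partitions" using * by (simp_all add: V_def vstrips_def)
    have "col la j = col la' j" for j
    proof -
      have "col mu j \<le> col la j" "col mu j \<le> col la' j" using * by (simp_all add: V_def vstrips_def)
      moreover have "col la j - col mu j = col la' j - col mu j" using fun_cong[OF *(3), of j] by (simp add: kk_def)
      ultimately show ?thesis by linarith
    qed
    then show "la = la'" by (rule partition_eqI[OF P])
  qed
  have KVeq: "K = kk ` V" using VK KV by blast
  have lenmu: "length (blk (mm n mu) (Suc J)) = n" by (rule length_blk_mm[OF mu True]) (simp add: J_def)
  have zi: "inj_on z {..<n}" using z by (simp add: zgood_def)
  have finK: "finite (KN m N)" for m N
  proof (induction N)
    case (Suc N)
    have "KN m (Suc N) \<subseteq> (\<lambda>(x,k). k(N := x)) ` ({..m N} \<times> KN m N)"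
    proof
      fix k assume "k \<in> KN m (Suc N)"
      then have "(k N, k(N := 0)) \<in> {..m N} \<times> KN m N" "k = (\<lambda>(x,k). k(N := x)) (k N, k(N := 0))"
        by (auto simp: KN_def)
      then show "k \<in> (\<lambda>(x,k). k(N := x)) ` ({..m N} \<times> KN m N)" by blast
    qed
    then show ?case using Suc finite_subset by (metis finite_SigmaI finite_atMost finite_imageI)
  qed (simp add: KN_0)
  have mmJ: "mm n mu J = 0" using count_large[of mu J] by (simp add: mm_def J_def)
  define rs where "rs k j = mm n mu j - k j + (if j = 0 then 0 else k (j - 1))" for k j
  have kJ: "k J = 0" if "k \<in> KN (mm n mu) (Suc J)" for k using that mmJ by (auto simp: KN_def)
  have blkrs: "blk' (mm n mu) k (Suc J) = blk (rs k) (Suc J)" if "k \<in> KN (mm n mu) (Suc J)" for k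
    using blk'_eq[of "mm n mu" J k] kJ[OF that] unfolding rs_def by simp
  have "esI (int r) {..<n} z * rr (blk (mm n mu) (Suc J)) {..<n} z = Er (blk (mm n mu) (Suc J)) (int r) (\<lambda>be. rr be {..<n} z)"
    by (rule esI_rr) (use lenmu in simp_all)
  also have "\<dots> = (\<Sum>k\<in>KN (mm n mu) (Suc J). if int (\<Sum>j<Suc J. k j) = int r
      then of_real (\<Prod>j<Suc J. qbin (mm n mu j) (k j)) * rr (blk' (mm n mu) k (Suc J)) {..<n} z else 0)"
    by (rule Er_blk) (use strt_rr zi in auto)
  also have "\<dots> = (\<Sum>k\<in>K. of_real (\<Prod>j<Suc J. qbin (mm n mu j) (k j)) * rr (blk (rs k) (Suc J)) {..<n} z)"
    unfolding K_def of_nat_eq_iff sum.inter_filter[OF finK]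
    by (intro sum.cong refl if_cong) (simp only: blkrs)
  also have "\<dots> = (\<Sum>la\<in>V. of_real (\<Prod>j<Suc J. qbin (mm n mu j) (kk la j)) * rr (blk (rs (kk la)) (Suc J)) {..<n} z)"
    unfolding KVeq sum.reindex[OF inj] comp_def ..
  finally have main: "esI (int r) {..<n} z * rr (blk (mm n mu) (Suc J)) {..<n} z
     = (\<Sum>la\<in>V. of_real (\<Prod>j<Suc J. qbin (mm n mu j) (kk la j)) * rr (blk (rs (kk la)) (Suc J)) {..<n} z)" .
  have Pmu: "Pn n mu z = of_real ((1 - t) ^ n / (\<Prod>j\<le>J. qp (mm n mu j))) * rr (blk (mm n mu) (Suc J)) {..<n} z"
    by (rule Pn_eq[OF True]) (simp add: J_def)
  \<comment> \<open>The rows of length \<open>Suc j\<close> in la are those raised from j together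
    with the unraised ones of mu. So \<open>qp (kk la j)\<close> from block j is paired with the
    leftover factor of block \<open>Suc j\<close>, which produces the binomial in
    \<open>dd\<close>.\<close>
  have trm: "of_real ((1 - t) ^ n / (\<Prod>j\<le>J. qp (mm n mu j))) *
      (of_real (\<Prod>j<Suc J. qbin (mm n mu j) (kk la j)) * rr (blk (rs (kk la)) (Suc J)) {..<n} z)
      = of_real (dd la mu) * Pn n la z" if la: "la \<in> V" for la
  proof -
    have la1: "la \<in> partitions" "sum_mset la = sum_mset mu + r" "\<And>j. col mu j \<le> col la j" "\<And>j. col la (Suc j) \<le> col mu j" "size la \<le> n"
      using la by (auto simp: V_def vstrips_def)
    have kle: "kk la j \<le> mm n mu j" if "j < Suc J" for j using VK[OF la] that by (auto simp: K_def KN_def)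
    have kkJ: "kk la J = 0" using VK[OF la] kJ by (auto simp: K_def)
    have rs0: "mm n la 0 = mm n mu 0 - kk la 0" using la1(3)[of 0] col_0[OF la1(1)] col_0[OF mu] by (simp add: mm_def kk_def)
    have rsS: "mm n la (Suc i) = mm n mu (Suc i) - kk la (Suc i) + kk la i" for i
    proof -
      have "count la (Suc i) = count mu (Suc i) - (col la (Suc i) - col mu (Suc i)) + (col la i - col mu i)"
        using la1(3)[of i] la1(3)[of "Suc i"] la1(4)[of i] col_Suc[of la i] col_Suc[of mu i] by linarith
      then show ?thesis by (simp add: mm_def kk_def)
    qed
    have "rs (kk la) j = mm n la j" for j using rs0 rsS by (cases j) (auto simp: rs_def)
    then have blk: "rr (blk (rs (kk la)) (Suc J)) {..<n} z = rr (blk (mm n la) (Suc J)) {..<n} z"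
      by (metis blk_cong)
    have Pla: "Pn n la z = of_real ((1 - t) ^ n / (\<Prod>j\<le>J. qp (mm n la j))) * rr (blk (mm n la) (Suc J)) {..<n} z"
      by (rule Pn_eq[OF la1(5)]) (simp add: J_def la1)
    have "(\<Prod>j<Suc J. qbin (mm n mu j) (kk la j)) / (\<Prod>j\<le>J. qp (mm n mu j))
        = (\<Prod>j<Suc J. 1 / qp (kk la j) * (1 / qp (mm n mu j - kk la j)))"
      unfolding lessThan_Suc_atMost[symmetric] prod_dividef[symmetric]
      by (intro prod.cong refl) (use kle in \<open>auto simp: qbin_def\<close>)
    also have "\<dots> = (\<Prod>j<Suc J. 1 / qp (kk la j)) * (\<Prod>j<Suc J. 1 / qp (mm n mu j - kk la j))"
      by (rule prod.distrib)
    also have "(\<Prod>j<Suc J. 1 / qp (kk la j)) = (\<Prod>j<J. 1 / qp (kk la j))" using kkJ by simp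
    also have "(\<Prod>j<Suc J. 1 / qp (mm n mu j - kk la j)) = 1 / qp (mm n la 0) * (\<Prod>j<J. 1 / qp (mm n la (Suc j) - kk la j))"
      unfolding prod.lessThan_Suc_shift by (simp add: rs0 rsS)
    also have "(\<Prod>j<J. 1 / qp (kk la j)) * (1 / qp (mm n la 0) * (\<Prod>j<J. 1 / qp (mm n la (Suc j) - kk la j)))
        = 1 / qp (mm n la 0) * (\<Prod>j<J. qbin (count la (Suc j)) (kk la j) / qp (mm n la (Suc j)))"
    proof -
      have "1 / qp (kk la j) * (1 / qp (mm n la (Suc j) - kk la j)) = qbin (count la (Suc j)) (kk la j) / qp (mm n la (Suc j))" for j
        using rsS[of j] by (simp add: qbin_def mm_def)
      then show ?thesis by (simp add: prod.distrib[symmetric])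
    qed
    also have "\<dots> = dd la mu / (\<Prod>j<Suc J. qp (mm n la j))"
      unfolding prod.lessThan_Suc_shift dd_eq[of la J, unfolded J_def la1(2), simplified, folded J_def] prod_dividef
      using dd_eq[of la J mu] by (simp add: kk_def J_def la1(2))
    finally have c: "(\<Prod>j<Suc J. qbin (mm n mu j) (kk la j)) / (\<Prod>j\<le>J. qp (mm n mu j)) = dd la mu / (\<Prod>j\<le>J. qp (mm n la j))"
      unfolding lessThan_Suc_atMost .
    have "of_real ((1 - t) ^ n / (\<Prod>j\<le>J. qp (mm n mu j))) * (of_real (\<Prod>j<Suc J. qbin (mm n mu j) (kk la j)) * X)
        = of_real ((1 - t) ^ n * ((\<Prod>j<Suc J. qbin (mm n mu j) (kk la j)) / (\<Prod>j\<le>J. qp (mm n mu j)))) * X" for X :: complex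
      by simp
    then show ?thesis unfolding blk Pla c by simp
  qed
  have "esI (int r) {..<n} z * Pn n mu z = (\<Sum>la\<in>V. of_real (dd la mu) * Pn n la z)"
    unfolding Pmu mult.left_commute[of "esI _ _ _"] main sum_distrib_left by (intro sum.cong refl) (rule trm)
  also have "\<dots> = (\<Sum>la\<in>vstrips mu r. of_real (dd la mu) * Pn n la z)"
    by (rule sum.mono_neutral_left) (auto simp: V_def Pn_def)
  finally show ?thesis .
qed

text \<open>One and the same series must have the prescribed values in every number of variables and
  be unitriangular for dominance. Existence is proved from the Pieri rule, since \<open>Pn\<close>
  is only a sum of rational functions.\<close>

definition is_hl :: "partition \<Rightarrow> mps \<Rightarrow> bool"
  where "is_hl la f \<longleftrightarrow> symf f \<and> (\<forall>n z. zgood n z \<longrightarrow> ev z f = Pn n la z) \<and>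
    (\<forall>M. cf f M \<noteq> 0 \<longrightarrow> dominance_le (exponents M) la) \<and> (\<forall>M. exponents M = la \<longrightarrow> cf f M = 1)"

lemma is_hl_empty: "is_hl {#} 1"
  unfolding is_hl_def
proof (intro conjI allI impI)
  fix n z assume z: "zgood n z"
  have "rr (replicate (card {..<n}) 0) {..<n} z = of_real (qp (card {..<n}) / (1 - t) ^ card {..<n})"
    by (rule rr_replicate_0) (use z in \<open>auto simp: zgood_def\<close>)
  then have "Pn n {#} z = of_real ((1 - t) ^ n / qp n) * of_real (qp n / (1 - t) ^ n)"
    by (simp add: Pn_def mm_def)
  also have "\<dots> = 1" using t1 unfolding of_real_mult[symmetric] by simp
  finally show "ev z 1 = Pn n {#} z" by simp
next
  fix M assume "exponents M = {#}"
  then have "size M = 0" using sum_exponents[of M] by simp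
  then show "cf 1 M = 1" by (simp add: cf_one)
qed (auto simp: cf_one split: if_splits)

lemma es_mult_nonzero:
  assumes "cf (es r * f) M \<noteq> 0" "\<And>M. cf f M \<noteq> 0 \<Longrightarrow> dominance_le (exponents M) mu"
  shows "size M = sum_mset mu + r" "topsum (exponents M) k \<le> topsum mu k + min k r"
proof -
  obtain A where A: "A \<subseteq># M" "cf (es r) A \<noteq> 0" "cf f (M - A) \<noteq> 0"
    using assms(1) unfolding cf_mult by (auto elim!: sum.not_neutral_contains_not_neutral)
  have sq: "size A = r" "\<And>i. count A i \<le> 1" using A(2) by (auto simp: cf_es split: if_splits)
  have d: "dominance_le (exponents (M - A)) mu" using assms(2) A(3) by blast
  have "size M = size (M - A) + size A" using A(1) by (simp add: size_Diff_submset size_mset_mono)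
  then show "size M = sum_mset mu + r" using d sq by (simp add: dominance_le_iff)
  obtain K where K: "finite K" "card K \<le> k" "topsum (exponents M) k = (\<Sum>i\<in>K. count M i)"
    by (rule top_attained)
  have "(\<Sum>i\<in>K. count M i) = (\<Sum>i\<in>K. count (M - A) i) + (\<Sum>i\<in>K. count A i)"
    unfolding sum.distrib[symmetric] using A(1) by (intro sum.cong) (auto simp: subseteq_mset_def)
  moreover have "(\<Sum>i\<in>K. count (M - A) i) \<le> topsum mu k"
    using sum_count_le_topsum[OF K(1,2), of "M - A"] d by (auto simp: dominance_le_iff intro: order_trans)
  moreover have "(\<Sum>i\<in>K. count A i) \<le> k"
  proof -
    have "(\<Sum>i\<in>K. count A i) \<le> (\<Sum>i\<in>K. 1)" using sq(2) by (intro sum_mono) auto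
    then show ?thesis using K(2) by simp
  qed
  moreover have "(\<Sum>i\<in>K. count A i) \<le> r"
  proof -
    have "(\<Sum>i\<in>K. count A i) \<le> (\<Sum>i\<in>K \<union> set_mset A. count A i)" using K(1) by (intro sum_mono2) auto
    also have "\<dots> = (\<Sum>i\<in>set_mset A. count A i)"
      by (rule sum.mono_neutral_right) (use K(1) in \<open>auto simp: not_in_iff\<close>)
    finally show ?thesis using sq(1) by (simp add: size_multiset_overloaded_eq)
  qed
  ultimately show "topsum (exponents M) k \<le> topsum mu k + min k r" unfolding K(3) by linarith
qed

text \<open>With as many factors as M has variables, the squarefree monomial split off must be the
  product of all of them. What remains has the shape of M with its first column removed.\<close>

lemma es_mult_leading:
  assumes f: "\<And>M. exponents M = mu \<Longrightarrow> cf f M = 1" and mu: "mu \<in> partitions"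
    and la: "\<And>j. col mu j = col (exponents M) (Suc j)"
  shows "cf (es (card (set_mset M)) * f) M = 1"
proof -
  let ?r = "card (set_mset M)" and ?S = "mset_set (set_mset M)"
  have sub: "?S \<subseteq># M" by (auto simp: subseteq_mset_def count_mset_set' Suc_leI)
  have "cf (es ?r * f) M = (\<Sum>A\<in>{?S}. cf (es ?r) A * cf f (M - A))"
    unfolding cf_mult
  proof (rule sum.mono_neutral_right)
    show "\<forall>A\<in>{A. A \<subseteq># M} - {?S}. cf (es ?r) A * cf f (M - A) = 0"
    proof
      fix A assume A: "A \<in> {A. A \<subseteq># M} - {?S}"
      have "\<not> (size A = ?r \<and> (\<forall>i. count A i \<le> 1))"
      proof
        assume *: "size A = ?r \<and> (\<forall>i. count A i \<le> 1)"
        then have e: "A = mset_set (set_mset A)" by (simp only: squarefree_iff)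
        have "card (set_mset A) = ?r" using * e by (metis size_mset_set)
        moreover have "set_mset A \<subseteq> set_mset M" using A by (auto dest: mset_subset_eqD)
        ultimately have "set_mset A = set_mset M" by (intro card_subset_eq) auto
        then show False using A e by auto
      qed
      then show "cf (es ?r) A * cf f (M - A) = 0" by (auto simp: cf_es)
    qed
  qed (use sub in auto)
  also have "\<dots> = cf f (M - ?S)" by (simp add: cf_es count_mset_set')
  also have "\<dots> = 1"
  proof (rule f, rule partition_eqI)
    fix j
    have "{i. j < count (M - ?S) i} = {i. Suc j < count M i}"
    proof -
      have "j < count (M - ?S) i \<longleftrightarrow> Suc j < count M i" for i
      proof (cases "i \<in># M")
        case False
        then show ?thesis by (simp add: not_in_iff[THEN iffD1])
      qed (simp add: count_mset_set' less_diff_conv)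
      then show ?thesis by blast
    qed
    then show "col (exponents (M - ?S)) j = col mu j" by (simp add: la col_exponents)
  qed (use mu in auto)
  finally show ?thesis .
qed

lemma dd_first_column:
  assumes "\<And>j. col mu j = col la (Suc j)" shows "dd la mu = 1"
  unfolding dd_def by (rule prod.neutral) (auto simp: assms count_eq_col[symmetric] qbin_def)

text \<open>Let ka be la without its first column, of length r. In e_r P_ka the function of la
  occurs with coefficient 1 and every other term has more parts, so P_la is obtained by subtraction.
  The measure decreases lexicographically: ka has smaller weight, the other terms have equal weight
  and greater length.\<close>

lemma is_hl_exists: "la \<in> partitions \<Longrightarrow> \<exists>f. is_hl la f"
proof (induction la rule: wf_induct_rule[OF wf_measures[of "[sum_mset, \<lambda>la. sum_mset la - size la]"]])
  case (1 la)
  show ?case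
  proof (cases "la = {#}")
    case True
    then show ?thesis using is_hl_empty by blast
  next
    case False
    define r where "r = size la"
    have r: "r > 0" "col la 0 = r" using False col_0[OF 1(2)] by (auto simp: r_def nonempty_has_size)
    have "col la (Suc (Suc j)) \<le> col la (Suc j)" for j by (rule col_antimono) simp
    moreover have "col la (Suc (sum_mset la)) = 0" by (rule col_eq_0) simp
    ultimately obtain ka where ka: "ka \<in> partitions" "\<And>j. col ka j = col la (Suc j)"
      using col_exists[of "\<lambda>j. col la (Suc j)" "sum_mset la"] by blast
    have sumla: "sum_mset la = sum_mset ka + r"
    proof -
      define N where "N = max (sum_mset la) (sum_mset ka)"
      have "sum_mset la = col la 0 + (\<Sum>j<N. col la (Suc j))" by (rule sum_mset_col_Suc) (simp add: N_def)
      also have "(\<Sum>j<N. col la (Suc j)) = (\<Sum>j<N. col ka j)" by (simp add: ka)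
      also have "\<dots> = sum_mset ka" by (rule sum_col) (simp add: N_def)
      finally show ?thesis using r by simp
    qed
    have topla: "topsum la k = min k r + topsum ka k" for k
    proof -
      have "topsum la k = min k (col la 0) + (\<Sum>j<sum_mset la. min k (col la (Suc j)))" by (rule topsum_Suc) simp
      also have "(\<Sum>j<sum_mset la. min k (col la (Suc j))) = (\<Sum>j<sum_mset la. min k (col ka j))" by (simp add: ka)
      also have "\<dots> = topsum ka k" by (rule top_eq[symmetric]) (simp add: sumla)
      finally show ?thesis by (simp add: r)
    qed
    have lav: "la \<in> vstrips ka r"
      using ka sumla 1(2) col_antimono[of _ "Suc _" la] by (auto simp: vstrips_def)
    \<comment> \<open>The later columns of rho are bounded by those of la. Weights being equal, the
      first column of rho has length at least r, with equality only if all columns agree.\<close>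
    have longer: "r < size rho" if rho: "rho \<in> vstrips ka r" "rho \<noteq> la" for rho
    proof (rule ccontr)
      assume "\<not> r < size rho"
      have rp: "rho \<in> partitions" "sum_mset rho = sum_mset la" "\<And>j. col rho (Suc j) \<le> col la (Suc j)"
        using rho sumla ka by (auto simp: vstrips_def)
      define N where "N = sum_mset la"
      have "sum_mset rho = col rho 0 + (\<Sum>j<N. col rho (Suc j))" by (rule sum_mset_col_Suc) (simp add: N_def rp)
      moreover have "sum_mset la = col la 0 + (\<Sum>j<N. col la (Suc j))" by (rule sum_mset_col_Suc) (simp add: N_def)
      moreover have le: "(\<Sum>j<N. col rho (Suc j)) \<le> (\<Sum>j<N. col la (Suc j))" by (intro sum_mono rp)
      moreover have "col rho 0 \<le> r" using \<open>\<not> r < size rho\<close> col_0[OF rp(1)] by simp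
      ultimately have eq: "col rho 0 = r" "(\<Sum>j<N. col rho (Suc j)) = (\<Sum>j<N. col la (Suc j))"
        using r rp(2) by linarith+
      have "col rho (Suc j) = col la (Suc j)" for j
      proof (cases "j < N")
        case True
        show ?thesis
        proof (rule ccontr)
          assume "col rho (Suc j) \<noteq> col la (Suc j)"
          then have "col rho (Suc j) < col la (Suc j)" using rp(3)[of j] by simp
          then have "(\<Sum>j<N. col rho (Suc j)) < (\<Sum>j<N. col la (Suc j))"
            using True rp(3) by (intro sum_strict_mono_ex1) auto
          then show False using eq by simp
        qed
      next
        case False
        then show ?thesis using rp by (simp add: col_eq_0 N_def)
      qed
      then have "col rho j = col la j" for j using eq r by (cases j) auto
      then show False using partition_eqI[OF rp(1) 1(2)] rho by blast
    qed
    have szp: "size rho \<le> sum_mset rho" if "rho \<in> vstrips ka r" for rho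
      using that by (intro size_le_sum_partition) (auto simp: vstrips_def)
    have "\<exists>f. is_hl ka f" using 1(1)[of ka] ka(1) r sumla by simp
    then obtain fk where fk: "is_hl ka fk" ..
    have "\<exists>f. is_hl rho f" if rho: "rho \<in> vstrips ka r - {la}" for rho
    proof (rule 1(1))
      have "size la < size rho" "size rho \<le> sum_mset rho" "sum_mset rho = sum_mset la"
        using rho longer[of rho] szp[of rho] sumla by (auto simp: r_def vstrips_def)
      then show "(rho, la) \<in> measures [sum_mset, \<lambda>la. sum_mset la - size la]" by auto
      show "rho \<in> partitions" using rho by (simp add: vstrips_def)
    qed
    then obtain F where F: "\<And>rho. rho \<in> vstrips ka r - {la} \<Longrightarrow> is_hl rho (F rho)" by metis
    define S where "S = vstrips ka r - {la}"
    define f where "f = es r * fk - (\<Sum>rho\<in>S. sc (dd rho ka) * F rho)"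
    have symF: "symf (F rho)" if "rho \<in> S" for rho using F that by (auto simp: S_def is_hl_def)
    have symk: "symf fk" using fk by (simp add: is_hl_def)
    have b: "bounded_deg (es r * fk)" "bounded_deg (\<Sum>rho\<in>S. sc (dd rho ka) * F rho)"
      using symF symk by (auto intro!: symf_bounded symf_sum symf_mult)
    have "is_hl la f" unfolding is_hl_def
    proof (intro conjI allI impI)
      show "symf f" unfolding f_def using symF symk by (intro symf_diff symf_sum symf_mult) auto
    next
      fix n z assume z: "zgood n z"
      then have z0: "\<And>i. n \<le> i \<Longrightarrow> z i = 0" by (simp add: zgood_def)
      have "ev z f = ev z (es r) * ev z fk - (\<Sum>rho\<in>S. of_real (dd rho ka) * ev z (F rho))"
        unfolding f_def using symF symk
        by (subst ev_diff[OF z0 b], simp, subst ev_mult[OF z0], simp, simp add: symf_bounded, simp add: symf_bounded,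
            subst ev_sum[OF z0]) (auto intro!: symf_bounded symf_mult)
      also have "ev z (es r) = esI (int r) {..<n} z" using ev_es[OF z0] by (simp add: esI_def)
      also have "ev z fk = Pn n ka z" using fk z by (simp add: is_hl_def)
      also have "esI (int r) {..<n} z * Pn n ka z = (\<Sum>rho\<in>vstrips ka r. of_real (dd rho ka) * Pn n rho z)"
        by (rule Pn_pieri[OF ka(1) z])
      also have "\<dots> = of_real (dd la ka) * Pn n la z + (\<Sum>rho\<in>S. of_real (dd rho ka) * Pn n rho z)"
        unfolding S_def by (rule sum.remove[OF finite_vstrips lav])
      also have "(\<Sum>rho\<in>S. of_real (dd rho ka) * ev z (F rho)) = (\<Sum>rho\<in>S. of_real (dd rho ka) * Pn n rho z)"
        using F z by (intro sum.cong) (auto simp: S_def is_hl_def)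
      finally show "ev z f = Pn n la z" by (simp add: dd_first_column[OF ka(2)])
    next
      fix M assume M: "cf f M \<noteq> 0"
      have "cf (es r * fk) M \<noteq> 0 \<or> (\<exists>rho\<in>S. cf (F rho) M \<noteq> 0)"
      proof (rule ccontr)
        assume "\<not> ?thesis"
        then have "cf f M = 0" by (simp add: f_def)
        then show False using M by simp
      qed
      then show "dominance_le (exponents M) la"
      proof
        assume *: "cf (es r * fk) M \<noteq> 0"
        have tr: "\<And>M. cf fk M \<noteq> 0 \<Longrightarrow> dominance_le (exponents M) ka" using fk by (simp add: is_hl_def)
        show ?thesis using es_mult_nonzero[OF * tr] by (simp add: dominance_le_iff sumla topla add.commute)
      next
        assume "\<exists>rho\<in>S. cf (F rho) M \<noteq> 0"
        then obtain rho where rho: "rho \<in> S" "cf (F rho) M \<noteq> 0" by blast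
        have "dominance_le (exponents M) rho" using F[of rho] rho by (simp add: S_def is_hl_def)
        moreover have "dominance_le rho la" using rho(1) topsum_vstrip[of rho ka r] sumla
          by (auto simp: dominance_le_iff S_def topla vstrips_def add.commute)
        ultimately show ?thesis by (rule dominance_le_trans)
      qed
    next
      fix M assume M: "exponents M = la"
      have "cf (F rho) M = 0" if rho: "rho \<in> S" for rho
      proof (rule ccontr)
        assume "cf (F rho) M \<noteq> 0"
        then have "dominance_le la rho" using F[of rho] rho M by (auto simp: S_def is_hl_def)
        moreover have "dominance_le rho la" using rho(1) topsum_vstrip[of rho ka r] sumla
          by (auto simp: dominance_le_iff S_def topla vstrips_def add.commute)
        ultimately show False using dominance_le_antisym[OF 1(2), of rho] rho by (auto simp: S_def vstrips_def)
      qed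
      moreover have "cf (es r * fk) M = 1"
      proof -
        have "r = card (set_mset M)" using M by (metis r_def size_exponents)
        then show ?thesis using es_mult_leading[of ka fk M] fk ka M by (simp add: is_hl_def)
      qed
      ultimately show "cf f M = 1" by (simp add: f_def)
    qed
    then show ?thesis by blast
  qed
qed

definition PP :: "partition \<Rightarrow> mps" where "PP la = (SOME f. is_hl la f)"

lemma is_hl_PP: "la \<in> partitions \<Longrightarrow> is_hl la (PP la)"
  unfolding PP_def by (rule someI_ex[OF is_hl_exists])

lemma symf_PP: "la \<in> partitions \<Longrightarrow> symf (PP la)"
  and ev_PP: "la \<in> partitions \<Longrightarrow> zgood n z \<Longrightarrow> ev z (PP la) = Pn n la z"
  and PP_dominance: "la \<in> partitions \<Longrightarrow> cf (PP la) M \<noteq> 0 \<Longrightarrow> dominance_le (exponents M) la"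
  and PP_leading: "la \<in> partitions \<Longrightarrow> exponents M = la \<Longrightarrow> cf (PP la) M = 1"
  using is_hl_PP by (auto simp: is_hl_def)

lemma PP_empty: "PP {#} = 1"
proof (rule mps_eqI)
  fix M show "cf (PP {#}) M = cf 1 M"
  proof (cases "M = {#}")
    case True
    then show ?thesis using PP_leading[of "{#}" "{#}"] by (simp add: cf_one)
  next
    case False
    then have "\<not> dominance_le (exponents M) {#}" by (simp add: dominance_le_iff)
    then show ?thesis using PP_dominance[of "{#}" M] False by (auto simp: cf_one)
  qed
qed

text \<open>The rule in finitely many variables lifts to series, because a series of bounded degree
  is determined by its values at good points.\<close>

lemma e_pieri:
  assumes mu: "mu \<in> partitions"
  shows "es r * PP mu = (\<Sum>la\<in>vstrips mu r. sc (dd la mu) * PP la)"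
proof -
  have P: "la \<in> partitions" if "la \<in> vstrips mu r" for la using that by (simp add: vstrips_def)
  have b: "bounded_deg (es r * PP mu)" "bounded_deg (\<Sum>la\<in>vstrips mu r. sc (dd la mu) * PP la)"
    using symf_PP P mu by (auto intro!: symf_bounded symf_sum symf_mult)
  have "es r * PP mu - (\<Sum>la\<in>vstrips mu r. sc (dd la mu) * PP la) = 0"
  proof (rule ev_eq_0_imp)
    fix n z assume z: "zgood n z"
    then have z0: "\<And>i. n \<le> i \<Longrightarrow> z i = 0" by (simp add: zgood_def)
    have "ev z (es r * PP mu) = ev z (es r) * ev z (PP mu)"
      by (rule ev_mult[OF z0]) (use symf_PP mu in \<open>auto intro: symf_bounded\<close>)
    also have "\<dots> = esI (int r) {..<n} z * Pn n mu z" using ev_es[OF z0] ev_PP[OF mu z] by (simp add: esI_def)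
    also have "\<dots> = (\<Sum>la\<in>vstrips mu r. of_real (dd la mu) * Pn n la z)" by (rule Pn_pieri[OF mu z])
    also have "\<dots> = ev z (\<Sum>la\<in>vstrips mu r. sc (dd la mu) * PP la)"
      by (subst ev_sum[OF z0]) (use symf_PP P ev_PP z in \<open>auto intro!: symf_bounded symf_mult sum.cong\<close>)
    finally show "ev z (es r * PP mu - (\<Sum>la\<in>vstrips mu r. sc (dd la mu) * PP la)) = 0"
      by (subst ev_diff[OF z0 b]) auto
  qed (use symf_PP P mu in \<open>auto intro!: symf_bounded symf_sum symf_mult\<close>)
  then show ?thesis by simp
qed

end

section \<open>Multiplication by the one-row functions\<close>

text \<open>A sum over subsets \<open>H\<close> of \<open>{j..<N}\<close> whose summand is a product of factors depending on
  neighbouring memberships is a product of \<open>2 \<times> 2\<close> transfer matrices.\<close>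

definition transfer_sum :: "nat \<Rightarrow> (nat \<Rightarrow> bool \<Rightarrow> bool \<Rightarrow> real) \<Rightarrow> nat \<Rightarrow> bool \<Rightarrow> real"
  where "transfer_sum N X j h = (\<Sum>H\<in>Pow {j..<N}. if (j \<in> H) = h then \<Prod>i=j..<N. X i (i \<in> H) (Suc i \<in> H) else 0)"

lemma transfer_sum_end: "transfer_sum N X N h = (if h then 0 else 1)"
  by (simp add: transfer_sum_def)

lemma transfer_sum_step:
  assumes "j < N"
  shows "transfer_sum N X j h = X j h False * transfer_sum N X (Suc j) False + X j h True * transfer_sum N X (Suc j) True"
proof -
  let ?S = "{Suc j..<N}"
  define p where "p H = (\<Prod>i\<in>?S. X i (i \<in> H) (Suc i \<in> H))" for H
  have S: "{j..<N} = insert j ?S" using assms by auto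
  have inj: "inj_on (insert j) (Pow ?S)" by (rule inj_onI) (metis PowD Suc_n_not_le_n atLeastLessThan_iff insert_ident subsetD)
  have split: "(\<Prod>i=j..<N. X i (i \<in> H) (Suc i \<in> H)) = X j (j \<in> H) (Suc j \<in> H) * p H" for H
    unfolding S p_def by simp
  have pins: "p (insert j H) = p H" for H unfolding p_def by (rule prod.cong) auto
  have "transfer_sum N X j h = (\<Sum>H\<in>Pow ?S. if (j \<in> H) = h then X j (j \<in> H) (Suc j \<in> H) * p H else 0)
     + (\<Sum>H\<in>insert j ` Pow ?S. if (j \<in> H) = h then X j (j \<in> H) (Suc j \<in> H) * p H else 0)"
    unfolding transfer_sum_def split unfolding S Pow_insert by (rule sum.union_disjoint) auto
  also have "\<dots> = (\<Sum>H\<in>Pow ?S. X j h (Suc j \<in> H) * p H)"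
    unfolding sum.reindex[OF inj] comp_def sum.distrib[symmetric]
  proof (rule sum.cong)
    fix H assume "H \<in> Pow ?S"
    then have "j \<notin> H" by auto
    then show "(if (j \<in> H) = h then X j (j \<in> H) (Suc j \<in> H) * p H else 0) +
        (if (j \<in> insert j H) = h then X j (j \<in> insert j H) (Suc j \<in> insert j H) * p (insert j H) else 0) = X j h (Suc j \<in> H) * p H"
      unfolding pins by (cases h) auto
  qed simp
  also have "\<dots> = X j h False * transfer_sum N X (Suc j) False + X j h True * transfer_sum N X (Suc j) True"
    unfolding transfer_sum_def p_def[symmetric] sum_distrib_left sum.distrib[symmetric]
    by (intro sum.cong) auto
  finally show ?thesis .
qed

lemma transfer_sum_total:
  "transfer_sum N X 0 False + transfer_sum N X 0 True = (\<Sum>H\<in>Pow {..<N}. \<Prod>i<N. X i (i \<in> H) (Suc i \<in> H))"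
  unfolding transfer_sum_def sum.distrib[symmetric] atLeast0LessThan by (intro sum.cong) auto

text \<open>The la for which la/mu is a horizontal strip of size r: at most one new box in each
  column.\<close>

definition hstrips :: "partition \<Rightarrow> nat \<Rightarrow> partition set"
  where "hstrips mu r = {la \<in> partitions. sum_mset la = sum_mset mu + r \<and>
    (\<forall>j. col mu j \<le> col la j \<and> col la j \<le> Suc (col mu j))}"

lemma finite_hstrips [simp]: "finite (hstrips mu r)"
  by (rule finite_subset[OF _ finite_partitions_of[of "sum_mset mu + r"]]) (auto simp: hstrips_def)

context hl begin

text \<open>Macdonald's \<phi>_{la/mu}(t): a factor for each column that contains a box of the strip
  while the next column does not. The exponent is the multiplicity in la of the part ending
  there.\<close>

definition ph :: "partition \<Rightarrow> partition \<Rightarrow> real"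
  where "ph la mu = (\<Prod>j<sum_mset la. if col la j = Suc (col mu j) \<and> col la (Suc j) = col mu (Suc j)
    then 1 - t ^ count la (Suc j) else 1)"

lemma ph_eq:
  assumes "sum_mset la \<le> N"
  shows "ph la mu = (\<Prod>j<N. if col la j = Suc (col mu j) \<and> col la (Suc j) = col mu (Suc j)
    then 1 - t ^ count la (Suc j) else 1)"
  unfolding ph_def by (rule prod.mono_neutral_left) (use assms in \<open>auto simp: col_eq_0\<close>)

lemma ph_nonneg: "0 \<le> ph la mu"
  unfolding ph_def using t0 t1 by (intro prod_nonneg) (auto simp: power_le_one)

text \<open>The coefficient form of E(-y) Q(y) = E(-ty): the factors 1 - x_i y of E(-y) cancel the
  denominators of Q(y). The proof factors the coefficient of a monomial over its variables.\<close>

lemma es_qs: "(\<Sum>k\<le>r. sc ((-1) ^ k) * (es k * qs (r - k))) = sc ((- t) ^ r) * es r"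
proof (rule mps_eqI)
  fix M :: monomial
  let ?S = "set_mset M"
  have inner: "cf (es k * qs (r - k)) M = (\<Sum>A | A \<subseteq># M. if size A = k \<and> (\<forall>i. count A i \<le> 1) \<and> size (M - A) = r - k then (1 - t) ^ card (set_mset (M - A)) else 0)" for k
    unfolding cf_mult by (intro sum.cong) (auto simp: cf_es cf_qs)
  have sz: "size (M - A) = size M - size A" "size A \<le> size M" if "A \<subseteq># M" for A
    using that by (auto simp: size_Diff_submset size_mset_mono)
  show "cf (\<Sum>k\<le>r. sc ((-1) ^ k) * (es k * qs (r - k))) M = cf (sc ((- t) ^ r) * es r) M"
  proof (cases "size M = r")
    case False
    have "cf (es k * qs (r - k)) M = 0" if "k \<le> r" for k
      unfolding inner
    proof (rule sum.neutral, intro ballI if_not_P notI)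
      fix A assume "A \<in> {A. A \<subseteq># M}" "size A = k \<and> (\<forall>i. count A i \<le> 1) \<and> size (M - A) = r - k"
      then show False using sz[of A] that False by auto
    qed
    then show ?thesis using False by (simp add: cf_es)
  next
    case True
    have "cf (\<Sum>k\<le>r. sc ((-1) ^ k) * (es k * qs (r - k))) M =
      (\<Sum>k\<le>r. \<Sum>A | A \<subseteq># M. if size A = k then (if \<forall>i. count A i \<le> 1 then (-1) ^ size A * (1 - t) ^ card (set_mset (M - A)) else 0) else 0)"
      unfolding cf_sum cf_sc_mult inner sum_distrib_left
      by (intro sum.cong refl) (use True sz in auto)
    also have "\<dots> = (\<Sum>A | A \<subseteq># M. \<Sum>k\<le>r. if size A = k then (if \<forall>i. count A i \<le> 1 then (-1) ^ size A * (1 - t) ^ card (set_mset (M - A)) else 0) else 0)"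
      by (rule sum.swap)
    also have "\<dots> = (\<Sum>A | A \<subseteq># M. if \<forall>i. count A i \<le> 1 then (-1) ^ size A * (1 - t) ^ card (set_mset (M - A)) else 0)"
      using True sz by (intro sum.cong) (auto simp: sum.delta)
    also have "\<dots> = (\<Sum>A\<in>mset_set ` Pow ?S. (-1) ^ size A * (1 - t) ^ card (set_mset (M - A)))"
    proof (rule sum.mono_neutral_cong_right)
      show "mset_set ` Pow ?S \<subseteq> {A. A \<subseteq># M}"
      proof clarify
        fix S assume "S \<subseteq> ?S"
        then show "mset_set S \<subseteq># M" by (auto simp: subseteq_mset_def count_mset_set' Suc_leI)
      qed
      show "\<forall>A\<in>{A. A \<subseteq># M} - mset_set ` Pow ?S. (if \<forall>i. count A i \<le> 1 then (-1) ^ size A * (1 - t) ^ card (set_mset (M - A)) else 0) = 0"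
      proof
        fix A assume A: "A \<in> {A. A \<subseteq># M} - mset_set ` Pow ?S"
        then have "set_mset A \<in> Pow ?S" by (auto dest: mset_subset_eqD)
        then have "A \<noteq> mset_set (set_mset A)" using A by blast
        then have "\<not> (\<forall>i. count A i \<le> 1)" unfolding squarefree_iff .
        then show "(if \<forall>i. count A i \<le> 1 then (-1) ^ size A * (1 - t) ^ card (set_mset (M - A)) else 0) = 0" by (rule if_not_P)
      qed
      fix A assume "A \<in> mset_set ` Pow ?S"
      then have "\<forall>i. count A i \<le> 1" by (auto simp: count_mset_set')
      then show "(if \<forall>i. count A i \<le> 1 then (-1) ^ size A * (1 - t) ^ card (set_mset (M - A)) else 0) = (-1) ^ size A * (1 - t) ^ card (set_mset (M - A))"
        by (rule if_P)
    qed simp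
    also have "\<dots> = (\<Sum>S\<in>Pow ?S. (-1) ^ size (mset_set S) * (1 - t) ^ card (set_mset (M - mset_set S)))"
    proof (subst sum.reindex)
      show "inj_on mset_set (Pow ?S)"
        by (rule inj_onI) (metis PowD finite_set_mset finite_set_mset_mset_set finite_subset)
    qed simp
    \<comment> \<open>A variable outside S contributes 1 - t from the q-part. A variable in S
      contributes -1 if its exponent is 1, since it then disappears from the q-part, and -(1 - t)
      otherwise.\<close>
    also have "\<dots> = (\<Sum>S\<in>Pow ?S. (\<Prod>i\<in>S. if count M i = 1 then -1 else - (1 - t)) * (\<Prod>i\<in>?S - S. 1 - t))"
    proof (rule sum.cong)
      fix S assume S: "S \<in> Pow ?S"
      have fin: "finite S" using S finite_subset by blast
      have set: "set_mset (M - mset_set S) = (?S - S) \<union> {i\<in>S. count M i \<noteq> 1}"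
      proof -
        have "i \<in># M - mset_set S \<longleftrightarrow> i \<in> (?S - S) \<union> {i\<in>S. count M i \<noteq> 1}" for i
        proof (cases "i \<in> S")
          case True
          then have "i \<in># M" using S by auto
          then obtain m where "count M i = Suc m" by (cases "count M i") (auto simp: not_in_iff[symmetric])
          then show ?thesis using True fin by (auto simp: in_diff_count count_mset_set')
        qed (use fin in \<open>auto simp: in_diff_count count_mset_set'\<close>)
        then show ?thesis by blast
      qed
      have "card (set_mset (M - mset_set S)) = card (?S - S) + card {i\<in>S. count M i \<noteq> 1}"
        unfolding set by (rule card_Un_disjoint) (use fin in auto)
      moreover have "(\<Prod>i\<in>S. if count M i = 1 then -1 else - (1 - t)) = (-1) ^ card S * (1 - t) ^ card {i\<in>S. count M i \<noteq> 1}"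
      proof -
        have "(\<Prod>i\<in>S. if count M i = 1 then -1 else - (1 - t)) = (\<Prod>i\<in>S. (-1) * (if count M i \<noteq> 1 then 1 - t else 1))"
          by (intro prod.cong) auto
        also have "\<dots> = (-1) ^ card S * (\<Prod>i\<in>S. if count M i \<noteq> 1 then 1 - t else 1)"
          unfolding prod.distrib by simp
        also have "(\<Prod>i\<in>S. if count M i \<noteq> 1 then 1 - t else 1) = (\<Prod>i\<in>{i\<in>S. count M i \<noteq> 1}. 1 - t)"
          by (rule prod.inter_filter[symmetric, OF fin])
        finally show ?thesis by simp
      qed
      ultimately show "(-1) ^ size (mset_set S) * (1 - t) ^ card (set_mset (M - mset_set S)) =
         (\<Prod>i\<in>S. if count M i = 1 then -1 else - (1 - t)) * (\<Prod>i\<in>?S - S. 1 - t)"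
        by (simp add: power_add)
    qed simp
    also have "\<dots> = (\<Prod>i\<in>?S. (if count M i = 1 then -1 else - (1 - t)) + (1 - t))"
      by (rule prod_add[symmetric]) simp
    also have "\<dots> = (\<Prod>i\<in>?S. if count M i = 1 then - t else 0)" by (intro prod.cong) auto
    also have "\<dots> = (- t) ^ r * (if \<forall>i. count M i \<le> 1 then 1 else 0)"
    proof (cases "\<forall>i. count M i \<le> 1")
      case sq: True
      then have "count M i = 1" if "i \<in># M" for i
        using that sq[rule_format, of i] count_greater_zero_iff[of M i] by linarith
      moreover have "card ?S = r" using sq True unfolding squarefree_iff by (metis size_mset_set)
      ultimately show ?thesis unfolding if_P[OF sq] by simp
    next
      case False
      then obtain i where i: "\<not> count M i \<le> 1" by blast
      then have "i \<in># M" by (metis not_in_iff zero_le)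
      then have "(\<Prod>i\<in>?S. if count M i = 1 then - t else 0) = 0" using i by (intro prod_zero bexI[of _ i]) auto
      then show ?thesis unfolding if_not_P[OF False] by simp
    qed
    finally show ?thesis using True by (simp add: cf_es)
  qed
qed

text \<open>If the interlacing fails, a Gaussian binomial with lower index above the upper one
  occurs. Hence the interlacing condition may be dropped from sums weighted by
  \<open>dd\<close>.\<close>

lemma dd_not_vstrip:
  assumes "\<And>j. col ka j \<le> col la j" "col ka j < col la (Suc j)"
  shows "dd la ka = 0"
  unfolding dd_def
proof (rule prod_zero)
  have "j < sum_mset la" using assms(2) col_eq_0[of la "Suc j"] by (metis not_less_eq not_less_zero le_Suc_eq not_le_imp_less)
  moreover have "qbin (count la (Suc j)) (col la j - col ka j) = 0"
    using assms col_Suc[of la j] assms(1)[of j] by (simp add: qbin_def)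
  ultimately show "\<exists>j\<in>{..<sum_mset la}. qbin (count la (Suc j)) (col la j - col ka j) = 0" by blast
qed simp

lemma dd_refl [simp]: "dd la la = 1"
  unfolding dd_def by simp

text \<open>The shapes inside la that arise from mu by adding a horizontal strip; the vertical strip
  condition towards la is left to the vanishing of \<open>dd\<close>.\<close>

definition between :: "partition \<Rightarrow> partition \<Rightarrow> partition set"
  where "between mu la = {ka \<in> partitions. \<forall>j. col mu j \<le> col ka j \<and> col ka j \<le> Suc (col mu j) \<and> col ka j \<le> col la j}"

lemma sum_mset_mono_col:
  assumes "\<And>j. col ka j \<le> col la j" shows "sum_mset ka \<le> sum_mset la"
proof -
  define N where "N = max (sum_mset ka) (sum_mset la)"
  have "sum_mset ka = (\<Sum>j<N. col ka j)" by (rule sum_col[symmetric]) (simp add: N_def)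
  also have "\<dots> \<le> (\<Sum>j<N. col la j)" by (intro sum_mono assms)
  also have "\<dots> = sum_mset la" by (rule sum_col) (simp add: N_def)
  finally show ?thesis .
qed

lemma finite_between [simp]: "finite (between mu la)"
  by (rule finite_subset[OF _ finite_partitions_le[of "sum_mset la"]]) (auto simp: between_def intro: sum_mset_mono_col)

text \<open>The coefficient identity behind \<open>P\<^sub>\<mu> q\<^sub>r\<close>: intermediate shapes are encoded by the set of columns
  to which a box is added.\<close>

lemma strip_identity:
  assumes mu: "mu \<in> partitions" and la: "la \<in> partitions" and sub: "\<And>j. col mu j \<le> col la j"
  shows "(\<Sum>ka\<in>between mu la. (-1) ^ (sum_mset la - sum_mset ka) * ph ka mu * dd la ka) = (- t) ^ (sum_mset la - sum_mset mu) * dd la mu"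
proof -
  define N where "N = sum_mset la"
  \<comment> \<open>\<open>th j\<close> counts the boxes of la/mu in column j. The binomial of that
    column is \<open>q j\<close> if the intermediate shape has no new box there and
    \<open>q' j\<close> if it has one.\<close>
  define th where "th j = col la j - col mu j" for j
  define m where "m j = count la (Suc j)" for j
  define q where "q j = qbin (m j) (th j)" for j
  define q' where "q' j = (if th j = 0 then 0 else qbin (m j) (th j - 1))" for j
  \<comment> \<open>The factor of column j: sign, binomial and strip factor, where h and h' record
    whether the intermediate shape has a new box in columns j and \<open>Suc j\<close>. The exponent
    of t is the multiplicity of \<open>Suc j\<close> in that shape when only column j gains a
    box.\<close>
  define X where "X j h h' = (if h then - ((-1) ^ th j * q' j) * (if h' then 1 else 1 - t ^ (m j + 1 + th (Suc j) - th j)) else (-1) ^ th j * q j)" for j h h'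
  define Hs where "Hs ka = {j. col ka j = Suc (col mu j)}" for ka
  define p where "p H = (\<Prod>i<N. X i (i \<in> H) (Suc i \<in> H))" for H
  have laN: "col la j = 0" if "N \<le> j" for j using that by (simp add: N_def col_eq_0)
  then have thN: "th j = 0" if "N \<le> j" for j using that by (simp add: th_def)
  have muN: "col mu j = 0" if "N \<le> j" for j using that laN[of j] sub[of j] by simp
  have pterm: "(-1) ^ (sum_mset la - sum_mset ka) * ph ka mu * dd la ka = p (Hs ka)" if ka: "ka \<in> between mu la" for ka
  proof -
    have c: "col mu j \<le> col ka j" "col ka j \<le> Suc (col mu j)" "col ka j \<le> col la j" for j using ka by (auto simp: between_def)
    have sle: "sum_mset ka \<le> N" unfolding N_def by (rule sum_mset_mono_col) (rule c)
    have s: "sum_mset la - sum_mset ka = (\<Sum>j<N. col la j - col ka j)"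
      using sum_col[of la N] sum_col[of ka N] sle unfolding sum_subtractf_nat[OF c(3)] by (simp add: N_def)
    have "(-1) ^ (sum_mset la - sum_mset ka) * ph ka mu * dd la ka = (\<Prod>j<N. (-1) ^ (col la j - col ka j) *
       (if col ka j = Suc (col mu j) \<and> col ka (Suc j) = col mu (Suc j) then 1 - t ^ count ka (Suc j) else 1) *
       qbin (count la (Suc j)) (col la j - col ka j))"
      unfolding s power_sum ph_eq[OF sle] dd_eq[of la N, unfolded N_def, OF order_refl, folded N_def] prod.distrib ..
    also have "\<dots> = p (Hs ka)" unfolding p_def
    proof (rule prod.cong)
      fix j
      show "(-1) ^ (col la j - col ka j) *
       (if col ka j = Suc (col mu j) \<and> col ka (Suc j) = col mu (Suc j) then 1 - t ^ count ka (Suc j) else 1) *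
       qbin (count la (Suc j)) (col la j - col ka j) = X j (j \<in> Hs ka) (Suc j \<in> Hs ka)"
      proof (cases "col ka j = Suc (col mu j)")
        case False
        then have "col ka j = col mu j" using c(1,2)[of j] by linarith
        then show ?thesis by (simp add: X_def Hs_def q_def th_def m_def)
      next
        case True
        then have e: "col la j - col ka j = th j - 1" "th j \<noteq> 0" using c(3)[of j] by (auto simp: th_def)
        then have sg: "(-1::real) ^ (th j - 1) = - ((-1) ^ th j)" by (cases "th j") auto
        have S: "Suc j \<in> Hs ka \<longleftrightarrow> \<not> (col ka (Suc j) = col mu (Suc j))"
          using c(1,2)[of "Suc j"] by (auto simp: Hs_def)
        have cnt: "count ka (Suc j) = m j + 1 + th (Suc j) - th j" if "col ka (Suc j) = col mu (Suc j)"
          using that True col_Suc[of ka j] col_Suc[of la j] sub[of j] sub[of "Suc j"] unfolding m_def th_def by linarith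
        show ?thesis using True e S cnt sg by (simp add: X_def Hs_def q'_def m_def)
      qed
    qed simp
    finally show ?thesis .
  qed
  have inj: "inj_on Hs (between mu la)"
  proof (rule inj_onI)
    fix a b assume ab: "a \<in> between mu la" "b \<in> between mu la" "Hs a = Hs b"
    have P: "a \<in> partitions" "b \<in> partitions" using ab by (simp_all add: between_def)
    have "col a j = col b j" for j
    proof -
      have "col mu j \<le> col a j" "col a j \<le> Suc (col mu j)" "col mu j \<le> col b j" "col b j \<le> Suc (col mu j)"
        using ab by (simp_all add: between_def)
      moreover have "col a j = Suc (col mu j) \<longleftrightarrow> col b j = Suc (col mu j)" using ab(3) by (auto simp: Hs_def)
      ultimately show ?thesis by linarith
    qed
    then show "a = b" by (rule partition_eqI[OF P])
  qed
  have img: "Hs ` between mu la \<subseteq> Pow {..<N}"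
  proof -
    have "j < N" if "ka \<in> between mu la" "j \<in> Hs ka" for ka j
    proof (rule ccontr)
      assume "\<not> j < N"
      then have "col la j = 0" using laN by simp
      moreover have "col ka j \<le> col la j" using that by (simp add: between_def)
      ultimately show False using that by (simp add: Hs_def)
    qed
    then show ?thesis by blast
  qed
  \<comment> \<open>A set H not coming from a shape contributes 0: either a column of H has no room
    in la, so \<open>q'\<close> vanishes, or the new columns would fail to decrease, and then
    \<open>q\<close> vanishes.\<close>
  have zero: "p H = 0" if H: "H \<in> Pow {..<N} - Hs ` between mu la" for H
  proof (rule ccontr)
    assume nz: "p H \<noteq> 0"
    have nzX: "X j (j \<in> H) (Suc j \<in> H) \<noteq> 0" if "j < N" for j
      using nz that unfolding p_def by (metis finite_lessThan lessThan_iff prod_zero)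
    define c where "c j = col mu j + (if j \<in> H then 1 else 0)" for j
    have HN: "j < N" if "j \<in> H" for j using H that by auto
    have pos: "th j > 0" if "j \<in> H" for j
      using nzX[OF HN[OF that]] that by (auto simp: X_def q'_def split: if_splits)
    have cle: "c j \<le> col la j" for j using pos[of j] sub[of j] by (auto simp: c_def th_def)
    have mono: "c (Suc j) \<le> c j" for j
    proof (rule ccontr)
      assume "\<not> c (Suc j) \<le> c j"
      then have *: "Suc j \<in> H" "j \<notin> H" "col mu (Suc j) = col mu j"
        using col_antimono[of j "Suc j" mu] by (auto simp: c_def split: if_splits)
      have "m j < th j"
        using col_Suc[of la j] pos[OF *(1)] *(3) sub[of j] by (simp add: m_def th_def)
      then have "q j = 0" by (simp add: q_def qbin_def)
      then show False using nzX[of j] HN[OF *(1)] *(2) by (simp add: X_def)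
    qed
    have c0: "c N = 0" using muN[of N] HN[of N] by (auto simp: c_def)
    obtain ka where ka: "ka \<in> partitions" "\<And>j. col ka j = c j" using col_exists[of c N, OF mono c0] by blast
    have "ka \<in> between mu la" unfolding between_def using ka cle by (auto simp: c_def)
    moreover have "Hs ka = H" using ka by (auto simp: Hs_def c_def)
    ultimately show False using H by blast
  qed
  have "(\<Sum>ka\<in>between mu la. (-1) ^ (sum_mset la - sum_mset ka) * ph ka mu * dd la ka) = (\<Sum>ka\<in>between mu la. p (Hs ka))"
    by (rule sum.cong) (simp_all add: pterm)
  also have "\<dots> = (\<Sum>H\<in>Hs ` between mu la. p H)" by (simp add: sum.reindex[OF inj])
  also have "\<dots> = (\<Sum>H\<in>Pow {..<N}. p H)"
    by (rule sum.mono_neutral_left) (use img zero in auto)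
  also have "\<dots> = transfer_sum N X 0 False + transfer_sum N X 0 True"
    unfolding p_def transfer_sum_total ..
  also have "\<dots> = t ^ (\<Sum>i=0..<N. th i) * (\<Prod>i=0..<N. (-1) ^ th i * q i)"
  proof -
    \<comment> \<open>This is 1 - t^(s+e) = (1 - t^s) + t^s (1 - t^e) with e = m j + 1 - th j. In
      the range where the subtraction truncates, \<open>q' j\<close> is 0.\<close>
    have qq: "q' j * (1 - t ^ (m j + 1 + s - th j)) = q' j - (if th j = 0 then 0 else q' j * t ^ s) + (if th j = 0 then 0 else t ^ s * (q' j * (1 - t ^ (m j + 1 - th j))))" for j s
    proof (cases "th j = 0 \<or> m j + 1 < th j")
      case True
      then show ?thesis by (auto simp: q'_def qbin_def)
    next
      case False
      then have "m j + 1 + s - th j = s + (m j + 1 - th j)" by linarith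
      then have "t ^ (m j + 1 + s - th j) = t ^ s * t ^ (m j + 1 - th j)" by (simp only: power_add)
      then show ?thesis using False by (simp add: algebra_simps)
    qed
    \<comment> \<open>The ratio of neighbouring Gaussian binomials.\<close>
    have q'q: "q' j * (1 - t ^ (m j + 1 - th j)) = q j * (1 - t ^ th j)" for j
    proof (cases "th j")
      case (Suc i)
      consider "i < m j" | "i = m j" | "m j < i" by linarith
      then show ?thesis
      proof cases
        case 1
        define d where "d = m j - Suc i"
        have e: "m j = Suc i + d" "m j - i = Suc d" "m j + 1 - Suc i = Suc d" using 1 by (auto simp: d_def)
        show ?thesis using 1 one_minus_pow[of "Suc i"] one_minus_pow[of "Suc d"] e
          by (simp add: q'_def q_def Suc qbin_def qp_Suc divide_simps del: power_Suc)
      qed (auto simp: q'_def q_def Suc qbin_def)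
    qed (simp add: q'_def)
    \<comment> \<open>The total and the \<open>False\<close> component have closed forms differing
      by a power of t, and one transfer step reproduces both. Carrying the pair through the downward
      induction makes it go through.\<close>
    have "transfer_sum N X j False + transfer_sum N X j True = t ^ (\<Sum>i=j..<N. th i) * (\<Prod>i=j..<N. (-1) ^ th i * q i) \<and>
        transfer_sum N X j False = t ^ (\<Sum>i=Suc j..<N. th i) * (\<Prod>i=j..<N. (-1) ^ th i * q i)" if "j \<le> N" for j
      using that
    proof (induction j rule: inc_induct)
      case base
      then show ?case by (simp add: transfer_sum_end)
    next
      case (step j)
      define T where "T = (\<Sum>i=Suc (Suc j)..<N. th i)"
      define W where "W = (\<Prod>i=Suc j..<N. (-1) ^ th i * q i)"
      have T1: "(\<Sum>i=Suc j..<N. th i) = th (Suc j) + T"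
        using thN[of "Suc j"] by (cases "Suc j < N") (auto simp: T_def sum.atLeast_Suc_lessThan)
      have T0: "(\<Sum>i=j..<N. th i) = th j + (th (Suc j) + T)"
        using step.hyps T1 by (simp add: sum.atLeast_Suc_lessThan)
      have W0: "(\<Prod>i=j..<N. (-1) ^ th i * q i) = (-1) ^ th j * q j * W"
        using step.hyps by (simp add: W_def prod.atLeast_Suc_lessThan)
      have IH: "transfer_sum N X (Suc j) False + transfer_sum N X (Suc j) True = t ^ (th (Suc j) + T) * W"
        "transfer_sum N X (Suc j) False = t ^ T * W"
        using step.IH unfolding T1 by (auto simp: W_def T_def)
      define F where "F = transfer_sum N X (Suc j) False"
      define G where "G = transfer_sum N X (Suc j) True"
      define s where "s = (-1::real) ^ th j"
      have G: "G = t ^ (th (Suc j) + T) * W - t ^ T * W" and F: "F = t ^ T * W" using IH by (auto simp: F_def G_def)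
      have E0: "transfer_sum N X j False = s * q j * (F + G)"
        unfolding transfer_sum_step[OF step.hyps(2)] F_def G_def by (simp add: X_def s_def algebra_simps)
      have E1: "transfer_sum N X j True = - s * (q' j * (1 - t ^ (m j + 1 + th (Suc j) - th j)) * F + q' j * G)"
        unfolding transfer_sum_step[OF step.hyps(2)] F_def G_def by (simp add: X_def s_def algebra_simps)
      have "q' j * (1 - t ^ (m j + 1 + th (Suc j) - th j)) * F + q' j * G = t ^ (th (Suc j) + T) * (q j * (1 - t ^ th j)) * W"
      proof (cases "th j = 0")
        case True
        then show ?thesis by (simp add: q'_def)
      next
        case False
        then show ?thesis unfolding qq q'q F G by (simp add: power_add algebra_simps)
      qed
      then have E1': "transfer_sum N X j True = - s * (t ^ (th (Suc j) + T) * (q j * (1 - t ^ th j)) * W)"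
        unfolding E1 by simp
      have E0': "transfer_sum N X j False = s * q j * (t ^ (th (Suc j) + T) * W)"
        unfolding E0 F G by simp
      show ?case unfolding E0' E1' T0 W0 T1 s_def[symmetric] by (simp add: power_add algebra_simps)
    qed
    from this[of 0] show ?thesis by simp
  qed
  also have "\<dots> = (- t) ^ (sum_mset la - sum_mset mu) * dd la mu"
  proof -
    have sm: "sum_mset mu \<le> N" unfolding N_def by (rule sum_mset_mono_col) (rule sub)
    have s: "sum_mset la - sum_mset mu = (\<Sum>j<N. th j)"
      using sum_col[of la N] sum_col[of mu N] sm unfolding th_def sum_subtractf_nat[OF sub] by (simp add: N_def)
    have "(- t) ^ (\<Sum>j<N. th j) = t ^ (\<Sum>j<N. th j) * (\<Prod>j<N. (-1) ^ th j)"
      unfolding power_sum[symmetric] by (simp flip: power_mult_distrib)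
    moreover have "dd la mu = (\<Prod>j<N. q j)"
      unfolding q_def m_def th_def by (rule dd_eq) (simp add: N_def)
    ultimately show ?thesis unfolding s prod.distrib atLeast0LessThan by (simp add: mult.assoc)
  qed
  finally show ?thesis .
qed

text \<open>The coefficient of P_la in \<Sum> (-1)^k e_k (q_{r-k} P_mu), with q_{r-k} P_mu expanded
  by \<open>ph\<close>. The size of a vertical strip fixes k, so the double sum is a single sum over
  intermediate shapes, to which \<open>strip_identity\<close> applies.\<close>

lemma strip_sum:
  assumes mu: "mu \<in> partitions" and la: "la \<in> partitions" "sum_mset la = sum_mset mu + r"
  shows "(\<Sum>k\<le>r. \<Sum>ka\<in>hstrips mu (r - k). if la \<in> vstrips ka k then (-1) ^ k * ph ka mu * dd la ka else 0)
    = (if la \<in> vstrips mu r then (- t) ^ r * dd la mu else 0)"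
proof (cases "\<forall>j. col mu j \<le> col la j")
  case False
  then obtain j where j: "col la j < col mu j" by (auto simp: not_le)
  have "la \<notin> vstrips ka k" if "ka \<in> hstrips mu (r - k)" for ka k
  proof
    assume "la \<in> vstrips ka k"
    then have "col ka j \<le> col la j" by (simp add: vstrips_def)
    moreover have "col mu j \<le> col ka j" using that by (simp add: hstrips_def)
    ultimately show False using j by simp
  qed
  moreover have "la \<notin> vstrips mu r" using False by (auto simp: vstrips_def)
  ultimately show ?thesis by simp
next
  case True
  define H where "H = {ka \<in> between mu la. \<forall>j. col la (Suc j) \<le> col ka j}"
  have finH: "finite H" by (simp add: H_def)
  define g where "g ka = sum_mset la - sum_mset ka" for ka
  have Hs: "{ka \<in> H. g ka = k} = {ka \<in> hstrips mu (r - k). la \<in> vstrips ka k}" if "k \<le> r" for k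
  proof -
    have "ka \<in> H \<and> g ka = k \<longleftrightarrow> ka \<in> hstrips mu (r - k) \<and> la \<in> vstrips ka k" for ka
    proof
      assume *: "ka \<in> H \<and> g ka = k"
      then have "\<And>j. col ka j \<le> col la j" by (simp add: H_def between_def)
      then have "sum_mset ka \<le> sum_mset la" by (rule sum_mset_mono_col)
      then show "ka \<in> hstrips mu (r - k) \<and> la \<in> vstrips ka k"
        using * that la by (auto simp: H_def between_def hstrips_def vstrips_def g_def)
    next
      assume "ka \<in> hstrips mu (r - k) \<and> la \<in> vstrips ka k"
      then show "ka \<in> H \<and> g ka = k" using that
        by (auto simp: H_def between_def hstrips_def vstrips_def g_def)
    qed
    then show ?thesis by blast
  qed
  have "(\<Sum>k\<le>r. \<Sum>ka\<in>hstrips mu (r - k). if la \<in> vstrips ka k then (-1) ^ k * ph ka mu * dd la ka else 0)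
     = (\<Sum>k\<le>r. \<Sum>ka\<in>{ka \<in> H. g ka = k}. (-1) ^ g ka * ph ka mu * dd la ka)"
  proof (rule sum.cong[OF refl])
    fix k assume k: "k \<in> {..r}"
    have "(\<Sum>ka\<in>hstrips mu (r - k). if la \<in> vstrips ka k then (-1) ^ k * ph ka mu * dd la ka else 0) =
       (\<Sum>ka\<in>{ka \<in> hstrips mu (r - k). la \<in> vstrips ka k}. (-1) ^ k * ph ka mu * dd la ka)"
      by (rule sum.inter_filter[symmetric]) simp
    also have "\<dots> = (\<Sum>ka\<in>{ka \<in> H. g ka = k}. (-1) ^ g ka * ph ka mu * dd la ka)"
      using Hs[of k] k by (intro sum.cong) auto
    finally show "(\<Sum>ka\<in>hstrips mu (r - k). if la \<in> vstrips ka k then (-1) ^ k * ph ka mu * dd la ka else 0) =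
      (\<Sum>ka\<in>{ka \<in> H. g ka = k}. (-1) ^ g ka * ph ka mu * dd la ka)" .
  qed
  also have "\<dots> = (\<Sum>ka\<in>H. (-1) ^ g ka * ph ka mu * dd la ka)"
  proof -
    have "g ka \<le> r" if "ka \<in> H" for ka
    proof -
      have "\<And>j. col mu j \<le> col ka j" using that by (simp add: H_def between_def)
      then have "sum_mset mu \<le> sum_mset ka" by (rule sum_mset_mono_col)
      then show ?thesis using la by (simp add: g_def)
    qed
    then have "g ` H \<subseteq> {..r}" by auto
    then show ?thesis by (rule sum.group[OF finH finite_atMost])
  qed
  also have "\<dots> = (\<Sum>ka\<in>between mu la. (-1) ^ (sum_mset la - sum_mset ka) * ph ka mu * dd la ka)"
  proof -
    have z: "(-1) ^ (sum_mset la - sum_mset ka) * ph ka mu * dd la ka = 0" if ka: "ka \<in> between mu la - H" for ka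
    proof -
      obtain j where "col ka j < col la (Suc j)" using ka by (auto simp: H_def not_le)
      moreover have "\<And>j. col ka j \<le> col la j" using ka by (simp add: between_def)
      ultimately show ?thesis by (simp add: dd_not_vstrip)
    qed
    have "H \<subseteq> between mu la" by (auto simp: H_def)
    then show ?thesis unfolding g_def by (intro sum.mono_neutral_left ballI z) simp_all
  qed
  also have "\<dots> = (- t) ^ (sum_mset la - sum_mset mu) * dd la mu"
    using strip_identity[OF mu la(1)] True by blast
  also have "\<dots> = (if la \<in> vstrips mu r then (- t) ^ r * dd la mu else 0)"
  proof (cases "la \<in> vstrips mu r")
    case False
    then obtain j where "col mu j < col la (Suc j)" using True la by (auto simp: vstrips_def not_le)
    then have "dd la mu = 0" using dd_not_vstrip True by blast
    then show ?thesis by simp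
  qed (simp add: la)
  finally show ?thesis .
qed

text \<open>The relation \<open>es_qs\<close> expresses q_r through e_r and the e_k q_{r-k} with k >
  0. By induction on r all of these act on P_mu in a known way, and \<open>strip_sum\<close> says
  that the expected answer satisfies the same relation.\<close>

lemma q_pieri:
  assumes mu: "mu \<in> partitions"
  shows "qs r * PP mu = (\<Sum>la\<in>hstrips mu r. sc (ph la mu) * PP la)"
proof (induction r rule: less_induct)
  case (less r)
  define A where "A = {la \<in> partitions. sum_mset la = sum_mset mu + r}"
  have finA: "finite A" unfolding A_def by (rule finite_partitions_of)
  define D where "D k la = (\<Sum>ka\<in>hstrips mu (r - k). if la \<in> vstrips ka k then (-1) ^ k * ph ka mu * dd la ka else 0)" for k la
  have toA: "(\<Sum>la\<in>S. sc (c la) * PP la) = (\<Sum>la\<in>A. sc (if la \<in> S then c la else 0) * PP la)" if "S \<subseteq> A" for S c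
    by (rule sum.mono_neutral_cong_left[OF finA that]) auto
  have vA: "vstrips ka k \<subseteq> A" if "ka \<in> hstrips mu (r - k)" "k \<le> r" for ka k
    using that by (auto simp: vstrips_def hstrips_def A_def)
  have step: "sc ((-1) ^ k) * (es k * (\<Sum>ka\<in>hstrips mu (r - k). sc (ph ka mu) * PP ka)) = (\<Sum>la\<in>A. sc (D k la) * PP la)"
    if k: "k \<le> r" for k
  proof -
    have "sc ((-1) ^ k) * (es k * (\<Sum>ka\<in>hstrips mu (r - k). sc (ph ka mu) * PP ka)) =
      (\<Sum>ka\<in>hstrips mu (r - k). sc ((-1) ^ k * ph ka mu) * (es k * PP ka))"
      by (simp add: sum_distrib_left sc_mult ac_simps)
    also have "\<dots> = (\<Sum>ka\<in>hstrips mu (r - k). \<Sum>la\<in>A. sc (if la \<in> vstrips ka k then (-1) ^ k * ph ka mu * dd la ka else 0) * PP la)"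
    proof (rule sum.cong)
      fix ka assume ka: "ka \<in> hstrips mu (r - k)"
      then have "ka \<in> partitions" by (simp add: hstrips_def)
      then have "sc ((-1) ^ k * ph ka mu) * (es k * PP ka) = (\<Sum>la\<in>vstrips ka k. sc ((-1) ^ k * ph ka mu * dd la ka) * PP la)"
        by (simp add: e_pieri sum_distrib_left sc_mult ac_simps)
      then show "sc ((-1) ^ k * ph ka mu) * (es k * PP ka) = (\<Sum>la\<in>A. sc (if la \<in> vstrips ka k then (-1) ^ k * ph ka mu * dd la ka else 0) * PP la)"
        using toA[OF vA[OF ka k]] by simp
    qed simp
    also have "\<dots> = (\<Sum>la\<in>A. \<Sum>ka\<in>hstrips mu (r - k). sc (if la \<in> vstrips ka k then (-1) ^ k * ph ka mu * dd la ka else 0) * PP la)"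
      by (rule sum.swap)
    also have "\<dots> = (\<Sum>la\<in>A. sc (D k la) * PP la)"
      by (simp add: D_def sc_sum sum_distrib_right)
    finally show ?thesis .
  qed
  \<comment> \<open>The summand k = 0 isolates the wanted coefficient, because a vertical strip of
    size 0 is empty.\<close>
  have D0: "D 0 la = (if la \<in> hstrips mu r then ph la mu else 0)" if "la \<in> A" for la
  proof -
    have "la \<in> vstrips ka 0 \<longleftrightarrow> ka = la" if ka: "ka \<in> hstrips mu r" for ka
    proof
      assume *: "la \<in> vstrips ka 0"
      have c: "\<And>j. col ka j \<le> col la j" and s: "sum_mset la = sum_mset ka" using * by (auto simp: vstrips_def)
      have "col ka j = col la j" for j
      proof (rule ccontr)
        assume ne: "col ka j \<noteq> col la j"
        define N where "N = Suc (max j (sum_mset la))"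
        have lt: "col ka j < col la j" using ne c[of j] by simp
        have "(\<Sum>j<N. col ka j) < (\<Sum>j<N. col la j)"
          by (rule sum_strict_mono_ex1) (use lt in \<open>auto simp: c N_def intro!: bexI[of _ j]\<close>)
        then show False using sum_col[of ka N] sum_col[of la N] s by (simp add: N_def)
      qed
      then show "ka = la" using ka \<open>la \<in> A\<close> by (intro partition_eqI) (auto simp: A_def hstrips_def)
    next
      assume "ka = la"
      then show "la \<in> vstrips ka 0" using \<open>la \<in> A\<close> col_antimono[of _ "Suc _" la] by (auto simp: vstrips_def A_def)
    qed
    then have "D 0 la = (\<Sum>ka\<in>hstrips mu r. if ka = la then ph la mu else 0)"
      unfolding D_def by (intro sum.cong) auto
    then show ?thesis by (simp add: sum.delta)
  qed
  have "(\<Sum>k\<le>r. sc ((-1) ^ k) * (es k * qs (r - k))) * PP mu = sc ((- t) ^ r) * (es r * PP mu)"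
    unfolding es_qs by (simp add: mult.assoc)
  moreover have "(\<Sum>k\<le>r. sc ((-1) ^ k) * (es k * qs (r - k))) * PP mu =
     qs r * PP mu + (\<Sum>k=1..r. sc ((-1) ^ k) * (es k * (qs (r - k) * PP mu)))"
  proof -
    have "{..r} = insert 0 {1..r}" by auto
    moreover have "es 0 = 1" by (rule mps_eqI) (auto simp: cf_es cf_one)
    ultimately show ?thesis by (simp add: distrib_right sum_distrib_right mult.assoc)
  qed
  moreover have "(\<Sum>k=1..r. sc ((-1) ^ k) * (es k * (qs (r - k) * PP mu))) = (\<Sum>k=1..r. \<Sum>la\<in>A. sc (D k la) * PP la)"
    by (intro sum.cong refl) (use less step in auto)
  moreover have "sc ((- t) ^ r) * (es r * PP mu) = (\<Sum>la\<in>A. sc (if la \<in> vstrips mu r then (- t) ^ r * dd la mu else 0) * PP la)"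
  proof -
    have "sc ((- t) ^ r) * (es r * PP mu) = (\<Sum>la\<in>vstrips mu r. sc ((- t) ^ r * dd la mu) * PP la)"
      by (simp add: e_pieri[OF mu] sum_distrib_left sc_mult mult.assoc)
    also have "vstrips mu r \<subseteq> A" by (auto simp: vstrips_def A_def)
    then have "(\<Sum>la\<in>vstrips mu r. sc ((- t) ^ r * dd la mu) * PP la) = (\<Sum>la\<in>A. sc (if la \<in> vstrips mu r then (- t) ^ r * dd la mu else 0) * PP la)"
      by (rule toA)
    finally show ?thesis .
  qed
  ultimately have "qs r * PP mu = (\<Sum>la\<in>A. sc (if la \<in> vstrips mu r then (- t) ^ r * dd la mu else 0) * PP la)
     - (\<Sum>la\<in>A. \<Sum>k=1..r. sc (D k la) * PP la)"
    by (simp add: sum.swap[of _ A] algebra_simps)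
  also have "\<dots> = (\<Sum>la\<in>A. sc (D 0 la) * PP la)"
    unfolding sum_subtractf[symmetric]
  proof (rule sum.cong)
    fix la assume la: "la \<in> A"
    have "(\<Sum>k\<le>r. D k la) = (if la \<in> vstrips mu r then (- t) ^ r * dd la mu else 0)"
      unfolding D_def by (rule strip_sum[OF mu]) (use la in \<open>auto simp: A_def\<close>)
    moreover have "(\<Sum>k\<le>r. D k la) = D 0 la + (\<Sum>k=1..r. D k la)"
    proof -
      have "{..r} = insert 0 {1..r}" by auto
      then show ?thesis by simp
    qed
    ultimately have "(if la \<in> vstrips mu r then (- t) ^ r * dd la mu else 0) - (\<Sum>k=1..r. D k la) = D 0 la" by simp
    then have "sc ((if la \<in> vstrips mu r then (- t) ^ r * dd la mu else 0) - (\<Sum>k=1..r. D k la)) * PP la = sc (D 0 la) * PP la"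
      by (rule arg_cong)
    then show "sc (if la \<in> vstrips mu r then (- t) ^ r * dd la mu else 0) * PP la - (\<Sum>k=1..r. sc (D k la) * PP la) = sc (D 0 la) * PP la"
      unfolding sc_diff sc_sum left_diff_distrib sum_distrib_right .
  qed simp
  also have "\<dots> = (\<Sum>la\<in>A. sc (if la \<in> hstrips mu r then ph la mu else 0) * PP la)"
    by (intro sum.cong) (auto simp: D0)
  also have "\<dots> = (\<Sum>la\<in>hstrips mu r. sc (ph la mu) * PP la)"
    by (rule toA[symmetric]) (auto simp: hstrips_def A_def)
  finally show ?case .
qed

section \<open>Skew Hall--Littlewood functions\<close>

text \<open>The coefficient of P_la in q_al P_mu: a sum over chains of horizontal strips from mu to
  la, weighted by \<open>ph\<close>. The strip sizes are read from the end of al, so the head of the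
  list is added last.\<close>

primrec chi :: "partition \<Rightarrow> nat list \<Rightarrow> partition \<Rightarrow> real" where
  "chi mu [] la = (if la = mu then 1 else 0)"
| "chi mu (a # al) la = (\<Sum>ka | ka \<in> partitions \<and> sum_mset ka = sum_mset mu + sum_list al.
    if la \<in> hstrips ka a then ph la ka * chi mu al ka else 0)"

lemma chi_nonneg: "0 \<le> chi mu al la"
  by (induction al arbitrary: la) (auto intro!: sum_nonneg mult_nonneg_nonneg simp: ph_nonneg)

lemma chi_nonzero_Cons:
  assumes "chi mu (a # al) la \<noteq> 0"
  obtains ka where "ka \<in> partitions" "la \<in> hstrips ka a" "chi mu al ka \<noteq> 0" "sum_mset ka = sum_mset mu + sum_list al"
  using assms by (auto elim!: sum.not_neutral_contains_not_neutral split: if_splits)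

lemma chi_degree:
  assumes "mu \<in> partitions" "chi mu al la \<noteq> 0"
  shows "la \<in> partitions \<and> sum_mset la = sum_mset mu + sum_list al"
proof (cases al)
  case Nil
  then show ?thesis using assms by (auto split: if_splits)
next
  case (Cons a al')
  have "chi mu (a # al') la \<noteq> 0" using assms(2) unfolding Cons .
  then obtain ka where "la \<in> hstrips ka a" "sum_mset ka = sum_mset mu + sum_list al'" by (rule chi_nonzero_Cons)
  then show ?thesis using Cons by (simp add: hstrips_def)
qed

lemma qprod_PP:
  assumes mu: "mu \<in> partitions"
  shows "qprod al * PP mu = (\<Sum>la | la \<in> partitions \<and> sum_mset la = sum_mset mu + sum_list al. sc (chi mu al la) * PP la)"
proof (induction al)
  case Nil
  have "(\<Sum>la | la \<in> partitions \<and> sum_mset la = sum_mset mu + sum_list []. sc (chi mu [] la) * PP la) = (\<Sum>la\<in>{mu}. sc (chi mu [] la) * PP la)"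
    by (rule sum.mono_neutral_right) (use mu finite_partitions_of in auto)
  then show ?case by simp
next
  case (Cons a al)
  let ?A = "\<lambda>n. {la. la \<in> partitions \<and> sum_mset la = n}"
  let ?n = "sum_mset mu + sum_list al"
  have fin: "finite (?A n)" for n by (rule finite_partitions_of)
  have "qprod (a # al) * PP mu = (\<Sum>ka\<in>?A ?n. sc (chi mu al ka) * (qs a * PP ka))"
    using Cons by (simp add: mult.assoc sum_distrib_left mult.left_commute)
  also have "\<dots> = (\<Sum>ka\<in>?A ?n. \<Sum>la\<in>?A (sum_mset mu + sum_list (a # al)). sc (if la \<in> hstrips ka a then ph la ka * chi mu al ka else 0) * PP la)"
  proof (rule sum.cong)
    fix ka assume ka: "ka \<in> ?A ?n"
    have "sc (chi mu al ka) * (qs a * PP ka) = (\<Sum>la\<in>hstrips ka a. sc (ph la ka * chi mu al ka) * PP la)"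
    proof -
      have "qs a * PP ka = (\<Sum>la\<in>hstrips ka a. sc (ph la ka) * PP la)" using q_pieri[of ka a] ka by simp
      then show ?thesis by (simp only: sum_distrib_left sc_mult mult.assoc mult.left_commute)
    qed
    also have "\<dots> = (\<Sum>la\<in>?A (sum_mset mu + sum_list (a # al)). sc (if la \<in> hstrips ka a then ph la ka * chi mu al ka else 0) * PP la)"
      by (rule sum.mono_neutral_cong_left[OF fin]) (use ka in \<open>auto simp: hstrips_def\<close>)
    finally show "sc (chi mu al ka) * (qs a * PP ka) = (\<Sum>la\<in>?A (sum_mset mu + sum_list (a # al)). sc (if la \<in> hstrips ka a then ph la ka * chi mu al ka else 0) * PP la)" .
  qed simp
  also have "\<dots> = (\<Sum>la\<in>?A (sum_mset mu + sum_list (a # al)). \<Sum>ka\<in>?A ?n. sc (if la \<in> hstrips ka a then ph la ka * chi mu al ka else 0) * PP la)"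
    by (rule sum.swap)
  also have "\<dots> = (\<Sum>la\<in>?A (sum_mset mu + sum_list (a # al)). sc (chi mu (a # al) la) * PP la)"
    by (simp add: sc_sum sum_distrib_right)
  finally show ?case .
qed

lemma topsum_mono_col: "(\<And>j. col la j \<le> col mu j) \<Longrightarrow> topsum la k \<le> topsum mu k"
proof -
  assume c: "\<And>j. col la j \<le> col mu j"
  define N where "N = max (sum_mset la) (sum_mset mu)"
  have "topsum la k = (\<Sum>j<N. min k (col la j))" by (rule top_eq) (simp add: N_def)
  also have "\<dots> \<le> (\<Sum>j<N. min k (col mu j))" by (rule sum_mono) (use c in \<open>simp add: min.coboundedI2\<close>)
  also have "\<dots> = topsum mu k" by (rule top_eq[symmetric]) (simp add: N_def)
  finally show ?thesis .
qed

text \<open>Each horizontal strip adds at most one row, so the boxes of the first k strips lie in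
  the first k rows. The reversal reflects that strips are taken from the end of al.\<close>

lemma chi_support:
  assumes "chi {#} al la \<noteq> 0"
  shows "size la \<le> length al \<and> (\<forall>k. sum_list (take k (rev al)) \<le> topsum la k)"
  using assms
proof (induction al arbitrary: la)
  case Nil
  then show ?case by (simp split: if_splits)
next
  case (Cons a al)
  obtain ka where ka: "ka \<in> partitions" "la \<in> hstrips ka a" "chi {#} al ka \<noteq> 0"
    using Cons.prems by (rule chi_nonzero_Cons)
  have la: "la \<in> partitions" "sum_mset la = sum_list (a # al)" using chi_degree[OF _ Cons.prems] by auto
  have c: "\<And>j. col ka j \<le> col la j" "\<And>j. col la j \<le> Suc (col ka j)" using ka(2) by (auto simp: hstrips_def)
  have sz: "size la \<le> length (a # al)"
    using Cons.IH[OF ka(3)] c(2)[of 0] col_0[OF la(1)] col_0[OF ka(1)] by simp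
  have "sum_list (take k (rev (a # al))) \<le> topsum la k" for k
  proof (cases "k \<le> length al")
    case True
    then have "sum_list (take k (rev (a # al))) \<le> topsum ka k" using Cons.IH[OF ka(3)] by simp
    also have "\<dots> \<le> topsum la k" by (rule topsum_mono_col) (rule c)
    finally show ?thesis .
  next
    case False
    have "col la j \<le> k" for j using col_le_size[of la j] sz False by simp
    then have "topsum la k = (\<Sum>j<sum_mset la. col la j)" by (simp add: topsum_def min_absorb2)
    also have "\<dots> = sum_mset la" by (rule sum_col) simp
    finally show ?thesis using False la(2) by simp
  qed
  then show ?case using sz by blast
qed

lemma chi_dominance:
  assumes "nu \<in> partitions" "chi {#} (rev (parts nu)) la \<noteq> 0" shows "dominance_le nu la"
proof -
  have "sum_list (parts nu) = sum_mset nu" by (metis mset_parts sum_mset_sum_list)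
  then have "sum_mset la = sum_mset nu" using chi_degree[OF _ assms(2)] by simp
  then show ?thesis using chi_support[OF assms(2)] by (simp add: dominance_le_iff sum_take_parts)
qed

text \<open>b_la(t), the inverse of the squared length of P_la (see \<open>frm_PP\<close>).\<close>

definition bb :: "partition \<Rightarrow> real" where "bb la = (\<Prod>i\<in>set_mset la. qp (count la i))"

lemma bb_pos: "0 < bb la" unfolding bb_def by (intro prod_pos) (simp add: qp_pos)
lemma bb_nz [simp]: "bb la \<noteq> 0" using bb_pos[of la] by simp

lemma bb_add: "bb (add_mset a la) = bb la * (1 - t ^ Suc (count la a))"
proof -
  have *: "(\<Prod>i\<in>set_mset la - {a}. qp (count (add_mset a la) i)) = (\<Prod>i\<in>set_mset la - {a}. qp (count la i))"
    by (intro prod.cong) auto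
  show ?thesis
  proof (cases "a \<in># la")
    case True
    have 1: "bb (add_mset a la) = qp (count (add_mset a la) a) * (\<Prod>i\<in>set_mset la - {a}. qp (count (add_mset a la) i))"
      unfolding bb_def using True prod.remove[of "set_mset la" a "\<lambda>i. qp (count (add_mset a la) i)"] by (simp add: insert_absorb)
    have 2: "bb la = qp (count la a) * (\<Prod>i\<in>set_mset la - {a}. qp (count la i))"
      unfolding bb_def by (rule prod.remove) (use True in auto)
    show ?thesis unfolding 1 2 * by (simp add: qp_Suc del: power_Suc)
  next
    case False
    then have e: "set_mset la - {a} = set_mset la" and c: "count la a = 0" by (auto simp: not_in_iff)
    have "bb (add_mset a la) = qp (Suc 0) * (\<Prod>i\<in>set_mset la. qp (count (add_mset a la) i))"
      unfolding bb_def using False c by simp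
    then show ?thesis using * unfolding e bb_def c qp_Suc[of 0] by simp
  qed
qed

text \<open>The parts are added from the largest to the smallest, and only the chain in which each
  strip is a whole new row reaches the shape. A strip contributes 1 - t^m with m the new
  multiplicity of its part; these factors multiply to b_la.\<close>

lemma chi_leading: "sorted xs \<Longrightarrow> 0 \<notin> set xs \<Longrightarrow> chi {#} xs (mset xs) = bb (mset xs)"
proof (induction xs)
  case Nil
  then show ?case by (simp add: bb_def)
next
  case (Cons a xs)
  let ?la = "mset (a # xs)" and ?mu = "mset xs"
  have a: "0 < a" using Cons.prems by (cases a) auto
  have P: "?la \<in> partitions" "?mu \<in> partitions" using Cons.prems by (auto simp: partitions_def)
  have c: "col ?la j = (if j < a then Suc (col ?mu j) else col ?mu j)" for j by simp
  have full: "col ?mu j = size ?mu" if "j < a" for j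
  proof -
    have "filter_mset ((<) j) ?mu = ?mu"
      using Cons.prems(1) that by (intro filter_mset_eq_conv[THEN iffD2]) auto
    then show ?thesis by (simp add: col_def)
  qed
  have h: "?la \<in> hstrips ?mu a" using P c by (auto simp: hstrips_def)
  have only: "ka = ?mu" if ka: "ka \<in> partitions" "?la \<in> hstrips ka a" "chi {#} xs ka \<noteq> 0" for ka
  proof -
    have le: "col ka j \<le> col ?mu j" for j
    proof (cases "j < a")
      case True
      have "col ka j \<le> size ka" by (rule col_le_size)
      then show ?thesis using chi_support[OF ka(3)] full[OF True] by simp
    next
      case False
      have "col ka j \<le> col ?la j" using ka(2) by (simp add: hstrips_def)
      then show ?thesis using False by simp
    qed
    have s: "sum_mset ka = sum_mset ?mu" using chi_degree[OF _ ka(3)] by (simp add: sum_mset_sum_list)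
    have "col ka j = col ?mu j" for j
    proof (rule ccontr)
      assume ne: "col ka j \<noteq> col ?mu j"
      define N where "N = Suc (max j (sum_mset ka))"
      have lt: "col ka j < col ?mu j" using ne le[of j] by simp
      have "(\<Sum>j<N. col ka j) < (\<Sum>j<N. col ?mu j)"
        by (rule sum_strict_mono_ex1) (use lt in \<open>auto simp: le N_def intro!: bexI[of _ j]\<close>)
      moreover have "sum_mset ka \<le> N" "sum_mset ?mu \<le> N" using s by (auto simp: N_def)
      ultimately show False using sum_col[of ka N] sum_col[of ?mu N] s by simp
    qed
    then show ?thesis by (rule partition_eqI[OF ka(1) P(2)])
  qed
  have "chi {#} (a # xs) ?la = (\<Sum>ka | ka \<in> partitions \<and> sum_mset ka = sum_mset {#} + sum_list xs.
      if ka = ?mu then ph ?la ?mu * chi {#} xs ?mu else 0)"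
    unfolding chi.simps
  proof (rule sum.cong)
    fix ka assume ka: "ka \<in> {ka. ka \<in> partitions \<and> sum_mset ka = sum_mset {#} + sum_list xs}"
    show "(if ?la \<in> hstrips ka a then ph ?la ka * chi {#} xs ka else 0) = (if ka = ?mu then ph ?la ?mu * chi {#} xs ?mu else 0)"
    proof (cases "ka = ?mu")
      case True then show ?thesis using h by simp
    next
      case False
      then show ?thesis using only[of ka] ka by (cases "chi {#} xs ka = 0") auto
    qed
  qed simp
  also have "\<dots> = ph ?la ?mu * chi {#} xs ?mu"
  proof -
    have "finite {ka. ka \<in> partitions \<and> sum_mset ka = sum_mset {#} + sum_list xs}" by (rule finite_partitions_of)
    then show ?thesis using P(2) by (simp add: sum.delta sum_mset_sum_list)
  qed
  also have "ph ?la ?mu = 1 - t ^ Suc (count ?mu a)"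
  proof -
    have "ph ?la ?mu = (\<Prod>j<sum_mset ?la. if j = a - 1 then 1 - t ^ count ?la (Suc j) else 1)"
      unfolding ph_def using a by (intro prod.cong) auto
    also have "\<dots> = 1 - t ^ count ?la a"
    proof -
      have "a - 1 \<in> {..<sum_mset ?la}" using a by (simp add: sum_mset_sum_list)
      then show ?thesis using a by (simp add: prod.delta)
    qed
    finally show ?thesis by simp
  qed
  also have "(1 - t ^ Suc (count ?mu a)) * chi {#} xs ?mu = bb ?la"
    using Cons by (simp add: bb_add del: power_Suc)
  finally show ?case .
qed

lemma chi_parts: "la \<in> partitions \<Longrightarrow> chi {#} (rev (parts la)) la = bb la"
  using chi_leading[of "rev (parts la)"] mset_parts[of la]
  by (auto simp: parts_def partitions_def simp del: mset_parts)

lemma exponents_mono_of_rev_parts: "la \<in> partitions \<Longrightarrow> exponents (mono_of (rev (parts la))) = la"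
  using exponents_mono_of_parts[of la] by (simp add: exponents_mono_of)

text \<open>Pairing g with the q-product of ka reads the coefficient of g at ka, and that product
  expands into P_rh with rh above ka and diagonal coefficient b_ka. If ka is not below mu, neither
  is any such rh, so downward induction on the rank removes all terms; for la = mu only the diagonal
  survives.\<close>

lemma frm_triangular:
  assumes la: "la \<in> partitions" and g: "symf g" "\<And>M. cf g M \<noteq> 0 \<Longrightarrow> dominance_le (exponents M) mu"
  shows "\<not> dominance_le la mu \<Longrightarrow> frm (PP la) g = 0"
    and "la = mu \<Longrightarrow> frm (PP la) g = cf g (mono_of (rev (parts la))) / bb la"
proof -
  let ?n = "sum_mset la"
  let ?A = "{la. la \<in> partitions \<and> sum_mset la = ?n}"
  have fin: "finite ?A" by (rule finite_partitions_of)
  have expand: "bb ka * frm (PP ka) g = cf g (mono_of (rev (parts ka))) - (\<Sum>rh\<in>?A - {ka}. chi {#} (rev (parts ka)) rh * frm (PP rh) g)"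
    if ka: "ka \<in> ?A" for ka
  proof -
    have s: "sum_list (rev (parts ka)) = ?n" using ka by (metis (mono_tags) mem_Collect_eq mset_parts mset_rev sum_mset_sum_list)
    have "cf g (mono_of (rev (parts ka))) = frm (qprod (rev (parts ka))) g" using frm_qprod[OF g(1)] by simp
    also have "qprod (rev (parts ka)) = (\<Sum>rh\<in>?A. sc (chi {#} (rev (parts ka)) rh) * PP rh)"
      using qprod_PP[of "{#}" "rev (parts ka)"] s by (simp add: PP_empty)
    also have "frm \<dots> g = (\<Sum>rh\<in>?A. chi {#} (rev (parts ka)) rh * frm (PP rh) g)"
      by (subst frm_sum_left) (use g symf_PP in \<open>auto simp: frm_sc_left\<close>)
    also have "\<dots> = bb ka * frm (PP ka) g + (\<Sum>rh\<in>?A - {ka}. chi {#} (rev (parts ka)) rh * frm (PP rh) g)"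
      using sum.remove[OF fin ka, of "\<lambda>rh. chi {#} (rev (parts ka)) rh * frm (PP rh) g"] ka chi_parts[of ka] by simp
    finally show ?thesis by simp
  qed
  have main: "\<not> dominance_le ka mu \<Longrightarrow> frm (PP ka) g = 0" if "ka \<in> ?A" for ka
    using that
  proof (induction "Max (dom_rank ` ?A) - dom_rank ka" arbitrary: ka rule: less_induct)
    case less
    have kaP: "ka \<in> partitions" using less.prems by simp
    have "cf g (mono_of (rev (parts ka))) = 0"
      using g(2)[of "mono_of (rev (parts ka))"] less.prems exponents_mono_of_rev_parts[OF kaP] by auto
    moreover have "chi {#} (rev (parts ka)) rh * frm (PP rh) g = 0" if rh: "rh \<in> ?A - {ka}" for rh
    proof (cases "chi {#} (rev (parts ka)) rh = 0")
      case False
      then have d: "dominance_le ka rh" by (rule chi_dominance[OF kaP])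
      then have nd: "\<not> dominance_le rh mu" using less.prems dominance_le_trans by blast
      have "dom_rank ka < dom_rank rh" using dom_rank_less[OF kaP _ d] rh by auto
      moreover have "dom_rank rh \<le> Max (dom_rank ` ?A)" using fin rh by (intro Max_ge) auto
      ultimately have "Max (dom_rank ` ?A) - dom_rank rh < Max (dom_rank ` ?A) - dom_rank ka" by linarith
      then show ?thesis using less.hyps[of rh] nd rh by auto
    qed simp
    then have "(\<Sum>rh\<in>?A - {ka}. chi {#} (rev (parts ka)) rh * frm (PP rh) g) = 0" by (rule sum.neutral[OF ballI])
    ultimately have "bb ka * frm (PP ka) g = 0" using expand[OF less.prems(2)] by simp
    then show ?case by simp
  qed
  show "\<not> dominance_le la mu \<Longrightarrow> frm (PP la) g = 0" using main[of la] la by simp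
  assume lm: "la = mu"
  have "chi {#} (rev (parts la)) rh * frm (PP rh) g = 0" if rh: "rh \<in> ?A - {la}" for rh
  proof (cases "chi {#} (rev (parts la)) rh = 0")
    case False
    then have "dominance_le la rh" by (rule chi_dominance[OF la])
    then have "\<not> dominance_le rh mu" using dominance_le_antisym[of la rh] la rh lm by auto
    then show ?thesis using main[of rh] rh by simp
  qed simp
  then have "(\<Sum>rh\<in>?A - {la}. chi {#} (rev (parts la)) rh * frm (PP rh) g) = 0" by (rule sum.neutral[OF ballI])
  then have "bb la * frm (PP la) g = cf g (mono_of (rev (parts la)))" using expand[of la] la by simp
  then show "frm (PP la) g = cf g (mono_of (rev (parts la))) / bb la" by (simp add: field_simps)
qed

text \<open>Two different partitions cannot dominate each other, so triangularity applies in one of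
  the two orders and the form is symmetric.\<close>

lemma frm_PP:
  assumes "la \<in> partitions" "mu \<in> partitions"
  shows "frm (PP la) (PP mu) = (if la = mu then 1 / bb la else 0)"
proof (cases "la = mu")
  case True
  then show ?thesis using frm_triangular(2)[OF assms(1) symf_PP[OF assms(2)] PP_dominance[OF assms(2)]]
      PP_leading[OF assms(2), of "mono_of (rev (parts la))"] exponents_mono_of_rev_parts assms by simp
next
  case False
  show ?thesis
  proof (cases "dominance_le la mu")
    case True
    then have "\<not> dominance_le mu la" using False dominance_le_antisym assms by blast
    then have "frm (PP mu) (PP la) = 0"
      using frm_triangular(1)[OF assms(2) symf_PP[OF assms(1)] PP_dominance[OF assms(1)]] by simp
    then show ?thesis using False frm_commute[OF symf_PP symf_PP] assms by simp
  next
    case nd: False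
    then show ?thesis using False
      frm_triangular(1)[OF assms(1) symf_PP[OF assms(2)] PP_dominance[OF assms(2)]] by simp
  qed
qed

lemma PP_degree: "la \<in> partitions \<Longrightarrow> cf (PP la) M \<noteq> 0 \<Longrightarrow> size M = sum_mset la"
  using PP_dominance by (fastforce simp: dominance_le_iff)

sublocale PP: triangular_family PP dom_rank
proof
  fix la M assume la: "la \<in> partitions" and M: "cf (PP la) M \<noteq> 0"
  then have "dominance_le (exponents M) la" by (rule PP_dominance)
  then show "size M = sum_mset la \<and> (exponents M = la \<or> dom_rank (exponents M) < dom_rank la)"
    using dom_rank_less[of "exponents M" la] la PP_degree[OF la M] by auto
qed (auto simp: symf_PP PP_leading)

lemma PP_expand:
  assumes f: "symf f" and D: "finite D" "\<And>M. cf f M \<noteq> 0 \<Longrightarrow> size M \<in> D"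
  shows "f = (\<Sum>la\<in>partitions_in D. sc (bb la * frm (PP la) f) * PP la)"
proof -
  obtain c where c: "f = (\<Sum>la\<in>partitions_in D. sc (c la) * PP la)" using PP.span[OF f D] by blast
  have fin: "finite (partitions_in D)" by (rule finite_partitions_in[OF D(1)])
  have co: "bb la * frm (PP la) f = c la" if la: "la \<in> partitions_in D" for la
  proof -
    have "frm (PP la) f = (\<Sum>mu\<in>partitions_in D. c mu * frm (PP la) (PP mu))"
      unfolding c by (subst frm_sum_right) (use la symf_PP in \<open>auto simp: frm_sc_right\<close>)
    also have "\<dots> = (\<Sum>mu\<in>partitions_in D. if mu = la then c la / bb la else 0)"
      using la by (intro sum.cong) (auto simp: frm_PP)
    also have "\<dots> = c la / bb la" using la fin by (simp add: sum.delta)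
    finally show ?thesis by simp
  qed
  have "(\<Sum>la\<in>partitions_in D. sc (bb la * frm (PP la) f) * PP la) = (\<Sum>la\<in>partitions_in D. sc (c la) * PP la)"
    by (rule sum.cong[OF refl]) (simp only: co)
  from c this[symmetric] show ?thesis by (rule trans)
qed

lemma PP_nondegenerate:
  assumes "symf f" "symf g" "\<And>la. la \<in> partitions \<Longrightarrow> frm (PP la) f = frm (PP la) g"
  shows "f = g"
proof -
  obtain d e where de: "\<And>M. size M > d \<Longrightarrow> cf f M = 0" "\<And>M. size M > e \<Longrightarrow> cf g M = 0"
    using symf_bounded[OF assms(1)] symf_bounded[OF assms(2)] by (auto simp: bounded_deg_def)
  have "f = (\<Sum>la\<in>partitions_in {..max d e}. sc (bb la * frm (PP la) f) * PP la)"
    by (rule PP_expand) (use assms de in \<open>auto simp: not_less[symmetric]\<close>)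
  also have "\<dots> = (\<Sum>la\<in>partitions_in {..max d e}. sc (bb la * frm (PP la) g) * PP la)"
    by (intro sum.cong) (simp_all add: assms)
  also have "\<dots> = g"
    by (rule PP_expand[symmetric]) (use assms de in \<open>auto simp: not_less[symmetric]\<close>)
  finally show ?thesis .
qed

section \<open>Identification with the defined functions P, Q and their skew versions\<close>

lemma PP_unitriangular:
  assumes la: "la \<in> partitions"
  shows "\<exists>c. cf (PP la) = (\<lambda>M. monomial_sym la M +
    (\<Sum>mu | mu \<in> partitions \<and> dominance_le mu la \<and> mu \<noteq> la. c mu * monomial_sym mu M))"
proof (intro exI[of _ "\<lambda>mu. cf (PP la) (mono_of (parts mu))"] ext)
  fix M
  let ?S = "{mu. mu \<in> partitions \<and> dominance_le mu la \<and> mu \<noteq> la}"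
  have fin: "finite ?S"
    by (rule finite_subset[OF _ finite_partitions_of[of "sum_mset la"]]) (auto simp: dominance_le_iff)
  have "(\<Sum>mu\<in>?S. cf (PP la) (mono_of (parts mu)) * monomial_sym mu M) =
      (\<Sum>mu\<in>?S. if mu = exponents M then cf (PP la) (mono_of (parts (exponents M))) else 0)"
    by (rule sum.cong) (auto simp: monomial_sym_def)
  also have "\<dots> = (if exponents M \<in> ?S then cf (PP la) (mono_of (parts (exponents M))) else 0)"
    using fin by (simp add: sum.delta')
  also have "cf (PP la) (mono_of (parts (exponents M))) = cf (PP la) M"
    by (rule symf_exponents[OF symf_PP[OF la]]) simp
  finally have e: "(\<Sum>mu\<in>?S. cf (PP la) (mono_of (parts mu)) * monomial_sym mu M) = (if exponents M \<in> ?S then cf (PP la) M else 0)" .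
  show "cf (PP la) M = monomial_sym la M + (\<Sum>mu\<in>?S. cf (PP la) (mono_of (parts mu)) * monomial_sym mu M)"
    unfolding e using PP_leading[OF la, of M] PP_dominance[OF la, of M]
    by (cases "cf (PP la) M = 0") (auto simp: monomial_sym_def)
qed

lemma unitriangular_cf:
  assumes f: "f = (\<lambda>M. monomial_sym la M +
    (\<Sum>mu | mu \<in> partitions \<and> dominance_le mu la \<and> mu \<noteq> la. c mu * monomial_sym mu M))"
  shows "f M \<noteq> 0 \<Longrightarrow> dominance_le (exponents M) la" "exponents M = la \<Longrightarrow> f M = 1"
proof -
  show "dominance_le (exponents M) la" if "f M \<noteq> 0"
  proof (rule ccontr)
    assume nd: "\<not> dominance_le (exponents M) la"
    have "monomial_sym la M = 0" using nd by (auto simp: monomial_sym_def)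
    moreover have "(\<Sum>mu | mu \<in> partitions \<and> dominance_le mu la \<and> mu \<noteq> la. c mu * monomial_sym mu M) = 0"
      by (rule sum.neutral) (use nd in \<open>auto simp: monomial_sym_def\<close>)
    ultimately show False using that f by simp
  qed
  show "f M = 1" if "exponents M = la"
  proof -
    have "(\<Sum>mu | mu \<in> partitions \<and> dominance_le mu la \<and> mu \<noteq> la. c mu * monomial_sym mu M) = 0"
      by (rule sum.neutral) (use that in \<open>auto simp: monomial_sym_def\<close>)
    then show ?thesis using f that by (simp add: monomial_sym_def)
  qed
qed

text \<open>Uniqueness is by induction on the rank: a competitor at la is orthogonal to the P_mu
  below it by induction and to those not below it by triangularity, and its leading coefficient
  fixes the pairing with P_la. The restriction matches the extensional function space in the
  definition.\<close>

lemma macdonald_P_eq: "macdonald_P 0 t = restrict (\<lambda>la. cf (PP la)) partitions"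
  unfolding macdonald_P_def
proof (rule the_equality, intro conjI ballI impI)
  show "restrict (\<lambda>la. cf (PP la)) partitions \<in> partitions \<rightarrow>\<^sub>E symmetric_functions"
    using symf_PP by (auto simp: symf_def)
  fix la assume la: "la \<in> partitions"
  show "\<exists>c. restrict (\<lambda>la. cf (PP la)) partitions la = (\<lambda>M. monomial_sym la M +
    (\<Sum>mu | mu \<in> partitions \<and> dominance_le mu la \<and> mu \<noteq> la. c mu * monomial_sym mu M))"
    using PP_unitriangular[OF la] la by simp
  fix mu assume "mu \<in> partitions" "la \<noteq> mu"
  then show "macdonald_form 0 t (restrict (\<lambda>la. cf (PP la)) partitions la) (restrict (\<lambda>la. cf (PP la)) partitions mu) = 0"
    using la frm_PP[of la mu] by (simp add: frm_def)
next
  fix P assume P: "P \<in> partitions \<rightarrow>\<^sub>E symmetric_functions \<and>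
       (\<forall>la\<in>partitions. \<exists>c. P la = (\<lambda>M. monomial_sym la M +
          (\<Sum>mu | mu \<in> partitions \<and> dominance_le mu la \<and> mu \<noteq> la. c mu * monomial_sym mu M))) \<and>
       (\<forall>la\<in>partitions. \<forall>mu\<in>partitions. la \<noteq> mu \<longrightarrow> macdonald_form 0 t (P la) (P mu) = 0)"
  have eq: "la \<in> partitions \<Longrightarrow> Ser (P la) = PP la" for la
  proof (induction "dom_rank la" arbitrary: la rule: less_induct)
    case less
    note la = less.prems
    define g where "g = Ser (P la)"
    have cg: "cf g = P la" by (simp add: g_def)
    have symg: "symf g" using P la by (auto simp: symf_def cg)
    obtain c where "cf g = (\<lambda>M. monomial_sym la M +
          (\<Sum>mu | mu \<in> partitions \<and> dominance_le mu la \<and> mu \<noteq> la. c mu * monomial_sym mu M))"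
      using P la unfolding cg by blast
    note tri = unitriangular_cf[OF this]
    have z: "frm (PP mu) g = 0" if mu: "mu \<in> partitions" "mu \<noteq> la" for mu
    proof (cases "dominance_le mu la")
      case True
      then have "Ser (P mu) = PP mu" using less.hyps dom_rank_less[OF mu(1) la True mu(2)] mu by blast
      then have "cf (PP mu) = P mu" by (metis cf_Ser)
      then show ?thesis using P mu la by (simp add: frm_def cg)
    next
      case False
      then show ?thesis using frm_triangular(1)[OF mu(1) symg tri(1)] by simp
    qed
    have "g = PP la"
    proof (rule PP_nondegenerate[OF symg symf_PP[OF la]])
      fix mu assume mu: "mu \<in> partitions"
      show "frm (PP mu) g = frm (PP mu) (PP la)"
      proof (cases "mu = la")
        case True
        then show ?thesis using frm_triangular(2)[OF la symg tri(1)] tri(2)[of "mono_of (rev (parts la))"]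
          exponents_mono_of_rev_parts[OF la] frm_PP[OF la la] by simp
      next
        case False
        then show ?thesis using z[OF mu] frm_PP[OF mu la] by simp
      qed
    qed
    then show ?case by (simp add: g_def)
  qed
  show "P = restrict (\<lambda>la. cf (PP la)) partitions"
  proof
    fix la
    show "P la = restrict (\<lambda>la. cf (PP la)) partitions la"
    proof (cases "la \<in> partitions")
      case True
      then show ?thesis using eq[OF True] by (metis cf_Ser restrict_apply')
    next
      case False
      then show ?thesis using P by (auto simp: PiE_def extensional_def)
    qed
  qed
qed

definition QQ :: "partition \<Rightarrow> mps" where "QQ la = sc (bb la) * PP la"

lemma symf_QQ: "la \<in> partitions \<Longrightarrow> symf (QQ la)"
  using symf_PP by (auto simp: QQ_def)

lemma frm_PP_QQ: "la \<in> partitions \<Longrightarrow> mu \<in> partitions \<Longrightarrow> frm (PP la) (QQ mu) = (if la = mu then 1 else 0)"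
  by (simp add: QQ_def frm_sc_right symf_PP frm_PP)

lemma macdonald_Q_eq: "macdonald_Q 0 t = restrict (\<lambda>la. cf (QQ la)) partitions"
  unfolding macdonald_Q_def macdonald_P_eq
proof (rule the_equality, intro conjI ballI)
  show "restrict (\<lambda>la. cf (QQ la)) partitions \<in> partitions \<rightarrow>\<^sub>E symmetric_functions"
    using symf_QQ by (auto simp: symf_def)
  fix la mu assume "la \<in> partitions" "mu \<in> partitions"
  then show "macdonald_form 0 t (restrict (\<lambda>la. cf (PP la)) partitions la) (restrict (\<lambda>la. cf (QQ la)) partitions mu) = (if la = mu then 1 else 0)"
    using frm_PP_QQ[of la mu] by (simp add: frm_def)
next
  fix Q assume Q: "Q \<in> partitions \<rightarrow>\<^sub>E symmetric_functions \<and> (\<forall>la\<in>partitions. \<forall>mu\<in>partitions.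
          macdonald_form 0 t (restrict (\<lambda>la. cf (PP la)) partitions la) (Q mu) = (if la = mu then 1 else 0))"
  show "Q = restrict (\<lambda>la. cf (QQ la)) partitions"
  proof
    fix mu
    show "Q mu = restrict (\<lambda>la. cf (QQ la)) partitions mu"
    proof (cases "mu \<in> partitions")
      case True
      have "Ser (Q mu) = QQ mu"
      proof (rule PP_nondegenerate)
        show "symf (Ser (Q mu))" using Q True by (auto simp: symf_def)
        fix la assume la: "la \<in> partitions"
        show "frm (PP la) (Ser (Q mu)) = frm (PP la) (QQ mu)"
          using Q la True frm_PP_QQ[OF la True] by (simp add: frm_def)
      qed (rule symf_QQ[OF True])
      then show ?thesis using True by (metis cf_Ser restrict_apply')
    next
      case False
      then show ?thesis using Q by (auto simp: PiE_def extensional_def)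
    qed
  qed
qed

text \<open>Q_{la/mu} expanded in the basis Q_nu = b_nu P_nu. Only nu of weight at most that of la
  can contribute, so a finite sum suffices.\<close>

definition SQ :: "partition \<Rightarrow> partition \<Rightarrow> mps"
  where "SQ la mu = (\<Sum>nu\<in>partitions_in {..sum_mset la}. sc (bb nu * frm (QQ la) (PP mu * PP nu)) * PP nu)"

lemma symf_SQ [simp]: "symf (SQ la mu)"
  unfolding SQ_def using symf_PP by (intro symf_sum symf_mult) auto

lemma cf_mult_degree:
  assumes "\<And>M. cf f M \<noteq> 0 \<Longrightarrow> size M = d" "\<And>M. cf g M \<noteq> 0 \<Longrightarrow> size M = e" "cf (f * g) M \<noteq> 0"
  shows "size M = d + e"
proof -
  obtain A where A: "A \<subseteq># M" "cf f A \<noteq> 0" "cf g (M - A) \<noteq> 0"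
    using assms(3) unfolding cf_mult by (auto elim!: sum.not_neutral_contains_not_neutral)
  have "size M = size A + size (M - A)" using A(1) by (simp add: size_Diff_submset size_mset_mono)
  then show ?thesis using assms(1)[OF A(2)] assms(2)[OF A(3)] by simp
qed

lemma frm_degree:
  assumes la: "la \<in> partitions" and f: "symf f" "\<And>M. cf f M \<noteq> 0 \<Longrightarrow> size M = d" "sum_mset la \<noteq> d"
  shows "frm (PP la) f = 0"
proof -
  have "f = (\<Sum>mu\<in>partitions_in {d}. sc (bb mu * frm (PP mu) f) * PP mu)"
    by (rule PP_expand) (use f in auto)
  then have "frm (PP la) f = frm (PP la) (\<Sum>mu\<in>partitions_in {d}. sc (bb mu * frm (PP mu) f) * PP mu)" by simp
  also have "\<dots> = (\<Sum>mu\<in>partitions_in {d}. (bb mu * frm (PP mu) f) * frm (PP la) (PP mu))"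
    by (subst frm_sum_right) (use symf_PP la in \<open>auto simp: frm_sc_right\<close>)
  also have "\<dots> = 0" by (rule sum.neutral) (use la f(3) in \<open>auto simp: frm_PP\<close>)
  finally show ?thesis .
qed

lemma frm_SQ_PP:
  assumes la: "la \<in> partitions" and mu: "mu \<in> partitions" and nu: "nu \<in> partitions"
  shows "frm (SQ la mu) (PP nu) = frm (QQ la) (PP mu * PP nu)"
proof -
  have fin: "finite (partitions_in {..sum_mset la})" by (rule finite_partitions_in) simp
  have "frm (SQ la mu) (PP nu) = (\<Sum>ka\<in>partitions_in {..sum_mset la}. (bb ka * frm (QQ la) (PP mu * PP ka)) * frm (PP ka) (PP nu))"
    unfolding SQ_def by (subst frm_sum_left) (use symf_PP nu in \<open>auto simp: frm_sc_left\<close>)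
  also have "\<dots> = (\<Sum>ka\<in>partitions_in {..sum_mset la}. if ka = nu then frm (QQ la) (PP mu * PP nu) else 0)"
    by (intro sum.cong) (use nu in \<open>auto simp: frm_PP\<close>)
  also have "\<dots> = (if sum_mset nu \<le> sum_mset la then frm (QQ la) (PP mu * PP nu) else 0)"
    using fin nu by (simp add: sum.delta)
  also have "\<dots> = frm (QQ la) (PP mu * PP nu)"
  proof (cases "sum_mset nu \<le> sum_mset la")
    case False
    have "cf (PP mu * PP nu) M \<noteq> 0 \<Longrightarrow> size M = sum_mset mu + sum_mset nu" for M
      using cf_mult_degree[of "PP mu" _ "PP nu"] PP_degree mu nu by blast
    then have "frm (PP la) (PP mu * PP nu) = 0"
      by (intro frm_degree[where d = "sum_mset mu + sum_mset nu"]) (use la symf_PP mu nu False in auto)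
    then show ?thesis using False la mu nu symf_PP by (simp add: QQ_def frm_sc_left symf_mult)
  qed simp
  finally show ?thesis .
qed

lemma skew_Q_eq:
  assumes la: "la \<in> partitions" and mu: "mu \<in> partitions"
  shows "skew_Q 0 t la mu = cf (SQ la mu)"
  unfolding skew_Q_def macdonald_P_eq macdonald_Q_eq
proof (rule the_equality, intro conjI ballI)
  show "cf (SQ la mu) \<in> symmetric_functions" using symf_SQ by (simp add: symf_def)
  fix nu assume "nu \<in> partitions"
  then show "macdonald_form 0 t (cf (SQ la mu)) (restrict (\<lambda>la. cf (PP la)) partitions nu) =
          macdonald_form 0 t (restrict (\<lambda>la. cf (QQ la)) partitions la)
            (series_mult (restrict (\<lambda>la. cf (PP la)) partitions mu) (restrict (\<lambda>la. cf (PP la)) partitions nu))"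
    using frm_SQ_PP[OF la mu, of nu] la mu by (simp add: frm_def cf_mult_series)
next
  fix f assume f: "f \<in> symmetric_functions \<and> (\<forall>nu\<in>partitions. macdonald_form 0 t f (restrict (\<lambda>la. cf (PP la)) partitions nu) =
          macdonald_form 0 t (restrict (\<lambda>la. cf (QQ la)) partitions la)
            (series_mult (restrict (\<lambda>la. cf (PP la)) partitions mu) (restrict (\<lambda>la. cf (PP la)) partitions nu)))"
  have sf: "symf (Ser f)" using f by (simp add: symf_def)
  have "Ser f = SQ la mu"
  proof (rule PP_nondegenerate[OF sf symf_SQ])
    fix nu assume nu: "nu \<in> partitions"
    have "frm (Ser f) (PP nu) = frm (SQ la mu) (PP nu)"
      using frm_SQ_PP[OF la mu nu] la mu nu f by (simp add: frm_def cf_mult_series)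
    then show "frm (PP nu) (Ser f) = frm (PP nu) (SQ la mu)"
      using frm_commute[OF symf_PP[OF nu]] sf by simp
  qed
  then show "f = cf (SQ la mu)" by (metis cf_Ser)
qed

text \<open>Since Q = b P, the two skew functions differ by b_mu / b_la only, and it is enough to
  work with \<open>SQ\<close>.\<close>

lemma skew_P_eq:
  assumes la: "la \<in> partitions" and mu: "mu \<in> partitions"
  shows "skew_P 0 t la mu = cf (sc (bb mu / bb la) * SQ la mu)"
  unfolding skew_P_def macdonald_P_eq macdonald_Q_eq
proof (rule the_equality, intro conjI ballI)
  let ?S = "sc (bb mu / bb la) * SQ la mu"
  have symS: "symf ?S" by (intro symf_mult) auto
  show "cf ?S \<in> symmetric_functions" using symS by (simp add: symf_def)
  have main: "frm ?S (QQ nu) = frm (PP la) (QQ mu * QQ nu)" if nu: "nu \<in> partitions" for nu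
  proof -
    have s: "symf (PP mu * PP nu)" using symf_PP mu nu by auto
    have "QQ mu * QQ nu = sc (bb mu * bb nu) * (PP mu * PP nu)" by (simp add: QQ_def sc_mult ac_simps)
    then have "frm (PP la) (QQ mu * QQ nu) = bb mu * bb nu * frm (PP la) (PP mu * PP nu)"
      using frm_sc_right[OF symf_PP[OF la] s] by simp
    moreover have "frm ?S (QQ nu) = bb mu / bb la * (bb nu * frm (SQ la mu) (PP nu))"
      using symf_PP[OF nu] symf_QQ[OF nu] by (simp add: frm_sc_left frm_sc_right QQ_def)
    moreover have "frm (QQ la) (PP mu * PP nu) = bb la * frm (PP la) (PP mu * PP nu)"
      unfolding QQ_def by (rule frm_sc_left[OF s symf_PP[OF la]])
    ultimately show ?thesis using frm_SQ_PP[OF la mu nu] by simp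
  qed
  fix nu assume nu: "nu \<in> partitions"
  show "macdonald_form 0 t (cf ?S) (restrict (\<lambda>la. cf (QQ la)) partitions nu) =
          macdonald_form 0 t (restrict (\<lambda>la. cf (PP la)) partitions la)
            (series_mult (restrict (\<lambda>la. cf (QQ la)) partitions mu) (restrict (\<lambda>la. cf (QQ la)) partitions nu))"
    using main[OF nu] la mu nu by (simp add: frm_def cf_mult_series)
next
  let ?S = "sc (bb mu / bb la) * SQ la mu"
  have symS: "symf ?S" by (intro symf_mult) auto
  fix f assume f: "f \<in> symmetric_functions \<and> (\<forall>nu\<in>partitions. macdonald_form 0 t f (restrict (\<lambda>la. cf (QQ la)) partitions nu) =
          macdonald_form 0 t (restrict (\<lambda>la. cf (PP la)) partitions la)
            (series_mult (restrict (\<lambda>la. cf (QQ la)) partitions mu) (restrict (\<lambda>la. cf (QQ la)) partitions nu)))"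
  have sf: "symf (Ser f)" using f by (simp add: symf_def)
  have "Ser f = ?S"
  proof (rule PP_nondegenerate[OF sf symS])
    fix nu assume nu: "nu \<in> partitions"
    have s: "symf (PP mu * PP nu)" using symf_PP mu nu by auto
    have "QQ mu * QQ nu = sc (bb mu * bb nu) * (PP mu * PP nu)" by (simp add: QQ_def sc_mult ac_simps)
    then have "frm (PP la) (QQ mu * QQ nu) = bb mu * bb nu * frm (PP la) (PP mu * PP nu)"
      using frm_sc_right[OF symf_PP[OF la] s] by simp
    moreover have "frm (Ser f) (QQ nu) = frm (PP la) (QQ mu * QQ nu)"
      using la mu nu f by (simp add: frm_def cf_mult_series)
    moreover have "frm (Ser f) (QQ nu) = bb nu * frm (Ser f) (PP nu)"
      unfolding QQ_def by (rule frm_sc_right[OF sf symf_PP[OF nu]])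
    moreover have "frm (QQ la) (PP mu * PP nu) = bb la * frm (PP la) (PP mu * PP nu)"
      unfolding QQ_def by (rule frm_sc_left[OF s symf_PP[OF la]])
    moreover have "frm ?S (PP nu) = bb mu / bb la * frm (SQ la mu) (PP nu)"
      by (rule frm_sc_left[OF symf_PP[OF nu] symf_SQ])
    ultimately have "frm (Ser f) (PP nu) = frm ?S (PP nu)" using frm_SQ_PP[OF la mu nu] by simp
    then show "frm (PP nu) (Ser f) = frm (PP nu) ?S"
      using frm_commute[OF symf_PP[OF nu]] sf symS by simp
  qed
  then show "f = cf ?S" by (metis cf_Ser)
qed

text \<open>The coefficient of x^al is the pairing with q_al. Moving P_mu to the other side gives
  the pairing of Q_la with q_al P_mu, where \<open>chi\<close> is read off. In particular the
  coefficients are nonnegative.\<close>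

lemma cf_SQ:
  assumes la: "la \<in> partitions" and mu: "mu \<in> partitions"
  shows "cf (SQ la mu) (mono_of al) = chi mu al la"
proof -
  have ext: "frm (SQ la mu) g = frm (QQ la) (PP mu * g)" if g: "symf g" for g
  proof -
    obtain d where d: "\<And>M. size M > d \<Longrightarrow> cf g M = 0" using symf_bounded[OF g] by (auto simp: bounded_deg_def)
    define c where "c nu = bb nu * frm (PP nu) g" for nu
    have e: "g = (\<Sum>nu\<in>partitions_in {..d}. sc (c nu) * PP nu)"
      unfolding c_def by (rule PP_expand) (use g d in \<open>auto simp: not_less[symmetric]\<close>)
    have "frm (SQ la mu) g = (\<Sum>nu\<in>partitions_in {..d}. c nu * frm (SQ la mu) (PP nu))"
      by (subst e, subst frm_sum_right) (use symf_PP in \<open>auto simp: frm_sc_right\<close>)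
    also have "\<dots> = (\<Sum>nu\<in>partitions_in {..d}. c nu * frm (QQ la) (PP mu * PP nu))"
      by (intro sum.cong) (auto simp: frm_SQ_PP[OF la mu])
    also have "\<dots> = frm (QQ la) (\<Sum>nu\<in>partitions_in {..d}. sc (c nu) * (PP mu * PP nu))"
      by (subst frm_sum_right) (use symf_PP symf_QQ la mu in \<open>auto simp: frm_sc_right symf_mult\<close>)
    also have "(\<Sum>nu\<in>partitions_in {..d}. sc (c nu) * (PP mu * PP nu)) = PP mu * g"
    proof -
      have "PP mu * g = PP mu * (\<Sum>nu\<in>partitions_in {..d}. sc (c nu) * PP nu)" by (rule arg_cong[OF e])
      then show ?thesis by (simp add: sum_distrib_left mult.left_commute)
    qed
    finally show ?thesis .
  qed
  let ?A = "{ka. ka \<in> partitions \<and> sum_mset ka = sum_mset mu + sum_list al}"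
  have fin: "finite ?A" by (rule finite_partitions_of)
  have "cf (SQ la mu) (mono_of al) = frm (qprod al) (SQ la mu)" by (simp add: frm_qprod)
  also have "\<dots> = frm (SQ la mu) (qprod al)" by (rule frm_commute) auto
  also have "\<dots> = frm (QQ la) (qprod al * PP mu)" by (simp add: ext mult.commute)
  also have "\<dots> = (\<Sum>ka\<in>?A. chi mu al ka * frm (QQ la) (PP ka))"
    unfolding qprod_PP[OF mu] by (subst frm_sum_right) (use symf_PP symf_QQ la in \<open>auto simp: frm_sc_right\<close>)
  also have "\<dots> = (\<Sum>ka\<in>?A. if ka = la then chi mu al la else 0)"
  proof (rule sum.cong)
    fix ka assume "ka \<in> ?A"
    then have ka: "ka \<in> partitions" by simp
    have "frm (QQ la) (PP ka) = frm (PP ka) (QQ la)" by (rule frm_commute[OF symf_QQ[OF la] symf_PP[OF ka]])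
    then show "chi mu al ka * frm (QQ la) (PP ka) = (if ka = la then chi mu al la else 0)"
      by (simp add: frm_PP_QQ[OF ka la])
  qed simp
  also have "\<dots> = chi mu al la"
    using fin chi_degree[OF mu, of al la] by (cases "chi mu al la = 0") (auto simp: sum.delta)
  finally show ?thesis .
qed

lemma cf_SQ_nonneg: "la \<in> partitions \<Longrightarrow> mu \<in> partitions \<Longrightarrow> 0 \<le> cf (SQ la mu) M"
  using mono_of_exists[of M] cf_SQ chi_nonneg by metis

lemma SQ_degree: 
  assumes "la \<in> partitions" "mu \<in> partitions" "cf (SQ la mu) M \<noteq> 0"
  shows "sum_mset la = sum_mset mu + size M"
  using mono_of_exists[of M] cf_SQ[OF assms(1,2)] chi_degree[OF assms(2)] assms(3) size_mono_of by metis

lemma SQ_empty: "la \<in> partitions \<Longrightarrow> SQ la {#} = QQ la"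
proof (rule PP_nondegenerate)
  fix nu assume "la \<in> partitions" "nu \<in> partitions"
  then show "frm (PP nu) (SQ la {#}) = frm (PP nu) (QQ la)"
    using frm_SQ_PP[of la "{#}" nu] frm_commute[OF symf_PP[of nu]] symf_QQ[of la] by (simp add: PP_empty)
qed (auto simp: symf_QQ)

lemma cf_PP_nonneg: "la \<in> partitions \<Longrightarrow> 0 \<le> cf (PP la) M"
  using cf_SQ_nonneg[of la "{#}" M] bb_pos[of la] by (simp add: SQ_empty QQ_def zero_le_mult_iff)

end

section \<open>Torus integrals of Laurent series\<close>

lemma contour_integral_powi:
  assumes "0 < r"
  shows "((\<lambda>w. w powi k / (2 * of_real pi * \<i> * w)) has_contour_integral (if k = 0 then 1 else 0)) (circlepath 0 r)"
proof -
  have img: "path_image (circlepath 0 r) \<subseteq> - {0}" using assms by auto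
  show ?thesis
  proof (cases "k = 0")
    case True
    have "((\<lambda>w. 1 / (w - 0)) has_contour_integral 2 * of_real pi * \<i>) (circlepath 0 r)"
    proof -
      have "(\<lambda>w. 1 / (w - 0)) contour_integrable_on (circlepath 0 r)"
        using img assms by (intro contour_integrable_continuous_circlepath continuous_intros) auto
      then show ?thesis using contour_integral_circlepath[OF assms, of 0] has_contour_integral_integral by metis
    qed
    from has_contour_integral_div[OF this, of "2 * of_real pi * \<i>"] show ?thesis
      using True by (simp add: field_simps)
  next
    case False
    define c where "c = 1 / (of_int k * (2 * of_real pi * \<i>))"
    have "((\<lambda>w. c * w powi k) has_field_derivative w powi k / (2 * of_real pi * \<i> * w)) (at w within - {0})" if "w \<in> - {0}" for w
    proof -
      have w: "w \<noteq> 0" using that by simp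
      have "((\<lambda>w. c * w powi k) has_field_derivative c * (of_int k * w powi (k - 1) * 1)) (at w within - {0})"
        by (intro DERIV_cmult DERIV_power_int) (use w in \<open>auto intro: derivative_eq_intros\<close>)
      moreover have "c * (of_int k * w powi (k - 1) * 1) = w powi k / (2 * of_real pi * \<i> * w)"
        using w False by (simp add: c_def power_int_diff)
      ultimately show ?thesis by simp
    qed
    from Cauchy_theorem_primitive[OF this valid_path_circlepath img] show ?thesis using False by simp
  qed
qed

text \<open>On the circle the terms have constant modulus, so absolute summability is uniform by the
  M-test and the integral may be taken term by term.\<close>

lemma circle_integral_infsum:
  fixes c :: "'k \<Rightarrow> complex" and b :: "'k \<Rightarrow> int"
  assumes r: "0 < r" and sum: "(\<lambda>k. norm (c k) * r powi b k) summable_on A"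
    and G: "\<And>w. norm w = r \<Longrightarrow> G w = (\<Sum>\<^sub>\<infinity>k\<in>A. c k * w powi b k)"
  shows "contour_integral (circlepath 0 r) (\<lambda>w. G w / (2 * of_real pi * \<i> * w)) = (\<Sum>\<^sub>\<infinity>k | k \<in> A \<and> b k = 0. c k)"
proof -
  define f where "f k w = c k * (w powi b k / (2 * of_real pi * \<i> * w))" for k w
  have int: "(f k has_contour_integral (c k * (if b k = 0 then 1 else 0))) (circlepath 0 r)" for k
    unfolding f_def by (intro has_contour_integral_lmul contour_integral_powi r)
  have un: "uniform_limit (sphere 0 r) (\<lambda>X w. \<Sum>k\<in>X. f k w) (\<lambda>w. \<Sum>\<^sub>\<infinity>k\<in>A. f k w) (finite_subsets_at_top A)"
  proof (rule Weierstrass_m_test_general)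
    show "(\<lambda>k. norm (c k) * r powi b k * (1 / (2 * pi * r))) summable_on A"
      by (rule summable_on_cmult_left) (rule sum)
    fix k w assume "w \<in> sphere (0::complex) r"
    then show "norm (f k w) \<le> norm (c k) * r powi b k * (1 / (2 * pi * r))"
      using r by (simp add: f_def norm_mult norm_divide norm_power_int)
  qed
  have "((\<lambda>X. contour_integral (circlepath 0 r) (\<lambda>w. \<Sum>k\<in>X. f k w)) \<longlongrightarrow> contour_integral (circlepath 0 r) (\<lambda>w. \<Sum>\<^sub>\<infinity>k\<in>A. f k w)) (finite_subsets_at_top A)"
  proof (rule contour_integral_uniform_limit_circlepath(2)[OF _ un _ r])
    show "\<forall>\<^sub>F X in finite_subsets_at_top A. (\<lambda>w. \<Sum>k\<in>X. f k w) contour_integrable_on circlepath 0 r"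
    proof (rule eventually_finite_subsets_at_top_weakI)
      fix X :: "'k set" assume "finite X"
      then have "((\<lambda>w. \<Sum>k\<in>X. f k w) has_contour_integral (\<Sum>k\<in>X. c k * (if b k = 0 then 1 else 0))) (circlepath 0 r)"
        by (rule has_contour_integral_sum) (rule int)
      then show "(\<lambda>w. \<Sum>k\<in>X. f k w) contour_integrable_on circlepath 0 r"
        unfolding contour_integrable_on_def by blast
    qed
  qed simp
  moreover have "contour_integral (circlepath 0 r) (\<lambda>w. \<Sum>k\<in>X. f k w) = (\<Sum>k\<in>X. c k * (if b k = 0 then 1 else 0))" if "finite X" for X
    by (rule contour_integral_unique, rule has_contour_integral_sum[OF that]) (rule int)
  ultimately have "((\<lambda>X. \<Sum>k\<in>X. c k * (if b k = 0 then 1 else 0)) \<longlongrightarrow> contour_integral (circlepath 0 r) (\<lambda>w. \<Sum>\<^sub>\<infinity>k\<in>A. f k w)) (finite_subsets_at_top A)"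
    by (subst (asm) tendsto_cong[OF eventually_finite_subsets_at_top_weakI]) auto
  then have "((\<lambda>k. c k * (if b k = 0 then 1 else 0)) has_sum contour_integral (circlepath 0 r) (\<lambda>w. \<Sum>\<^sub>\<infinity>k\<in>A. f k w)) A"
    by (simp add: has_sum_def)
  then have "(\<Sum>\<^sub>\<infinity>k\<in>A. c k * (if b k = 0 then 1 else 0)) = contour_integral (circlepath 0 r) (\<lambda>w. \<Sum>\<^sub>\<infinity>k\<in>A. f k w)"
    by (rule infsumI)
  moreover have "(\<Sum>\<^sub>\<infinity>k\<in>A. c k * (if b k = 0 then 1 else 0)) = (\<Sum>\<^sub>\<infinity>k | k \<in> A \<and> b k = 0. c k)"
    by (rule infsum_cong_neutral) auto
  moreover have "contour_integral (circlepath 0 r) (\<lambda>w. G w / (2 * of_real pi * \<i> * w)) = contour_integral (circlepath 0 r) (\<lambda>w. \<Sum>\<^sub>\<infinity>k\<in>A. f k w)"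
  proof (rule contour_integral_eq)
    fix w assume "w \<in> path_image (circlepath 0 r)"
    then have w: "norm w = r" using r by simp
    have "(\<Sum>\<^sub>\<infinity>k\<in>A. f k w) = (\<Sum>\<^sub>\<infinity>k\<in>A. c k * w powi b k * (1 / (2 * of_real pi * \<i> * w)))"
      by (intro infsum_cong) (simp add: f_def)
    also have "\<dots> = (\<Sum>\<^sub>\<infinity>k\<in>A. c k * w powi b k) * (1 / (2 * of_real pi * \<i> * w))"
      by (rule infsum_cmult_left')
    finally show "G w / (2 * of_real pi * \<i> * w) = (\<Sum>\<^sub>\<infinity>k\<in>A. f k w)" by (simp add: G[OF w])
  qed
  ultimately show ?thesis by simp
qed

definition tor :: "nat \<Rightarrow> real \<Rightarrow> (nat \<Rightarrow> complex) set"
  where "tor n r = {z. (\<forall>i<n. norm (z i) = r) \<and> (\<forall>i\<ge>n. z i = 0)}"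

definition zmon :: "nat \<Rightarrow> (nat \<Rightarrow> 'a::field) \<Rightarrow> (nat \<Rightarrow> int) \<Rightarrow> 'a"
  where "zmon n z al = (\<Prod>i<n. z i powi al i)"

lemma zmon_Suc: "zmon (Suc n) (case_nat w z) al = w powi al 0 * zmon n z (\<lambda>i. al (Suc i))"
  unfolding zmon_def prod.lessThan_Suc_shift by simp

lemma norm_zmon: "z \<in> tor n r \<Longrightarrow> norm (zmon n z al) = zmon n (\<lambda>_. r) al"
  by (simp add: zmon_def tor_def norm_power_int prod_norm[symmetric])

lemma zmon_pos: "0 < r \<Longrightarrow> 0 < zmon n (\<lambda>_. r :: real) al"
  by (simp add: zmon_def prod_pos)

text \<open>The inner integrals keep only terms whose inner exponents are 0; for these the inner
  monomial is 1, so the summability hypothesis carries over to the outer variable.\<close>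

lemma torus_integral_infsum:
  fixes c :: "'k \<Rightarrow> complex" and al :: "'k \<Rightarrow> nat \<Rightarrow> int"
  assumes r: "0 < r" and "(\<lambda>k. norm (c k) * zmon n (\<lambda>_. r) (al k)) summable_on A"
    and "\<And>z. z \<in> tor n r \<Longrightarrow> F z = (\<Sum>\<^sub>\<infinity>k\<in>A. c k * zmon n z (al k))"
  shows "torus_integral n r F = (\<Sum>\<^sub>\<infinity>k | k \<in> A \<and> (\<forall>i<n. al k i = 0). c k)"
  using assms(2,3)
proof (induction n arbitrary: F c al A)
  case 0
  have "(\<lambda>_. 0) \<in> tor 0 r" by (simp add: tor_def)
  from 0(2)[OF this] show ?case by (simp add: zmon_def)
next
  case (Suc n)
  let ?al = "\<lambda>k i. al k (Suc i)"
  let ?A = "{k. k \<in> A \<and> (\<forall>i<n. al k (Suc i) = 0)}"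
  have zm: "zmon (Suc n) (\<lambda>_. r) (al k) = r powi al k 0 * zmon n (\<lambda>_. r) (?al k)" for k
    unfolding zmon_def prod.lessThan_Suc_shift by simp
  have zm0: "zmon n (\<lambda>_. r) (?al k) = 1" if "k \<in> ?A" for k using that by (simp add: zmon_def)
  have inner: "torus_integral n r (\<lambda>z. F (case_nat w z)) = (\<Sum>\<^sub>\<infinity>k\<in>?A. c k * w powi al k 0)" if w: "norm w = r" for w
  proof (rule Suc.IH)
    show "(\<lambda>k. norm (c k * w powi al k 0) * zmon n (\<lambda>_. r) (?al k)) summable_on A"
      using Suc.prems(1) by (simp add: norm_mult norm_power_int w zm mult.assoc)
    fix z assume z: "z \<in> tor n r"
    then have "case_nat w z \<in> tor (Suc n) r" using w by (auto simp: tor_def split: nat.splits)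
    then show "F (case_nat w z) = (\<Sum>\<^sub>\<infinity>k\<in>A. c k * w powi al k 0 * zmon n z (?al k))"
      using Suc.prems(2)[of "case_nat w z"] by (simp add: zmon_Suc mult.assoc)
  qed
  have "torus_integral (Suc n) r F = (\<Sum>\<^sub>\<infinity>k | k \<in> ?A \<and> al k 0 = 0. c k)"
    unfolding torus_integral.simps
  proof (rule circle_integral_infsum[OF r])
    have "(\<lambda>k. norm (c k) * zmon (Suc n) (\<lambda>_. r) (al k)) summable_on ?A"
      by (rule summable_on_subset_banach[OF Suc.prems(1)]) auto
    then show "(\<lambda>k. norm (c k) * r powi al k 0) summable_on ?A"
      by (rule summable_on_cong[THEN iffD1, rotated]) (use zm zm0 in auto)
  qed (rule inner)
  also have "{k. k \<in> ?A \<and> al k 0 = 0} = {k. k \<in> A \<and> (\<forall>i<Suc n. al k i = 0)}"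
    by (auto simp: less_Suc_eq_0_disj)
  finally show ?case .
qed

section \<open>Laurent series on the torus\<close>

definition Zn :: "nat \<Rightarrow> (nat \<Rightarrow> int) set"
  where "Zn n = {al. \<forall>i\<ge>n. al i = 0}"

text \<open>F is given on the torus of radius r by an absolutely convergent Laurent series with
  coefficients c. Exponents vanish from n on, so each monomial has one exponent function.\<close>

definition laurent :: "nat \<Rightarrow> real \<Rightarrow> ((nat \<Rightarrow> int) \<Rightarrow> complex) \<Rightarrow> ((nat \<Rightarrow> complex) \<Rightarrow> complex) \<Rightarrow> bool"
  where "laurent n r c F \<longleftrightarrow> (\<lambda>al. norm (c al) * zmon n (\<lambda>_. r) al) summable_on Zn n \<and>
    (\<forall>z\<in>tor n r. ((\<lambda>al. c al * zmon n z al) has_sum F z) (Zn n))"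

lemma laurent_summable: "laurent n r c F \<Longrightarrow> (\<lambda>al. norm (c al) * zmon n (\<lambda>_. r) al) summable_on Zn n"
  and laurent_has_sum: "laurent n r c F \<Longrightarrow> z \<in> tor n r \<Longrightarrow> ((\<lambda>al. c al * zmon n z al) has_sum F z) (Zn n)"
  by (auto simp: laurent_def)

lemma zmon_add: "0 < r \<Longrightarrow> z \<in> tor n r \<Longrightarrow> zmon n z (\<lambda>i. al i + be i) = zmon n z al * zmon n z be"
  unfolding zmon_def prod.distrib[symmetric]
  by (intro prod.cong) (auto simp: tor_def intro!: power_int_add)

lemma zmon_add_real: "0 < r \<Longrightarrow> zmon n (\<lambda>_. r) (\<lambda>i. al i + be i) = zmon n (\<lambda>_. r) al * zmon n (\<lambda>_. r :: real) be"
  unfolding zmon_def prod.distrib[symmetric] by (intro prod.cong) (auto intro!: power_int_add)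

text \<open>The monomial with exponent \<beta>, multiplied by a Laurent series, has as its constant
  term the coefficient of the series at -\<beta>. The index set may be infinite, so joint
  summability is assumed.\<close>

lemma torus_integral_laurent:
  fixes c :: "'k \<Rightarrow> complex" and be :: "'k \<Rightarrow> nat \<Rightarrow> int"
  assumes r: "0 < r" and D: "\<And>k. k \<in> A \<Longrightarrow> laurent n r (d k) (D k)" and be: "\<And>k. k \<in> A \<Longrightarrow> be k \<in> Zn n"
    and sum: "(\<lambda>(k, al). norm (c k) * zmon n (\<lambda>_. r) (be k) * (norm (d k al) * zmon n (\<lambda>_. r) al)) summable_on A \<times> Zn n"
    and F: "\<And>z. z \<in> tor n r \<Longrightarrow> F z = (\<Sum>\<^sub>\<infinity>k\<in>A. c k * zmon n z (be k) * D k z)"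
  shows "torus_integral n r F = (\<Sum>\<^sub>\<infinity>k\<in>A. c k * d k (\<lambda>i. - be k i))"
    and "(\<lambda>k. norm (c k * d k (\<lambda>i. - be k i))) summable_on A"
proof -
  define C where "C = (\<lambda>(k, al). c k * d k al)"
  define E where "E = (\<lambda>(k, al) i. be k i + al i :: int)"
  have nC: "norm (C p) * zmon n (\<lambda>_. r) (E p) = (case p of (k, al) \<Rightarrow> norm (c k) * zmon n (\<lambda>_. r) (be k) * (norm (d k al) * zmon n (\<lambda>_. r) al))" for p
    by (cases p) (simp add: C_def E_def norm_mult zmon_add_real[OF r])
  have sumC: "(\<lambda>p. norm (C p) * zmon n (\<lambda>_. r) (E p)) summable_on A \<times> Zn n"
    unfolding nC by (rule sum)
  have FC: "F z = (\<Sum>\<^sub>\<infinity>p\<in>A \<times> Zn n. C p * zmon n z (E p))" if z: "z \<in> tor n r" for z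
  proof -
    have abs: "(\<lambda>p. norm (C p * zmon n z (E p))) summable_on A \<times> Zn n"
      using sumC by (simp add: norm_mult norm_zmon[OF z])
    have "(\<Sum>\<^sub>\<infinity>p\<in>A \<times> Zn n. C p * zmon n z (E p)) = (\<Sum>\<^sub>\<infinity>k\<in>A. \<Sum>\<^sub>\<infinity>al\<in>Zn n. C (k, al) * zmon n z (E (k, al)))"
      by (rule infsum_Sigma_banach[symmetric, unfolded case_prod_unfold, simplified])
        (use abs_summable_summable[OF abs] in simp)
    also have "\<dots> = (\<Sum>\<^sub>\<infinity>k\<in>A. c k * zmon n z (be k) * D k z)"
    proof (rule infsum_cong)
      fix k assume k: "k \<in> A"
      have "((\<lambda>al. c k * zmon n z (be k) * (d k al * zmon n z al)) has_sum c k * zmon n z (be k) * D k z) (Zn n)"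
        by (intro has_sum_cmult_right laurent_has_sum[OF D[OF k] z])
      then have "((\<lambda>al. C (k, al) * zmon n z (E (k, al))) has_sum c k * zmon n z (be k) * D k z) (Zn n)"
        by (simp add: C_def E_def zmon_add[OF r z] mult_ac)
      then show "(\<Sum>\<^sub>\<infinity>al\<in>Zn n. C (k, al) * zmon n z (E (k, al))) = c k * zmon n z (be k) * D k z"
        by (rule infsumI)
    qed
    finally show ?thesis using F[OF z] by simp
  qed
  let ?B = "{p. p \<in> A \<times> Zn n \<and> (\<forall>i<n. E p i = 0)}"
  have bij: "bij_betw (\<lambda>k. (k, \<lambda>i. - be k i)) A ?B"
  proof (rule bij_betwI[where g = fst])
    show "(\<lambda>k. (k, \<lambda>i. - be k i)) \<in> A \<rightarrow> ?B" using be by (auto simp: E_def Zn_def)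
    fix p assume p: "p \<in> ?B"
    obtain k al where kal: "p = (k, al)" by (cases p)
    have "al i = - be k i" for i
      using p be[of k] by (cases "i < n") (auto simp: kal E_def Zn_def eq_neg_iff_add_eq_0 add.commute not_less)
    then show "(fst p, \<lambda>i. - be (fst p) i) = p" by (auto simp: kal)
  qed auto
  have "torus_integral n r F = (\<Sum>\<^sub>\<infinity>p\<in>?B. C p)"
    by (rule torus_integral_infsum[OF r sumC FC])
  also have "\<dots> = (\<Sum>\<^sub>\<infinity>k\<in>A. C (k, \<lambda>i. - be k i))"
    by (rule infsum_reindex_bij_betw[OF bij, symmetric])
  finally show "torus_integral n r F = (\<Sum>\<^sub>\<infinity>k\<in>A. c k * d k (\<lambda>i. - be k i))" by (simp add: C_def)
  have "(\<lambda>p. norm (C p) * zmon n (\<lambda>_. r) (E p)) summable_on ?B"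
    by (rule summable_on_subset_banach[OF sumC]) auto
  then have "(\<lambda>p. norm (C p)) summable_on ?B"
    by (rule summable_on_cong[THEN iffD1, rotated]) (auto simp: zmon_def)
  then have "(\<lambda>k. norm (C (k, \<lambda>i. - be k i))) summable_on A"
    using summable_on_reindex_bij_betw[OF bij, of "\<lambda>p. norm (C p)"] by simp
  then show "(\<lambda>k. norm (c k * d k (\<lambda>i. - be k i))) summable_on A" by (simp add: C_def)
qed

lemma summable_on_product_nonneg:
  fixes f :: "'a \<Rightarrow> real" and g :: "'b \<Rightarrow> real"
  assumes "f summable_on A" "g summable_on B" "\<And>x. 0 \<le> f x" "\<And>x. 0 \<le> g x"
  shows "(\<lambda>(x, y). f x * g y) summable_on A \<times> B"
proof (rule summable_on_SigmaI)
  show "((\<lambda>y. case (x, y) of (x, y) \<Rightarrow> f x * g y) has_sum f x * infsum g B) B" for x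
    using assms(2) by (simp add: has_sum_cmult_right)
  show "(\<lambda>x. f x * infsum g B) summable_on A" by (rule summable_on_cmult_left[OF assms(1)])
qed (use assms in auto)

lemma has_sum_product_banach:
  fixes f :: "'a \<Rightarrow> 'c :: {real_normed_field, banach}"
  assumes f: "(f has_sum S) A" and g: "(g has_sum T) B" and s: "(\<lambda>(x, y). f x * g y) summable_on A \<times> B"
  shows "((\<lambda>(x, y). f x * g y) has_sum S * T) (A \<times> B)"
proof -
  obtain U where U: "((\<lambda>(x, y). f x * g y) has_sum U) (A \<times> B)" using s by (auto simp: summable_on_def)
  have "((\<lambda>x. f x * T) has_sum U) A"
    by (rule has_sum_SigmaD[OF U]) (auto intro: has_sum_cmult_right g)
  moreover have "((\<lambda>x. f x * T) has_sum S * T) A" by (rule has_sum_cmult_left[OF f])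
  ultimately have "U = S * T" by (rule has_sum_unique)
  then show ?thesis using U by simp
qed

definition conv :: "nat \<Rightarrow> ((nat \<Rightarrow> int) \<Rightarrow> complex) \<Rightarrow> ((nat \<Rightarrow> int) \<Rightarrow> complex) \<Rightarrow> (nat \<Rightarrow> int) \<Rightarrow> complex"
  where "conv n c d ga = (\<Sum>\<^sub>\<infinity>al\<in>Zn n. c al * d (\<lambda>i. ga i - al i))"

text \<open>The double series is reindexed by (\<gamma>, \<alpha>) with the second exponent equal to
  \<gamma> - \<alpha>; absolute summability of the product allows summing over \<alpha>
  first.\<close>

lemma laurent_mult:
  assumes r: "0 < r" and c: "laurent n r c F" and d: "laurent n r d G"
  shows "laurent n r (conv n c d) (\<lambda>z. F z * G z)"
proof -
  define N where "N = (\<lambda>(al, be). norm (c al) * zmon n (\<lambda>_. r) al * (norm (d be) * zmon n (\<lambda>_. r) be))"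
  have nn: "0 \<le> norm (c al) * zmon n (\<lambda>_. r) al" "0 \<le> norm (d al) * zmon n (\<lambda>_. r) al" for al
    using zmon_pos[OF r, of n al] by auto
  have sumN: "N summable_on Zn n \<times> Zn n"
  proof -
    show ?thesis unfolding N_def by (rule summable_on_product_nonneg laurent_summable[OF c] laurent_summable[OF d] nn)+
  qed
  define sh where "sh = (\<lambda>(ga, al). (al, \<lambda>i::nat. ga i - al i :: int))"
  have bij: "bij_betw sh (Zn n \<times> Zn n) (Zn n \<times> Zn n)"
    by (rule bij_betwI[where g = "\<lambda>(al, be). (\<lambda>i. al i + be i, al)"]) (auto simp: sh_def Zn_def)
  have sumN': "(\<lambda>p. N (sh p)) summable_on Zn n \<times> Zn n"
    using summable_on_reindex_bij_betw[OF bij, of N] sumN by simp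
  define T where "T = (\<lambda>(ga, al). c al * d (\<lambda>i. ga i - al i))"
  have NT: "N (sh (ga, al)) = norm (T (ga, al)) * zmon n (\<lambda>_. r) ga" for ga al
    using zmon_add_real[OF r, of n al "\<lambda>i. ga i - al i"] by (simp add: N_def sh_def T_def norm_mult)
  have s1: "(\<lambda>p. norm (T p) * zmon n (\<lambda>_. r) (fst p)) summable_on Zn n \<times> Zn n"
    using sumN' by (rule summable_on_cong[THEN iffD1, rotated]) (auto simp: NT)
  have in1: "(\<lambda>al. norm (T (ga, al))) summable_on Zn n" if "ga \<in> Zn n" for ga
  proof -
    have sm: "(\<lambda>al. norm (T (ga, al)) * zmon n (\<lambda>_. r) ga) summable_on Zn n"
      using summable_on_SigmaD1[of "\<lambda>ga al. norm (T (ga, al)) * zmon n (\<lambda>_. r) ga" "Zn n" "\<lambda>_. Zn n" ga] s1 that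
      by (simp add: case_prod_unfold)
    have nz: "zmon n (\<lambda>_. r) ga \<noteq> 0" using zmon_pos[OF r, of n ga] by simp
    show ?thesis by (rule summable_on_cmult_left'[OF nz, THEN iffD1, OF sm])
  qed
  have "(\<lambda>ga. (\<Sum>\<^sub>\<infinity>al\<in>Zn n. norm (T (ga, al)) * zmon n (\<lambda>_. r) ga)) summable_on Zn n"
    using summable_on_Sigma_banach[of "\<lambda>ga al. norm (T (ga, al)) * zmon n (\<lambda>_. r) ga" "Zn n" "\<lambda>_. Zn n"] s1
    by (simp add: case_prod_unfold)
  then have "(\<lambda>ga. norm (conv n c d ga) * zmon n (\<lambda>_. r) ga) summable_on Zn n"
  proof (rule summable_on_comparison_test)
    fix ga assume ga: "ga \<in> Zn n"
    have "norm (conv n c d ga) \<le> (\<Sum>\<^sub>\<infinity>al\<in>Zn n. norm (T (ga, al)))"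
      unfolding conv_def using norm_infsum_bound[OF in1[OF ga]] by (simp add: T_def)
    then show "norm (conv n c d ga) * zmon n (\<lambda>_. r) ga \<le> (\<Sum>\<^sub>\<infinity>al\<in>Zn n. norm (T (ga, al)) * zmon n (\<lambda>_. r) ga)"
      using zmon_pos[OF r, of n ga] by (simp add: infsum_cmult_left' mult_right_mono)
    show "0 \<le> norm (conv n c d ga) * zmon n (\<lambda>_. r) ga" using zmon_pos[OF r, of n ga] by simp
  qed
  moreover have "((\<lambda>ga. conv n c d ga * zmon n z ga) has_sum F z * G z) (Zn n)" if z: "z \<in> tor n r" for z
  proof -
    have hs: "((\<lambda>(al, be). c al * zmon n z al * (d be * zmon n z be)) has_sum F z * G z) (Zn n \<times> Zn n)"
    proof (rule has_sum_product_banach)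
      show "((\<lambda>al. c al * zmon n z al) has_sum F z) (Zn n)" by (rule laurent_has_sum[OF c z])
      show "((\<lambda>al. d al * zmon n z al) has_sum G z) (Zn n)" by (rule laurent_has_sum[OF d z])
      have "(\<lambda>p. norm (case p of (al, be) \<Rightarrow> c al * zmon n z al * (d be * zmon n z be))) summable_on Zn n \<times> Zn n"
        using sumN by (rule summable_on_cong[THEN iffD1, rotated]) (auto simp: N_def norm_mult norm_zmon[OF z])
      then show "(\<lambda>(al, be). c al * zmon n z al * (d be * zmon n z be)) summable_on Zn n \<times> Zn n"
        by (rule abs_summable_summable)
    qed
    have eq: "(case sh (ga, al) of (al, be) \<Rightarrow> c al * zmon n z al * (d be * zmon n z be)) = T (ga, al) * zmon n z ga" for ga al
      using zmon_add[OF r z, of al "\<lambda>i. ga i - al i"] by (simp add: sh_def T_def)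
    have hs': "((\<lambda>p. T p * zmon n z (fst p)) has_sum F z * G z) (Zn n \<times> Zn n)"
    proof -
      have "((\<lambda>p. case sh p of (al, be) \<Rightarrow> c al * zmon n z al * (d be * zmon n z be)) has_sum F z * G z) (Zn n \<times> Zn n)"
        by (rule has_sum_reindex_bij_betw[OF bij, THEN iffD2, OF hs])
      moreover have "(case sh p of (al, be) \<Rightarrow> c al * zmon n z al * (d be * zmon n z be)) = T p * zmon n z (fst p)" for p
        using eq[of "fst p" "snd p"] by simp
      ultimately show ?thesis by (simp only:)
    qed
    show ?thesis
    proof (rule has_sum_SigmaD[OF hs'])
      fix ga assume ga: "ga \<in> Zn n"
      have "((\<lambda>al. T (ga, al)) has_sum conv n c d ga) (Zn n)"
        unfolding conv_def using has_sum_infsum[OF abs_summable_summable[OF in1[OF ga]]] by (simp add: T_def)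
      then show "((\<lambda>al. T (ga, al) * zmon n z (fst (ga, al))) has_sum conv n c d ga * zmon n z ga) (Zn n)"
        by (simp add: has_sum_cmult_left)
    qed
  qed
  ultimately show ?thesis by (simp add: laurent_def)
qed

lemma conv_nonzero:
  assumes "conv n c d ga \<noteq> 0"
  obtains al where "c al \<noteq> 0" "d (\<lambda>i. ga i - al i) \<noteq> 0"
proof -
  have "\<exists>al. c al \<noteq> 0 \<and> d (\<lambda>i. ga i - al i) \<noteq> 0"
  proof (rule ccontr)
    assume "\<not> ?thesis"
    then have "conv n c d ga = (\<Sum>\<^sub>\<infinity>al\<in>Zn n. 0)" unfolding conv_def by (intro infsum_cong) auto
    then show False using assms by simp
  qed
  then show thesis using that by blast
qed

definition expo :: "nat \<Rightarrow> nat \<Rightarrow> int \<Rightarrow> nat \<Rightarrow> int"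
  where "expo i j k = (\<lambda>x. if x = i then k else if x = j then - k else 0)"

definition fac :: "real \<Rightarrow> nat \<Rightarrow> nat \<Rightarrow> (nat \<Rightarrow> complex) \<Rightarrow> complex"
  where "fac s i j z = (1 - z i * inverse (z j)) / (1 - of_real s * z i * inverse (z j))"

lemma zmon_expo:
  fixes z :: "nat \<Rightarrow> 'a::field"
  assumes "i < n" "j < n" "i \<noteq> j"
  shows "zmon n z (expo i j (int k)) = (z i * inverse (z j)) ^ k"
proof -
  have "zmon n z (expo i j (int k)) = (\<Prod>x<n. (if x = i then z i ^ k else 1) * (if x = j then inverse (z j) ^ k else 1))"
    unfolding zmon_def by (rule prod.cong) (use assms in \<open>auto simp: expo_def power_int_def\<close>)
  then show ?thesis using assms by (simp add: prod.distrib prod.delta power_mult_distrib)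
qed

lemma laurent_fac:
  assumes r: "0 < r" and s: "0 \<le> s" "s < 1" and ij: "i < n" "j < n" "i \<noteq> j"
  shows "\<exists>c. laurent n r c (fac s i j) \<and> (\<forall>al. c al \<noteq> 0 \<longrightarrow> (\<exists>k::nat. al = expo i j (int k))) \<and> c (\<lambda>_. 0) = 1"
proof -
  \<comment> \<open>(1 - x) / (1 - s x) = 1 + \<Sum> (s^k - s^(k-1)) x^k over positive k, applied
    with x = z_i / z_j of modulus 1.\<close>
  define cc where "cc k = (if k = 0 then 1 else of_real (s ^ k - s ^ (k - 1)) :: complex)" for k :: nat
  define g where "g k = expo i j (int k)" for k :: nat
  have gi: "g k i = int k" for k by (simp add: g_def expo_def)
  have inj: "inj g" by (rule injI) (metis gi of_nat_eq_iff)
  define c where "c al = (if al \<in> range g then cc (nat (al i)) else 0)" for al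
  have cg: "c (g k) = cc k" for k by (simp add: c_def gi)
  have gZ: "range g \<subseteq> Zn n" using ij by (auto simp: g_def expo_def Zn_def)
  have ncc: "summable (\<lambda>k. norm (cc k))"
  proof (rule summable_comparison_test')
    have "summable (\<lambda>k. s ^ k + s ^ k)" by (intro summable_add summable_geometric) (use s in auto)
    then have "summable (\<lambda>k. s ^ (Suc k - 1) + s ^ (Suc k - 1))" by simp
    then show "summable (\<lambda>k. s ^ (k - 1) + s ^ (k - 1))" by (subst (asm) summable_Suc_iff)
    fix k :: nat assume "k \<ge> 0"
    have "s ^ k \<le> s ^ (k - 1)" "0 \<le> s ^ k" "0 \<le> s ^ (k - 1)" using s by (auto intro: power_decreasing)
    moreover have "- (s ^ k) \<le> s ^ (k - 1)"
      using zero_le_power[OF s(1), of k] zero_le_power[OF s(1), of "k - 1"] by linarith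
    ultimately show "norm (norm (cc k)) \<le> s ^ (k - 1) + s ^ (k - 1)" using s by (auto simp: cc_def simp flip: of_real_power of_real_diff)
  qed
  have to_Zn: "((\<lambda>al. c al * zmon n z al) has_sum S) (Zn n)" if "((\<lambda>k. cc k * zmon n z (g k)) has_sum S) UNIV" for z :: "nat \<Rightarrow> complex" and S
  proof -
    have "((\<lambda>al. c al * zmon n z al) has_sum S) (range g)"
      unfolding has_sum_reindex[OF inj] using that by (simp add: comp_def cg)
    then show ?thesis
      by (rule has_sum_cong_neutral[THEN iffD1, rotated -1]) (use gZ in \<open>auto simp: c_def\<close>)
  qed
  have "laurent n r c (fac s i j)" unfolding laurent_def
  proof (intro conjI ballI)
    have "(\<lambda>k. norm (cc k)) summable_on UNIV" using ncc by (simp add: norm_summable_imp_summable_on)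
    then have "(\<lambda>al. norm (c al) * zmon n (\<lambda>_. r) al) summable_on range g"
    proof -
      have "zmon n (\<lambda>_. r) (g k) = 1" for k using r ij by (simp add: g_def zmon_expo)
      then have "(\<lambda>al. norm (c al) * zmon n (\<lambda>_. r) al) \<circ> g = (\<lambda>k. norm (cc k))" by (auto simp: cg)
      then show ?thesis unfolding summable_on_reindex[OF inj] using \<open>(\<lambda>k. norm (cc k)) summable_on UNIV\<close> by simp
    qed
    then show "(\<lambda>al. norm (c al) * zmon n (\<lambda>_. r) al) summable_on Zn n"
      by (rule summable_on_cong_neutral[THEN iffD1, rotated -1]) (use gZ in \<open>auto simp: c_def\<close>)
  next
    fix z assume z: "z \<in> tor n r"
    define x where "x = z i * inverse (z j)"
    have nx: "norm x = 1" using z ij r by (simp add: x_def tor_def norm_mult norm_inverse)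
    have sx: "norm (of_real s * x) < 1" using s nx by (simp add: norm_mult)
    have sums1: "(\<lambda>k. (of_real s * x) ^ k) sums (1 / (1 - of_real s * x))" by (rule geometric_sums[OF sx])
    have "(\<lambda>k. if k = 0 then 0 else of_real (s ^ (k - 1)) * x ^ k) sums (x * (1 / (1 - of_real s * x)))"
    proof -
      have "(\<lambda>k. x * (of_real s * x) ^ k) sums (x * (1 / (1 - of_real s * x)))" by (rule sums_mult[OF sums1])
      then have "(\<lambda>k. if Suc k = 0 then 0 else of_real (s ^ (Suc k - 1)) * x ^ Suc k) sums (x * (1 / (1 - of_real s * x)))"
        by (simp add: power_mult_distrib mult_ac)
      then show ?thesis by (subst (asm) sums_Suc_iff) simp
    qed
    from sums_diff[OF sums1 this]
    have "(\<lambda>k. cc k * x ^ k) sums (1 / (1 - of_real s * x) - x * (1 / (1 - of_real s * x)))"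
      by (rule sums_cong[THEN iffD1, rotated]) (auto simp: cc_def power_mult_distrib algebra_simps)
    moreover have "1 / (1 - of_real s * x) - x * (1 / (1 - of_real s * x)) = fac s i j z"
      by (simp add: fac_def x_def diff_divide_distrib mult.assoc)
    ultimately have "(\<lambda>k. cc k * x ^ k) sums fac s i j z" by simp
    have ns: "summable (\<lambda>k. norm (cc k * x ^ k))" using ncc nx by (simp add: norm_mult norm_power)
    have "((\<lambda>k. cc k * x ^ k) has_sum fac s i j z) UNIV"
      by (rule norm_summable_imp_has_sum[OF ns]) fact
    then show "((\<lambda>al. c al * zmon n z al) has_sum fac s i j z) (Zn n)"
      by (intro to_Zn) (simp add: g_def zmon_expo[OF ij] x_def)
  qed
  moreover have "c (\<lambda>_. 0) = 1"
  proof -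
    have "g 0 = (\<lambda>_. 0)" by (auto simp: g_def expo_def)
    then show ?thesis using cg[of 0] by (simp add: cc_def)
  qed
  moreover have "\<forall>al. c al \<noteq> 0 \<longrightarrow> (\<exists>k::nat. al = expo i j (int k))"
    by (auto simp: c_def g_def split: if_splits)
  ultimately show ?thesis by blast
qed

lemma laurent_1: "laurent n r (\<lambda>al. if al = (\<lambda>_. 0) then 1 else 0) (\<lambda>_. 1)"
proof -
  have Z: "(\<lambda>_. 0) \<in> Zn n" by (simp add: Zn_def)
  have zm: "zmon n z (\<lambda>_. 0) = 1" for z :: "nat \<Rightarrow> 'a::field" by (simp add: zmon_def)
  have "((\<lambda>al. (if al = (\<lambda>_. 0) then 1 else 0) * zmon n z al) has_sum 1) (Zn n)" for z :: "nat \<Rightarrow> complex"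
  proof -
    have "((\<lambda>al. (if al = (\<lambda>_. 0) then 1 else 0) * zmon n z al) has_sum (\<Sum>al\<in>{\<lambda>_. 0}. (if al = (\<lambda>_. 0) then 1 else 0) * zmon n z al)) {\<lambda>_. 0}"
      by (rule has_sum_finite) simp
    then have "((\<lambda>al. (if al = (\<lambda>_. 0) then 1 else 0) * zmon n z al) has_sum 1) {\<lambda>_. 0}" by (simp add: zm)
    then show ?thesis by (rule has_sum_cong_neutral[THEN iffD1, rotated -1]) (use Z in auto)
  qed
  moreover have "(\<lambda>al. norm (if al = (\<lambda>_. 0) then 1 else 0 :: complex) * zmon n (\<lambda>_. r) al) summable_on Zn n"
  proof -
    have "(\<lambda>al. norm (if al = (\<lambda>_. 0) then 1 else 0 :: complex) * zmon n (\<lambda>_. r) al) summable_on {\<lambda>_. 0}" by simp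
    then show ?thesis by (rule summable_on_cong_neutral[THEN iffD1, rotated -1]) (use Z in auto)
  qed
  ultimately show ?thesis by (simp add: laurent_def)
qed

text \<open>C is an additively closed set containing the exponents of all factors, hence also those
  of the product. If C contains no two opposite nonzero exponents, the constant term of the product
  arises only from the constant terms 1 of the factors.\<close>

lemma laurent_prod_fac:
  assumes r: "0 < r" and s: "0 \<le> s" "s < 1"
    and C: "(\<lambda>_. 0) \<in> C" "\<And>al be. al \<in> C \<Longrightarrow> be \<in> C \<Longrightarrow> (\<lambda>i. al i + be i) \<in> C"
    and S: "finite S" "\<And>i j. (i, j) \<in> S \<Longrightarrow> i < n \<and> j < n \<and> i \<noteq> j"
      "\<And>i j k. (i, j) \<in> S \<Longrightarrow> expo i j (int k) \<in> C"
  shows "\<exists>c. laurent n r c (\<lambda>z. \<Prod>(i, j)\<in>S. fac s i j z) \<and> (\<forall>al. c al \<noteq> 0 \<longrightarrow> al \<in> C) \<and>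
    ((\<forall>al\<in>C. (\<lambda>i. - al i) \<in> C \<longrightarrow> al = (\<lambda>_. 0)) \<longrightarrow> c (\<lambda>_. 0) = 1)"
  using S
proof (induction S rule: finite_induct)
  case empty
  show ?case
  proof (intro exI[of _ "\<lambda>al. if al = (\<lambda>_. 0) then 1 else 0"] conjI allI impI)
    show "laurent n r (\<lambda>al. if al = (\<lambda>_. 0) then 1 else 0) (\<lambda>z. \<Prod>(i, j)\<in>{}. fac s i j z)"
      unfolding prod.empty by (rule laurent_1)
    show "al \<in> C" if "(if al = (\<lambda>_. 0) then 1 else 0 :: complex) \<noteq> 0" for al using that C(1) by (simp split: if_splits)
  qed simp
next
  case (insert p S)
  obtain i j where p: "p = (i, j)" by (cases p)
  have ij: "i < n" "j < n" "i \<noteq> j" using insert.prems(1)[of i j] p by simp_all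
  have eC: "expo i j (int k) \<in> C" for k using insert.prems(2)[of i j k] p by simp
  obtain d where d: "laurent n r d (fac s i j)" "\<And>al. d al \<noteq> 0 \<Longrightarrow> \<exists>k::nat. al = expo i j (int k)" "d (\<lambda>_. 0) = 1"
    using laurent_fac[OF r s ij] by metis
  have dC: "al \<in> C" if "d al \<noteq> 0" for al using d(2)[OF that] eC by auto
  have "\<exists>c. laurent n r c (\<lambda>z. \<Prod>(i, j)\<in>S. fac s i j z) \<and> (\<forall>al. c al \<noteq> 0 \<longrightarrow> al \<in> C) \<and>
      ((\<forall>al\<in>C. (\<lambda>i. - al i) \<in> C \<longrightarrow> al = (\<lambda>_. 0)) \<longrightarrow> c (\<lambda>_. 0) = 1)"
    by (rule insert.IH) (use insert.prems in auto)
  then obtain c where c0: "laurent n r c (\<lambda>z. \<Prod>(i, j)\<in>S. fac s i j z) \<and> (\<forall>al. c al \<noteq> 0 \<longrightarrow> al \<in> C) \<and>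
      ((\<forall>al\<in>C. (\<lambda>i. - al i) \<in> C \<longrightarrow> al = (\<lambda>_. 0)) \<longrightarrow> c (\<lambda>_. 0) = 1)" ..
  note c = c0[THEN conjunct1] c0[THEN conjunct2, THEN conjunct1, rule_format] c0[THEN conjunct2, THEN conjunct2, THEN mp]
  have "laurent n r (conv n d c) (\<lambda>z. \<Prod>(i, j)\<in>insert p S. fac s i j z)"
    using laurent_mult[OF r d(1) c(1)] insert.hyps by (simp add: p)
  moreover have "ga \<in> C" if nz: "conv n d c ga \<noteq> 0" for ga
  proof -
    obtain al where "d al \<noteq> 0" "c (\<lambda>i. ga i - al i) \<noteq> 0" using nz by (rule conv_nonzero)
    then have "(\<lambda>i. al i + (ga i - al i)) \<in> C" by (intro C(2) dC c(2))
    then show ?thesis by simp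
  qed
  moreover have "conv n d c (\<lambda>_. 0) = 1" if pt: "\<forall>al\<in>C. (\<lambda>i. - al i) \<in> C \<longrightarrow> al = (\<lambda>_. 0)"
  proof -
    have "conv n d c (\<lambda>_. 0) = (\<Sum>\<^sub>\<infinity>al\<in>{\<lambda>_. 0}. d al * c (\<lambda>i. 0 - al i))"
      unfolding conv_def
    proof (rule infsum_cong_neutral)
      fix al assume al: "al \<in> Zn n - {\<lambda>_. 0}"
      show "d al * c (\<lambda>i. 0 - al i) = 0"
      proof (rule ccontr)
        assume "d al * c (\<lambda>i. 0 - al i) \<noteq> 0"
        then have "d al \<noteq> 0" "c (\<lambda>i. - al i) \<noteq> 0" by simp_all
        then have "al \<in> C" "(\<lambda>i. - al i) \<in> C" using dC c(2) by blast+
        then show False using pt al by blast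
      qed
    qed (auto simp: Zn_def)
    then show ?thesis using d(3) c(3)[OF pt] by simp
  qed
  ultimately show ?case by (intro exI[of _ "conv n d c"] conjI allI impI)
qed

section \<open>Torus orthogonality\<close>

lemma exponents_superset:
  assumes "finite K" "set_mset M \<subseteq> K"
  shows "exponents M = filter_mset (\<lambda>x. x \<noteq> 0) (image_mset (count M) (mset_set K))"
proof -
  have "{x \<in> K. count M x \<noteq> 0} = set_mset M" using assms by (auto simp: count_eq_zero_iff)
  then show ?thesis using assms by (simp add: filter_mset_image_mset exponents_def)
qed

lemma mset_sum_replicate: "finite K \<Longrightarrow> count (\<Sum>x\<in>K. replicate_mset (f x) x) y = (if y \<in> K then f y else 0)"
  by (induction K rule: finite_induct) auto

primrec pairs_before :: "nat list \<Rightarrow> (nat \<times> nat) set" where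
  "pairs_before [] = {}"
| "pairs_before (x # l) = Pair x ` set l \<union> pairs_before l"

lemma pairs_before_subset: "(i, j) \<in> pairs_before l \<Longrightarrow> i \<in> set l \<and> j \<in> set l"
  by (induction l) auto

lemma finite_pairs_before [simp]: "finite (pairs_before l)"
  by (induction l) auto

lemma pairs_before_neq: "distinct l \<Longrightarrow> (i, j) \<in> pairs_before l \<Longrightarrow> i \<noteq> j"
  by (induction l) auto

lemma pairs_before_take:
  "distinct l \<Longrightarrow> (i, j) \<in> pairs_before l \<Longrightarrow> j \<in> set (take k l) \<Longrightarrow> i \<in> set (take k l)"
proof (induction l arbitrary: k)
  case (Cons x l)
  show ?case
  proof (cases k)
    case (Suc m)
    then show ?thesis using Cons pairs_before_subset[of i j l] by auto
  qed (use Cons in simp)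
qed simp

text \<open>The exponent received by variable x when the list al is laid along the ordering l of the
  variables; 0 for variables outside l.\<close>

definition lex :: "nat list \<Rightarrow> nat list \<Rightarrow> nat \<Rightarrow> nat"
  where "lex al l x = (case map_of (zip l al) x of None \<Rightarrow> 0 | Some a \<Rightarrow> a)"

lemma lex_Cons: "lex (a # al) (x # l) y = (if y = x then a else lex al l y)"
  by (simp add: lex_def)

lemma lex_notin: "x \<notin> set l \<Longrightarrow> lex al l x = 0"
  by (auto simp: lex_def map_of_eq_None_iff dest: set_zip_leftD split: option.splits dest!: map_of_SomeD)

lemma sum_lex_take: "distinct l \<Longrightarrow> length al = length l \<Longrightarrow> (\<Sum>x\<in>set (take k l). lex al l x) = sum_list (take k al)"
proof (induction al l arbitrary: k rule: list_induct2')
  case (4 a al x l)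
  show ?case
  proof (cases k)
    case (Suc m)
    have "x \<notin> set (take m l)" using 4(2) by (auto dest: in_set_takeD)
    moreover have "(\<Sum>y\<in>set (take m l). lex (a # al) (x # l) y) = (\<Sum>y\<in>set (take m l). lex al l y)"
      using \<open>x \<notin> set (take m l)\<close> by (intro sum.cong) (auto simp: lex_Cons)
    ultimately show ?thesis using 4 Suc by (simp add: lex_Cons)
  qed simp
qed auto

lemma map_lex: "distinct l \<Longrightarrow> length al = length l \<Longrightarrow> map (lex al l) l = al"
proof (induction al l rule: list_induct2')
  case (4 a al x l)
  have "map (lex (a # al) (x # l)) l = map (lex al l) l" using 4(2) by (intro map_cong refl) (auto simp: lex_Cons)
  also have "\<dots> = al" using 4 by simp
  finally show ?case by (metis lex_Cons list.simps(9))
qed auto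

text \<open>Exponents of total 0 with nonnegative partial sums along l. All z_i / z_j with i before
  j in l lie in this cone, and partial sums are what dominance compares.\<close>

definition cone :: "nat \<Rightarrow> nat list \<Rightarrow> (nat \<Rightarrow> int) set"
  where "cone n l = {al \<in> Zn n. (\<Sum>i<n. al i) = 0 \<and> (\<forall>k. 0 \<le> (\<Sum>i\<in>set (take k l). al i))}"

lemma cone_0: "(\<lambda>_. 0) \<in> cone n l"
  by (simp add: cone_def Zn_def)

lemma cone_add: "al \<in> cone n l \<Longrightarrow> be \<in> cone n l \<Longrightarrow> (\<lambda>i. al i + be i) \<in> cone n l"
  by (auto simp: cone_def Zn_def sum.distrib)

lemma take_sums_zero:
  "distinct l \<Longrightarrow> (\<And>k. (\<Sum>i\<in>set (take k l). al i) = (0::int)) \<Longrightarrow> x \<in> set l \<Longrightarrow> al x = 0"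
proof (induction l)
  case (Cons y l)
  have y: "al y = 0" using Cons.prems(2)[of 1] by simp
  show ?case
  proof (cases "x = y")
    case False
    have "(\<Sum>i\<in>set (take k l). al i) = 0" for k
    proof -
      have "y \<notin> set (take k l)" using Cons.prems(1) by (auto dest: in_set_takeD)
      then show ?thesis using Cons.prems(2)[of "Suc k"] y by simp
    qed
    then show ?thesis using Cons False by auto
  qed (simp add: y)
qed simp

lemma cone_pointed:
  assumes "distinct l" "set l = {..<n}" "al \<in> cone n l" "(\<lambda>i. - al i) \<in> cone n l"
  shows "al = (\<lambda>_. 0)"
proof
  fix x
  have "(\<Sum>i\<in>set (take k l). al i) = 0" for k
    using assms(3,4) by (auto simp: cone_def sum_negf intro: antisym)
  then show "al x = 0"
    using take_sums_zero[OF assms(1), of al x] assms(2,3) by (cases "x < n") (auto simp: cone_def Zn_def)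
qed

lemma sum_expo: "finite K \<Longrightarrow> i \<noteq> j \<Longrightarrow> (\<Sum>x\<in>K. expo i j k x) = (if i \<in> K then k else 0) - (if j \<in> K then k else 0)"
proof -
  assume "finite K" "i \<noteq> j"
  have "(\<Sum>x\<in>K. expo i j k x) = (\<Sum>x\<in>K. (if x = i then k else 0) - (if x = j then k else 0))"
    using \<open>i \<noteq> j\<close> by (intro sum.cong) (auto simp: expo_def)
  then show ?thesis using \<open>finite K\<close> by (simp add: sum_subtractf sum.delta)
qed

lemma expo_cone:
  assumes "distinct l" "set l = {..<n}" "(i, j) \<in> pairs_before l"
  shows "expo i j (int k) \<in> cone n l"
proof -
  have ij: "i < n" "j < n" "i \<noteq> j" using pairs_before_subset[OF assms(3)] pairs_before_neq[OF assms(1,3)] assms(2) by auto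
  have "0 \<le> (\<Sum>x\<in>set (take m l). expo i j (int k) x)" for m
    using pairs_before_take[OF assms(1,3), of m] sum_expo[of "set (take m l)" i j "int k"] ij by auto
  then show ?thesis using ij sum_expo[of "{..<n}" i j "int k"] by (auto simp: cone_def Zn_def expo_def)
qed

text \<open>The flag exchanges z and 1/z, so one computation gives triangularity of the torus form
  in both orders. The padding survives because \<open>inverse 0 = 0\<close>.\<close>

definition flipz :: "bool \<Rightarrow> (nat \<Rightarrow> complex) \<Rightarrow> nat \<Rightarrow> complex"
  where "flipz s z i = (if s then z i else inverse (z i))"

definition sg :: "bool \<Rightarrow> int" where "sg s = (if s then 1 else -1)"

lemma sg_simps: "sg True = 1" "sg False = -1" "sg s * sg s = 1" "sg (\<not> s) = - sg s"
  by (auto simp: sg_def)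

lemma zmon_flipz: "zmon n (flipz s z) al = zmon n z (\<lambda>i. sg s * al i)"
  by (cases s) (simp_all add: zmon_def flipz_def sg_def power_int_minus power_int_inverse)

lemma tor_flipz: "z \<in> tor n r \<Longrightarrow> flipz s z \<in> tor n (if s then r else inverse r)"
  by (auto simp: tor_def flipz_def norm_inverse)

lemma fac_flipz: "fac t i j (flipz s z) = (if s then fac t i j z else fac t j i z)"
  by (simp add: fac_def flipz_def mult_ac)

definition offd :: "nat set \<Rightarrow> (nat \<times> nat) set" where "offd I = {(i, j). i \<in> I \<and> j \<in> I \<and> i \<noteq> j}"

lemma finite_offd [simp]: "finite I \<Longrightarrow> finite (offd I)"
  by (rule finite_subset[of _ "I \<times> I"]) (auto simp: offd_def)

lemma prod_offd_insert:
  assumes "finite I" "x \<notin> I"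
  shows "(\<Prod>p\<in>offd (insert x I). f p) = (\<Prod>p\<in>offd I. f p) * (\<Prod>y\<in>I. f (x, y) * f (y, x) :: 'a::comm_monoid_mult)"
proof -
  have e: "offd (insert x I) = offd I \<union> (Pair x ` I \<union> (\<lambda>y. (y, x)) ` I)" using assms(2) by (auto simp: offd_def)
  have "(\<Prod>p\<in>offd (insert x I). f p) = (\<Prod>p\<in>offd I. f p) * ((\<Prod>p\<in>Pair x ` I. f p) * (\<Prod>p\<in>(\<lambda>y. (y, x)) ` I. f p))"
    unfolding e using assms by (subst prod.union_disjoint, simp, simp, force simp: offd_def, subst prod.union_disjoint) auto
  also have "\<dots> = (\<Prod>p\<in>offd I. f p) * (\<Prod>y\<in>I. f (x, y) * f (y, x))"
    by (subst (1 2) prod.reindex) (auto simp: inj_on_def prod.distrib)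
  finally show ?thesis .
qed

context hl begin

text \<open>The Hall-Littlewood torus density, up to a constant factor.\<close>

definition Dt :: "nat set \<Rightarrow> (nat \<Rightarrow> complex) \<Rightarrow> complex"
  where "Dt I z = (\<Prod>(i, j)\<in>offd I. fac t i j z)"

lemma Dt_flipz: "Dt I (flipz s z) = Dt I z"
proof (cases s)
  case False
  have "(\<Prod>p\<in>offd I. fac t (snd p) (fst p) z) = (\<Prod>p\<in>offd I. fac t (fst p) (snd p) z)"
    by (rule prod.reindex_bij_witness[of _ prod.swap prod.swap]) (auto simp: offd_def)
  then show ?thesis using False by (simp add: Dt_def fac_flipz case_prod_unfold)
qed (simp add: Dt_def fac_flipz)

text \<open>The summand of \<open>rr\<close> that belongs to the ordering l of the
  variables.\<close>

primrec wterm :: "nat list \<Rightarrow> nat list \<Rightarrow> (nat \<Rightarrow> complex) \<Rightarrow> complex" where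
  "wterm al [] z = 1"
| "wterm al (x # l) z = z x ^ hd al * ge z (insert x (set l)) x * wterm (tl al) l z"

lemma rr_permutations:
  "finite I \<Longrightarrow> card I = length al \<Longrightarrow> rr al I z = (\<Sum>l\<in>permutations_of_set I. wterm al l z)"
proof (induction al arbitrary: I)
  case Nil
  then show ?case by simp
next
  case (Cons a al)
  have ne: "I \<noteq> {}" using Cons.prems by auto
  have inj: "inj_on ((#) x) A" for x :: nat and A by simp
  have "(\<Sum>l\<in>permutations_of_set I. wterm (a # al) l z) = (\<Sum>x\<in>I. \<Sum>l\<in>(#) x ` permutations_of_set (I - {x}). wterm (a # al) l z)"
    unfolding permutations_of_set_nonempty[OF ne] by (rule sum.UNION_disjoint) (use Cons.prems in auto)
  also have "\<dots> = (\<Sum>x\<in>I. z x ^ a * ge z I x * rr al (I - {x}) z)"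
  proof (rule sum.cong)
    fix x assume x: "x \<in> I"
    have "(\<Sum>l\<in>(#) x ` permutations_of_set (I - {x}). wterm (a # al) l z) = (\<Sum>l\<in>permutations_of_set (I - {x}). wterm (a # al) (x # l) z)"
      by (simp add: sum.reindex[OF inj])
    also have "\<dots> = (\<Sum>l\<in>permutations_of_set (I - {x}). z x ^ a * ge z I x * wterm al l z)"
      using x by (intro sum.cong) (auto simp: permutations_of_set_def insert_absorb)
    also have "\<dots> = z x ^ a * ge z I x * rr al (I - {x}) z"
      using Cons x by (simp add: sum_distrib_left[symmetric])
    finally show "(\<Sum>l\<in>(#) x ` permutations_of_set (I - {x}). wterm (a # al) l z) = z x ^ a * ge z I x * rr al (I - {x}) z" .
  qed simp
  finally show ?case by simp
qed

text \<open>For x before y the factor (z_x - t z_y) / (z_x - z_y) of the summand is the reciprocal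
  of \<open>fac t y x z\<close>. So half of the density cancels, leaving factors that expand in z_x
  / z_y with x before y only. On the torus z_x = t z_y is impossible.\<close>

lemma wterm_Dt:
  assumes "distinct l" "length al = length l" "inj_on z (set l)" "\<And>x. x \<in> set l \<Longrightarrow> norm (z x) = r" "0 < r"
  shows "wterm al l z * Dt (set l) z = (\<Prod>x\<in>set l. z x ^ lex al l x) * (\<Prod>(i, j)\<in>pairs_before l. fac t i j z)"
  using assms(1-4)
proof (induction al l rule: list_induct2')
  case 1
  then show ?case by (simp add: Dt_def offd_def)
next
  case (4 a al x l)
  have x: "x \<notin> set l" "distinct l" using 4(2) by auto
  have nz: "z y \<noteq> 0" if "y \<in> set (x # l)" for y using 4(5)[OF that] assms(5) by auto
  have IH: "wterm al l z * Dt (set l) z = (\<Prod>x\<in>set l. z x ^ lex al l x) * (\<Prod>(i, j)\<in>pairs_before l. fac t i j z)"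
    using 4 by (simp add: inj_on_insert)
  have cancel: "(z x - of_real t * z y) / (z x - z y) * (fac t x y z * fac t y x z) = fac t x y z" if y: "y \<in> set l" for y
  proof -
    have "z x \<noteq> z y" using 4(4) x y by (auto simp: inj_on_def)
    moreover have "z x \<noteq> of_real t * z y"
    proof
      assume "z x = of_real t * z y"
      then have "norm (z x) = t * norm (z y)" using t0 by (simp add: norm_mult)
      then have "r = t * r" using 4(5) y by simp
      then show False using assms(5) t1 by simp
    qed
    moreover have "z x \<noteq> 0" "z y \<noteq> 0" using nz y by auto
    ultimately have "(z x - of_real t * z y) / (z x - z y) * fac t y x z = 1"
      by (simp add: fac_def divide_simps)
    then show ?thesis by (metis mult.assoc mult.commute mult_1)
  qed
  have "ge z (insert x (set l)) x * (\<Prod>y\<in>set l. fac t x y z * fac t y x z) = (\<Prod>y\<in>set l. fac t x y z)"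
  proof -
    have "insert x (set l) - {x} = set l" using x by simp
    then have "ge z (insert x (set l)) x = (\<Prod>y\<in>set l. (z x - of_real t * z y) / (z x - z y))" by (simp add: ge_def)
    then have "ge z (insert x (set l)) x * (\<Prod>y\<in>set l. fac t x y z * fac t y x z) =
        (\<Prod>y\<in>set l. (z x - of_real t * z y) / (z x - z y) * (fac t x y z * fac t y x z))"
      by (simp only: prod.distrib)
    also have "\<dots> = (\<Prod>y\<in>set l. fac t x y z)" by (rule prod.cong[OF refl]) (rule cancel)
    finally show ?thesis .
  qed
  moreover have "Dt (set (x # l)) z = Dt (set l) z * (\<Prod>y\<in>set l. fac t x y z * fac t y x z)"
    unfolding Dt_def list.set(2) by (subst prod_offd_insert) (use x in auto)
  moreover have "(\<Prod>(i, j)\<in>pairs_before (x # l). fac t i j z) = (\<Prod>y\<in>set l. fac t x y z) * (\<Prod>(i, j)\<in>pairs_before l. fac t i j z)"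
  proof -
    have "Pair x ` set l \<inter> pairs_before l = {}" using x pairs_before_subset by blast
    then have "(\<Prod>(i, j)\<in>pairs_before (x # l). fac t i j z) = (\<Prod>(i, j)\<in>Pair x ` set l. fac t i j z) * (\<Prod>(i, j)\<in>pairs_before l. fac t i j z)"
      by (simp add: prod.union_disjoint)
    then show ?thesis by (simp add: prod.reindex inj_on_def)
  qed
  moreover have "(\<Prod>y\<in>set (x # l). z y ^ lex (a # al) (x # l) y) = z x ^ a * (\<Prod>y\<in>set l. z y ^ lex al l y)"
  proof -
    have "(\<Prod>y\<in>set l. z y ^ lex (a # al) (x # l) y) = (\<Prod>y\<in>set l. z y ^ lex al l y)"
      using x by (intro prod.cong) (auto simp: lex_Cons)
    then show ?thesis using x by (simp add: lex_Cons)
  qed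
  ultimately show ?case using IH by (simp add: mult_ac)
qed auto

text \<open>The parts of la in decreasing order, padded with zeros; its length is n when la has at
  most n parts.\<close>

definition ptail :: "nat \<Rightarrow> partition \<Rightarrow> nat list"
  where "ptail n la = blk (mm n la) (Suc (sum_mset la))"

lemma length_ptail: "la \<in> partitions \<Longrightarrow> size la \<le> n \<Longrightarrow> length (ptail n la) = n"
  unfolding ptail_def by (rule length_blk_mm) auto

lemma count_blk: "count (mset (blk m N)) j = (if j < N then m j else 0)"
  by (induction N) (auto simp: less_Suc_eq)

lemma mset_ptail: "la \<in> partitions \<Longrightarrow> mset (ptail n la) = la + replicate_mset (n - size la) 0"
  unfolding ptail_def
  by (rule multiset_eqI) (auto simp: count_blk mm_def partitions_def not_in_iff count_large simp del: blk.simps)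

lemma sorted_blk: "sorted (rev (blk m N)) \<and> (\<forall>x\<in>set (blk m N). x < N)"
proof (induction N)
  case (Suc N)
  then show ?case by (auto simp: sorted_append intro: less_imp_le less_SucI)
qed simp

lemma sum_take_ptail:
  assumes "la \<in> partitions" shows "sum_list (take k (ptail n la)) = topsum la k"
proof -
  have "sum_list (ptail n la) = sum_mset (mset (ptail n la))" by (simp add: sum_mset_sum_list)
  then have s: "sum_list (ptail n la) = sum_mset la" by (simp add: mset_ptail[OF assms])
  have "col (mset (ptail n la)) j = col la j" for j by (simp add: mset_ptail[OF assms] col_def)
  then show ?thesis unfolding topsum_def
    using sum_take_sorted_desc[of "ptail n la" "sum_mset la" k] s sorted_blk by (simp add: ptail_def del: blk.simps)
qed

lemma prod_mm: "(\<Prod>j\<le>sum_mset la. qp (mm n la j)) = qp (n - size la) * bb la" if "la \<in> partitions"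
proof -
  have "(\<Prod>j\<le>sum_mset la. qp (mm n la j)) = qp (mm n la 0) * (\<Prod>j\<in>{1..sum_mset la}. qp (mm n la j))"
  proof -
    have "{..sum_mset la} = insert 0 {1..sum_mset la}" by auto
    then show ?thesis by simp
  qed
  also have "(\<Prod>j\<in>{1..sum_mset la}. qp (mm n la j)) = (\<Prod>j\<in>{1..sum_mset la}. qp (count la j))"
    by (intro prod.cong) (auto simp: mm_def)
  also have "\<dots> = bb la" unfolding bb_def
  proof (rule prod.mono_neutral_right)
    show "set_mset la \<subseteq> {1..sum_mset la}"
    proof
      fix x assume "x \<in># la"
      then show "x \<in> {1..sum_mset la}" using in_partition_pos[OF that] count_large[of la x]
        by (metis One_nat_def Suc_leI atLeastAtMost_iff not_in_iff not_less)
    qed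
  qed (auto simp: not_in_iff)
  finally show ?thesis by (simp add: mm_def)
qed

text \<open>The reciprocal of v_la(t), which normalises the symmetrisation. The factor from the n -
  l(la) zeros is where the length of la enters the final formula.\<close>

definition vnorm :: "nat \<Rightarrow> partition \<Rightarrow> real"
  where "vnorm n la = (1 - t) ^ n / (qp (n - size la) * bb la)"

lemma ev_PP_Dt:
  assumes la: "la \<in> partitions" "size la \<le> n" and z: "z \<in> tor n r" and r: "0 < r"
  shows "ev z (PP la) * Dt {..<n} z = (\<Sum>l\<in>permutations_of_set {..<n}. of_real (vnorm n la) *
    ((\<Prod>x<n. z x ^ lex (ptail n la) l x) * (\<Prod>(i, j)\<in>pairs_before l. fac t i j z)))"
proof (cases "inj_on z {..<n}")
  case True
  have nz: "norm (z x) = r" if "x < n" for x using z that by (simp add: tor_def)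
  have "z x \<noteq> 0" if "x < n" for x using nz[OF that] r by auto
  then have "zgood n z" using True z by (auto simp: zgood_def tor_def)
  then have "ev z (PP la) = of_real (vnorm n la) * rr (ptail n la) {..<n} z"
    using ev_PP[OF la(1)] la prod_mm[OF la(1), of n] by (simp add: Pn_def vnorm_def ptail_def del: blk.simps)
  also have "rr (ptail n la) {..<n} z = (\<Sum>l\<in>permutations_of_set {..<n}. wterm (ptail n la) l z)"
    by (rule rr_permutations) (simp_all add: length_ptail la)
  finally have "ev z (PP la) * Dt {..<n} z = (\<Sum>l\<in>permutations_of_set {..<n}. of_real (vnorm n la) * (wterm (ptail n la) l z * Dt {..<n} z))"
    by (simp add: sum_distrib_left sum_distrib_right mult.assoc)
  also have "\<dots> = (\<Sum>l\<in>permutations_of_set {..<n}. of_real (vnorm n la) *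
    ((\<Prod>x<n. z x ^ lex (ptail n la) l x) * (\<Prod>(i, j)\<in>pairs_before l. fac t i j z)))"
  proof (intro sum.cong refl)
    fix l assume l: "l \<in> permutations_of_set {..<n}"
    then have ld: "distinct l" "set l = {..<n}" by (auto simp: permutations_of_set_def)
    have len: "length (ptail n la) = length l" using ld length_ptail[OF la] by (metis card_lessThan distinct_card)
    have "wterm (ptail n la) l z * Dt (set l) z = (\<Prod>x\<in>set l. z x ^ lex (ptail n la) l x) * (\<Prod>(i, j)\<in>pairs_before l. fac t i j z)"
      by (rule wterm_Dt[OF ld(1) len _ _ r]) (use True nz ld in auto)
    then show "of_real (vnorm n la) * (wterm (ptail n la) l z * Dt {..<n} z) = of_real (vnorm n la) *
    ((\<Prod>x<n. z x ^ lex (ptail n la) l x) * (\<Prod>(i, j)\<in>pairs_before l. fac t i j z))" unfolding ld by simp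
  qed
  finally show ?thesis .
next
  case False
  then obtain i j where ij: "i < n" "j < n" "i \<noteq> j" "z i = z j" by (auto simp: inj_on_def)
  have nz: "z i \<noteq> 0" "z j \<noteq> 0" using z r ij by (auto simp: tor_def)
  have f0: "fac t i j z = 0" "fac t j i z = 0" using nz ij by (simp_all add: fac_def)
  have "Dt {..<n} z = 0" unfolding Dt_def
  proof (rule prod_zero)
    show "finite (offd {..<n})" by simp
    show "\<exists>p\<in>offd {..<n}. (case p of (i, j) \<Rightarrow> fac t i j z) = 0"
      using ij f0 by (intro bexI[of _ "(i, j)"]) (auto simp: offd_def)
  qed
  moreover have "(\<Prod>(i, j)\<in>pairs_before l. fac t i j z) = 0" if "l \<in> permutations_of_set {..<n}" for l
  proof -
    have ld: "distinct l" "set l = {..<n}" using that by (auto simp: permutations_of_set_def)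
    have "(i, j) \<in> pairs_before l \<or> (j, i) \<in> pairs_before l" if "i \<in> set l" "j \<in> set l" "i \<noteq> j" for i j and l :: "nat list"
      using that by (induction l) auto
    then have "(i, j) \<in> pairs_before l \<or> (j, i) \<in> pairs_before l" using ij ld by auto
    then have "\<exists>p\<in>pairs_before l. (case p of (i, j) \<Rightarrow> fac t i j z) = 0" using f0 by (metis case_prod_conv)
    then show ?thesis by (intro prod_zero finite_pairs_before)
  qed
  ultimately have "ev z (PP la) * Dt {..<n} z = 0" "\<forall>l\<in>permutations_of_set {..<n}. of_real (vnorm n la) *
    ((\<Prod>x<n. z x ^ lex (ptail n la) l x) * (\<Prod>(i, j)\<in>pairs_before l. fac t i j z)) = 0"
    by (metis mult_zero_right)+
  then show ?thesis by (simp only: sum.neutral)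
qed

lemma prod_zmon: "(\<Prod>x<n. z x ^ m x) = zmon n z (\<lambda>x. int (m x))"
  by (simp add: zmon_def)

lemma topsum_less: "la \<in> partitions \<Longrightarrow> n < size la \<Longrightarrow> topsum la n < sum_mset la"
proof -
  assume la: "la \<in> partitions" "n < size la"
  define N where "N = sum_mset la"
  have c0: "col la 0 = size la" using col_0[OF la(1)] .
  have "0 < N" using size_le_sum_partition[OF la(1)] la(2) by (simp add: N_def)
  then have "(\<Sum>j<N. min n (col la j)) < (\<Sum>j<N. col la j)"
    using la(2) c0 by (intro sum_strict_mono_ex1) (auto intro: bexI[of _ 0])
  then show ?thesis using top_eq[of la N n] sum_col[of la N] by (simp add: N_def)
qed

text \<open>The degree of a monomial in n variables is carried by n exponents, hence is at most the
  sum of the n largest parts of la. This is less than the weight if la has more than n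
  parts.\<close>

lemma ev_PP_0:
  assumes la: "la \<in> partitions" "n < size la" and z: "\<And>i. n \<le> i \<Longrightarrow> z i = 0"
  shows "ev z (PP la) = 0"
proof -
  have "cf (PP la) M = 0" if M: "set_mset M \<subseteq> {..<n}" for M
  proof (rule ccontr)
    assume "cf (PP la) M \<noteq> 0"
    then have d: "dominance_le (exponents M) la" "size M = sum_mset la"
      using PP_dominance[OF la(1)] PP_degree[OF la(1)] by auto
    have "size M = (\<Sum>i<n. count M i)"
      unfolding size_multiset_overloaded_eq using M by (intro sum.mono_neutral_left) (auto simp: count_eq_zero_iff)
    also have "\<dots> \<le> topsum (exponents M) n" by (rule sum_count_le_topsum) auto
    also have "\<dots> \<le> topsum la n" using d by (simp add: dominance_le_iff)
    finally show False using topsum_less[OF la] d by simp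
  qed
  then have "(\<Sum>M\<in>monoms n (sum_mset la). of_real (cf (PP la) M) * mon z M) = 0"
    by (intro sum.neutral) (auto simp: monoms_def)
  moreover have "ev z (PP la) = (\<Sum>M\<in>monoms n (sum_mset la). of_real (cf (PP la) M) * mon z M)"
    using PP_degree[OF la(1)] by (intro ev_finite[OF z]) (metis less_irrefl)+
  ultimately show ?thesis by simp
qed

definition torus_form :: "nat \<Rightarrow> real \<Rightarrow> bool \<Rightarrow> partition \<Rightarrow> partition \<Rightarrow> complex"
  where "torus_form n r s la mu =
    torus_integral n r (\<lambda>z. ev (flipz s z) (PP la) * ev (flipz (\<not> s) z) (PP mu) * Dt {..<n} z)"

text \<open>The exponent of the monomial in front of the product over pairs in the summand for l and
  M; the sign records which alphabet is inverted.\<close>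

definition wd :: "nat \<Rightarrow> partition \<Rightarrow> bool \<Rightarrow> nat list \<Rightarrow> monomial \<Rightarrow> nat \<Rightarrow> int"
  where "wd n la s l M i = sg s * (int (lex (ptail n la) l i) - int (count M i))"

text \<open>What is retained of the Laurent coefficients \<open>d l\<close> of the products over
  pairs: the torus form is a finite sum in them, their constant terms are 1, and a nonzero summand
  puts the difference of the exponents of M and of la along l into the cone.\<close>

definition wd_ok :: "nat \<Rightarrow> real \<Rightarrow> bool \<Rightarrow> partition \<Rightarrow> partition \<Rightarrow> (nat list \<Rightarrow> (nat \<Rightarrow> int) \<Rightarrow> complex) \<Rightarrow> bool"
  where "wd_ok n r s la mu d \<longleftrightarrow> torus_form n r s la mu = (\<Sum>(l, M)\<in>permutations_of_set {..<n} \<times> monoms n (sum_mset mu).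
       of_real (vnorm n la) * of_real (cf (PP mu) M) * d l (\<lambda>i. - wd n la s l M i)) \<and>
     (\<forall>l\<in>permutations_of_set {..<n}. d l (\<lambda>_. 0) = 1) \<and>
     (\<forall>l M. l \<in> permutations_of_set {..<n} \<longrightarrow> d l (\<lambda>i. - wd n la s l M i) \<noteq> 0 \<longrightarrow>
       (\<lambda>i. int (count M i) - int (lex (ptail n la) l i)) \<in> cone n l)"

text \<open>The two functions are treated asymmetrically: P_la together with the density is expanded
  over orderings l, P_mu into monomials. Each summand is a monomial times a product over pairs,
  whose support lies in a pointed cone depending on l.\<close>

lemma torus_form_sum:
  assumes la: "la \<in> partitions" "size la \<le> n" and mu: "mu \<in> partitions" and r: "0 < r"
  shows "\<exists>d. wd_ok n r s la mu d"
proof -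
  \<comment> \<open>When the roles of z and 1/z are exchanged, the ordered pairs and the cone are
    reversed as well.\<close>
  define S where "S l = (if s then pairs_before l else prod.swap ` pairs_before l)" for l :: "nat list"
  define C where "C l = {al. (\<lambda>i. sg s * al i) \<in> cone n l}" for l
  have sg: "sg s = 1 \<or> sg s = -1" by (auto simp: sg_def)
  have "\<exists>c. laurent n r c (\<lambda>z. \<Prod>(i, j)\<in>S l. fac t i j z) \<and> (\<forall>al. c al \<noteq> 0 \<longrightarrow> al \<in> C l) \<and> c (\<lambda>_. 0) = 1"
    if l: "l \<in> permutations_of_set {..<n}" for l
  proof -
    have ld: "distinct l" "set l = {..<n}" using l by (auto simp: permutations_of_set_def)
    have pt: "\<forall>al\<in>C l. (\<lambda>i. - al i) \<in> C l \<longrightarrow> al = (\<lambda>_. 0)"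
    proof (intro ballI impI)
      fix al assume a: "al \<in> C l" "(\<lambda>i. - al i) \<in> C l"
      then have "(\<lambda>i. sg s * al i) = (\<lambda>_. 0)" by (intro cone_pointed[OF ld]) (simp_all add: C_def)
      then show "al = (\<lambda>_. 0)" using sg by (auto simp: fun_eq_iff)
    qed
    have "\<exists>c. laurent n r c (\<lambda>z. \<Prod>(i, j)\<in>S l. fac t i j z) \<and> (\<forall>al. c al \<noteq> 0 \<longrightarrow> al \<in> C l) \<and>
      ((\<forall>al\<in>C l. (\<lambda>i. - al i) \<in> C l \<longrightarrow> al = (\<lambda>_. 0)) \<longrightarrow> c (\<lambda>_. 0) = 1)"
    proof (rule laurent_prod_fac[OF r t0 t1])
      show "(\<lambda>_. 0) \<in> C l" by (simp add: C_def cone_0)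
      show "(\<lambda>i. al i + be i) \<in> C l" if "al \<in> C l" "be \<in> C l" for al be
        using cone_add[of "\<lambda>i. sg s * al i" n l "\<lambda>i. sg s * be i"] that by (simp add: C_def distrib_left)
      show "finite (S l)" by (simp add: S_def)
      show "i < n \<and> j < n \<and> i \<noteq> j" if "(i, j) \<in> S l" for i j
        using that pairs_before_subset[of i j l] pairs_before_subset[of j i l]
          pairs_before_neq[OF ld(1), of i j] pairs_before_neq[OF ld(1), of j i] ld(2) by (auto simp: S_def split: if_splits)
      show "expo i j (int k) \<in> C l" if ij: "(i, j) \<in> S l" for i j k
      proof (cases s)
        case True
        then show ?thesis using expo_cone[OF ld, of i j k] ij by (simp add: C_def S_def sg_def)
      next
        case False
        then have ji: "(j, i) \<in> pairs_before l" using ij by (auto simp: S_def)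
        have "j \<noteq> i" by (rule pairs_before_neq[OF ld(1) ji])
        then have "(\<lambda>x. sg s * expo i j (int k) x) = expo j i (int k)" using False by (auto simp: sg_def expo_def)
        then show ?thesis using expo_cone[OF ld ji, of k] by (simp add: C_def)
      qed
    qed
    then show ?thesis using pt by blast
  qed
  then obtain d where d: "\<And>l. l \<in> permutations_of_set {..<n} \<Longrightarrow> laurent n r (d l) (\<lambda>z. \<Prod>(i, j)\<in>S l. fac t i j z) \<and>
      (\<forall>al. d l al \<noteq> 0 \<longrightarrow> al \<in> C l) \<and> d l (\<lambda>_. 0) = 1"
    by metis
  define A where "A = permutations_of_set {..<n} \<times> monoms n (sum_mset mu)"
  define c where "c = (\<lambda>(l :: nat list, M). complex_of_real (vnorm n la) * of_real (cf (PP mu) M))"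
  define be where "be = (\<lambda>(l, M). wd n la s l M)"
  have fA: "finite A" by (simp add: A_def)
  have "torus_form n r s la mu = (\<Sum>\<^sub>\<infinity>k\<in>A. c k * d (fst k) (\<lambda>i. - be k i))"
    unfolding torus_form_def
  proof (rule torus_integral_laurent(1)[OF r, where D = "\<lambda>k z. \<Prod>(i, j)\<in>S (fst k). fac t i j z"])
    show "laurent n r (d (fst k)) (\<lambda>z. \<Prod>(i, j)\<in>S (fst k). fac t i j z)" if "k \<in> A" for k
      using that d[of "fst k"] by (auto simp: A_def)
    show "be k \<in> Zn n" if "k \<in> A" for k
    proof -
      obtain l M where k: "k = (l, M)" by (cases k)
      have "be k i = 0" if i: "n \<le> i" for i
      proof -
        have "i \<notin> set l" "i \<notin># M" using \<open>k \<in> A\<close> i by (auto simp: k A_def permutations_of_set_def monoms_def)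
        then show ?thesis by (simp add: be_def k wd_def lex_notin not_in_iff)
      qed
      then show ?thesis by (simp add: Zn_def)
    qed
    show "(\<lambda>(k, al). norm (c k) * zmon n (\<lambda>_. r) (be k) * (norm (d (fst k) al) * zmon n (\<lambda>_. r) al)) summable_on A \<times> Zn n"
    proof (rule summable_on_SigmaI)
      fix k assume k: "k \<in> A"
      have "(\<lambda>al. norm (d (fst k) al) * zmon n (\<lambda>_. r) al) summable_on Zn n"
        using d[of "fst k"] k by (intro laurent_summable[of n r _ "\<lambda>z. \<Prod>(i, j)\<in>S (fst k). fac t i j z"]) (auto simp: A_def)
      then have "((\<lambda>al. norm (c k) * zmon n (\<lambda>_. r) (be k) * (norm (d (fst k) al) * zmon n (\<lambda>_. r) al)) has_sum
          norm (c k) * zmon n (\<lambda>_. r) (be k) * infsum (\<lambda>al. norm (d (fst k) al) * zmon n (\<lambda>_. r) al) (Zn n)) (Zn n)"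
        by (intro has_sum_cmult_right has_sum_infsum)
      then show "((\<lambda>al. case (k, al) of (k, al) \<Rightarrow> norm (c k) * zmon n (\<lambda>_. r) (be k) * (norm (d (fst k) al) * zmon n (\<lambda>_. r) al)) has_sum
          norm (c k) * zmon n (\<lambda>_. r) (be k) * infsum (\<lambda>al. norm (d (fst k) al) * zmon n (\<lambda>_. r) al) (Zn n)) (Zn n)"
        by simp
      show "0 \<le> (case (k, al) of (k, al) \<Rightarrow> norm (c k) * zmon n (\<lambda>_. r) (be k) * (norm (d (fst k) al) * zmon n (\<lambda>_. r) al))" for al
        using less_imp_le[OF zmon_pos[OF r]] by (simp add: zmon_def)
    qed (use fA in simp)
    fix z assume z: "z \<in> tor n r"
    have fz: "flipz s z \<in> tor n (if s then r else inverse r)" using tor_flipz[OF z] .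
    have r': "0 < (if s then r else inverse r)" using r by simp
    have z0: "flipz (\<not> s) z i = 0" if "n \<le> i" for i using z that by (auto simp: tor_def flipz_def)
    have 1: "ev (flipz s z) (PP la) * Dt {..<n} z = (\<Sum>l\<in>permutations_of_set {..<n}. of_real (vnorm n la) *
        (zmon n z (\<lambda>i. sg s * int (lex (ptail n la) l i)) * (\<Prod>(i, j)\<in>S l. fac t i j z)))"
    proof -
      have pf: "(\<Prod>(i, j)\<in>pairs_before l. fac t i j (flipz s z)) = (\<Prod>(i, j)\<in>S l. fac t i j z)" for l
      proof (cases s)
        case False
        have "inj_on prod.swap (pairs_before l)" by simp
        then show ?thesis using False by (simp add: S_def fac_flipz prod.reindex case_prod_unfold)
      qed (simp add: S_def fac_flipz)
      have "ev (flipz s z) (PP la) * Dt {..<n} z = ev (flipz s z) (PP la) * Dt {..<n} (flipz s z)" by (simp add: Dt_flipz)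
      also have "\<dots> = (\<Sum>l\<in>permutations_of_set {..<n}. of_real (vnorm n la) *
          ((\<Prod>x<n. flipz s z x ^ lex (ptail n la) l x) * (\<Prod>(i, j)\<in>pairs_before l. fac t i j (flipz s z))))"
        by (rule ev_PP_Dt[OF la fz r'])
      finally show ?thesis by (simp only: prod_zmon zmon_flipz pf)
    qed
    have 2: "ev (flipz (\<not> s) z) (PP mu) = (\<Sum>M\<in>monoms n (sum_mset mu). of_real (cf (PP mu) M) * zmon n z (\<lambda>i. - (sg s * int (count M i))))"
    proof -
      have "ev (flipz (\<not> s) z) (PP mu) = (\<Sum>M\<in>monoms n (sum_mset mu). of_real (cf (PP mu) M) * mon (flipz (\<not> s) z) M)"
      proof (rule ev_finite[OF z0])
        show "cf (PP mu) M = 0" if "sum_mset mu < size M" for M using PP_degree[OF mu, of M] that by (cases "cf (PP mu) M = 0") simp_all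
      qed simp_all
      also have "\<dots> = (\<Sum>M\<in>monoms n (sum_mset mu). of_real (cf (PP mu) M) * zmon n z (\<lambda>i. - (sg s * int (count M i))))"
      proof (rule sum.cong[OF refl])
        fix M assume "M \<in> monoms n (sum_mset mu)"
        then have "mon (flipz (\<not> s) z) M = zmon n (flipz (\<not> s) z) (\<lambda>i. int (count M i))"
          by (subst mon_count[of M n]) (simp_all add: monoms_def prod_zmon)
        then show "of_real (cf (PP mu) M) * mon (flipz (\<not> s) z) M = of_real (cf (PP mu) M) * zmon n z (\<lambda>i. - (sg s * int (count M i)))"
          by (simp add: zmon_flipz sg_simps)
      qed
      finally show ?thesis .
    qed
    have 3: "zmon n z (wd n la s l M) = zmon n z (\<lambda>i. sg s * int (lex (ptail n la) l i)) * zmon n z (\<lambda>i. - (sg s * int (count M i)))" for l M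
      using zmon_add[OF r z, of "\<lambda>i. sg s * int (lex (ptail n la) l i)" "\<lambda>i. - (sg s * int (count M i))"]
      by (simp add: wd_def[abs_def] right_diff_distrib)
    have "ev (flipz s z) (PP la) * ev (flipz (\<not> s) z) (PP mu) * Dt {..<n} z = (ev (flipz s z) (PP la) * Dt {..<n} z) * ev (flipz (\<not> s) z) (PP mu)"
      by (simp only: mult_ac)
    also have "\<dots> = (\<Sum>k\<in>A. c k * zmon n z (be k) * (\<Prod>(i, j)\<in>S (fst k). fac t i j z))"
      unfolding 1 2 sum_product A_def sum.cartesian_product c_def be_def
      by (intro sum.cong refl) (simp add: case_prod_unfold 3 mult_ac)
    finally show "ev (flipz s z) (PP la) * ev (flipz (\<not> s) z) (PP mu) * Dt {..<n} z =
        (\<Sum>\<^sub>\<infinity>k\<in>A. c k * zmon n z (be k) * (\<Prod>(i, j)\<in>S (fst k). fac t i j z))"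
      using fA by simp
  qed
  also have "\<dots> = (\<Sum>k\<in>A. c k * d (fst k) (\<lambda>i. - be k i))" using fA by simp
  finally have main: "torus_form n r s la mu = (\<Sum>(l, M)\<in>permutations_of_set {..<n} \<times> monoms n (sum_mset mu).
       of_real (vnorm n la) * of_real (cf (PP mu) M) * d l (\<lambda>i. - wd n la s l M i))"
    by (simp add: A_def c_def be_def case_prod_unfold)
  have supp: "(\<lambda>i. int (count M i) - int (lex (ptail n la) l i)) \<in> cone n l"
    if "l \<in> permutations_of_set {..<n}" "d l (\<lambda>i. - wd n la s l M i) \<noteq> 0" for l M
  proof -
    have "(\<lambda>i. - wd n la s l M i) \<in> C l" using d[OF that(1)] that(2) by blast
    moreover have "(\<lambda>i. sg s * - wd n la s l M i) = (\<lambda>i. int (count M i) - int (lex (ptail n la) l i))"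
      using sg by (auto simp: wd_def)
    ultimately show ?thesis by (simp only: C_def mem_Collect_eq)
  qed
  have "wd_ok n r s la mu d" unfolding wd_ok_def
  proof (intro conjI allI impI ballI)
    show "d l (\<lambda>_. 0) = 1" if "l \<in> permutations_of_set {..<n}" for l using d[OF that] by blast
  qed (rule main, rule supp)
  then show ?thesis by (intro exI)
qed

text \<open>Membership in the cone bounds the partial sums of la by those of M along l, and the
  latter are at most the \<open>topsum\<close> of the shape of M. If the shapes agree, equality
  holds throughout and determines M.\<close>

lemma cone_dominance:
  assumes la: "la \<in> partitions" "size la \<le> n" and l: "l \<in> permutations_of_set {..<n}"
    and M: "set_mset M \<subseteq> {..<n}" and c: "(\<lambda>i. int (count M i) - int (lex (ptail n la) l i)) \<in> cone n l"
  shows "dominance_le la (exponents M)"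
    and "exponents M = la \<Longrightarrow> M = (\<Sum>x<n. replicate_mset (lex (ptail n la) l x) x)"
proof -
  have ld: "distinct l" "set l = {..<n}" using l by (auto simp: permutations_of_set_def)
  have len: "length (ptail n la) = length l" using ld length_ptail[OF la] by (metis card_lessThan distinct_card)
  have lt: "(\<Sum>i\<in>set (take k l). lex (ptail n la) l i) = topsum la k" for k
    by (simp add: sum_lex_take[OF ld(1) len] sum_take_ptail[OF la(1)])
  have le: "topsum la k \<le> (\<Sum>i\<in>set (take k l). count M i)" for k
  proof -
    have "0 \<le> (\<Sum>i\<in>set (take k l). int (count M i) - int (lex (ptail n la) l i))" using c by (simp add: cone_def)
    then have "int (\<Sum>i\<in>set (take k l). lex (ptail n la) l i) \<le> int (\<Sum>i\<in>set (take k l). count M i)"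
      by (simp add: sum_subtractf)
    then show ?thesis using lt[of k] unfolding of_nat_le_iff by simp
  qed
  have le2: "(\<Sum>i\<in>set (take k l). count M i) \<le> topsum (exponents M) k" for k
    by (rule sum_count_le_topsum) (auto intro: order_trans[OF card_length])
  have "(\<Sum>i<n. lex (ptail n la) l i) = sum_list (ptail n la)"
    using sum_lex_take[OF ld(1) len, of "length l"] ld(2) len by simp
  also have "\<dots> = sum_mset la"
  proof -
    have "sum_list (ptail n la) = sum_mset (mset (ptail n la))" by (simp add: sum_mset_sum_list)
    then show ?thesis by (simp add: mset_ptail[OF la(1)])
  qed
  finally have s1: "(\<Sum>i<n. lex (ptail n la) l i) = sum_mset la" .
  have "size M = (\<Sum>i<n. count M i)"
    unfolding size_multiset_overloaded_eq using M by (intro sum.mono_neutral_left) (auto simp: count_eq_zero_iff)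
  moreover have "int (\<Sum>i<n. count M i) = int (\<Sum>i<n. lex (ptail n la) l i)"
    using c by (simp add: cone_def sum_subtractf)
  ultimately have sz: "sum_mset (exponents M) = sum_mset la" using s1 unfolding of_nat_eq_iff by simp
  show "dominance_le la (exponents M)" unfolding dominance_le_iff
    using sz le le2 le_trans by metis
  assume ex: "exponents M = la"
  have eq: "(\<Sum>i\<in>set (take k l). int (count M i) - int (lex (ptail n la) l i)) = 0" for k
  proof -
    have "(\<Sum>i\<in>set (take k l). count M i) = (\<Sum>i\<in>set (take k l). lex (ptail n la) l i)"
      using le[of k] le2[of k] ex lt[of k] by simp
    then show ?thesis by (simp add: sum_subtractf flip: of_nat_sum)
  qed
  show "M = (\<Sum>x<n. replicate_mset (lex (ptail n la) l x) x)"
  proof (rule multiset_eqI)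
    fix x
    show "count M x = count (\<Sum>x<n. replicate_mset (lex (ptail n la) l x) x) x"
    proof (cases "x < n")
      case True
      then have "int (count M x) - int (lex (ptail n la) l x) = 0"
        using ld(2) by (intro take_sums_zero[OF ld(1) eq, of x]) auto
      then show ?thesis using True by (simp add: mset_sum_replicate)
    next
      case False
      then have "x \<notin># M" using M by auto
      then show ?thesis using False by (simp add: mset_sum_replicate not_in_iff)
    qed
  qed
qed

lemma exponents_lex:
  assumes la: "la \<in> partitions" "size la \<le> n" and l: "l \<in> permutations_of_set {..<n}"
  shows "exponents (\<Sum>x<n. replicate_mset (lex (ptail n la) l x) x) = la"
proof -
  have ld: "distinct l" "set l = {..<n}" using l by (auto simp: permutations_of_set_def)
  have len: "length (ptail n la) = length l" using ld length_ptail[OF la] by (metis card_lessThan distinct_card)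
  let ?M = "\<Sum>x<n. replicate_mset (lex (ptail n la) l x) x"
  have sub: "set_mset ?M \<subseteq> {..<n}"
  proof
    fix x assume "x \<in># ?M"
    then have "count ?M x \<noteq> 0" by (simp add: count_eq_zero_iff)
    then show "x \<in> {..<n}" by (simp add: mset_sum_replicate split: if_splits)
  qed
  have "exponents ?M = filter_mset (\<lambda>x. x \<noteq> 0) (image_mset (count ?M) (mset_set {..<n}))"
    by (rule exponents_superset[OF _ sub]) simp
  also have "image_mset (count ?M) (mset_set {..<n}) = image_mset (lex (ptail n la) l) (mset_set {..<n})"
    by (rule image_mset_cong) (simp add: mset_sum_replicate)
  also have "mset_set {..<n} = mset l" using ld mset_set_set by metis
  also have "image_mset (lex (ptail n la) l) (mset l) = mset (ptail n la)" using map_lex[OF ld(1) len] by (metis mset_map)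
  also have "filter_mset (\<lambda>x. x \<noteq> 0) (mset (ptail n la)) = la"
  proof -
    have "filter_mset (\<lambda>x. x \<noteq> 0) la = la"
      using la(1) by (intro multiset_eqI) (simp add: partitions_def not_in_iff)
    then show ?thesis by (simp add: mset_ptail[OF la(1)])
  qed
  finally show ?thesis .
qed

text \<open>A nonzero summand needs a monomial whose shape lies between la and mu in the dominance
  order.\<close>

lemma torus_form_neq:
  assumes "la \<in> partitions" "size la \<le> n" "mu \<in> partitions" "0 < r" "\<not> dominance_le la mu"
  shows "torus_form n r s la mu = 0"
proof -
  obtain d where ok: "wd_ok n r s la mu d" using torus_form_sum[OF assms(1-4), of s] by (rule exE)
  have d: "torus_form n r s la mu = (\<Sum>(l, M)\<in>permutations_of_set {..<n} \<times> monoms n (sum_mset mu).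
       of_real (vnorm n la) * of_real (cf (PP mu) M) * d l (\<lambda>i. - wd n la s l M i))"
    and d1: "\<And>l. l \<in> permutations_of_set {..<n} \<Longrightarrow> d l (\<lambda>_. 0) = 1"
    and supp: "\<And>l M. l \<in> permutations_of_set {..<n} \<Longrightarrow> d l (\<lambda>i. - wd n la s l M i) \<noteq> 0 \<Longrightarrow>
       (\<lambda>i. int (count M i) - int (lex (ptail n la) l i)) \<in> cone n l"
    using ok unfolding wd_ok_def by simp_all
  have z: "of_real (vnorm n la) * of_real (cf (PP mu) M) * d l (\<lambda>i. - wd n la s l M i) = 0"
    if l: "l \<in> permutations_of_set {..<n}" and M: "M \<in> monoms n (sum_mset mu)" for l M
  proof (rule ccontr)
    assume "\<not> ?thesis"
    then have "cf (PP mu) M \<noteq> 0" "d l (\<lambda>i. - wd n la s l M i) \<noteq> 0" by auto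
    then have "dominance_le (exponents M) mu" "dominance_le la (exponents M)"
      using PP_dominance[OF assms(3)] cone_dominance(1)[OF assms(1,2) l _ supp[OF l]] M by (auto simp: monoms_def)
    then show False using dominance_le_trans assms(5) by blast
  qed
  show ?thesis unfolding d by (rule sum.neutral) (use z in auto)
qed

text \<open>For each of the n! orderings exactly one monomial of P_la survives. It has coefficient 1
  and meets the constant term 1 of the product over pairs.\<close>

lemma torus_form_same:
  assumes la: "la \<in> partitions" "size la \<le> n" and r: "0 < r"
  shows "torus_form n r s la la = of_real (fact n * vnorm n la)"
proof -
  obtain d where ok: "wd_ok n r s la la d" using torus_form_sum[OF la la(1) r, of s] by (rule exE)
  have d: "torus_form n r s la la = (\<Sum>(l, M)\<in>permutations_of_set {..<n} \<times> monoms n (sum_mset la).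
       of_real (vnorm n la) * of_real (cf (PP la) M) * d l (\<lambda>i. - wd n la s l M i))"
    and d1: "\<And>l. l \<in> permutations_of_set {..<n} \<Longrightarrow> d l (\<lambda>_. 0) = 1"
    and supp: "\<And>l M. l \<in> permutations_of_set {..<n} \<Longrightarrow> d l (\<lambda>i. - wd n la s l M i) \<noteq> 0 \<Longrightarrow>
       (\<lambda>i. int (count M i) - int (lex (ptail n la) l i)) \<in> cone n l"
    using ok unfolding wd_ok_def by simp_all
  have "(\<Sum>M\<in>monoms n (sum_mset la). of_real (vnorm n la) * of_real (cf (PP la) M) * d l (\<lambda>i. - wd n la s l M i)) = of_real (vnorm n la)"
    if l: "l \<in> permutations_of_set {..<n}" for l
  proof -
    define M0 where "M0 = (\<Sum>x<n. replicate_mset (lex (ptail n la) l x) x)"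
    have ex: "exponents M0 = la" unfolding M0_def by (rule exponents_lex[OF la l])
    have ld: "set l = {..<n}" using l by (auto simp: permutations_of_set_def)
    have sub: "set_mset M0 \<subseteq> {..<n}"
    proof
      fix x assume "x \<in># M0"
      then have "count M0 x \<noteq> 0" by (simp add: count_eq_zero_iff)
      then show "x \<in> {..<n}" by (simp add: M0_def mset_sum_replicate split: if_splits)
    qed
    have M0: "M0 \<in> monoms n (sum_mset la)" using sub ex sum_exponents[of M0] by (simp add: monoms_def)
    have "wd n la s l M0 = (\<lambda>_. 0)"
    proof
      show "wd n la s l M0 i = 0" for i
        using lex_notin[of i l "ptail n la"] ld by (simp add: wd_def M0_def mset_sum_replicate)
    qed
    then have v: "of_real (vnorm n la) * of_real (cf (PP la) M0) * d l (\<lambda>i. - wd n la s l M0 i) = of_real (vnorm n la)"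
      using d1[OF l] PP_leading[OF la(1) ex] by simp
    have z: "of_real (vnorm n la) * of_real (cf (PP la) M) * d l (\<lambda>i. - wd n la s l M i) = 0"
      if M: "M \<in> monoms n (sum_mset la) - {M0}" for M
    proof (rule ccontr)
      assume "\<not> ?thesis"
      then have nz: "cf (PP la) M \<noteq> 0" "d l (\<lambda>i. - wd n la s l M i) \<noteq> 0" by auto
      have sM: "set_mset M \<subseteq> {..<n}" using M by (simp add: monoms_def)
      have "dominance_le (exponents M) la" "dominance_le la (exponents M)"
        using PP_dominance[OF la(1) nz(1)] cone_dominance(1)[OF la l sM supp[OF l nz(2)]] by auto
      then have "exponents M = la" by (intro dominance_le_antisym) (simp_all add: la exponents_partition)
      then show False using cone_dominance(2)[OF la l sM supp[OF l nz(2)]] M by (simp add: M0_def)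
    qed
    show ?thesis by (subst sum.remove[OF finite_monoms M0]) (use z v in \<open>simp add: sum.neutral\<close>)
  qed
  then have "torus_form n r s la la = (\<Sum>l\<in>permutations_of_set {..<n}. of_real (vnorm n la))"
    unfolding d sum.cartesian_product[symmetric] by (intro sum.cong) auto
  then show ?thesis by simp
qed

text \<open>Triangularity holds in both orders by exchanging z and 1/z, and antisymmetry of
  dominance leaves only la = mu. With more than n parts the integrand vanishes on the torus and is
  written as an empty series.\<close>

lemma torus_orthogonality:
  assumes la: "la \<in> partitions" and mu: "mu \<in> partitions" and r: "0 < r"
  shows "torus_integral n r (\<lambda>z. ev z (PP la) * ev (\<lambda>i. inverse (z i)) (PP mu) * Dt {..<n} z) =
    (if la = mu \<and> size la \<le> n then of_real (fact n * vnorm n la) else 0)"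
proof -
  have f: "flipz True z = z" "flipz False z = (\<lambda>i. inverse (z i))" for z by (auto simp: flipz_def)
  have sym: "torus_form n r True la mu = torus_form n r False mu la"
    by (simp add: torus_form_def mult_ac)
  have ti: "torus_integral n r (\<lambda>z. ev z (PP la) * ev (\<lambda>i. inverse (z i)) (PP mu) * Dt {..<n} z) = torus_form n r True la mu"
    by (simp add: torus_form_def f)
  have zero: "torus_form n r s la mu = 0" if "n < size la \<or> n < size mu" for s
  proof -
    have "torus_integral n r (\<lambda>z. ev (flipz s z) (PP la) * ev (flipz (\<not> s) z) (PP mu) * Dt {..<n} z)
      = (\<Sum>\<^sub>\<infinity>k | k \<in> {} \<and> (\<forall>i<n. (\<lambda>_ _. 0::int) k i = 0). (\<lambda>_. 0) (k::nat))"
    proof (rule torus_integral_infsum[OF r])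
      fix z assume z: "z \<in> tor n r"
      have z0: "flipz s' z i = 0" if "n \<le> i" for s' i using z that by (auto simp: tor_def flipz_def)
      have "ev (flipz s z) (PP la) = 0 \<or> ev (flipz (\<not> s) z) (PP mu) = 0"
        using \<open>n < size la \<or> n < size mu\<close>
      proof
        assume "n < size la"
        then have "ev (flipz s z) (PP la) = 0" by (rule ev_PP_0[OF la]) (rule z0)
        then show ?thesis by blast
      next
        assume "n < size mu"
        then have "ev (flipz (\<not> s) z) (PP mu) = 0" by (rule ev_PP_0[OF mu]) (rule z0)
        then show ?thesis by blast
      qed
      then show "ev (flipz s z) (PP la) * ev (flipz (\<not> s) z) (PP mu) * Dt {..<n} z = (\<Sum>\<^sub>\<infinity>k\<in>{}. (\<lambda>_. 0) k * zmon n z ((\<lambda>_ _. 0) k))"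
        by auto
    qed simp
    then show ?thesis by (simp add: torus_form_def)
  qed
  consider "n < size la \<or> n < size mu" | "size la \<le> n" "size mu \<le> n" "\<not> dominance_le la mu"
    | "size la \<le> n" "size mu \<le> n" "\<not> dominance_le mu la" | "size la \<le> n" "la = mu"
    using dominance_le_antisym[OF la mu] by fastforce
  then show ?thesis
  proof cases
    case 1 then show ?thesis unfolding ti using zero by auto
  next
    case 2 then show ?thesis unfolding ti using torus_form_neq[OF la _ mu r] by auto
  next
    case 3 then show ?thesis unfolding ti sym using torus_form_neq[OF mu _ la r] by auto
  next
    case 4 then show ?thesis unfolding ti using torus_form_same[OF la _ r] by auto
  qed
qed

end

section \<open>The Cauchy kernel\<close>

text \<open>Expanding a product of series over the variables in I gives a sum over monomials in
  these variables; the induction separates the exponent of one variable.\<close>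

lemma has_sum_multisets:
  fixes f :: "nat \<Rightarrow> nat \<Rightarrow> complex"
  assumes "finite I" "\<And>i. i \<in> I \<Longrightarrow> (\<lambda>k. norm (f i k)) summable_on UNIV"
  shows "((\<lambda>M. \<Prod>i\<in>I. f i (count M i)) has_sum (\<Prod>i\<in>I. infsum (f i) UNIV)) {M. set_mset M \<subseteq> I} \<and>
    (\<lambda>M. norm (\<Prod>i\<in>I. f i (count M i))) summable_on {M. set_mset M \<subseteq> I}"
  using assms
proof (induction I rule: finite_induct)
  case empty
  have "{M :: nat multiset. set_mset M \<subseteq> {}} = {{#}}" by auto
  then show ?case by (simp add: has_sum_finite_iff)
next
  case (insert x I)
  let ?S = "{M :: nat multiset. set_mset M \<subseteq> I}"
  let ?g = "\<lambda>(k, M). M + replicate_mset k x"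
  have bij: "bij_betw ?g (UNIV \<times> ?S) {M. set_mset M \<subseteq> insert x I}"
  proof (rule bij_betwI[where g = "\<lambda>M. (count M x, filter_mset (\<lambda>y. y \<noteq> x) M)"])
    show "?g \<in> UNIV \<times> ?S \<rightarrow> {M. set_mset M \<subseteq> insert x I}" by (auto split: if_splits)
    show "(\<lambda>M. (count M x, filter_mset (\<lambda>y. y \<noteq> x) M)) \<in> {M. set_mset M \<subseteq> insert x I} \<rightarrow> UNIV \<times> ?S" by auto
    show "(count (?g p) x, filter_mset (\<lambda>y. y \<noteq> x) (?g p)) = p" if p: "p \<in> UNIV \<times> ?S" for p
    proof -
      obtain k M where kM: "p = (k, M)" by (cases p)
      have "x \<notin># M" using p insert.hyps by (auto simp: kM)
      then have c: "count M x = 0" by (simp add: count_eq_zero_iff)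
      then have "filter_mset (\<lambda>y. y \<noteq> x) (M + replicate_mset k x) = M" by (auto simp: multiset_eq_iff)
      then show ?thesis using c by (simp only: kM case_prod_conv) simp
    qed
    show "?g (count M x, filter_mset (\<lambda>y. y \<noteq> x) M) = M" for M
      by (auto simp: multiset_eq_iff)
  qed
  have IH: "((\<lambda>M. \<Prod>i\<in>I. f i (count M i)) has_sum (\<Prod>i\<in>I. infsum (f i) UNIV)) ?S"
    "(\<lambda>M. norm (\<Prod>i\<in>I. f i (count M i))) summable_on ?S"
    using insert by auto
  have xs: "(\<lambda>k. norm (f x k)) summable_on UNIV" using insert.prems by simp
  have pr: "(\<Prod>i\<in>insert x I. f i (count (?g p) i)) = f x (fst p) * (\<Prod>i\<in>I. f i (count (snd p) i))" if "p \<in> UNIV \<times> ?S" for p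
  proof -
    obtain k M where kM: "p = (k, M)" by (cases p)
    have "x \<notin># M" using that insert.hyps by (auto simp: kM)
    then have "count M x = 0" by (simp add: not_in_iff)
    moreover have "(\<Prod>i\<in>I. f i (count (?g p) i)) = (\<Prod>i\<in>I. f i (count M i))"
      using insert.hyps by (intro prod.cong) (auto simp: kM)
    ultimately show ?thesis using insert.hyps by (simp add: kM)
  qed
  have ns: "(\<lambda>p. norm (case p of (k, M) \<Rightarrow> f x k * (\<Prod>i\<in>I. f i (count M i)))) summable_on UNIV \<times> ?S"
    using summable_on_product_nonneg[OF xs IH(2)] by (simp add: norm_mult case_prod_unfold)
  have "((\<lambda>(k, M). f x k * (\<Prod>i\<in>I. f i (count M i))) has_sum infsum (f x) UNIV * (\<Prod>i\<in>I. infsum (f i) UNIV)) (UNIV \<times> ?S)"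
    by (rule has_sum_product_banach[OF _ IH(1) abs_summable_summable[OF ns]])
      (rule has_sum_infsum[OF abs_summable_summable[OF xs]])
  then have "((\<lambda>p. \<Prod>i\<in>insert x I. f i (count (?g p) i)) has_sum infsum (f x) UNIV * (\<Prod>i\<in>I. infsum (f i) UNIV)) (UNIV \<times> ?S)"
    by (rule has_sum_cong[THEN iffD1, rotated]) (simp only: pr, simp only: case_prod_unfold)
  moreover have "(\<lambda>p. norm (\<Prod>i\<in>insert x I. f i (count (?g p) i))) summable_on UNIV \<times> ?S"
    using ns by (rule summable_on_cong[THEN iffD1, rotated]) (simp only: pr, simp only: case_prod_unfold)
  ultimately show ?case
    using has_sum_reindex_bij_betw[OF bij, of "\<lambda>M. \<Prod>i\<in>insert x I. f i (count M i)"]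
      summable_on_reindex_bij_betw[OF bij, of "\<lambda>M. norm (\<Prod>i\<in>insert x I. f i (count M i))"] insert.hyps by simp
qed

lemma infsum_exhaustion:
  fixes f :: "'a \<Rightarrow> complex" and S :: "nat \<Rightarrow> 'a set"
  assumes f: "(\<lambda>x. norm (f x)) summable_on UNIV" and S: "\<And>F. finite F \<Longrightarrow> \<exists>m0. \<forall>m\<ge>m0. F \<subseteq> S m"
  shows "(\<lambda>m. infsum f (S m)) \<longlonglongrightarrow> infsum f UNIV"
proof (rule LIMSEQ_I)
  fix e :: real assume e: "0 < e"
  have nf: "(\<lambda>x. norm (f x)) summable_on A" for A by (rule summable_on_subset_banach[OF f]) simp
  obtain F where F: "finite F" "dist (\<Sum>x\<in>F. norm (f x)) (\<Sum>\<^sub>\<infinity>x. norm (f x)) \<le> e / 3"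
    using has_sum_finite_approximation[OF has_sum_infsum[OF f], of "e / 3"] e by auto
  obtain m0 where m0: "\<And>m. m \<ge> m0 \<Longrightarrow> F \<subseteq> S m" using S[OF F(1)] by auto
  have "norm (infsum f (S m) - infsum f UNIV) < e" if m: "m \<ge> m0" for m
  proof -
    have "infsum f UNIV = infsum f (S m) + infsum f (- S m)"
      using infsum_Un_disjoint[of f "S m" "- S m"] abs_summable_summable[OF nf] by simp
    then have "norm (infsum f (S m) - infsum f UNIV) = norm (infsum f (- S m))" by (simp add: norm_minus_commute)
    also have "\<dots> \<le> (\<Sum>\<^sub>\<infinity>x\<in>- S m. norm (f x))" by (rule norm_infsum_bound[OF nf])
    also have "\<dots> = (\<Sum>\<^sub>\<infinity>x. norm (f x)) - (\<Sum>\<^sub>\<infinity>x\<in>S m. norm (f x))"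
      using infsum_Un_disjoint[OF nf nf, of "S m" "- S m"] by simp
    finally have "norm (infsum f (S m) - infsum f UNIV) \<le> (\<Sum>\<^sub>\<infinity>x. norm (f x)) - (\<Sum>\<^sub>\<infinity>x\<in>S m. norm (f x))" .
    moreover have "(\<Sum>x\<in>F. norm (f x)) \<le> (\<Sum>\<^sub>\<infinity>x\<in>S m. norm (f x))"
      by (rule finite_sum_le_infsum[OF nf F(1) m0[OF m]]) simp
    ultimately show ?thesis using F(2) e unfolding dist_real_def by linarith
  qed
  then show "\<exists>no. \<forall>m\<ge>no. norm (infsum f (S m) - infsum f UNIV) < e" by blast
qed

lemma multisets_exhaustion: "finite F \<Longrightarrow> \<exists>m0. \<forall>m\<ge>m0. F \<subseteq> {M :: nat multiset. set_mset M \<subseteq> {..<m}}"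
proof -
  assume "finite F"
  then have "finite (\<Union>M\<in>F. set_mset M)" by simp
  then obtain m0 where m0: "\<forall>i\<in>\<Union>M\<in>F. set_mset M. i < m0" unfolding finite_nat_set_iff_bounded by (rule exE)
  have "set_mset M \<subseteq> {..<m}" if "M \<in> F" "m0 \<le> m" for M m
  proof
    fix i assume "i \<in># M"
    then have "i < m0" using m0 \<open>M \<in> F\<close> by blast
    then show "i \<in> {..<m}" using \<open>m0 \<le> m\<close> by simp
  qed
  then have "\<forall>m\<ge>m0. F \<subseteq> {M. set_mset M \<subseteq> {..<m}}" by blast
  then show ?thesis by (rule exI)
qed

text \<open>The moduli of the variables. A series with nonnegative coefficients is dominated by its
  value there, which is the comparison used for absolute convergence.\<close>

definition absz :: "(nat \<Rightarrow> complex) \<Rightarrow> nat \<Rightarrow> complex" where "absz z i = of_real (norm (z i))"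

lemma mon_absz: "mon (absz z) M = of_real (norm (mon z M))"
  by (induction M) (simp_all add: absz_def norm_mult)

lemma ev_absz:
  assumes z: "\<And>i. n \<le> i \<Longrightarrow> z i = 0" and f: "bounded_deg f" "\<And>M. 0 \<le> cf f M"
  shows "norm (ev z f) \<le> norm (ev (absz z) f)" "ev (absz z) f = of_real (norm (ev (absz z) f))"
proof -
  obtain d where d: "\<And>M. d < size M \<Longrightarrow> cf f M = 0" using f by (auto simp: bounded_deg_def)
  have z': "absz z i = 0" if "n \<le> i" for i using z[OF that] by (simp add: absz_def)
  have 1: "ev z f = (\<Sum>M\<in>monoms n d. of_real (cf f M) * mon z M)" by (rule ev_finite[OF z d])
  have "ev (absz z) f = (\<Sum>M\<in>monoms n d. of_real (cf f M) * mon (absz z) M)" by (rule ev_finite[OF z' d])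
  also have "\<dots> = of_real (\<Sum>M\<in>monoms n d. cf f M * norm (mon z M))" by (simp add: mon_absz)
  finally have 2: "ev (absz z) f = of_real (\<Sum>M\<in>monoms n d. cf f M * norm (mon z M))" .
  have nn: "0 \<le> (\<Sum>M\<in>monoms n d. cf f M * norm (mon z M))" using f(2) by (intro sum_nonneg) simp
  then have 3: "norm (ev (absz z) f) = (\<Sum>M\<in>monoms n d. cf f M * norm (mon z M))" unfolding 2 norm_of_real by simp
  have "norm (ev z f) \<le> (\<Sum>M\<in>monoms n d. norm (of_real (cf f M) * mon z M))" unfolding 1 by (rule norm_sum)
  then show "norm (ev z f) \<le> norm (ev (absz z) f)" unfolding 3 using f(2) by (simp add: norm_mult)
  show "ev (absz z) f = of_real (norm (ev (absz z) f))" using 2 3 by simp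
qed

context hl begin

definition kf :: "complex \<Rightarrow> complex" where "kf x = (1 - of_real t * x) / (1 - x)"

definition KK :: "nat \<Rightarrow> (nat \<Rightarrow> complex) \<Rightarrow> (nat \<Rightarrow> complex) \<Rightarrow> complex"
  where "KK n z b = (\<Prod>i<n. \<Prod>j. kf (z i * b j))"

text \<open>The Taylor coefficients of \<open>kf\<close>: 1, then 1 - t throughout.\<close>

definition ck :: "nat \<Rightarrow> complex" where "ck k = (if k = 0 then 1 else of_real (1 - t))"

lemma kf_sums:
  assumes x: "norm x < 1"
  shows "(\<lambda>k. norm (ck k * x ^ k)) summable_on UNIV" "(\<Sum>\<^sub>\<infinity>k. ck k * x ^ k) = kf x"
proof -
  have 1: "norm (norm (ck k * x ^ k)) \<le> norm x ^ k" for k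
    using t0 t1 by (auto simp: ck_def norm_mult norm_power simp del: of_real_diff intro!: mult_left_le_one_le)
  have s: "summable (\<lambda>k. norm (ck k * x ^ k))"
    by (rule summable_comparison_test'[where g = "\<lambda>k. norm x ^ k"]) (use 1 x in \<open>auto intro: summable_geometric\<close>)
  then show "(\<lambda>k. norm (ck k * x ^ k)) summable_on UNIV" by (simp add: norm_summable_imp_summable_on)
  have "(\<lambda>k. of_real (1 - t) * x ^ k + (if k = 0 then of_real t else 0)) sums (of_real (1 - t) * (1 / (1 - x)) + of_real t)"
    by (intro sums_add sums_mult geometric_sums x sums_single)
  then have "(\<lambda>k. ck k * x ^ k) sums (of_real (1 - t) * (1 / (1 - x)) + of_real t)"
    by (rule sums_cong[THEN iffD1, rotated]) (auto simp: ck_def)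
  moreover have "1 - x \<noteq> 0" using x by auto
  ultimately have "(\<lambda>k. ck k * x ^ k) sums kf x" by (simp add: kf_def field_simps)
  then show "(\<Sum>\<^sub>\<infinity>k. ck k * x ^ k) = kf x"
    using norm_summable_imp_has_sum[OF s] infsumI by blast
qed

lemma ck_prod:
  assumes "set_mset M \<subseteq> {..<n}"
  shows "(\<Prod>i<n. ck (count M i) * (z i * b) ^ count M i) = b ^ size M * (of_real ((1 - t) ^ card (set_mset M)) * mon z M)"
proof -
  have "(\<Prod>i<n. ck (count M i)) = (\<Prod>i\<in>set_mset M. of_real (1 - t))"
    by (rule prod.mono_neutral_cong_right) (use assms in \<open>auto simp: ck_def count_eq_zero_iff\<close>)
  moreover have "(\<Prod>i<n. (z i * b) ^ count M i) = mon z M * b ^ size M"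
  proof -
    have "(\<Prod>i<n. b ^ count M i) = b ^ (\<Sum>i<n. count M i)" by (simp add: power_sum)
    moreover have "(\<Sum>i<n. count M i) = size M"
      unfolding size_multiset_overloaded_eq using assms by (intro sum.mono_neutral_right) (auto simp: count_eq_zero_iff)
    ultimately show ?thesis by (simp add: power_mult_distrib prod.distrib mon_count[OF assms])
  qed
  ultimately show ?thesis by (simp add: prod.distrib)
qed

text \<open>The generating series of q_k in the n variables z: the product of the n one-variable
  series, expanded over monomials and grouped by degree.\<close>

lemma ev_qs_sums:
  assumes z: "\<And>i. n \<le> i \<Longrightarrow> z i = 0" and b: "\<And>i. i < n \<Longrightarrow> norm (z i * b) < 1"
  shows "(\<lambda>k. norm (b ^ k * ev z (qs k))) summable_on UNIV" "(\<Sum>\<^sub>\<infinity>k. b ^ k * ev z (qs k)) = (\<Prod>i<n. kf (z i * b))"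
proof -
  let ?S = "{M :: nat multiset. set_mset M \<subseteq> {..<n}}"
  let ?B = "\<lambda>k. {M \<in> ?S. size M = k}"
  define g where "g M = (\<Prod>i<n. ck (count M i) * (z i * b) ^ count M i)" for M
  have "(g has_sum (\<Prod>i<n. \<Sum>\<^sub>\<infinity>k. ck k * (z i * b) ^ k)) ?S \<and> (\<lambda>M. norm (g M)) summable_on ?S"
    unfolding g_def by (rule has_sum_multisets) (use b kf_sums in auto)
  moreover have "(\<Prod>i<n. \<Sum>\<^sub>\<infinity>k. ck k * (z i * b) ^ k) = (\<Prod>i<n. kf (z i * b))"
    by (intro prod.cong) (use b kf_sums in auto)
  ultimately have g: "(g has_sum (\<Prod>i<n. kf (z i * b))) ?S" "(\<lambda>M. norm (g M)) summable_on ?S" by simp_all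
  have bij: "bij_betw snd (Sigma UNIV ?B) ?S" by (rule bij_betwI[where g = "\<lambda>M. (size M, M)"]) auto
  have fin: "finite (?B k)" for k by (rule finite_subset[OF _ finite_monoms[of n k]]) (auto simp: monoms_def)
  have evq: "(\<Sum>M\<in>?B k. g M) = b ^ k * ev z (qs k)" for k
  proof -
    have "ev z (qs k) = (\<Sum>M\<in>monoms n k. of_real (cf (qs k) M) * mon z M)" by (rule ev_finite[OF z]) (simp_all add: cf_qs)
    also have "\<dots> = (\<Sum>M\<in>?B k. of_real ((1 - t) ^ card (set_mset M)) * mon z M)"
      by (rule sum.mono_neutral_cong_right[OF finite_monoms]) (auto simp: monoms_def cf_qs)
    finally show ?thesis unfolding sum_distrib_left by (auto simp: sum_distrib_left g_def ck_prod intro!: sum.cong)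
  qed
  have "((\<lambda>p. g (snd p)) has_sum (\<Prod>i<n. kf (z i * b))) (Sigma UNIV ?B)"
    using g(1) unfolding has_sum_reindex_bij_betw[OF bij] .
  then have "((\<lambda>k. b ^ k * ev z (qs k)) has_sum (\<Prod>i<n. kf (z i * b))) UNIV"
    by (rule has_sum_SigmaD) (simp only: snd_conv has_sum_finite_iff[OF fin] evq)
  then show "(\<Sum>\<^sub>\<infinity>k. b ^ k * ev z (qs k)) = (\<Prod>i<n. kf (z i * b))" by (rule infsumI)
  have "((\<lambda>p. norm (g (snd p))) has_sum (\<Sum>\<^sub>\<infinity>M\<in>?S. norm (g M))) (Sigma UNIV ?B)"
    using has_sum_infsum[OF g(2)] unfolding has_sum_reindex_bij_betw[OF bij, of "\<lambda>M. norm (g M)"] .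
  then have "((\<lambda>k. \<Sum>M\<in>?B k. norm (g M)) has_sum (\<Sum>\<^sub>\<infinity>M\<in>?S. norm (g M))) UNIV"
    by (rule has_sum_SigmaD) (simp only: snd_conv has_sum_finite_iff[OF fin])
  then have "(\<lambda>k. \<Sum>M\<in>?B k. norm (g M)) summable_on UNIV" by (rule has_sum_imp_summable)
  then show "(\<lambda>k. norm (b ^ k * ev z (qs k))) summable_on UNIV"
    by (rule summable_on_comparison_test) (unfold evq[symmetric], rule norm_sum, rule norm_ge_zero)
qed

lemma kf_prod_limit:
  assumes b: "summable (\<lambda>j. norm (b j))" and w: "\<And>j. norm (w * b j) < 1"
  shows "(\<lambda>m. \<Prod>j<m. kf (w * b j)) \<longlonglongrightarrow> (\<Prod>j. kf (w * b j))"
proof -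
  \<comment> \<open>The linear bound near 0 turns summability of b into absolute convergence of the
    infinite product.\<close>
  have "norm (kf x - 1) \<le> 2 * norm x" if x: "norm x \<le> 1 / 2" for x
  proof -
    have nz: "1 - x \<noteq> 0" using x by auto
    have "kf x - 1 = of_real (1 - t) * x / (1 - x)" using nz by (simp add: kf_def field_simps)
    then have "norm (kf x - 1) = (1 - t) * norm x / norm (1 - x)" using t1 by (simp add: norm_mult norm_divide del: of_real_diff)
    also have "\<dots> \<le> 1 * norm x / (1 / 2)"
    proof (intro frac_le mult_right_mono)
      show "1 / 2 \<le> norm (1 - x)" using norm_triangle_ineq2[of 1 x] x by simp
    qed (use t0 in auto)
    finally show ?thesis by simp
  qed
  moreover have "(\<lambda>j. norm (w * b j)) \<longlonglongrightarrow> 0"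
    using summable_LIMSEQ_zero[OF summable_mult[OF b, of "norm w"]] by (simp add: norm_mult)
  then have "\<forall>\<^sub>F j in sequentially. norm (w * b j) < 1 / 2" by (rule order_tendstoD) simp
  ultimately have "\<forall>\<^sub>F j in sequentially. norm (norm (kf (w * b j) - 1)) \<le> 2 * norm (w * b j)"
    by (auto elim!: eventually_mono)
  moreover have "summable (\<lambda>j. 2 * norm (w * b j))"
    using summable_mult[OF b, of "2 * norm w"] by (simp add: norm_mult mult_ac)
  ultimately have "summable (\<lambda>j. norm (kf (w * b j) - 1))" by (rule summable_comparison_test_ev)
  then have "convergent_prod (\<lambda>j. kf (w * b j))"
    by (intro abs_convergent_prod_imp_convergent_prod summable_imp_abs_convergent_prod)
  then have "(\<lambda>m. \<Prod>j\<le>m. kf (w * b j)) \<longlonglongrightarrow> (\<Prod>j. kf (w * b j))" by (rule convergent_prod_LIMSEQ)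
  then show ?thesis by (simp only: lessThan_Suc_atMost[symmetric] filterlim_sequentially_Suc[of "\<lambda>m. \<Prod>j<m. kf (w * b j)"])
qed

text \<open>For M with exponent list al this is b^al q_al(z), the part of the kernel that belongs to
  the monomial M in b.\<close>

definition qterm :: "(nat \<Rightarrow> complex) \<Rightarrow> (nat \<Rightarrow> complex) \<Rightarrow> monomial \<Rightarrow> complex"
  where "qterm z b M = mon b M * (\<Prod>j\<in>set_mset M. ev z (qs (count M j)))"

lemma qterm_eq:
  assumes "set_mset M \<subseteq> {..<m}"
  shows "qterm z b M = (\<Prod>j<m. b j ^ count M j * ev z (qs (count M j)))"
proof -
  have "(\<Prod>j\<in>set_mset M. ev z (qs (count M j))) = (\<Prod>j<m. ev z (qs (count M j)))"
    by (rule prod.mono_neutral_left) (use assms in \<open>auto simp: not_in_iff\<close>)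
  then show ?thesis by (simp add: qterm_def prod.distrib mon_count[OF assms])
qed

end

text \<open>The conditions under which the kernel expands absolutely. They are met with three second
  alphabets: b itself, a with the z inverted, and u/z.\<close>

locale hl_kernel = hl +
  fixes n :: nat and z b :: "nat \<Rightarrow> complex"
  assumes z: "\<And>i. n \<le> i \<Longrightarrow> z i = 0" and b: "summable (\<lambda>j. norm (b j))"
    and zb: "\<And>i j. i < n \<Longrightarrow> norm (z i * b j) < 1"
begin

lemma absz_kernel: "hl_kernel t n (absz z) (absz b)"
proof
  show "absz z i = 0" if "n \<le> i" for i using z[OF that] by (simp add: absz_def)
  show "summable (\<lambda>j. norm (absz b j))" using b by (simp add: absz_def)
  show "norm (absz z i * absz b j) < 1" if "i < n" for i j using zb[OF that, of j] by (simp add: absz_def norm_mult)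
qed

lemma qterm_absz: "norm (qterm z b M) \<le> norm (qterm (absz z) (absz b) M)"
  "qterm (absz z) (absz b) M = of_real (norm (qterm (absz z) (absz b) M))"
proof -
  have q: "norm (ev z (qs k)) \<le> norm (ev (absz z) (qs k))" "ev (absz z) (qs k) = of_real (norm (ev (absz z) (qs k)))" for k
    using ev_absz[of n z "qs k"] z symf_bounded[OF symf_qs] t1 by (auto simp: cf_qs)
  have "(\<Prod>j\<in>set_mset M. norm (ev z (qs (count M j)))) \<le> (\<Prod>j\<in>set_mset M. norm (ev (absz z) (qs (count M j))))"
    by (intro prod_mono) (use q in auto)
  then show "norm (qterm z b M) \<le> norm (qterm (absz z) (absz b) M)"
    by (simp add: qterm_def norm_mult mon_absz prod_norm[symmetric] mult_left_mono)
  have "(\<Prod>j\<in>set_mset M. ev (absz z) (qs (count M j))) = (\<Prod>j\<in>set_mset M. of_real (norm (ev (absz z) (qs (count M j)))))"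
    by (intro prod.cong refl) (rule q(2))
  then show "qterm (absz z) (absz b) M = of_real (norm (qterm (absz z) (absz b) M))"
    by (simp add: qterm_def mon_absz norm_mult prod_norm[symmetric])
qed

lemma qterm_finite:
  "(qterm z b has_sum (\<Prod>j<m. \<Prod>i<n. kf (z i * b j))) {M. set_mset M \<subseteq> {..<m}}"
proof -
  have s: "(\<lambda>k. norm (b j ^ k * ev z (qs k))) summable_on UNIV" "(\<Sum>\<^sub>\<infinity>k. b j ^ k * ev z (qs k)) = (\<Prod>i<n. kf (z i * b j))" for j
    using ev_qs_sums[of n z "b j"] z zb by blast+
  have "((\<lambda>M. \<Prod>j<m. b j ^ count M j * ev z (qs (count M j))) has_sum (\<Prod>j<m. \<Sum>\<^sub>\<infinity>k. b j ^ k * ev z (qs k))) {M. set_mset M \<subseteq> {..<m}}"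
    by (rule has_sum_multisets[THEN conjunct1]) (use s in auto)
  then show ?thesis unfolding s(2)
    by (rule has_sum_cong[THEN iffD1, rotated]) (simp add: qterm_eq)
qed

lemma kernel_limit: "(\<lambda>m. \<Prod>j<m. \<Prod>i<n. kf (z i * b j)) \<longlonglongrightarrow> KK n z b"
  unfolding KK_def using kf_prod_limit[OF b zb]
  by (subst prod.swap) (intro tendsto_prod, simp)

text \<open>At the moduli all terms are nonnegative, and each finite sum is bounded by a partial
  product; the partial products converge, hence are bounded.\<close>

lemma qterm_abs_summable: "(\<lambda>M. norm (qterm z b M)) summable_on UNIV"
proof -
  interpret A: hl_kernel t n "absz z" "absz b" by (rule absz_kernel)
  let ?T = "qterm (absz z) (absz b)"
  let ?P = "\<lambda>m. \<Prod>j<m. \<Prod>i<n. kf (absz z i * absz b j)"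
  obtain B where B: "\<And>m. norm (?P m) \<le> B"
    using convergent_imp_Bseq[OF convergentI[OF A.kernel_limit]] unfolding Bseq_def by blast
  have "(\<lambda>M. norm (?T M)) summable_on UNIV"
  proof (rule nonneg_bdd_above_summable_on)
    show "bdd_above (sum (\<lambda>M. norm (?T M)) ` {F. F \<subseteq> UNIV \<and> finite F})"
    proof (rule bdd_aboveI2)
      fix F :: "monomial set" assume "F \<in> {F. F \<subseteq> UNIV \<and> finite F}"
      then have F: "finite F" by simp
      obtain m where m: "F \<subseteq> {M. set_mset M \<subseteq> {..<m}}" using multisets_exhaustion[OF F] by blast
      have hs: "(?T has_sum ?P m) {M. set_mset M \<subseteq> {..<m}}" by (rule A.qterm_finite)
      have "((\<lambda>M. Re (?T M)) has_sum Re (?P m)) {M. set_mset M \<subseteq> {..<m}}" by (rule has_sum_Re[OF hs])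
      moreover have "Re (?T M) = norm (?T M)" for M using qterm_absz(2)[of M] by (metis Re_complex_of_real)
      ultimately have "((\<lambda>M. norm (?T M)) has_sum Re (?P m)) {M. set_mset M \<subseteq> {..<m}}" by simp
      then have "(\<Sum>M\<in>F. norm (?T M)) \<le> Re (?P m)" by (rule finite_sum_le_has_sum[OF _ F m]) simp
      also have "\<dots> \<le> norm (?P m)" by (rule complex_Re_le_cmod)
      also have "\<dots> \<le> B" by (rule B)
      finally show "(\<Sum>M\<in>F. norm (?T M)) \<le> B" .
    qed
  qed simp
  then show ?thesis by (rule summable_on_comparison_test) (use qterm_absz in auto)
qed

lemma qterm_infsum: "infsum (qterm z b) UNIV = KK n z b"
proof -
  have "(\<lambda>m. infsum (qterm z b) {M. set_mset M \<subseteq> {..<m}}) \<longlonglongrightarrow> infsum (qterm z b) UNIV"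
    by (rule infsum_exhaustion[OF qterm_abs_summable multisets_exhaustion])
  then have "(\<lambda>m. \<Prod>j<m. \<Prod>i<n. kf (z i * b j)) \<longlonglongrightarrow> infsum (qterm z b) UNIV"
    by (simp add: infsumI[OF qterm_finite])
  then show ?thesis using kernel_limit LIMSEQ_unique by blast
qed

text \<open>Expanding q_al P_nu in the P_ka gives the coefficients of b^al in Q_{ka/nu}(b).\<close>

lemma qterm_PP:
  assumes nu: "nu \<in> partitions"
  shows "(\<Sum>ka | ka \<in> partitions \<and> sum_mset ka = sum_mset nu + size M. of_real (cf (SQ ka nu) M) * mon b M * ev z (PP ka)) =
    qterm z b M * ev z (PP nu)"
proof -
  obtain al where al: "M = mono_of al" using mono_of_exists by blast
  have sub: "set_mset M \<subseteq> {..<length al}"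
  proof
    fix j assume "j \<in># M"
    then have "count M j \<noteq> 0" by (simp add: count_eq_zero_iff)
    then show "j \<in> {..<length al}" by (simp add: al count_mono_of split: if_splits)
  qed
  have bd: "bounded_deg (qprod al)" for al
    by (induction al) (auto intro!: bounded_deg_mult symf_bounded simp flip: sc_1)
  have ql: "ev z (qprod al) = (\<Prod>j<length al. ev z (qs (al ! j)))"
  proof (induction al)
    case (Cons a al)
    have "ev z (qprod (a # al)) = ev z (qs a) * ev z (qprod al)"
      using ev_mult[OF z symf_bounded[OF symf_qs] bd] by simp
    then show ?case by (simp add: Cons prod.lessThan_Suc_shift del: prod.lessThan_Suc)
  qed simp
  have "qterm z b M = mon b M * ev z (qprod al)"
  proof -
    have "count M j = al ! j" if "j < length al" for j using that by (simp add: al count_mono_of)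
    then show ?thesis unfolding qterm_eq[OF sub] ql by (simp add: prod.distrib mon_count[OF sub])
  qed
  then have "qterm z b M * ev z (PP nu) = mon b M * ev z (qprod al * PP nu)"
    using ev_mult[OF z bd symf_bounded[OF symf_PP[OF nu]]] by simp
  also have "ev z (qprod al * PP nu) = (\<Sum>ka | ka \<in> partitions \<and> sum_mset ka = sum_mset nu + sum_list al. ev z (sc (chi nu al ka) * PP ka))"
    unfolding qprod_PP[OF nu] using symf_PP by (intro ev_sum[OF z] bounded_deg_mult bounded_deg_sc symf_bounded) auto
  also have "\<dots> = (\<Sum>ka | ka \<in> partitions \<and> sum_mset ka = sum_mset nu + size M. of_real (cf (SQ ka nu) M) * ev z (PP ka))"
    by (intro sum.cong) (auto simp: al size_mono_of cf_SQ[OF _ nu])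
  finally show ?thesis by (simp add: sum_distrib_left mult_ac)
qed

text \<open>The double series over M and ka, summed over M first, gives Q_{ka/nu}(b) P_ka(z); summed
  over ka first it gives the kernel expansion times P_nu(z). What has to be shown is that the two
  orders agree.\<close>

lemma kernel_PP:
  assumes nu: "nu \<in> partitions"
  shows "(\<lambda>ka. norm (ev b (SQ ka nu) * ev z (PP ka))) summable_on partitions" (is ?thesis1)
    and "(\<Sum>\<^sub>\<infinity>ka\<in>partitions. ev b (SQ ka nu) * ev z (PP ka)) = KK n z b * ev z (PP nu)" (is ?thesis2)
proof -
  interpret A: hl_kernel t n "absz z" "absz b" by (rule absz_kernel)
  define G where "G = (\<lambda>(M, ka). of_real (cf (SQ ka nu) M) * mon b M * ev z (PP ka))"
  define G' where "G' = (\<lambda>(M, ka). of_real (cf (SQ ka nu) M) * mon (absz b) M * ev (absz z) (PP ka))"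
  let ?K = "\<lambda>M :: monomial. {ka. ka \<in> partitions \<and> sum_mset ka = sum_mset nu + size M}"
  have fK: "finite (?K M)" for M by (rule finite_partitions_of)
  have G0: "G (M, ka) = 0" if "ka \<in> partitions - ?K M" for M ka
    using that SQ_degree[OF _ nu, of ka M] by (auto simp: G_def)
  have PPa: "norm (ev z (PP ka)) \<le> norm (ev (absz z) (PP ka))" "ev (absz z) (PP ka) = of_real (norm (ev (absz z) (PP ka)))"
    if "ka \<in> partitions" for ka
    using ev_absz[of n z "PP ka"] z symf_bounded[OF symf_PP[OF that]] cf_PP_nonneg[OF that] by auto
  have GG: "norm (G (M, ka)) \<le> norm (G' (M, ka))" "G' (M, ka) = of_real (norm (G' (M, ka)))" if "ka \<in> partitions" for M ka
  proof -
    show "norm (G (M, ka)) \<le> norm (G' (M, ka))"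
      using PPa(1)[OF that] by (simp add: G_def G'_def norm_mult mon_absz mult_left_mono)
    have "G' (M, ka) = of_real (cf (SQ ka nu) M * norm (mon b M) * norm (ev (absz z) (PP ka)))"
      using PPa(2)[OF that] by (simp add: G'_def mon_absz)
    moreover have "0 \<le> cf (SQ ka nu) M * norm (mon b M) * norm (ev (absz z) (PP ka))" using cf_SQ_nonneg[OF that nu] by simp
    ultimately show "G' (M, ka) = of_real (norm (G' (M, ka)))" by (simp only: norm_of_real abs_of_nonneg)
  qed
  \<comment> \<open>At the moduli the terms are nonnegative, so the norm of the sum is the sum of
    the norms and the exact row identity \<open>qterm_PP\<close> bounds the absolute row
    sum.\<close>
  have row: "(\<Sum>ka\<in>?K M. norm (G (M, ka))) \<le> norm (qterm (absz z) (absz b) M) * norm (ev (absz z) (PP nu))" for M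
  proof -
    have "(\<Sum>ka\<in>?K M. norm (G (M, ka))) \<le> (\<Sum>ka\<in>?K M. norm (G' (M, ka)))" by (intro sum_mono GG) simp
    also have "\<dots> = norm (\<Sum>ka\<in>?K M. G' (M, ka))"
    proof -
      have "(\<Sum>ka\<in>?K M. G' (M, ka)) = of_real (\<Sum>ka\<in>?K M. norm (G' (M, ka)))"
        unfolding of_real_sum by (intro sum.cong refl GG(2)) simp
      then have "norm (\<Sum>ka\<in>?K M. G' (M, ka)) = \<bar>\<Sum>ka\<in>?K M. norm (G' (M, ka))\<bar>" by (simp only: norm_of_real)
      then show ?thesis by (simp add: sum_nonneg)
    qed
    also have "(\<Sum>ka\<in>?K M. G' (M, ka)) = qterm (absz z) (absz b) M * ev (absz z) (PP nu)"
      using A.qterm_PP[OF nu, of M] by (simp add: G'_def)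
    finally show ?thesis by (simp add: norm_mult)
  qed
  have sumG: "(\<lambda>p. norm (G p)) summable_on UNIV \<times> partitions"
  proof (rule summable_on_SigmaI)
    show "((\<lambda>ka. norm (G (M, ka))) has_sum (\<Sum>ka\<in>?K M. norm (G (M, ka)))) partitions" for M
      by (rule has_sum_finite_neutralI[OF fK]) (use G0 in auto)
    show "(\<lambda>M. \<Sum>ka\<in>?K M. norm (G (M, ka))) summable_on UNIV"
      by (rule summable_on_comparison_test[OF summable_on_cmult_left[OF A.qterm_abs_summable]])
        (use row in \<open>auto intro: sum_nonneg\<close>)
  qed simp
  have inner: "ev b (SQ ka nu) * ev z (PP ka) = (\<Sum>\<^sub>\<infinity>M. G (M, ka))" for ka
    by (simp add: ev_def[of b] G_def infsum_cmult_left')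
  have swp: "(\<lambda>p. norm (G (prod.swap p))) summable_on partitions \<times> UNIV"
  proof -
    have "bij_betw prod.swap (partitions \<times> UNIV) (UNIV \<times> partitions)" by (rule bij_betwI[where g = prod.swap]) auto
    from summable_on_reindex_bij_betw[OF this, of "\<lambda>p. norm (G p)"] show ?thesis using sumG by simp
  qed
  then have sw: "(\<lambda>M. norm (G (M, ka))) summable_on UNIV" if "ka \<in> partitions" for ka
    using iffD1[OF Infinite_Sum.abs_summable_on_Sigma_iff[of "\<lambda>p. G (prod.swap p)" partitions "\<lambda>_. UNIV"] swp] that by simp
  have "(\<lambda>ka. \<Sum>\<^sub>\<infinity>M. norm (G (M, ka))) summable_on partitions"
    using swp summable_on_Sigma_banach[of "\<lambda>ka M. norm (G (M, ka))" partitions "\<lambda>_. UNIV"] by (simp add: case_prod_unfold prod.swap_def)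
  then show ?thesis1
    by (rule summable_on_comparison_test) (use norm_infsum_bound[OF sw] in \<open>auto simp: inner\<close>)
  have "(\<Sum>\<^sub>\<infinity>ka\<in>partitions. ev b (SQ ka nu) * ev z (PP ka)) = (\<Sum>\<^sub>\<infinity>M. \<Sum>\<^sub>\<infinity>ka\<in>partitions. G (M, ka))"
    unfolding inner using abs_summable_summable[OF sumG]
    by (intro infsum_swap_banach[symmetric]) (simp add: case_prod_unfold)
  also have "\<dots> = (\<Sum>\<^sub>\<infinity>M. qterm z b M * ev z (PP nu))"
  proof (intro infsum_cong)
    fix M
    have "((\<lambda>ka. G (M, ka)) has_sum (\<Sum>ka\<in>?K M. G (M, ka))) partitions"
      by (rule has_sum_finite_neutralI[OF fK]) (use G0 in auto)
    then show "(\<Sum>\<^sub>\<infinity>ka\<in>partitions. G (M, ka)) = qterm z b M * ev z (PP nu)"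
      using qterm_PP[OF nu, of M] by (simp add: infsumI G_def)
  qed
  also have "\<dots> = KK n z b * ev z (PP nu)" by (simp add: infsum_cmult_left' qterm_infsum)
  finally show ?thesis2 .
qed

end

section \<open>The contour integral\<close>

lemma infsum_of_real: "(\<Sum>\<^sub>\<infinity>x\<in>A. complex_of_real (f x)) = of_real (infsum f A)"
proof (cases "f summable_on A")
  case True
  then show ?thesis by (intro infsumI has_sum_of_real has_sum_infsum)
next
  case False
  have "\<not> (\<lambda>x. complex_of_real (f x)) summable_on A"
  proof
    assume "(\<lambda>x. complex_of_real (f x)) summable_on A"
    then have "(\<lambda>x. Re (complex_of_real (f x))) summable_on A" using has_sum_Re unfolding summable_on_def by blast
    then show False using False by simp
  qed
  then show ?thesis using False by (simp add: infsum_not_exists)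
qed

lemma sum_infsum_swap:
  fixes f :: "'k \<Rightarrow> 'a \<Rightarrow> real"
  assumes "finite K" "\<And>k. k \<in> K \<Longrightarrow> f k summable_on A"
  shows "(\<Sum>k\<in>K. infsum (f k) A) = (\<Sum>\<^sub>\<infinity>x\<in>A. \<Sum>k\<in>K. f k x) \<and> (\<lambda>x. \<Sum>k\<in>K. f k x) summable_on A"
  using assms by (induction K rule: finite_induct) (auto simp: infsum_add summable_on_add)

context hl begin

text \<open>The formal constant term of P_la(z) P_mu(1/z) times the density, when d holds the
  Laurent coefficients of the density.\<close>

definition wpair :: "nat \<Rightarrow> ((nat \<Rightarrow> int) \<Rightarrow> complex) \<Rightarrow> partition \<Rightarrow> partition \<Rightarrow> complex"
  where "wpair n d la mu = (\<Sum>(M, N)\<in>monoms n (sum_mset la) \<times> monoms n (sum_mset mu).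
    of_real (cf (PP la) M * cf (PP mu) N) * d (\<lambda>i. int (count N i) - int (count M i)))"

text \<open>The point of the torus with all coordinates equal to r, where polynomials with
  nonnegative coefficients attain their maximum modulus on the torus.\<close>

definition radii :: "nat \<Rightarrow> real \<Rightarrow> nat \<Rightarrow> complex"
  where "radii n r i = (if i < n then of_real r else 0)"

lemma ev_PP_monoms:
  assumes la: "la \<in> partitions" and z: "\<And>i. n \<le> i \<Longrightarrow> z i = 0"
  shows "ev z (PP la) = (\<Sum>M\<in>monoms n (sum_mset la). of_real (cf (PP la) M) * zmon n z (\<lambda>i. int (count M i)))"
proof -
  have "ev z (PP la) = (\<Sum>M\<in>monoms n (sum_mset la). of_real (cf (PP la) M) * mon z M)"
    by (rule ev_finite) (use z PP_degree[OF la] in \<open>blast, fastforce\<close>)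
  also have "\<dots> = (\<Sum>M\<in>monoms n (sum_mset la). of_real (cf (PP la) M) * zmon n z (\<lambda>i. int (count M i)))"
    by (rule sum.cong[OF refl], subst mon_count[of _ n]) (simp_all add: monoms_def prod_zmon)
  finally show ?thesis .
qed

lemma zmon_inverse: "zmon n (\<lambda>i. inverse (z i)) al = zmon n z (\<lambda>i. - al i)"
  by (simp add: zmon_def power_int_minus power_int_inverse)

lemma norm_ev_radii:
  assumes la: "la \<in> partitions" and r: "0 < r"
  shows "norm (ev (radii n r) (PP la)) = (\<Sum>M\<in>monoms n (sum_mset la). cf (PP la) M * zmon n (\<lambda>_. r) (\<lambda>i. int (count M i)))"
    and "norm (ev (\<lambda>i. inverse (radii n r i)) (PP la)) = (\<Sum>M\<in>monoms n (sum_mset la). cf (PP la) M * zmon n (\<lambda>_. r) (\<lambda>i. - int (count M i)))"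
proof -
  have zm: "zmon n (radii n r) al = of_real (zmon n (\<lambda>_. r) al)" for al
    by (simp add: zmon_def radii_def of_real_prod of_real_power_int)
  have R0: "radii n r i = 0" if "n \<le> i" for i using that by (simp add: radii_def)
  have nn: "0 \<le> (\<Sum>M\<in>monoms n (sum_mset la). cf (PP la) M * zmon n (\<lambda>_. r) (f M))" for f
    using cf_PP_nonneg[OF la] less_imp_le[OF zmon_pos[OF r]] by (intro sum_nonneg mult_nonneg_nonneg)
  have "ev (radii n r) (PP la) = of_real (\<Sum>M\<in>monoms n (sum_mset la). cf (PP la) M * zmon n (\<lambda>_. r) (\<lambda>i. int (count M i)))"
    by (subst ev_PP_monoms[OF la, of n]) (simp_all add: R0 zm)
  then show "norm (ev (radii n r) (PP la)) = (\<Sum>M\<in>monoms n (sum_mset la). cf (PP la) M * zmon n (\<lambda>_. r) (\<lambda>i. int (count M i)))"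
    using nn by (simp only: norm_of_real abs_of_nonneg)
  have "ev (\<lambda>i. inverse (radii n r i)) (PP la) = of_real (\<Sum>M\<in>monoms n (sum_mset la). cf (PP la) M * zmon n (\<lambda>_. r) (\<lambda>i. - int (count M i)))"
    by (subst ev_PP_monoms[OF la, of n]) (simp_all add: R0 zm zmon_inverse)
  then show "norm (ev (\<lambda>i. inverse (radii n r i)) (PP la)) = (\<Sum>M\<in>monoms n (sum_mset la). cf (PP la) M * zmon n (\<lambda>_. r) (\<lambda>i. - int (count M i)))"
    using nn by (simp only: norm_of_real abs_of_nonneg)
qed

text \<open>Each pair of functions is expanded into monomials to reach
  \<open>torus_integral_laurent\<close>. The coefficients of P are nonnegative, so the values at
  \<open>radii\<close> and at its inverse are the sums of the absolute terms; summability at this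
  one point suffices.\<close>

lemma torus_integral_PP_wpair:
  fixes c :: "'k \<Rightarrow> complex" and ka ka' :: "'k \<Rightarrow> partition"
  assumes r: "0 < r" and d: "laurent n r d (Dt {..<n})"
    and parts: "\<And>k. k \<in> A \<Longrightarrow> ka k \<in> partitions" "\<And>k. k \<in> A \<Longrightarrow> ka' k \<in> partitions"
    and sum: "(\<lambda>k. norm (c k) * (norm (ev (radii n r) (PP (ka k))) * norm (ev (\<lambda>i. inverse (radii n r i)) (PP (ka' k))))) summable_on A"
    and F: "\<And>z. z \<in> tor n r \<Longrightarrow> F z = (\<Sum>\<^sub>\<infinity>k\<in>A. c k * (ev z (PP (ka k)) * ev (\<lambda>i. inverse (z i)) (PP (ka' k)))) * Dt {..<n} z"
  shows "torus_integral n r F = (\<Sum>\<^sub>\<infinity>k\<in>A. c k * wpair n d (ka k) (ka' k))"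
    and "(\<lambda>k. norm (c k * wpair n d (ka k) (ka' k))) summable_on A"
proof -
  define B where "B k = monoms n (sum_mset (ka k)) \<times> monoms n (sum_mset (ka' k))" for k
  define I where "I = Sigma A B"
  define e where "e = (\<lambda>(k, M, N). c k * of_real (cf (PP (ka k)) M * cf (PP (ka' k)) N))"
  define be where "be = (\<lambda>(k :: 'k, M :: monomial, N :: monomial) i. int (count M i) - int (count N i))"
  have fB: "finite (B k)" for k by (simp add: B_def)
  have zr: "zmon n (\<lambda>_. r) (be (k, M, N)) = zmon n (\<lambda>_. r) (\<lambda>i. int (count M i)) * zmon n (\<lambda>_. r) (\<lambda>i. - int (count N i))" for k M N
    using zmon_add_real[OF r, of n "\<lambda>i. int (count M i)" "\<lambda>i. - int (count N i)"] by (simp add: be_def)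
  have sum1: "(\<lambda>p. norm (e p) * zmon n (\<lambda>_. r) (be p)) summable_on I"
    unfolding I_def
  proof (rule summable_on_SigmaI)
    fix k assume k: "k \<in> A"
    have nn: "0 \<le> cf (PP (ka k)) M" "0 \<le> cf (PP (ka' k)) M" for M using cf_PP_nonneg parts k by blast+
    have "(\<Sum>q\<in>B k. norm (e (k, q)) * zmon n (\<lambda>_. r) (be (k, q))) =
      norm (c k) * (norm (ev (radii n r) (PP (ka k))) * norm (ev (\<lambda>i. inverse (radii n r i)) (PP (ka' k))))"
      unfolding norm_ev_radii[OF parts(1)[OF k] r] norm_ev_radii[OF parts(2)[OF k] r] sum_product
      unfolding sum.cartesian_product unfolding sum_distrib_left B_def
      by (intro sum.cong refl) (auto simp: e_def zr norm_mult nn mult_ac)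
    then show "((\<lambda>q. norm (e (k, q)) * zmon n (\<lambda>_. r) (be (k, q))) has_sum
        norm (c k) * (norm (ev (radii n r) (PP (ka k))) * norm (ev (\<lambda>i. inverse (radii n r i)) (PP (ka' k))))) (B k)"
      using fB by (simp add: has_sum_finite_iff)
  next
    show "0 \<le> norm (e (k, q)) * zmon n (\<lambda>_. r) (be (k, q))" for k q
      using less_imp_le[OF zmon_pos[OF r]] by (intro mult_nonneg_nonneg) auto
  qed (rule sum)
  have Fe: "F z = (\<Sum>\<^sub>\<infinity>p\<in>I. e p * zmon n z (be p) * Dt {..<n} z)" if z: "z \<in> tor n r" for z
  proof -
    have z0: "z i = 0" "inverse (z i) = 0" if "n \<le> i" for i using z that by (auto simp: tor_def)
    have s: "(\<lambda>p. e p * zmon n z (be p)) summable_on I"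
      by (rule abs_summable_summable) (use sum1 in \<open>simp add: norm_mult norm_zmon[OF z]\<close>)
    have zz: "zmon n z (be (k, M, N)) = zmon n z (\<lambda>i. int (count M i)) * zmon n z (\<lambda>i. - int (count N i))" for k M N
      using zmon_add[OF r z, of "\<lambda>i. int (count M i)" "\<lambda>i. - int (count N i)"] by (simp add: be_def)
    have "(\<Sum>\<^sub>\<infinity>p\<in>I. e p * zmon n z (be p)) = (\<Sum>\<^sub>\<infinity>k\<in>A. \<Sum>\<^sub>\<infinity>q\<in>B k. e (k, q) * zmon n z (be (k, q)))"
      using s unfolding I_def by (rule infsum_Sigma_banach[symmetric])
    also have "\<dots> = (\<Sum>\<^sub>\<infinity>k\<in>A. c k * (ev z (PP (ka k)) * ev (\<lambda>i. inverse (z i)) (PP (ka' k))))"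
    proof (rule infsum_cong)
      fix k assume k: "k \<in> A"
      have e1: "ev z (PP (ka k)) = (\<Sum>M\<in>monoms n (sum_mset (ka k)). of_real (cf (PP (ka k)) M) * zmon n z (\<lambda>i. int (count M i)))"
        by (rule ev_PP_monoms[OF parts(1)[OF k]]) (rule z0)
      have e2: "ev (\<lambda>i. inverse (z i)) (PP (ka' k)) =
          (\<Sum>N\<in>monoms n (sum_mset (ka' k)). of_real (cf (PP (ka' k)) N) * zmon n (\<lambda>i. inverse (z i)) (\<lambda>i. int (count N i)))"
        by (rule ev_PP_monoms[OF parts(2)[OF k]]) (rule z0)
      have "(\<Sum>q\<in>B k. e (k, q) * zmon n z (be (k, q))) = c k * (ev z (PP (ka k)) * ev (\<lambda>i. inverse (z i)) (PP (ka' k)))"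
        unfolding e1 e2 sum_product
        unfolding sum.cartesian_product unfolding sum_distrib_left B_def
        by (intro sum.cong refl) (auto simp: e_def zz zmon_inverse mult_ac)
      then show "(\<Sum>\<^sub>\<infinity>q\<in>B k. e (k, q) * zmon n z (be (k, q))) = c k * (ev z (PP (ka k)) * ev (\<lambda>i. inverse (z i)) (PP (ka' k)))"
        using fB by simp
    qed
    finally show ?thesis by (simp add: F[OF z] infsum_cmult_left')
  qed
  have sum2: "(\<lambda>(p, al). norm (e p) * zmon n (\<lambda>_. r) (be p) * (norm (d al) * zmon n (\<lambda>_. r) al)) summable_on I \<times> Zn n"
    by (rule summable_on_product_nonneg[OF sum1 laurent_summable[OF d]])
      (use less_imp_le[OF zmon_pos[OF r]] in \<open>auto intro!: mult_nonneg_nonneg\<close>)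
  have beZ: "be p \<in> Zn n" if "p \<in> I" for p
  proof -
    obtain k M N where p: "p = (k, M, N)" by (cases p)
    have "i \<notin># M" "i \<notin># N" if "n \<le> i" for i using \<open>p \<in> I\<close> that by (auto simp: p I_def B_def monoms_def)
    then show ?thesis by (simp add: Zn_def be_def p not_in_iff)
  qed
  note ti = torus_integral_laurent[OF r d beZ sum2 Fe]
  have inner: "(\<Sum>\<^sub>\<infinity>q\<in>B k. e (k, q) * d (\<lambda>i. - be (k, q) i)) = c k * wpair n d (ka k) (ka' k)" for k
    using fB by (simp add: wpair_def sum_distrib_left B_def e_def be_def case_prod_unfold mult.assoc)
  have "torus_integral n r F = (\<Sum>\<^sub>\<infinity>p\<in>I. e p * d (\<lambda>i. - be p i))" by (rule ti(1))
  also have "\<dots> = (\<Sum>\<^sub>\<infinity>k\<in>A. c k * wpair n d (ka k) (ka' k))"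
    unfolding inner[symmetric] I_def
    by (rule infsum_Sigma_banach[symmetric]) (use abs_summable_summable[OF ti(2)] in \<open>simp add: I_def\<close>)
  finally show "torus_integral n r F = (\<Sum>\<^sub>\<infinity>k\<in>A. c k * wpair n d (ka k) (ka' k))" .
  have as: "(\<lambda>p. norm (e p * d (\<lambda>i. - be p i))) summable_on Sigma A B" using ti(2) by (simp add: I_def)
  have "(\<lambda>k. \<Sum>\<^sub>\<infinity>q\<in>B k. norm (e (k, q) * d (\<lambda>i. - be (k, q) i))) summable_on A"
    by (rule summable_on_Sigma_banach) (use as in \<open>simp add: case_prod_unfold\<close>)
  then show "(\<lambda>k. norm (c k * wpair n d (ka k) (ka' k))) summable_on A"
    by (rule summable_on_comparison_test) (use norm_infsum_bound[of "\<lambda>q. e (k, q) * d (\<lambda>i. - be (k, q) i)" "B k" for k] fB in \<open>auto simp flip: inner\<close>)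
qed

text \<open>A series with a single term identifies the formal pairing with the integral evaluated by
  orthogonality.\<close>

lemma wpair_eq:
  assumes r: "0 < r" and d: "laurent n r d (Dt {..<n})" and la: "la \<in> partitions" and mu: "mu \<in> partitions"
  shows "wpair n d la mu = (if la = mu \<and> size la \<le> n then of_real (fact n * vnorm n la) else 0)"
proof -
  have "torus_integral n r (\<lambda>z. ev z (PP la) * ev (\<lambda>i. inverse (z i)) (PP mu) * Dt {..<n} z) =
      (\<Sum>\<^sub>\<infinity>k\<in>{()}. 1 * wpair n d ((\<lambda>_. la) k) ((\<lambda>_. mu) k))"
    by (rule torus_integral_PP_wpair(1)[OF r d]) (use la mu in auto)
  then show ?thesis using torus_orthogonality[OF la mu r, of n] by simp
qed

lemma laurent_Dt:
  assumes r: "0 < r" shows "\<exists>d. laurent n r d (Dt {..<n})"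
proof -
  have "\<exists>c. laurent n r c (\<lambda>z. \<Prod>(i, j)\<in>offd {..<n}. fac t i j z) \<and> (\<forall>al. c al \<noteq> 0 \<longrightarrow> al \<in> UNIV) \<and>
    ((\<forall>al\<in>(UNIV :: (nat \<Rightarrow> int) set). (\<lambda>i. - al i) \<in> UNIV \<longrightarrow> al = (\<lambda>_. 0)) \<longrightarrow> c (\<lambda>_. 0) = 1)"
  proof (rule laurent_prod_fac[OF r t0 t1])
    show "finite (offd {..<n})" by simp
    show "i < n \<and> j < n \<and> i \<noteq> j" if "(i, j) \<in> offd {..<n}" for i j using that by (simp add: offd_def)
  qed simp_all
  then obtain c where "laurent n r c (\<lambda>z. \<Prod>(i, j)\<in>offd {..<n}. fac t i j z)" by (elim exE conjE)
  then have "laurent n r c (Dt {..<n})" by (simp only: Dt_def[abs_def])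
  then show ?thesis by (intro exI)
qed

lemma torus_integral_PP_series:
  fixes c :: "'k \<Rightarrow> complex" and ka ka' :: "'k \<Rightarrow> partition"
  assumes r: "0 < r"
    and parts: "\<And>k. k \<in> A \<Longrightarrow> ka k \<in> partitions" "\<And>k. k \<in> A \<Longrightarrow> ka' k \<in> partitions"
    and sum: "(\<lambda>k. norm (c k) * (norm (ev (radii n r) (PP (ka k))) * norm (ev (\<lambda>i. inverse (radii n r i)) (PP (ka' k))))) summable_on A"
    and F: "\<And>z. z \<in> tor n r \<Longrightarrow> F z = (\<Sum>\<^sub>\<infinity>k\<in>A. c k * (ev z (PP (ka k)) * ev (\<lambda>i. inverse (z i)) (PP (ka' k)))) * Dt {..<n} z"
  shows "torus_integral n r F = (\<Sum>\<^sub>\<infinity>k\<in>A. c k * (if ka k = ka' k \<and> size (ka k) \<le> n then of_real (fact n * vnorm n (ka k)) else 0))"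
    and "(\<lambda>k. norm (c k * (if ka k = ka' k \<and> size (ka k) \<le> n then of_real (fact n * vnorm n (ka k)) else 0))) summable_on A"
proof -
  obtain d where d: "laurent n r d (Dt {..<n})" using laurent_Dt[OF r] by (rule exE)
  have w: "wpair n d (ka k) (ka' k) = (if ka k = ka' k \<and> size (ka k) \<le> n then of_real (fact n * vnorm n (ka k)) else 0)" if "k \<in> A" for k
    by (rule wpair_eq[OF r d parts(1)[OF that] parts(2)[OF that]])
  have 1: "torus_integral n r F = (\<Sum>\<^sub>\<infinity>k\<in>A. c k * wpair n d (ka k) (ka' k))"
    by (rule torus_integral_PP_wpair(1)[OF r d parts sum F])
  have 2: "(\<lambda>k. norm (c k * wpair n d (ka k) (ka' k))) summable_on A"
    by (rule torus_integral_PP_wpair(2)[OF r d parts sum F])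
  show "torus_integral n r F = (\<Sum>\<^sub>\<infinity>k\<in>A. c k * (if ka k = ka' k \<and> size (ka k) \<le> n then of_real (fact n * vnorm n (ka k)) else 0))"
    unfolding 1 by (rule infsum_cong) (simp add: w)
  show "(\<lambda>k. norm (c k * (if ka k = ka' k \<and> size (ka k) \<le> n then of_real (fact n * vnorm n (ka k)) else 0))) summable_on A"
    using 2 by (rule summable_on_cong[THEN iffD1, rotated]) (simp add: w)
qed

end

section \<open>Convergence and positivity of the infinite products\<close>

lemma prod_one_minus:
  fixes y :: "nat \<Rightarrow> real"
  assumes y: "\<And>i. 0 \<le> y i" "\<And>i. y i < 1" "summable y"
  shows "convergent_prod (\<lambda>i. 1 - y i)" "0 < (\<Prod>i. 1 - y i)" "(\<Prod>i. 1 - y i) \<le> 1" "1 - (\<Prod>i. 1 - y i) \<le> suminf y"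
proof -
  have "summable (\<lambda>i. norm ((1 - y i) - 1))" using y by simp
  then show cp: "convergent_prod (\<lambda>i. 1 - y i)"
    by (intro abs_convergent_prod_imp_convergent_prod summable_imp_abs_convergent_prod)
  have lim: "(\<lambda>m. \<Prod>i\<le>m. 1 - y i) \<longlonglongrightarrow> (\<Prod>i. 1 - y i)" by (rule convergent_prod_LIMSEQ[OF cp])
  have nz: "(\<Prod>i. 1 - y i) \<noteq> 0"
  proof (rule prodinf_nonzero[OF cp])
    show "1 - y i \<noteq> 0" for i using y(2)[of i] by simp
  qed
  have p0: "0 \<le> (\<Prod>i\<le>m. 1 - y i)" for m by (rule prod_nonneg) (use y(2) in \<open>simp add: less_imp_le\<close>)
  have p1: "(\<Prod>i\<le>m. 1 - y i) \<le> 1" for m by (rule prod_le_1) (use y in \<open>simp add: less_imp_le\<close>)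
  have w: "1 - (\<Sum>i\<le>m. y i) \<le> (\<Prod>i\<le>m. 1 - y i)" for m
  proof (induction m)
    case (Suc m)
    have "(\<Prod>i\<le>m. 1 - y i) * y (Suc m) \<le> 1 * y (Suc m)" by (rule mult_right_mono) (use p1 y in auto)
    then show ?case using Suc by (simp add: algebra_simps)
  qed simp
  have "0 \<le> (\<Prod>i. 1 - y i)" by (rule LIMSEQ_le_const[OF lim]) (use p0 in blast)
  then show "0 < (\<Prod>i. 1 - y i)" using nz by simp
  show "(\<Prod>i. 1 - y i) \<le> 1" by (rule LIMSEQ_le_const2[OF lim]) (use p1 in blast)
  have "1 - suminf y \<le> (\<Prod>i\<le>m. 1 - y i)" for m
  proof -
    have "(\<Sum>i\<le>m. y i) \<le> suminf y" by (rule sum_le_suminf[OF y(3)]) (use y in auto)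
    then show ?thesis using w[of m] by simp
  qed
  then have "1 - suminf y \<le> (\<Prod>i. 1 - y i)" by (intro LIMSEQ_le_const[OF lim]) blast
  then show "1 - (\<Prod>i. 1 - y i) \<le> suminf y" by simp
qed

text \<open>The bound on 1 minus the product has the form of the hypothesis on the factors. The
  lemma can therefore be iterated through nested infinite products.\<close>

lemma prod_near_one:
  fixes Q :: "nat \<Rightarrow> real"
  assumes Q: "\<And>i. 0 < Q i" "\<And>i. Q i \<le> 1" "\<And>i. 1 - Q i \<le> c i" and c: "summable c"
  shows "convergent_prod Q" "0 < prodinf Q" "prodinf Q \<le> 1" "1 - prodinf Q \<le> suminf c"
proof -
  have s: "summable (\<lambda>i. 1 - Q i)"
    by (rule summable_comparison_test'[OF c, of 0]) (use Q in auto)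
  have y: "0 \<le> 1 - Q i" "1 - Q i < 1" for i using Q by auto
  note p = prod_one_minus[OF y s, simplified]
  show "convergent_prod Q" "0 < prodinf Q" "prodinf Q \<le> 1" using p by simp_all
  have "suminf (\<lambda>i. 1 - Q i) \<le> suminf c" by (rule suminf_le[OF Q(3) s c])
  then show "1 - prodinf Q \<le> suminf c" using p(4) by simp
qed

lemma qpoch_inf_pos:
  assumes "0 \<le> t" "t < 1" shows "0 < qpoch_inf t t"
proof -
  have "0 < (\<Prod>r. 1 - t ^ r * t)"
  proof (rule prod_one_minus(2))
    show "0 \<le> t ^ i * t" for i using assms by simp
    show "t ^ i * t < 1" for i
      using assms mult_right_mono[OF power_le_one[of t i], of t] by simp
    show "summable (\<lambda>i. t ^ i * t)" using assms by (intro summable_mult2 summable_geometric) simp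
  qed
  then show ?thesis by (simp add: qpoch_inf_def)
qed

lemma qpoch2_inf_bounds:
  assumes x: "0 \<le> x" "x < 1" and t: "0 \<le> t" "t < 1" and u: "0 \<le> u" "u < 1"
  shows "0 < qpoch2_inf x t u" "qpoch2_inf x t u \<le> 1" "1 - qpoch2_inf x t u \<le> 1 / ((1 - t) * (1 - u)) * x"
proof -
  define P where "P k = (\<Prod>l. 1 - t ^ k * u ^ l * x)" for k
  have sg: "summable (\<lambda>l. t ^ k * x * u ^ l)" for k using u by (intro summable_mult summable_geometric) simp
  have in_: "0 \<le> t ^ k * u ^ l * x" "t ^ k * u ^ l * x < 1" "summable (\<lambda>l. t ^ k * u ^ l * x)" for k l
  proof -
    show "0 \<le> t ^ k * u ^ l * x" using x t u by simp
    have "t ^ k * u ^ l \<le> 1" using t u by (simp add: mult_le_one power_le_one)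
    then have "t ^ k * u ^ l * x \<le> 1 * x" by (rule mult_right_mono[OF _ x(1)])
    then show "t ^ k * u ^ l * x < 1" using x by simp
    show "summable (\<lambda>l. t ^ k * u ^ l * x)" using sg[of k] by (simp add: mult_ac)
  qed
  have sm: "(\<Sum>l. t ^ k * u ^ l * x) = t ^ k * (x / (1 - u))" for k
  proof -
    have "(\<Sum>l. t ^ k * x * u ^ l) = t ^ k * x * (1 / (1 - u))"
      using u suminf_geometric[of u] by (subst suminf_mult) (auto intro: summable_geometric)
    then show ?thesis by (simp add: mult_ac)
  qed
  have P: "0 < P k" "P k \<le> 1" "1 - P k \<le> t ^ k * (x / (1 - u))" for k
    using prod_one_minus[OF in_(1)[of k] in_(2)[of k] in_(3)[of k]] unfolding P_def sm by blast+
  have sc: "summable (\<lambda>k. t ^ k * (x / (1 - u)))" using t by (intro summable_mult2 summable_geometric) simp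
  have "suminf (\<lambda>k. t ^ k * (x / (1 - u))) = 1 / ((1 - t) * (1 - u)) * x"
    using t suminf_geometric[of t] by (subst suminf_mult2[symmetric]) (auto intro: summable_geometric)
  then show "0 < qpoch2_inf x t u" "qpoch2_inf x t u \<le> 1" "1 - qpoch2_inf x t u \<le> 1 / ((1 - t) * (1 - u)) * x"
    using prod_near_one[OF P sc] by (simp_all add: qpoch2_inf_def P_def[symmetric])
qed

text \<open>Inverting an infinite product factor by factor needs convergence at every level; the
  explicit constants propagate it from summability of a and b.\<close>

lemma double_qpoch_prod:
  assumes t: "0 \<le> t" "t < 1" and u: "0 \<le> u" "u < 1"
    and a: "\<And>i. 0 \<le> a i" "\<And>i. a i < 1" "summable a" and b: "\<And>i. 0 \<le> b i" "\<And>i. b i < 1" "summable b"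
  shows "0 < (\<Prod>i. \<Prod>j. qpoch2_inf (a i * b j) t u)"
    and "(\<Prod>i. \<Prod>j. 1 / qpoch2_inf (a i * b j) t u) = 1 / (\<Prod>i. \<Prod>j. qpoch2_inf (a i * b j) t u)"
proof -
  define c where "c = 1 / ((1 - t) * (1 - u))"
  have x: "0 \<le> a i * b j" "a i * b j < 1" for i j
  proof -
    show "0 \<le> a i * b j" using a b by simp
    have "a i * b j \<le> a i * 1" by (rule mult_left_mono) (use a b in \<open>auto intro: less_imp_le\<close>)
    then show "a i * b j < 1" using a(2)[of i] by simp
  qed
  define R where "R i = (\<Prod>j. qpoch2_inf (a i * b j) t u)" for i
  have q: "0 < qpoch2_inf (a i * b j) t u" "qpoch2_inf (a i * b j) t u \<le> 1" "1 - qpoch2_inf (a i * b j) t u \<le> c * (a i * b j)" for i j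
    using qpoch2_inf_bounds[OF x t u] by (auto simp: c_def)
  have sb: "summable (\<lambda>j. c * (a i * b j))" for i using b by (intro summable_mult)
  have eq: "suminf (\<lambda>j. c * (a i * b j)) = c * suminf b * a i" for i
    using suminf_mult[OF b(3), of "c * a i"] by (simp add: mult_ac)
  have R: "convergent_prod (\<lambda>j. qpoch2_inf (a i * b j) t u)" "0 < R i" "R i \<le> 1" "1 - R i \<le> c * suminf b * a i" for i
    using prod_near_one[OF q(1)[of i] q(2)[of i] q(3)[of i] sb[of i]] unfolding R_def eq by blast+
  have sa: "summable (\<lambda>i. c * suminf b * a i)" using a by (intro summable_mult)
  note X = prod_near_one[OF R(2,3,4) sa]
  show "0 < (\<Prod>i. \<Prod>j. qpoch2_inf (a i * b j) t u)" using X(2) by (simp add: R_def[abs_def])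
  have "(\<Prod>j. 1 / qpoch2_inf (a i * b j) t u) = inverse (R i)" for i
    using prodinf_inverse[OF R(1)[of i]] by (simp add: R_def inverse_eq_divide)
  then have "(\<Prod>i. \<Prod>j. 1 / qpoch2_inf (a i * b j) t u) = inverse (prodinf R)"
    using prodinf_inverse[OF X(1)] by simp
  then show "(\<Prod>i. \<Prod>j. 1 / qpoch2_inf (a i * b j) t u) = 1 / (\<Prod>i. \<Prod>j. qpoch2_inf (a i * b j) t u)"
    by (simp add: R_def[abs_def] inverse_eq_divide)
qed

lemma mon_of_real: "mon (\<lambda>i. complex_of_real (b i)) M = of_real (\<Prod>i\<in>#M. b i)"
  by (induction M) simp_all

lemma ev_of_real: "ev (\<lambda>i. of_real (b i)) f = of_real (eval_series (cf f) b)"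
  unfolding ev_def eval_series_def mon_of_real by (simp add: infsum_of_real flip: of_real_mult)

lemma prod_mset_nonneg: "(\<And>i. 0 \<le> b i) \<Longrightarrow> 0 \<le> (\<Prod>i\<in>#M. b i :: real)"
  by (induction M) auto

context hl begin

lemma qp_le_1: "qp m \<le> 1"
proof (induction m)
  case (Suc m)
  have "0 \<le> t ^ Suc m" using t0 by simp
  then have "qp m * (1 - t ^ Suc m) \<le> qp m * 1" by (intro mult_left_mono) (auto simp: less_imp_le[OF qp_pos])
  then show ?case using Suc by (simp add: qp_Suc del: power_Suc)
qed simp

text \<open>Multiplied by the infinite product (t;t), this says that a t-geometric variable is at
  most m with probability (t;t)_\<infinity> / (t;t)_m.\<close>

lemma sum_qp: "(\<Sum>k\<le>m. t ^ k / qp k) = 1 / qp m"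
proof (induction m)
  case (Suc m)
  have "1 - t ^ Suc m \<noteq> 0" using qp_nz[of "Suc m"] by (simp add: qp_Suc del: power_Suc qp_nz)
  then have "1 / qp m + t ^ Suc m / qp (Suc m) = 1 / qp (Suc m)"
    by (simp add: qp_Suc field_simps del: power_Suc)
  then show ?case using Suc by simp
qed simp

lemma abs_eval_SQ: 
  assumes "\<And>i. 0 \<le> b i" "la \<in> partitions" "mu \<in> partitions"
  shows "0 \<le> eval_series (cf (SQ la mu)) b"
  unfolding eval_series_def by (intro infsum_nonneg mult_nonneg_nonneg cf_SQ_nonneg prod_mset_nonneg assms)

text \<open>At a point equal to its own moduli and for a nonnegative alphabet, every term of the
  kernel expansion is nonnegative, so the absolute row sum is the kernel value itself.\<close>

lemma kernel_row:
  assumes k: "hl_kernel t n Z (\<lambda>j. of_real (c j))" and Z: "absz Z = Z" and c: "\<And>j. 0 \<le> c j" and nu: "nu \<in> partitions"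
  shows "((\<lambda>ka. \<bar>eval_series (cf (SQ ka nu)) c\<bar> * norm (ev Z (PP ka))) has_sum
    norm (KK n Z (\<lambda>j. of_real (c j))) * norm (ev Z (PP nu))) partitions"
proof -
  let ?f = "\<lambda>ka. \<bar>eval_series (cf (SQ ka nu)) c\<bar> * norm (ev Z (PP ka))"
  have Z0: "Z i = 0" if "n \<le> i" for i using hl_kernel.z[OF k that] .
  have eZ: "ev Z (PP ka) = of_real (norm (ev Z (PP ka)))" if "ka \<in> partitions" for ka
    using ev_absz(2)[of n Z "PP ka"] Z0 symf_bounded[OF symf_PP[OF that]] cf_PP_nonneg[OF that] unfolding Z by blast
  have t: "ev (\<lambda>j. of_real (c j)) (SQ ka nu) * ev Z (PP ka) = of_real (?f ka)" if ka: "ka \<in> partitions" for ka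
  proof -
    have "ev (\<lambda>j. of_real (c j)) (SQ ka nu) * ev Z (PP ka) = of_real (eval_series (cf (SQ ka nu)) c) * of_real (norm (ev Z (PP ka)))"
      using eZ[OF ka] by (simp only: ev_of_real)
    then show ?thesis using abs_eval_SQ[OF c ka nu] by simp
  qed
  have s: "?f summable_on partitions"
    using hl_kernel.kernel_PP(1)[OF k nu] by (rule summable_on_cong[THEN iffD1, rotated]) (simp only: t norm_of_real abs_mult abs_idempotent abs_norm_cancel)
  have "(\<Sum>\<^sub>\<infinity>ka\<in>partitions. complex_of_real (?f ka)) = KK n Z (\<lambda>j. of_real (c j)) * ev Z (PP nu)"
    unfolding hl_kernel.kernel_PP(2)[OF k nu, symmetric] by (rule infsum_cong) (simp only: t)
  then have e: "complex_of_real (infsum ?f partitions) = KK n Z (\<lambda>j. of_real (c j)) * ev Z (PP nu)"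
    by (simp only: infsum_of_real)
  have "0 \<le> infsum ?f partitions" by (rule infsum_nonneg) simp
  then have "infsum ?f partitions = norm (complex_of_real (infsum ?f partitions))" by (simp only: norm_of_real abs_of_nonneg)
  also have "\<dots> = norm (KK n Z (\<lambda>j. of_real (c j))) * norm (ev Z (PP nu))" unfolding e norm_mult ..
  finally show ?thesis using has_sum_infsum[OF s] by simp
qed

end

text \<open>The conditions on r say that |a_j / z_i| < 1 and |z_i b_j| < 1 on the circle. These are
  the regions where the two kernels expand in powers of a_j / z_i and of z_i b_j.\<close>

locale hl_data = hl +
  fixes u r :: real and n :: nat and a b :: "nat \<Rightarrow> real"
  assumes u0: "0 \<le> u" and u1: "u < 1" and r: "0 < r" and a0: "\<And>i. 0 \<le> a i" and ar: "\<And>i. a i < r"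
    and b0: "\<And>j. 0 \<le> b j" and rb: "\<And>j. r * b j < 1" and sa: "summable a" and sb: "summable b"
begin

abbreviation "ac \<equiv> \<lambda>j. complex_of_real (a j)"
abbreviation "bc \<equiv> \<lambda>j. complex_of_real (b j)"
abbreviation "iz z \<equiv> \<lambda>i :: nat. inverse (z i :: complex)"
abbreviation "uz z \<equiv> \<lambda>j :: nat. complex_of_real u * inverse (z j)"
abbreviation "R \<equiv> radii n r"
abbreviation "Sa la mu \<equiv> eval_series (cf (SQ la mu)) a"
abbreviation "Sb la mu \<equiv> eval_series (cf (SQ la mu)) b"

lemma tor_kernels:
  assumes z: "z \<in> tor n r"
  shows "hl_kernel t n z bc" "hl_kernel t n (iz z) ac" "hl_kernel t n z (uz z)"
proof -
  have nz: "norm (z i) = r" if "i < n" for i using z that by (simp add: tor_def)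
  have z0: "z i = 0" if "n \<le> i" for i using z that by (simp add: tor_def)
  show "hl_kernel t n z bc"
  proof
    show "summable (\<lambda>j. norm (bc j))" using sb b0 by simp
    show "norm (z i * bc j) < 1" if "i < n" for i j using nz[OF that] rb[of j] b0[of j] by (simp add: norm_mult)
  qed (rule z0)
  show "hl_kernel t n (iz z) ac"
  proof
    show "iz z i = 0" if "n \<le> i" for i using z0[OF that] by simp
    show "summable (\<lambda>j. norm (ac j))" using sa a0 by simp
    show "norm (iz z i * ac j) < 1" if "i < n" for i j
      unfolding norm_mult norm_inverse norm_of_real nz[OF that]
      using ar[of j] a0[of j] r by (simp add: field_simps)
  qed
  show "hl_kernel t n z (uz z)"
  proof
    show "summable (\<lambda>j. norm (uz z j))" by (rule summable_finite[of "{..<n}"]) (auto simp: z0)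
    show "norm (z i * uz z j) < 1" if "i < n" for i j
    proof (cases "j < n")
      case True
      have "norm (z i * uz z j) = r * (u * inverse r)" using nz[OF that] nz[OF True] u0 by (simp add: norm_mult norm_inverse)
      also have "\<dots> = u" using r by simp
      finally show ?thesis using u1 by simp
    qed (simp add: z0)
  qed (rule z0)
qed

lemma R_tor: "R \<in> tor n r" using r by (simp add: tor_def radii_def)

lemma absz_tor: "z \<in> tor n r \<Longrightarrow> absz z = R" "z \<in> tor n r \<Longrightarrow> absz (iz z) = iz R"
  by (auto simp: absz_def tor_def radii_def norm_inverse fun_eq_iff)

lemma ev_tor_le:
  assumes z: "z \<in> tor n r" and la: "la \<in> partitions"
  shows "norm (ev z (PP la)) \<le> norm (ev R (PP la))" "norm (ev (iz z) (PP la)) \<le> norm (ev (iz R) (PP la))"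
proof -
  have z0: "z i = 0" "iz z i = 0" if "n \<le> i" for i using z that by (auto simp: tor_def)
  note bd = symf_bounded[OF symf_PP[OF la]] cf_PP_nonneg[OF la]
  show "norm (ev z (PP la)) \<le> norm (ev R (PP la))"
    using ev_absz(1)[of n z "PP la"] z0(1) bd unfolding absz_tor(1)[OF z] by blast
  show "norm (ev (iz z) (PP la)) \<le> norm (ev (iz R) (PP la))"
    using ev_absz(1)[of n "iz z" "PP la"] z0(2) bd unfolding absz_tor(2)[OF z] by blast
qed

lemma ev_uz:
  assumes nu: "nu \<in> partitions"
  shows "ev (uz z) (SQ nu {#}) = of_real (bb nu * u ^ sum_mset nu) * ev (iz z) (PP nu)"
proof -
  have m: "mon (uz z) M = of_real u ^ size M * mon (iz z) M" for M by (induction M) simp_all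
  have "ev (uz z) (PP nu) = (\<Sum>\<^sub>\<infinity>M. of_real u ^ sum_mset nu * (of_real (cf (PP nu) M) * mon (iz z) M))"
    unfolding ev_def
  proof (rule infsum_cong)
    fix M show "of_real (cf (PP nu) M) * mon (uz z) M = of_real u ^ sum_mset nu * (of_real (cf (PP nu) M) * mon (iz z) M)"
      using PP_degree[OF nu, of M] by (cases "cf (PP nu) M = 0") (simp_all add: m)
  qed
  also have "\<dots> = of_real u ^ sum_mset nu * ev (iz z) (PP nu)" by (simp add: ev_def infsum_cmult_right')
  finally show ?thesis using nu by (simp add: SQ_empty QQ_def)
qed

text \<open>The coefficient of P_ka(z) P_ka'(1/z) contributed by nu to the product of the three
  kernels.\<close>

definition coef :: "partition \<times> partition \<times> partition \<Rightarrow> real"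
  where "coef = (\<lambda>(nu, ka, ka'). u ^ sum_mset nu * bb nu * (Sb ka nu * Sa ka' nu))"

text \<open>For fixed nu the sums over ka and ka' are kernel rows and give constants times P_nu at
  \<open>R\<close> and at its inverse. The remaining sum over nu is the absolutely convergent
  expansion of the third kernel.\<close>

lemma coef_summable:
  "(\<lambda>p. \<bar>coef p\<bar> * (norm (ev R (PP (fst (snd p)))) * norm (ev (iz R) (PP (snd (snd p)))))) summable_on partitions \<times> partitions \<times> partitions"
proof (rule summable_on_SigmaI)
  let ?Kb = "norm (KK n R bc)" and ?Ka = "norm (KK n (iz R) ac)"
  let ?g = "\<lambda>nu. u ^ sum_mset nu * bb nu * ((?Kb * norm (ev R (PP nu))) * (?Ka * norm (ev (iz R) (PP nu))))"
  fix nu assume nu: "nu \<in> partitions"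
  have h1: "((\<lambda>ka. \<bar>Sb ka nu\<bar> * norm (ev R (PP ka))) has_sum ?Kb * norm (ev R (PP nu))) partitions"
    by (rule kernel_row[OF tor_kernels(1)[OF R_tor] absz_tor(1)[OF R_tor] b0 nu])
  have h2: "((\<lambda>ka. \<bar>Sa ka nu\<bar> * norm (ev (iz R) (PP ka))) has_sum ?Ka * norm (ev (iz R) (PP nu))) partitions"
    by (rule kernel_row[OF tor_kernels(2)[OF R_tor] absz_tor(2)[OF R_tor] a0 nu])
  have "((\<lambda>(ka, ka'). (\<bar>Sb ka nu\<bar> * norm (ev R (PP ka))) * (\<bar>Sa ka' nu\<bar> * norm (ev (iz R) (PP ka')))) has_sum
      (?Kb * norm (ev R (PP nu))) * (?Ka * norm (ev (iz R) (PP nu)))) (partitions \<times> partitions)"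
    by (rule has_sum_product_banach[OF h1 h2 summable_on_product_nonneg[OF has_sum_imp_summable[OF h1] has_sum_imp_summable[OF h2]]]) simp_all
  then have "((\<lambda>q. u ^ sum_mset nu * bb nu * (case q of (ka, ka') \<Rightarrow> (\<bar>Sb ka nu\<bar> * norm (ev R (PP ka))) * (\<bar>Sa ka' nu\<bar> * norm (ev (iz R) (PP ka'))))) has_sum ?g nu) (partitions \<times> partitions)"
    by (rule has_sum_cmult_right)
  moreover have "0 \<le> u ^ sum_mset nu * bb nu" using u0 bb_pos[of nu] by simp
  ultimately show "((\<lambda>q. \<bar>coef (nu, q)\<bar> * (norm (ev R (PP (fst (snd (nu, q))))) * norm (ev (iz R) (PP (snd (snd (nu, q))))))) has_sum ?g nu) (partitions \<times> partitions)"
    by (simp add: coef_def case_prod_unfold abs_mult mult_ac u0 less_imp_le[OF bb_pos])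
next
  let ?Kb = "norm (KK n R bc)" and ?Ka = "norm (KK n (iz R) ac)"
  have "(\<lambda>nu. norm (ev (uz R) (SQ nu {#}) * ev R (PP nu))) summable_on partitions"
    by (rule hl_kernel.kernel_PP(1)[OF tor_kernels(3)[OF R_tor]]) (simp add: partitions_def)
  then have "(\<lambda>nu. norm (ev (uz R) (SQ nu {#}) * ev R (PP nu)) * (?Kb * ?Ka)) summable_on partitions"
    by (rule summable_on_cmult_left)
  then show "(\<lambda>nu. u ^ sum_mset nu * bb nu * ((?Kb * norm (ev R (PP nu))) * (?Ka * norm (ev (iz R) (PP nu))))) summable_on partitions"
    by (rule summable_on_cong[THEN iffD1, rotated]) (simp add: ev_uz norm_mult norm_power abs_mult u0 less_imp_le[OF bb_pos] mult_ac)
qed simp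

text \<open>The third kernel applied to the empty partition produces the sum over nu; the other two
  kernels then turn P_nu(z) and P_nu(1/z) into sums over ka and ka'.\<close>

lemma kernel_series:
  assumes z: "z \<in> tor n r"
  shows "KK n (iz z) ac * KK n z bc * KK n z (uz z) =
    (\<Sum>\<^sub>\<infinity>p\<in>partitions \<times> partitions \<times> partitions. of_real (coef p) * (ev z (PP (fst (snd p))) * ev (iz z) (PP (snd (snd p)))))"
proof -
  define T where "T p = of_real (coef p) * (ev z (PP (fst (snd p))) * ev (iz z) (PP (snd (snd p))))" for p
  have "(\<lambda>p. norm (T p)) summable_on partitions \<times> partitions \<times> partitions"
  proof (rule summable_on_comparison_test[OF coef_summable])
    fix p assume "p \<in> partitions \<times> partitions \<times> partitions"
    then have "fst (snd p) \<in> partitions" "snd (snd p) \<in> partitions" by auto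
    then show "norm (T p) \<le> \<bar>coef p\<bar> * (norm (ev R (PP (fst (snd p)))) * norm (ev (iz R) (PP (snd (snd p)))))"
      unfolding T_def norm_mult norm_of_real by (intro mult_left_mono mult_mono ev_tor_le z) auto
  qed simp
  then have sT: "T summable_on partitions \<times> partitions \<times> partitions" by (rule abs_summable_summable)
  have row: "(\<Sum>\<^sub>\<infinity>q\<in>partitions \<times> partitions. T (nu, q)) =
      (KK n (iz z) ac * KK n z bc) * (ev (uz z) (SQ nu {#}) * ev z (PP nu))" if nu: "nu \<in> partitions" for nu
  proof -
    note k1 = hl_kernel.kernel_PP[OF tor_kernels(1)[OF z] nu] and k2 = hl_kernel.kernel_PP[OF tor_kernels(2)[OF z] nu]
    have h1: "((\<lambda>ka. ev bc (SQ ka nu) * ev z (PP ka)) has_sum KK n z bc * ev z (PP nu)) partitions"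
      unfolding k1(2)[symmetric] by (rule has_sum_infsum[OF abs_summable_summable[OF k1(1)]])
    have h2: "((\<lambda>ka. ev ac (SQ ka nu) * ev (iz z) (PP ka)) has_sum KK n (iz z) ac * ev (iz z) (PP nu)) partitions"
      unfolding k2(2)[symmetric] by (rule has_sum_infsum[OF abs_summable_summable[OF k2(1)]])
    have "(\<lambda>(x, y). norm (ev bc (SQ x nu) * ev z (PP x)) * norm (ev ac (SQ y nu) * ev (iz z) (PP y))) summable_on partitions \<times> partitions"
      by (rule summable_on_product_nonneg[OF k1(1) k2(1)]) simp_all
    then have "(\<lambda>p. norm (case p of (x, y) \<Rightarrow> ev bc (SQ x nu) * ev z (PP x) * (ev ac (SQ y nu) * ev (iz z) (PP y)))) summable_on partitions \<times> partitions"
      by (simp add: case_prod_unfold norm_mult)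
    then have "((\<lambda>(x, y). ev bc (SQ x nu) * ev z (PP x) * (ev ac (SQ y nu) * ev (iz z) (PP y))) has_sum
        KK n z bc * ev z (PP nu) * (KK n (iz z) ac * ev (iz z) (PP nu))) (partitions \<times> partitions)"
      by (rule has_sum_product_banach[OF h1 h2 abs_summable_summable])
    then have h3: "((\<lambda>q. of_real (u ^ sum_mset nu * bb nu) * (case q of (x, y) \<Rightarrow> ev bc (SQ x nu) * ev z (PP x) * (ev ac (SQ y nu) * ev (iz z) (PP y)))) has_sum
        of_real (u ^ sum_mset nu * bb nu) * (KK n z bc * ev z (PP nu) * (KK n (iz z) ac * ev (iz z) (PP nu)))) (partitions \<times> partitions)"
      by (rule has_sum_cmult_right)
    have e: "of_real (u ^ sum_mset nu * bb nu) * (case q of (x, y) \<Rightarrow> ev bc (SQ x nu) * ev z (PP x) * (ev ac (SQ y nu) * ev (iz z) (PP y))) = T (nu, q)" for q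
      by (simp add: T_def coef_def case_prod_unfold ev_of_real mult_ac)
    show ?thesis using infsumI[OF h3] unfolding e by (simp add: ev_uz[OF nu] mult_ac)
  qed
  have pe: "{#} \<in> partitions" by (simp add: partitions_def)
  have "(\<Sum>\<^sub>\<infinity>p\<in>partitions \<times> partitions \<times> partitions. T p) = (\<Sum>\<^sub>\<infinity>nu\<in>partitions. \<Sum>\<^sub>\<infinity>q\<in>partitions \<times> partitions. T (nu, q))"
    using sT by (rule infsum_Sigma_banach[symmetric])
  also have "\<dots> = (\<Sum>\<^sub>\<infinity>nu\<in>partitions. (KK n (iz z) ac * KK n z bc) * (ev (uz z) (SQ nu {#}) * ev z (PP nu)))"
    by (rule infsum_cong) (rule row)
  also have "\<dots> = (KK n (iz z) ac * KK n z bc) * (KK n z (uz z) * ev z (PP {#}))"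
    unfolding infsum_cmult_right' hl_kernel.kernel_PP(2)[OF tor_kernels(3)[OF z] pe] ..
  finally show ?thesis by (simp add: T_def PP_empty)
qed

abbreviation "SP \<equiv> {la \<in> partitions. size la \<le> n}"

definition skew_term :: "partition \<Rightarrow> partition \<Rightarrow> real"
  where "skew_term la mu = u ^ sum_mset mu * eval_series (skew_P 0 t la mu) a * eval_series (skew_Q 0 t la mu) b"

text \<open>The factor b_la comes from rescaling Q_{la/mu} to P_{la/mu}. It cancels the same factor
  in the denominator of \<open>vnorm\<close>.\<close>

lemma skew_term_eq: "la \<in> partitions \<Longrightarrow> mu \<in> partitions \<Longrightarrow> bb la * skew_term la mu = coef (mu, la, la)"
proof -
  assume la: "la \<in> partitions" and mu: "mu \<in> partitions"
  have "eval_series (cf (sc c * f)) a = c * eval_series (cf f) a" for c f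
    by (simp add: eval_series_def cf_sc_mult mult.assoc infsum_cmult_right')
  then show ?thesis by (simp add: skew_term_def skew_P_eq[OF la mu] skew_Q_eq[OF la mu] coef_def)
qed

lemma skew_term_nonneg: "la \<in> partitions \<Longrightarrow> mu \<in> partitions \<Longrightarrow> 0 \<le> skew_term la mu"
proof -
  assume la: "la \<in> partitions" and mu: "mu \<in> partitions"
  have "0 \<le> coef (mu, la, la)"
    using abs_eval_SQ[OF a0 la mu] abs_eval_SQ[OF b0 la mu] u0 bb_pos[of mu] by (simp add: coef_def)
  then have "0 \<le> bb la * skew_term la mu" unfolding skew_term_eq[OF la mu] .
  then show ?thesis using zero_le_mult_iff[of "bb la" "skew_term la mu"] bb_pos[of la] by auto
qed

definition skew_sum :: "partition \<Rightarrow> real" where "skew_sum la = (\<Sum>\<^sub>\<infinity>mu\<in>partitions. skew_term la mu)"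

lemma skew_sum_nonneg: "la \<in> partitions \<Longrightarrow> 0 \<le> skew_sum la"
  unfolding skew_sum_def by (intro infsum_nonneg skew_term_nonneg)

text \<open>The factor q stands for the constant relating \<Delta> to the density times the third
  kernel; with q = 1 the second claim provides the summability of the skew sums.\<close>

lemma torus_integral_kernels:
  assumes F: "\<And>z. z \<in> tor n r \<Longrightarrow> F z = of_real q * (KK n (iz z) ac * KK n z bc * KK n z (uz z)) * Dt {..<n} z"
  shows "torus_integral n r F = of_real (q * fact n * (1 - t) ^ n * (\<Sum>\<^sub>\<infinity>la\<in>SP. skew_sum la / qp (n - size la)))"
    and "q \<noteq> 0 \<Longrightarrow> (\<lambda>la. skew_sum la / qp (n - size la)) summable_on SP"
proof -
  let ?P3 = "partitions \<times> partitions \<times> partitions"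
  define c where "c p = complex_of_real (q * coef p)" for p
  define V where "V p = c p * (if fst (snd p) = snd (snd p) \<and> size (fst (snd p)) \<le> n then of_real (fact n * vnorm n (fst (snd p))) else 0)" for p
  have parts: "fst (snd p) \<in> partitions" "snd (snd p) \<in> partitions" if "p \<in> ?P3" for p using that by auto
  have sum: "(\<lambda>p. norm (c p) * (norm (ev R (PP (fst (snd p)))) * norm (ev (iz R) (PP (snd (snd p)))))) summable_on ?P3"
    using summable_on_cmult_right[OF coef_summable, of "\<bar>q\<bar>"] by (simp add: c_def abs_mult mult.assoc norm_mult)
  have F': "F z = (\<Sum>\<^sub>\<infinity>p\<in>?P3. c p * (ev z (PP (fst (snd p))) * ev (iz z) (PP (snd (snd p))))) * Dt {..<n} z" if z: "z \<in> tor n r" for z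
    unfolding F[OF z] kernel_series[OF z] infsum_cmult_right'[symmetric] by (simp add: c_def mult.assoc)
  have v1: "torus_integral n r F = (\<Sum>\<^sub>\<infinity>p\<in>?P3. V p)"
    unfolding V_def by (rule torus_integral_PP_series(1)[OF r parts sum F'])
  have v2: "(\<lambda>p. norm (V p)) summable_on ?P3"
    unfolding V_def by (rule torus_integral_PP_series(2)[OF r parts sum F'])
  \<comment> \<open>Orthogonality leaves the triples with ka = ka' of length at most n; h
    parametrises them by la and the inner partition mu.\<close>
  define h where "h = (\<lambda>(la, mu). (mu, la, la) :: partition \<times> partition \<times> partition)"
  define W where "W = (\<lambda>(la, mu). q * fact n * (1 - t) ^ n * (skew_term la mu / qp (n - size la)))"
  have inj: "inj_on h (SP \<times> partitions)" by (auto simp: inj_on_def h_def)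
  have hsub: "h ` (SP \<times> partitions) \<subseteq> ?P3" by (auto simp: h_def)
  have VW: "V (h x) = of_real (W x)" if "x \<in> SP \<times> partitions" for x
  proof -
    obtain la mu where x: "x = (la, mu)" by (cases x)
    have lm: "la \<in> partitions" "mu \<in> partitions" "size la \<le> n" using that by (auto simp: x)
    have "q * coef (mu, la, la) * (fact n * vnorm n la) = W x"
      unfolding skew_term_eq[OF lm(1,2), symmetric] by (simp add: W_def x vnorm_def)
    then show ?thesis using lm by (simp add: V_def c_def h_def x flip: of_real_mult)
  qed
  have "infsum V ?P3 = infsum V (h ` (SP \<times> partitions))"
    by (rule infsum_cong_neutral) (use hsub in \<open>auto simp: V_def h_def image_iff\<close>)
  also have "\<dots> = infsum (V \<circ> h) (SP \<times> partitions)" by (rule infsum_reindex[OF inj])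
  also have "\<dots> = (\<Sum>\<^sub>\<infinity>x\<in>SP \<times> partitions. of_real (W x))" by (rule infsum_cong) (simp add: VW)
  also have "\<dots> = of_real (infsum W (SP \<times> partitions))" by (rule infsum_of_real)
  finally have v3: "torus_integral n r F = of_real (infsum W (SP \<times> partitions))" using v1 by simp
  have "(\<lambda>p. norm (V p)) summable_on h ` (SP \<times> partitions)" by (rule summable_on_subset_banach[OF v2 hsub])
  then have "((\<lambda>p. norm (V p)) \<circ> h) summable_on SP \<times> partitions" by (simp only: summable_on_reindex[OF inj])
  then have "(\<lambda>x. norm (W x)) summable_on SP \<times> partitions"
    by (rule summable_on_cong[THEN iffD1, rotated]) (simp only: comp_apply VW norm_of_real real_norm_def)
  then have sW: "W summable_on SP \<times> partitions" by (rule abs_summable_summable)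
  have inner: "(\<Sum>\<^sub>\<infinity>mu\<in>partitions. W (la, mu)) = q * fact n * (1 - t) ^ n * (skew_sum la / qp (n - size la))" for la
    by (simp only: W_def case_prod_conv infsum_cmult_right' skew_sum_def divide_inverse infsum_cmult_left')
  have "infsum W (SP \<times> partitions) = (\<Sum>\<^sub>\<infinity>la\<in>SP. \<Sum>\<^sub>\<infinity>mu\<in>partitions. W (la, mu))"
    using sW by (rule infsum_Sigma_banach[symmetric])
  also have "\<dots> = q * fact n * (1 - t) ^ n * (\<Sum>\<^sub>\<infinity>la\<in>SP. skew_sum la / qp (n - size la))"
    unfolding inner infsum_cmult_right' ..
  finally show "torus_integral n r F = of_real (q * fact n * (1 - t) ^ n * (\<Sum>\<^sub>\<infinity>la\<in>SP. skew_sum la / qp (n - size la)))"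
    unfolding v3 by simp
  assume q: "q \<noteq> 0"
  define k where "k = q * fact n * (1 - t) ^ n"
  have "(\<lambda>la. \<Sum>\<^sub>\<infinity>mu\<in>partitions. W (la, mu)) summable_on SP"
    by (rule summable_on_Sigma_banach) (use sW in \<open>simp add: case_prod_unfold\<close>)
  then have "(\<lambda>la. k * (skew_sum la / qp (n - size la))) summable_on SP" unfolding inner k_def .
  then have "(\<lambda>la. inverse k * (k * (skew_sum la / qp (n - size la)))) summable_on SP" by (rule summable_on_cmult_right)
  moreover have "inverse k * (k * x) = x" for x
  proof -
    have "k \<noteq> 0" using q t1 by (simp add: k_def)
    then show ?thesis by simp
  qed
  ultimately show "(\<lambda>la. skew_sum la / qp (n - size la)) summable_on SP" by (simp only:)
qed

text \<open>Summability over lengths at most n is a by-product of the absolutely convergent constant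
  term. Dividing by \<open>qp\<close>, which lies in (0, 1], only enlarges the terms.\<close>

lemma skew_sum_summable: "(\<lambda>la. skew_sum la / qp (n - size la)) summable_on SP" "skew_sum summable_on SP"
proof -
  show s: "(\<lambda>la. skew_sum la / qp (n - size la)) summable_on SP"
    by (rule torus_integral_kernels(2)[where q = 1, OF refl]) simp
  show "skew_sum summable_on SP"
  proof (rule summable_on_comparison_test[OF s])
    fix la assume la: "la \<in> SP"
    show "0 \<le> skew_sum la" using la skew_sum_nonneg by simp
    then have "skew_sum la * qp (n - size la) \<le> skew_sum la * 1" by (intro mult_left_mono qp_le_1)
    then show "skew_sum la \<le> skew_sum la / qp (n - size la)" using qp_pos[of "n - size la"] by (simp add: field_simps)
  qed
qed

text \<open>The pairs i \<noteq> j of the third kernel supply the factors (1 - tu z_i/z_j) / (1 - u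
  z_i/z_j), the density supplies the rest, and the pairs i = j give a constant.\<close>

lemma Delta_tilde_eq:
  assumes z: "z \<in> tor n r"
  shows "Delta_tilde n z t u = of_real (((1 - u) / (1 - t * u)) ^ n) * KK n z (uz z) * Dt {..<n} z"
proof -
  define f where "f i j = kf (z i * uz z j)" for i j
  have z0: "z i = 0" if "n \<le> i" for i using z that by (simp add: tor_def)
  have nz: "z i \<noteq> 0" if "i < n" for i using z that r by (auto simp: tor_def)
  have tu: "t * u < 1"
  proof -
    have "t * u \<le> 1 * u" by (rule mult_right_mono) (use t1 u0 in auto)
    then show ?thesis using u1 by simp
  qed
  \<comment> \<open>Since \<open>inverse 0 = 0\<close>, the alphabet u/z is 0 from n on; the
    corresponding factors are 1 and the infinite product is finite.\<close>
  have "KK n z (uz z) = (\<Prod>i<n. \<Prod>j<n. f i j)" unfolding KK_def f_def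
    by (intro prod.cong refl prodinf_finite) (auto simp: z0 kf_def)
  also have "\<dots> = (\<Prod>p\<in>{..<n} \<times> {..<n}. f (fst p) (snd p))" by (simp add: prod.cartesian_product case_prod_unfold)
  also have "{..<n} \<times> {..<n} = (\<lambda>i. (i, i)) ` {..<n} \<union> offd {..<n}" by (auto simp: offd_def)
  also have "(\<Prod>p\<in>(\<lambda>i. (i, i)) ` {..<n} \<union> offd {..<n}. f (fst p) (snd p)) =
      (\<Prod>p\<in>(\<lambda>i. (i, i)) ` {..<n}. f (fst p) (snd p)) * (\<Prod>p\<in>offd {..<n}. f (fst p) (snd p))"
  proof (rule prod.union_disjoint)
    show "(\<lambda>i. (i, i)) ` {..<n} \<inter> offd {..<n} = {}" by (auto simp: offd_def)
  qed simp_all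
  also have "(\<Prod>p\<in>(\<lambda>i. (i, i)) ` {..<n}. f (fst p) (snd p)) = (\<Prod>i<n. f i i)"
    by (subst prod.reindex) (auto simp: inj_on_def)
  \<comment> \<open>On the diagonal z_i u / z_i = u: this is the origin of the power of (1 - u) / (1
    - tu) in the constant.\<close>
  also have "(\<Prod>i<n. f i i) = (\<Prod>i<n. of_real ((1 - t * u) / (1 - u)))"
  proof (rule prod.cong[OF refl])
    fix i assume "i \<in> {..<n}"
    then have e: "z i * uz z i = of_real u" using nz[of i] by simp
    show "f i i = of_real ((1 - t * u) / (1 - u))" unfolding f_def e kf_def by simp
  qed
  also have "\<dots> = of_real (((1 - t * u) / (1 - u)) ^ n)" by simp
  finally have K: "KK n z (uz z) = of_real (((1 - t * u) / (1 - u)) ^ n) * (\<Prod>p\<in>offd {..<n}. f (fst p) (snd p))" .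
  have "((1 - u) / (1 - t * u)) ^ n * ((1 - t * u) / (1 - u)) ^ n = 1"
    using tu u1 by (simp add: power_mult_distrib[symmetric])
  then have q: "complex_of_real (((1 - u) / (1 - t * u)) ^ n) * of_real (((1 - t * u) / (1 - u)) ^ n) = 1"
    by (metis of_real_1 of_real_mult)
  have "Delta_tilde n z t u = (\<Prod>p\<in>offd {..<n}. f (fst p) (snd p) * fac t (fst p) (snd p) z)"
    unfolding Delta_tilde_def
    by (rule prod.cong) (auto simp: offd_def f_def kf_def fac_def mult_ac)
  also have "\<dots> = (\<Prod>p\<in>offd {..<n}. f (fst p) (snd p)) * Dt {..<n} z"
    by (simp add: prod.distrib Dt_def case_prod_unfold)
  finally show ?thesis unfolding K mult.assoc[symmetric] q by simp
qed

lemma integral_value: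
  "torus_integral n r (\<lambda>z.
      (\<Prod>i<n. \<Prod>j. (1 - of_real t * inverse (z i) * of_real (a j)) / (1 - inverse (z i) * of_real (a j))) *
      (\<Prod>i<n. \<Prod>j. (1 - of_real t * z i * of_real (b j)) / (1 - z i * of_real (b j))) *
      Delta_tilde n z t u) =
    of_real (((1 - u) / (1 - t * u)) ^ n * fact n * (1 - t) ^ n * (\<Sum>\<^sub>\<infinity>la\<in>SP. skew_sum la / qp (n - size la)))"
proof (rule torus_integral_kernels(1))
  fix z assume z: "z \<in> tor n r"
  have e: "(\<Prod>i<n. \<Prod>j. (1 - of_real t * inverse (z i) * of_real (a j)) / (1 - inverse (z i) * of_real (a j))) = KK n (iz z) ac"
    "(\<Prod>i<n. \<Prod>j. (1 - of_real t * z i * of_real (b j)) / (1 - z i * of_real (b j))) = KK n z bc"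
    by (simp_all add: KK_def kf_def mult.assoc)
  show "(\<Prod>i<n. \<Prod>j. (1 - of_real t * inverse (z i) * of_real (a j)) / (1 - inverse (z i) * of_real (a j))) *
      (\<Prod>i<n. \<Prod>j. (1 - of_real t * z i * of_real (b j)) / (1 - z i * of_real (b j))) * Delta_tilde n z t u =
      of_real (((1 - u) / (1 - t * u)) ^ n) * (KK n (iz z) ac * KK n z bc * KK n z (uz z)) * Dt {..<n} z"
    unfolding e Delta_tilde_eq[OF z] by (simp only: mult_ac)
qed

end

section \<open>The periodic measure\<close>

text \<open>The density enters through \<open>ennreal\<close>, which sends negative values to 0;
  nonnegativity on S makes the measure a real sum.\<close>

lemma distributed_measure:
  fixes f :: "'a \<Rightarrow> real"
  assumes X: "distributed M (count_space A) X (\<lambda>x. ennreal (f x))" and S: "S \<subseteq> A"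
    and f: "\<And>x. x \<in> S \<Longrightarrow> 0 \<le> f x" "f summable_on S"
  shows "measure M (X -` S \<inter> space M) = infsum f S"
proof -
  have n: "(\<lambda>x. norm (f x)) summable_on S" using f(2) by (rule summable_on_cong[THEN iffD1, rotated]) (simp add: f(1))
  have old: "Infinite_Set_Sum.abs_summable_on f S" using n by (rule abs_summable_equivalent[THEN iffD1])
  have "emeasure M (X -` S \<inter> space M) = (\<integral>\<^sup>+x. ennreal (f x) * indicator S x \<partial>count_space A)"
    by (rule distributed_emeasure[OF X]) (use S in simp)
  also have "\<dots> = (\<integral>\<^sup>+x. ennreal (f x) * indicator S x \<partial>count_space S)"
    by (rule nn_integral_count_space_eq) (use S in auto)
  also have "\<dots> = (\<integral>\<^sup>+x. ennreal (f x) \<partial>count_space S)" by (rule nn_integral_cong) simp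
  also have "\<dots> = ennreal (infsetsum f S)" by (rule nn_integral_conv_infsetsum[OF old f(1)])
  also have "infsetsum f S = infsum f S" by (rule infsetsum_infsum[OF old])
  finally show ?thesis using f(1) by (simp add: measure_def infsum_nonneg)
qed

lemma alphabet_bounds: "alphabet a \<Longrightarrow> 0 \<le> a i \<and> a i < 1"
  unfolding alphabet_def by (metis less_eq_real_def zero_less_one)

text \<open>With second parameter 0 the numerators in \<open>Phi a b t 0 u\<close> are 1, so it is
  the reciprocal of the double product occurring in \<open>Phi_tilde\<close>. After cancellation
  only (t;t)_\<infinity> / F remains.\<close>

lemma (in hl_data) constants:
  assumes "\<And>i. a i < 1" "\<And>i. b i < 1" "F \<noteq> 0"
  shows "Phi a b t 0 u / (Phi_tilde n a b t u * F) * (((1 - u) / (1 - t * u)) ^ n * fact n * (1 - t) ^ n * S) =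
    qpoch_inf t t / F * S"
proof -
  define X where "X = (\<Prod>i. \<Prod>j. qpoch2_inf (a i * b j) t u)"
  note dp = double_qpoch_prod[OF t0 t1 u0 u1 a0 assms(1) sa b0 assms(2) sb]
  have one: "(\<Prod>k::nat. (1::real)) = 1" using prodinf_finite[of "{}" "\<lambda>_. 1 :: real"] by simp
  have "Phi a b t 0 u = 1 / qpoch_inf u u * (\<Prod>i. \<Prod>j. 1 / qpoch2_inf (a i * b j) t u)"
    by (simp add: Phi_def qpoch2_inf_def[of 0] one)
  then have P1: "Phi a b t 0 u = 1 / qpoch_inf u u * (1 / X)" unfolding dp(2) X_def .
  have P2: "Phi_tilde n a b t u = fact n * (1 - t) ^ n * (1 - u) ^ n / (qpoch_inf t t * qpoch_inf u u * (1 - t * u) ^ n * X)"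
    by (simp add: Phi_tilde_def X_def)
  have "t * u \<le> 1 * u" by (rule mult_right_mono) (use t1 u0 in auto)
  then have "1 - t * u \<noteq> 0" using u1 by simp
  then have nz: "X \<noteq> 0" "qpoch_inf u u \<noteq> 0" "qpoch_inf t t \<noteq> 0" "(1 - t * u) ^ n \<noteq> 0" "(1 - u) ^ n \<noteq> 0" "(1 - t) ^ n \<noteq> 0"
    using dp(1) qpoch_inf_pos[OF u0 u1] qpoch_inf_pos[OF t0 t1] u1 t1 by (auto simp: X_def)
  define x y w where "x = (1 - t * u) ^ n" and "y = (1 - u) ^ n" and "w = (1 - t) ^ n"
  have nz': "x \<noteq> 0" "y \<noteq> 0" "w \<noteq> 0" using nz by (simp_all add: x_def y_def w_def)
  show ?thesis unfolding P1 P2 power_divide x_def[symmetric] y_def[symmetric] w_def[symmetric]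
    using nz(1-3) nz' assms(3) by (simp add: field_simps)
qed

theorem corollary3p2:
  fixes t u r :: real and a b :: "nat \<Rightarrow> real" and n :: nat
    and \<Omega> :: "'w measure" and L :: "'w \<Rightarrow> partition" and X :: "'w \<Rightarrow> nat"
  assumes "0 \<le> t" "t < 1" "0 \<le> u" "u < 1"
    and "alphabet a" "alphabet b" "summable a" "summable b"
    and "prob_space \<Omega>"
    and "distributed \<Omega> (count_space partitions) L (\<lambda>la. ennreal (periodic_HL a b t u la))"
    and "distributed \<Omega> (count_space UNIV) X (\<lambda>k. ennreal (t_geometric t k))"
    and "prob_space.indep_set \<Omega>
      (sets (vimage_algebra (space \<Omega>) L (count_space partitions)))
      (sets (vimage_algebra (space \<Omega>) X (count_space UNIV)))"
    and "0 < r" "\<And>i. a i < r" "\<And>j. r * b j < 1"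
  shows "complex_of_real (measure \<Omega> {w \<in> space \<Omega>. size (L w) + X w \<le> n}) =
    complex_of_real (Phi a b t 0 u / (Phi_tilde n a b t u * Phi a b 0 t u)) *
    torus_integral n r (\<lambda>z.
      (\<Prod>i<n. \<Prod>j. (1 - of_real t * inverse (z i) * of_real (a j)) / (1 - inverse (z i) * of_real (a j))) *
      (\<Prod>i<n. \<Prod>j. (1 - of_real t * z i * of_real (b j)) / (1 - z i * of_real (b j))) *
      Delta_tilde n z t u)"
proof -
  interpret prob_space \<Omega> by fact
  have ab: "0 \<le> a i" "a i < 1" "0 \<le> b i" "b i < 1" for i
    using alphabet_bounds assms(5,6) by blast+
  interpret D: hl_data t u r n a b
    by unfold_locales (use assms(1-4,7,8,13-15) ab in auto)
  define F where "F = Phi a b 0 t u"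
  define p where "p = periodic_HL a b t u"
  define G where "G = t_geometric t"
  note Ld = assms(10)[folded p_def] and Xd = assms(11)[folded G_def]
  have p: "p la = 1 / F * D.skew_sum la" for la
    by (simp only: p_def F_def periodic_HL_def D.skew_sum_def D.skew_term_def)
  have Lm: "L \<in> measurable \<Omega> (count_space partitions)" and Xm: "X \<in> measurable \<Omega> (count_space UNIV)"
    using distributed_measurable[OF Ld] distributed_measurable[OF Xd] by auto
  have LP: "L w \<in> partitions" if "w \<in> space \<Omega>" for w using measurable_space[OF Lm that] by simp
  \<comment> \<open>If F were not positive, the density would be at most 0 on every partition, also
    for F = 0 because then \<open>1 / F = 0\<close>. The total mass would be 0 instead of 1.\<close>
  have F: "0 < F"
  proof (rule ccontr)
    assume "\<not> 0 < F"
    then have "p la \<le> 0" if "la \<in> partitions" for la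
      using D.skew_sum_nonneg[OF that] by (simp add: p divide_le_0_iff)
    then have "(\<integral>\<^sup>+x. ennreal (p x) * indicator partitions x \<partial>count_space partitions) = (\<integral>\<^sup>+x. 0 \<partial>count_space partitions)"
      by (intro nn_integral_cong) (simp add: ennreal_neg)
    moreover have "L -` partitions \<inter> space \<Omega> = space \<Omega>" using LP by auto
    ultimately have "emeasure \<Omega> (space \<Omega>) = 0" using distributed_emeasure[OF Ld, of partitions] by simp
    then show False using emeasure_space_1 by simp
  qed
  have p0: "0 \<le> p la" if "la \<in> partitions" for la using D.skew_sum_nonneg[OF that] F by (simp add: p)
  have G0: "0 \<le> G k" for k
    using assms(1) D.qp_pos[of k] qpoch_inf_pos[OF assms(1,2)] by (simp add: G_def t_geometric_def)
  \<comment> \<open>The truncated difference is harmless: T k is combined with the event that the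
    geometric variable equals k only for k at most n.\<close>
  define T where "T k = {la \<in> partitions. size la \<le> n - k}" for k
  let ?A = "\<lambda>k. X -` {k} \<inter> space \<Omega>" and ?B = "\<lambda>k. L -` T k \<inter> space \<Omega>"
  have ps: "p summable_on D.SP" unfolding p by (rule summable_on_cmult_right[OF D.skew_sum_summable(2)])
  have TS: "T k \<subseteq> D.SP" for k by (auto simp: T_def)
  have pT: "p summable_on T k" for k by (rule summable_on_subset_banach[OF ps TS])
  have pA: "prob (?A k) = G k" for k
    using distributed_measure[OF Xd, of "{k}"] G0 by simp
  have pB: "prob (?B k) = infsum p (T k)" for k
    by (rule distributed_measure[OF Ld _ _ pT]) (auto simp: T_def p0)
  have pAB: "prob (?B k \<inter> ?A k) = infsum p (T k) * G k" for k
  proof -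
    have "prob (?B k \<inter> ?A k) = prob (?B k) * prob (?A k)"
      by (rule indep_setD[OF assms(12)]; rule in_vimage_algebra) (auto simp: T_def)
    then show ?thesis by (simp only: pA pB)
  qed
  \<comment> \<open>Splitting by the value k of the geometric variable makes independence applicable
    to each piece.\<close>
  have E: "{w \<in> space \<Omega>. size (L w) + X w \<le> n} = (\<Union>k\<in>{..n}. ?B k \<inter> ?A k)"
    using LP by (auto simp: T_def)
  have "prob {w \<in> space \<Omega>. size (L w) + X w \<le> n} = (\<Sum>k\<le>n. prob (?B k \<inter> ?A k))"
    unfolding E
  proof (rule finite_measure_finite_Union)
    have "?B k \<inter> ?A k \<in> sets \<Omega>" for k
      using measurable_sets[OF Lm, of "T k"] measurable_sets[OF Xm, of "{k}"] by (auto simp: T_def)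
    then show "(\<lambda>k. ?B k \<inter> ?A k) ` {..n} \<subseteq> sets \<Omega>" by blast
    show "disjoint_family_on (\<lambda>k. ?B k \<inter> ?A k) {..n}" by (auto simp: disjoint_family_on_def)
  qed simp
  also have "\<dots> = (\<Sum>k\<le>n. \<Sum>\<^sub>\<infinity>la\<in>D.SP. if size la \<le> n - k then p la * G k else 0)"
  proof (rule sum.cong[OF refl])
    fix k
    have "infsum p (T k) * G k = (\<Sum>\<^sub>\<infinity>la\<in>T k. p la * G k)" by (rule infsum_cmult_left'[symmetric])
    also have "\<dots> = (\<Sum>\<^sub>\<infinity>la\<in>D.SP. if size la \<le> n - k then p la * G k else 0)"
      by (rule infsum_cong_neutral) (auto simp: T_def)
    finally show "prob (?B k \<inter> ?A k) = (\<Sum>\<^sub>\<infinity>la\<in>D.SP. if size la \<le> n - k then p la * G k else 0)" by (simp only: pAB)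
  qed
  also have "\<dots> = (\<Sum>\<^sub>\<infinity>la\<in>D.SP. \<Sum>k\<le>n. if size la \<le> n - k then p la * G k else 0)"
  proof (rule sum_infsum_swap[THEN conjunct1])
    fix k
    have "(\<lambda>la. p la * G k) summable_on T k" by (rule summable_on_cmult_left[OF pT])
    then show "(\<lambda>la. if size la \<le> n - k then p la * G k else 0) summable_on D.SP"
      by (rule summable_on_cong_neutral[THEN iffD1, rotated -1]) (auto simp: T_def)
  qed simp
  also have "\<dots> = (\<Sum>\<^sub>\<infinity>la\<in>D.SP. qpoch_inf t t / F * (D.skew_sum la / qpoch t t (n - size la)))"
  proof (rule infsum_cong)
    fix la assume la: "la \<in> D.SP"
    \<comment> \<open>For fixed la the sum over k is the probability that the geometric variable is
      at most n - l(la), which produces the denominator \<open>qpoch t t (n - size la)\<close> found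
      in the integral.\<close>
    have "(\<Sum>k\<le>n. if size la \<le> n - k then p la * G k else 0) = (\<Sum>k\<le>n - size la. p la * G k)"
      by (rule sum.mono_neutral_cong_right) (use la in auto)
    also have "\<dots> = p la * qpoch_inf t t * (\<Sum>k\<le>n - size la. t ^ k / qpoch t t k)"
      unfolding sum_distrib_left by (intro sum.cong refl) (simp add: G_def t_geometric_def)
    also have "\<dots> = qpoch_inf t t / F * (D.skew_sum la / qpoch t t (n - size la))"
      unfolding D.sum_qp p by simp
    finally show "(\<Sum>k\<le>n. if size la \<le> n - k then p la * G k else 0) = qpoch_inf t t / F * (D.skew_sum la / qpoch t t (n - size la))" .
  qed
  also have "\<dots> = qpoch_inf t t / F * (\<Sum>\<^sub>\<infinity>la\<in>D.SP. D.skew_sum la / qpoch t t (n - size la))"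
    by (rule infsum_cmult_right')
  also have "\<dots> = Phi a b t 0 u / (Phi_tilde n a b t u * F) *
      (((1 - u) / (1 - t * u)) ^ n * fact n * (1 - t) ^ n * (\<Sum>\<^sub>\<infinity>la\<in>D.SP. D.skew_sum la / qpoch t t (n - size la)))"
    using F by (intro D.constants[symmetric] ab) simp
  finally show ?thesis unfolding D.integral_value F_def[symmetric] of_real_mult[symmetric] by simp
qed

end
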